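(* Let $G$ be a split Kac--Moody group with Weyl group $(W,S)$, and let $H$ be its generic Iwahori--Hecke algebra over $\mathbb{Z}[\mathbf{q}^{\pm 1}]$. Then the cocenter $\overline{H}=H/[H,H]$ is a free $\mathbb{Z}[\mathbf{q}^{\pm 1}]$-module with basis $\{T_{\mathcal O}\mid \mathcal O\in \mathrm{Cl}(W)\}$.
   Context: The Weyl group $(W,S)$ of a split Kac--Moody group (attached to a Kac--Moody root datum with finite index set $S$) is a crystallographic Coxeter system: $S$ is finite, $s^2=1$ for $s\in S$, and the order $m_{s,t}$ of $st$ lies in $\{2,3,4,6,\infty\}$ for $s\ne t$. Let $\ell$ be the length function. The generic Hecke algebra $H$ is the associative $\mathbb Z[\mathbf q^{\pm1}]$-algebra with generators $T_s$ ($s\in S$) and relations $(T_s+1)(T_s-\mathbf q)=0$ and $T_sT_tT_s\cdots=T_tT_sT_t\cdots$ ($m_{s,t}$ factors on each side, for $s\ne t$ with $m_{s,t}<\infty$). For $w=s_1\cdots s_\ell$ reduced, $T_w=T_{s_1}\cdots T_{s_\ell}$; these are well defined and form a $\mathbb Z[\mathbf q^{\pm1}]$-basis of $H$. $[H,H]$ is the $\mathbb Z[\mathbf q^{\pm1}]$-submodule spanned by all $h_1h_2-h_2h_1$. $\mathrm{Cl}(W)$ is the set of conjugacy classes of $W$. For $\mathcal O\in\mathrm{Cl}(W)$, $\mathcal O_{\min}$ is the set of elements of minimal length in $\mathcal O$. It is known that the image of $T_w$ in $\overline H$ is the same for all $w\in\mathcal O_{\min}$; this common image is denoted $T_{\mathcal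 O}$. *)

theory Defs
  imports "HOL-Algebra.Algebra" "HOL-Algebra.Algebraic_Closure_Type"
    "HOL-Library.Poly_Mapping"
begin

section \<open>Kac--Moody root data and their Weyl groups\<close>

text \<open>The lattice of the datum is \<open>\<int>\<^sup>n\<close> in coordinates (only the indices \<open>k < n\<close> matter): \<open>c s\<close>
  are the simple roots in it and \<open>h s\<close> the simple coroots in its dual. They need be neither
  linearly independent nor spanning.\<close>

locale kac_moody_root_datum =
  fixes S :: "'s set" and A :: "'s \<Rightarrow> 's \<Rightarrow> int"
    and n :: nat and c h :: "'s \<Rightarrow> nat \<Rightarrow> int"
  assumes finite_index: "finite S"
    and cartan_diag: "s \<in> S \<Longrightarrow> A s s = 2"
    and cartan_nonpos: "\<lbrakk>s \<in> S; t \<in> S; s \<noteq> t\<rbrakk> \<Longrightarrow> A s t \<le> 0"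
    and cartan_zero: "\<lbrakk>s \<in> S; t \<in> S; A s t = 0\<rbrakk> \<Longrightarrow> A t s = 0"
    and cartan_pairing: "\<lbrakk>s \<in> S; t \<in> S\<rbrakk> \<Longrightarrow> (\<Sum>k<n. h s k * c t k) = A s t"

text \<open>Infinite order is encoded as \<open>0\<close>, the convention of \<^const>\<open>group.ord\<close>.\<close>

definition cartan_order :: "('s \<Rightarrow> 's \<Rightarrow> int) \<Rightarrow> 's \<Rightarrow> 's \<Rightarrow> nat" where
  "cartan_order A s t =
    (let p = A s t * A t s in
      if p = 0 then 2 else if p = 1 then 3 else if p = 2 then 4 else if p = 3 then 6 else 0)"

definition word_value :: "('w, 'm) monoid_scheme \<Rightarrow> 'w list \<Rightarrow> 'w" where
  "word_value W u = foldr (\<otimes>\<^bsub>W\<^esub>) u \<one>\<^bsub>W\<^esub>"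

text \<open>The congruence on words over \<open>S\<close> generated by the relations \<open>(s t)^m(s,t) = 1\<close>. It includes
  \<open>s s = 1\<close> when \<open>m s s = 1\<close>, so that words suffice to describe the presented group; if
  \<open>m s t = 0\<close> (infinite order) the relator is empty.\<close>

inductive coxeter_congruence :: "'w set \<Rightarrow> ('w \<Rightarrow> 'w \<Rightarrow> nat) \<Rightarrow> 'w list \<Rightarrow> 'w list \<Rightarrow> bool"
  for S m where
  relator: "\<lbrakk>u \<in> lists S; v \<in> lists S; s \<in> S; t \<in> S\<rbrakk> \<Longrightarrow>
    coxeter_congruence S m (u @ concat (replicate (m s t) [s, t]) @ v) (u @ v)"
| refl: "u \<in> lists S \<Longrightarrow> coxeter_congruence S m u u"
| sym: "coxeter_congruence S m u v \<Longrightarrow> coxeter_congruence S m v u"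
| trans: "\<lbrakk>coxeter_congruence S m u v; coxeter_congruence S m v w\<rbrakk> \<Longrightarrow> coxeter_congruence S m u w"

locale coxeter_system = group W for W (structure) and S +
  assumes gens_closed: "S \<subseteq> carrier W"
    and gens_generate: "generate W S = carrier W"
    and gens_nontrivial: "\<one> \<notin> S"
    and gens_involution: "s \<in> S \<Longrightarrow> s \<otimes> s = \<one>"
    and presentation: "\<lbrakk>u \<in> lists S; v \<in> lists S; word_value W u = word_value W v\<rbrakk> \<Longrightarrow>
      coxeter_congruence S (\<lambda>s t. ord (s \<otimes> t)) u v"

text \<open>\<open>(W, S)\<close> is the Weyl group of a root datum with Cartan matrix \<open>A\<close>, the index set of the datum
  being the set \<open>S\<close> of simple reflections.\<close>

locale weyl_group = coxeter_system W S for W (structure) and S +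
  fixes A :: "'a \<Rightarrow> 'a \<Rightarrow> int"
  assumes ord_cartan: "\<lbrakk>s \<in> S; t \<in> S; s \<noteq> t\<rbrakk> \<Longrightarrow> ord (s \<otimes> t) = cartan_order A s t"

definition cox_length :: "('w, 'm) monoid_scheme \<Rightarrow> 'w set \<Rightarrow> 'w \<Rightarrow> nat" where
  "cox_length W S w = (LEAST k. \<exists>u \<in> lists S. length u = k \<and> word_value W u = w)"

definition reduced_words :: "('w, 'm) monoid_scheme \<Rightarrow> 'w set \<Rightarrow> 'w \<Rightarrow> 'w list set" where
  "reduced_words W S w = {u \<in> lists S. word_value W u = w \<and> length u = cox_length W S w}"

definition conj_classes :: "('w, 'm) monoid_scheme \<Rightarrow> 'w set set" where
  "conj_classes W = orbits W (carrier W) (\<lambda>g. \<lambda>x \<in> carrier W. g \<otimes>\<^bsub>W\<^esub> x \<otimes>\<^bsub>W\<^esub> inv\<^bsub>W\<^esub> g)"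

definition min_elements :: "('w, 'm) monoid_scheme \<Rightarrow> 'w set \<Rightarrow> 'w set \<Rightarrow> 'w set" where
  "min_elements W S C = {w \<in> C. \<forall>x \<in> C. cox_length W S w \<le> cox_length W S x}"


section \<open>Modules: quotients, spans, bases\<close>

text \<open>On cosets modulo a submodule \<open>N\<close>, \<open>a \<odot> (N + x) = N + a \<odot> x\<close>. The ring
  multiplication of the quotient is meaningful only if \<open>N\<close> is a two-sided ideal.\<close>

definition quot_module :: "('r, 'a, 'm) module_scheme \<Rightarrow> 'a set \<Rightarrow> ('r, 'a set) module" where
  "quot_module M N =
    \<lparr>carrier = carrier (M Quot N), monoid.mult = monoid.mult (M Quot N), one = one (M Quot N),
     ring.zero = ring.zero (M Quot N), add = add (M Quot N),
     module.smult = (\<lambda>a B. \<Union>x\<in>B. N +>\<^bsub>M\<^esub> (a \<odot>\<^bsub>M\<^esub> x))\<rparr>"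

definition module_span ::
    "('r, 'k) ring_scheme \<Rightarrow> ('r, 'a, 'm) module_scheme \<Rightarrow> 'a set \<Rightarrow> 'a set" where
  "module_span R M E = \<Inter>{N. submodule N R M \<and> E \<subseteq> N}"

text \<open>Being a basis is a property of the family \<open>(b i)\<^sub>i\<close>; it forces \<open>b\<close> to be injective on \<open>I\<close>
  when \<open>R\<close> is not the zero ring.\<close>

definition free_module_basis ::
    "('r, 'k) ring_scheme \<Rightarrow> ('r, 'a, 'm) module_scheme \<Rightarrow> 'i set \<Rightarrow> ('i \<Rightarrow> 'a) \<Rightarrow> bool" where
  "free_module_basis R M I b \<longleftrightarrow>
    Module.module R M \<and> b \<in> I \<rightarrow> carrier M \<and>
    (\<forall>x \<in> carrier M. \<exists>J a. finite J \<and> J \<subseteq> I \<and> a \<in> J \<rightarrow> carrier R \<and>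
      x = (\<Oplus>\<^bsub>M\<^esub>i\<in>J. a i \<odot>\<^bsub>M\<^esub> b i)) \<and>
    (\<forall>J a. finite J \<longrightarrow> J \<subseteq> I \<longrightarrow> a \<in> J \<rightarrow> carrier R \<longrightarrow>
      (\<Oplus>\<^bsub>M\<^esub>i\<in>J. a i \<odot>\<^bsub>M\<^esub> b i) = \<zero>\<^bsub>M\<^esub> \<longrightarrow> (\<forall>i\<in>J. a i = \<zero>\<^bsub>R\<^esub>))"


section \<open>The generic Hecke algebra and its cocenter\<close>

text \<open>Finitely supported functions \<open>\<int> \<rightarrow> \<int>\<close> with convolution: the coefficient at \<open>k\<close> is that of
  \<open>q^k\<close>.\<close>

type_synonym laurent = "int \<Rightarrow>\<^sub>0 int"

abbreviation laurent_ring :: "laurent ring" where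
  "laurent_ring \<equiv> ring_of_type_algebra"

definition q_var :: laurent where
  "q_var = Poly_Mapping.single 1 1"

text \<open>Words as an additively written monoid under concatenation, so that finitely supported functions
  on them form the free associative algebra under the product of \<^theory>\<open>HOL-Library.Poly_Mapping\<close>.\<close>

datatype 's word = Word (letters: "'s list")

instantiation word :: (type) monoid_add
begin

definition zero_word :: "'a word" where
  "zero_word = Word []"

definition plus_word :: "'a word \<Rightarrow> 'a word \<Rightarrow> 'a word" where
  "plus_word u v = Word (letters u @ letters v)"

instance
  by standard (simp_all add: zero_word_def plus_word_def)

end

type_synonym 's free_alg = "'s word \<Rightarrow>\<^sub>0 laurent"

definition scalar :: "laurent \<Rightarrow> 's free_alg" where
  "scalar a = Poly_Mapping.single 0 a"

definition gen :: "'s \<Rightarrow> 's free_alg" where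
  "gen s = Poly_Mapping.single (Word [s]) 1"

definition free_algebra :: "'s set \<Rightarrow> (laurent, 's free_alg) module" where
  "free_algebra S =
    \<lparr>carrier = {f. \<forall>u \<in> Poly_Mapping.keys f. letters u \<in> lists S},
     monoid.mult = (*), one = 1, ring.zero = 0, add = (+), module.smult = (\<lambda>a f. scalar a * f)\<rparr>"

definition alternating :: "'s \<Rightarrow> 's \<Rightarrow> nat \<Rightarrow> 's list" where
  "alternating s t m = map (\<lambda>i. if even i then s else t) [0..<m]"

definition hecke_relators :: "('w, 'm) monoid_scheme \<Rightarrow> 'w set \<Rightarrow> 'w free_alg set" where
  "hecke_relators W S =
    {(gen s + 1) * (gen s - scalar q_var) | s. s \<in> S} \<union>
    {prod_list (map gen (alternating s t m)) - prod_list (map gen (alternating t s m)) | s t m.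
      s \<in> S \<and> t \<in> S \<and> s \<noteq> t \<and> m = group.ord W (s \<otimes>\<^bsub>W\<^esub> t) \<and> m \<noteq> 0}"

definition hecke_ideal :: "('w, 'm) monoid_scheme \<Rightarrow> 'w set \<Rightarrow> 'w free_alg set" where
  "hecke_ideal W S = Idl\<^bsub>free_algebra S\<^esub> (hecke_relators W S)"

definition hecke_algebra ::
    "('w, 'm) monoid_scheme \<Rightarrow> 'w set \<Rightarrow> (laurent, 'w free_alg set) module" where
  "hecke_algebra W S = quot_module (free_algebra S) (hecke_ideal W S)"

definition T_gen :: "('w, 'm) monoid_scheme \<Rightarrow> 'w set \<Rightarrow> 'w \<Rightarrow> 'w free_alg set" where
  "T_gen W S s = hecke_ideal W S +>\<^bsub>free_algebra S\<^esub> gen s"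

text \<open>The product of the \<open>T_gen W S s\<close> along a reduced word of \<open>w\<close>, which does not depend on the
  reduced word (Matsumoto).\<close>

definition T_elt :: "('w, 'm) monoid_scheme \<Rightarrow> 'w set \<Rightarrow> 'w \<Rightarrow> 'w free_alg set" where
  "T_elt W S w =
    (THE x. \<forall>u \<in> reduced_words W S w. x = word_value (hecke_algebra W S) (map (T_gen W S) u))"

definition hecke_commutators :: "('w, 'm) monoid_scheme \<Rightarrow> 'w set \<Rightarrow> 'w free_alg set set" where
  "hecke_commutators W S =
    (let H = hecke_algebra W S in
      module_span laurent_ring H
        {(x \<otimes>\<^bsub>H\<^esub> y) \<ominus>\<^bsub>H\<^esub> (y \<otimes>\<^bsub>H\<^esub> x) | x y. x \<in> carrier H \<and> y \<in> carrier H})"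

definition cocenter ::
    "('w, 'm) monoid_scheme \<Rightarrow> 'w set \<Rightarrow> (laurent, 'w free_alg set set) module" where
  "cocenter W S = quot_module (hecke_algebra W S) (hecke_commutators W S)"

text \<open>The common image in the cocenter of the \<open>T_elt W S w\<close>, for \<open>w\<close> of minimal length in \<open>C\<close>.\<close>

definition T_class :: "('w, 'm) monoid_scheme \<Rightarrow> 'w set \<Rightarrow> 'w set \<Rightarrow> 'w free_alg set set" where
  "T_class W S C =
    (THE x. \<forall>w \<in> min_elements W S C.
      x = hecke_commutators W S +>\<^bsub>hecke_algebra W S\<^esub> T_elt W S w)"

end

theory Submission
  imports Defs "HOL-Analysis.Continuum_Not_Denumerable"
begin

text \<open>
  Both halves of the theorem rest on one geometric fact: for \<open>w\<close> in \<open>W\<close>, any chamber \<open>x\<close> is joined to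
  any chamber \<open>y\<close> at which the conjugate \<open>y\<^sup>-\<^sup>1 w y\<close> has minimal length by a path of two kinds of
  conjugations, none of which increases the length: by a simple reflection that is a descent of the
  current conjugate \<open>u\<close>, and by \<open>z\<close> with \<open>u z = z u'\<close> such that both products are length additive. To
  find the path one draws a segment in the Tits cone from a generic point of \<open>x\<close> to one of \<open>y\<close>, after
  replacing both points by a large power of \<open>1 + 2 w\<close> applied to them. This smoothing makes the signs
  of a root along its \<open>w\<close>-orbit so regular that every wall on the segment can be crossed by such a
  conjugation; the remaining walls contain the \<open>w\<close>-average of the points and come in clusters that are
  crossed by strong conjugations.

  Reading the steps in the Hecke algebra, each \<open>T\<^sub>w\<close> is a combination of the classes \<open>T\<^sub>O\<close> modulo
  commutators. For the independence, put \<open>M = (q - 1) [H, H]\<close>. Modulo \<open>M\<close> a commutator depends only on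
  the images of its entries in the group ring, and \<open>z \<mapsto> [T(w z\<^sup>-\<^sup>1), T(z)]\<close> is a cocycle for
  conjugation. Along a path of conjugations of a minimal element it is the difference of the two basis
  elements, so it vanishes on the centralizer and has a potential on each class. Hence an element of
  \<open>[H, H]\<close> that is divisible by \<open>q - 1\<close> in \<open>H\<close> lies in \<open>M\<close>: the cocenter has no \<open>(q - 1)\<close>-torsion.
  A relation between the \<open>T\<^sub>O\<close> has coefficients divisible by \<open>q - 1\<close>, as class functions separate the
  classes at \<open>q = 1\<close>; one may divide, and infinite descent shows that the relation is trivial.
\<close>

text \<open>The factor 2 in 1 + 2 w has two reasons. It makes the operator injective on the root
  lattice, whereas 1 + w kills every root that w negates; and on the unit circle the norm of 1 + 2 z
  grows with the real part of z, so that the slowest rotation occurring in an orbit comes to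
  dominate. A straight segment between the smoothed points would not do: along a finite orbit with
  nonzero mean each root has the right sign at both ends, but the roots may change sign at different
  moments, and the first to do so may have no negative neighbour. The path therefore leads from x to
  its own average over powers of w, on to the average of y, and from there to y; between the
  averages the roots of such an orbit vanish together. Roots whose average is zero are dealt with
  close to the average of y. On the algebraic side, specializing q to 1 determines coefficients only
  modulo q - 1. The descent works because each step of a minimal path is realized by an invertible
  element of H that intertwines the two basis elements exactly, not merely modulo
  commutators.\<close>

declare in_lists_conv_set [simp del] in_listsD [rule del]

lemma rev_in_lists [simp]: "rev u \<in> lists S \<longleftrightarrow> u \<in> lists S"
  by (auto simp: in_lists_conv_set)

section \<open>Words and length in the Weyl group\<close>

locale km_weyl = weyl_group W S A for W (structure) and S and A +
  assumes finite_S: "finite S"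
    and A_diag: "s \<in> S \<Longrightarrow> A s s = 2"
    and A_nonpos: "\<lbrakk>s \<in> S; t \<in> S; s \<noteq> t\<rbrakk> \<Longrightarrow> A s t \<le> 0"
    and A_zero: "\<lbrakk>s \<in> S; t \<in> S; A s t = 0\<rbrakk> \<Longrightarrow> A t s = 0"
begin

abbreviation wv where "wv \<equiv> word_value W"
abbreviation len where "len \<equiv> cox_length W S"

lemma S_closed [simp, intro]: "s \<in> S \<Longrightarrow> s \<in> carrier W"
  using gens_closed by auto

lemma wv_Nil [simp]: "wv [] = \<one>"
  by (simp add: word_value_def)

lemma wv_Cons [simp]: "wv (s # u) = s \<otimes> wv u"
  by (simp add: word_value_def)

lemma wv_closed [simp, intro]: "u \<in> lists S \<Longrightarrow> wv u \<in> carrier W"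
  by (induction u) auto

lemma wv_append: "u \<in> lists S \<Longrightarrow> v \<in> lists S \<Longrightarrow> wv (u @ v) = wv u \<otimes> wv v"
  by (induction u) (auto simp: m_assoc)

lemma inv_gen [simp]: "s \<in> S \<Longrightarrow> inv s = s"
  using gens_involution by (intro inv_equality) auto

lemma gen_cancel [simp]:
  assumes "s \<in> S" "x \<in> carrier W"
  shows "s \<otimes> (s \<otimes> x) = x" "x \<otimes> s \<otimes> s = x"
  using assms gens_involution by (auto simp: m_assoc simp flip: m_assoc[of s s])

lemma wv_rev: "u \<in> lists S \<Longrightarrow> wv (rev u) = inv (wv u)"
proof (induction u)
  case (Cons s u)
  then have "wv (rev (s # u)) = wv (rev u) \<otimes> s" by (simp add: wv_append)
  with Cons show ?case by (simp add: inv_mult_group)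
qed simp

lemma ex_word: "x \<in> carrier W \<Longrightarrow> \<exists>u \<in> lists S. wv u = x"
proof -
  assume "x \<in> carrier W"
  then have "x \<in> generate W S" by (simp add: gens_generate)
  then show ?thesis
  proof induction
    case one show ?case by (intro bexI[of _ "[]"]) auto
  next
    case (incl h) then show ?case by (intro bexI[of _ "[h]"]) auto
  next
    case (inv h) then show ?case by (intro bexI[of _ "[h]"]) auto
  next
    case (eng h1 h2)
    then obtain u v where "u \<in> lists S" "v \<in> lists S" "wv u = h1" "wv v = h2" by auto
    then show ?case by (intro bexI[of _ "u @ v"]) (auto simp: wv_append)
  qed
qed

lemma len_le: "u \<in> lists S \<Longrightarrow> wv u = x \<Longrightarrow> len x \<le> length u"
  unfolding cox_length_def by (rule Least_le) auto

lemma ex_reduced: 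
  assumes "x \<in> carrier W"
  obtains u where "u \<in> lists S" "wv u = x" "length u = len x"
proof -
  obtain v where v: "v \<in> lists S" "wv v = x" using ex_word[OF assms] by auto
  have "\<exists>u\<in>lists S. length u = len x \<and> wv u = x"
    unfolding cox_length_def by (rule LeastI[of _ "length v"]) (use v in auto)
  then show ?thesis using that by auto
qed

lemma len_one [simp]: "len \<one> = 0"
  using len_le[of "[]" \<one>] by simp

lemma len_0_iff: "x \<in> carrier W \<Longrightarrow> len x = 0 \<longleftrightarrow> x = \<one>"
  by (metis len_one ex_reduced length_0_conv wv_Nil)

lemma len_mult_le: "x \<in> carrier W \<Longrightarrow> y \<in> carrier W \<Longrightarrow> len (x \<otimes> y) \<le> len x + len y"
  by (metis append_in_lists_conv ex_reduced len_le length_append wv_append)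

lemma len_inv [simp]: 
  assumes "x \<in> carrier W"
  shows "len (inv x) = len x"
proof -
  have "len (inv y) \<le> len y" if y: "y \<in> carrier W" for y
  proof -
    obtain u where "u \<in> lists S" "wv u = y" "length u = len y" using ex_reduced[OF y] .
    then show ?thesis using len_le[of "rev u" "inv y"] wv_rev by auto
  qed
  from this[of x] this[of "inv x"] assms show ?thesis by simp
qed

lemma len_gen_le: "s \<in> S \<Longrightarrow> len s \<le> 1"
  using len_le[of "[s]" s] by simp

text \<open>Relators have the even length 2m, so parity is a congruence invariant. Combined with the
  presentation it becomes the sign character of W.\<close>

lemma congruence_even:
  assumes "coxeter_congruence S m u v"
  shows "even (length u) = even (length v)"
  using assms
proof induction
  case (relator u v s t)
  have "length (concat (replicate k [s, t])) = 2 * k" for k by (induction k) auto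
  then show ?case by simp
qed auto

lemma even_len_wv: "u \<in> lists S \<Longrightarrow> even (len (wv u)) = even (length u)"
proof -
  assume u: "u \<in> lists S"
  obtain v where v: "v \<in> lists S" "wv v = wv u" "length v = len (wv u)" using ex_reduced[OF wv_closed[OF u]] .
  show ?thesis using congruence_even[OF presentation[OF v(1) u v(2)]] v by simp
qed

lemma even_len_mult:
  assumes "x \<in> carrier W" "y \<in> carrier W"
  shows "even (len (x \<otimes> y)) = even (len x + len y)"
proof -
  obtain u where u: "u \<in> lists S" "wv u = x" "length u = len x" using ex_reduced[OF assms(1)] .
  obtain v where v: "v \<in> lists S" "wv v = y" "length v = len y" using ex_reduced[OF assms(2)] .
  show ?thesis using even_len_wv[of "u @ v"] u v by (auto simp: wv_append)
qed

lemma len_gen [simp]: "s \<in> S \<Longrightarrow> len s = 1"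
  using len_gen_le[of s] len_0_iff[of s] gens_nontrivial by (cases "len s") auto

text \<open>The triangle inequality bounds the change of length by 1, and the sign character
  excludes 0.\<close>

lemma len_mult_gen_cases:
  assumes "x \<in> carrier W" "s \<in> S"
  shows "len (x \<otimes> s) = len x + 1 \<or> len x = len (x \<otimes> s) + 1"
proof -
  have "len (x \<otimes> s) \<le> len x + 1" using len_mult_le[of x s] assms by simp
  moreover have "len x \<le> len (x \<otimes> s) + 1" using len_mult_le[of "x \<otimes> s" s] assms by simp
  moreover have "even (len (x \<otimes> s)) = even (len x + 1)" using even_len_mult[of x s] assms by simp
  ultimately show ?thesis by (cases "len (x \<otimes> s) = len x") auto
qed

lemma len_gen_mult:
  assumes "x \<in> carrier W" "s \<in> S"
  shows "len (s \<otimes> x) = len (inv x \<otimes> s)"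
  using assms len_inv[of "s \<otimes> x"] by (simp add: inv_mult_group)

lemma len_gen_mult_cases:
  assumes "x \<in> carrier W" "s \<in> S"
  shows "len (s \<otimes> x) = len x + 1 \<or> len x = len (s \<otimes> x) + 1"
  using len_mult_gen_cases[of "inv x" s] assms by (simp add: len_gen_mult)

subsection \<open>The reflection representation\<close>

text \<open>Vectors are functions giving coefficients with respect to formal simple roots, which are
  thereby linearly independent whatever those of the datum are. \<open>pair s\<close> is the simple
  coroot of s as a linear form on them.\<close>

definition pair :: "'a \<Rightarrow> ('a \<Rightarrow> real) \<Rightarrow> real" where
  "pair s v = (\<Sum>r\<in>S. real_of_int (A s r) * v r)"

definition refl :: "'a \<Rightarrow> ('a \<Rightarrow> real) \<Rightarrow> 'a \<Rightarrow> real" where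
  "refl s v = (\<lambda>r. if r = s then v s - pair s v else v r)"

definition sroot :: "'a \<Rightarrow> 'a \<Rightarrow> real" where
  "sroot s = (\<lambda>r. if r = s then 1 else 0)"

lemma pair_refl:
  assumes "t \<in> S"
  shows "pair s (refl t v) = pair s v - A s t * pair t v"
proof -
  have "pair s (refl t v) = (\<Sum>r\<in>S. real_of_int (A s r) * v r - (if r = t then A s t * pair t v else 0))"
    unfolding pair_def[of s "refl t v"] by (intro sum.cong) (auto simp: refl_def algebra_simps)
  also have "\<dots> = pair s v - A s t * pair t v"
    using assms finite_S by (simp add: sum_subtractf pair_def)
  finally show ?thesis .
qed

lemma refl_refl [simp]: "s \<in> S \<Longrightarrow> refl s (refl s v) = v"
proof -
  assume "s \<in> S"
  then have "pair s (refl s v) = - pair s v" by (simp add: pair_refl A_diag)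
  then show ?thesis by (auto simp: refl_def[of s "refl s v"]) (auto simp: refl_def fun_eq_iff)
qed

definition wact :: "'a list \<Rightarrow> ('a \<Rightarrow> real) \<Rightarrow> 'a \<Rightarrow> real" where
  "wact u v = foldr refl u v"

lemma wact_Nil [simp]: "wact [] v = v"
  and wact_Cons [simp]: "wact (s # u) v = refl s (wact u v)"
  and wact_append: "wact (u @ u') v = wact u (wact u' v)"
  by (auto simp: wact_def)

text \<open>The product of the two reflections changes only the coordinates at s and t, and does so
  through the two pairings. The quadruple \<open>coord\<close> of these numbers therefore evolves by
  the explicit linear map \<open>st\<close>, whose order is checked for the finitely many pairs of
  Cartan entries with product below 4; for all other products the relator is empty.\<close>

lemma relator_trivial:
  assumes s: "s \<in> S" and t: "t \<in> S"
  shows "wact (concat (replicate (ord (s \<otimes> t)) [s, t])) v = v"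
proof (cases "s = t")
  case True
  then have "wact (concat (replicate k [s, t])) v = v" for k
    using s by (induction k arbitrary: v) (auto simp: wact_append)
  then show ?thesis .
next
  case False
  define a b :: real where "a = A s t" and "b = A t s"
  have ab: "a \<le> 0" "b \<le> 0" "a = 0 \<longleftrightarrow> b = 0"
    using s t False by (auto simp: a_def b_def intro: A_nonpos A_zero)
  define coord where "coord v = (v s, v t, pair s v, pair t v)" for v
  have ext: "v = v'" if "coord v = coord v'" "\<forall>r. r \<noteq> s \<and> r \<noteq> t \<longrightarrow> v r = v' r" for v v'
    using that by (auto simp: coord_def fun_eq_iff)
  define st where "st = (\<lambda>(x, y, p, q). (x - (p - a * q), y - q, - (p - a * q), - q - b * (p - a * q)))"
  have step: "coord (refl s (refl t v)) = st (coord v)" for v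
  proof -
    have "pair s (refl s (refl t v)) = - (pair s v - a * pair t v)"
      "pair t (refl s (refl t v)) = - pair t v - b * (pair s v - a * pair t v)"
      "pair s (refl t v) = pair s v - a * pair t v"
      using s t by (simp_all add: pair_refl A_diag a_def b_def)
    moreover have "refl s (refl t v) s = v s - pair s (refl t v)" "refl s (refl t v) t = v t - pair t v"
      using False by (simp_all add: refl_def)
    ultimately show ?thesis by (simp add: coord_def st_def)
  qed
  have other: "r \<noteq> s \<Longrightarrow> r \<noteq> t \<Longrightarrow> wact (concat (replicate k [s, t])) v r = v r" for r k v
    by (induction k arbitrary: v) (auto simp: refl_def)
  have coord: "coord (wact (concat (replicate k [s, t])) v) = (st ^^ k) (coord v)" for k
    by (induction k) (auto simp: step)
  have st: "st (x, y, p, q) = (x - (p - a * q), y - q, - (p - a * q), - q - b * (p - a * q))" for x y p q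
    by (simp add: st_def)
  have m: "ord (s \<otimes> t) = cartan_order A s t" using s t False by (simp add: ord_cartan)
  have "(st ^^ ord (s \<otimes> t)) c = c" for c
  proof -
    obtain x y p q where c: "c = (x, y, p, q)" by (cases c)
    define i j where "i = A s t" and "j = A t s"
    have ij: "a = i" "b = j" "i \<le> 0" "j \<le> 0" using ab by (auto simp: i_def j_def a_def b_def)
    \<comment> \<open>Two negative integers with product k are both at least -k, which leaves a
      finite list of pairs.\<close>
    have prod: "- i \<le> k \<and> - j \<le> k" if "i * j = k" "k > 0" for k
    proof -
      have "i < 0" "j < 0" using ij that by (auto simp: order_less_le)
      then have "- i * 1 \<le> - i * - j" "1 * - j \<le> - i * - j" by (intro mult_mono; simp)+
      then show ?thesis using that by simp
    qed
    consider "i * j = 0" | "i * j = 1" | "i * j = 2" | "i * j = 3" | "i * j < 0 \<or> i * j > 3" by linarith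
    then show ?thesis
    proof cases
      case 1
      then have "i = 0" "j = 0" using ab ij by auto
      then show ?thesis using 1 by (simp add: m cartan_order_def Let_def ij flip: i_def j_def)
          (simp add: eval_nat_numeral st c ij)
    next
      case 2
      then have "i \<in> {-1,0}" "j \<in> {-1,0}" using prod[of 1] ij by auto
      then have "i = -1" "j = -1" using 2 by auto
      then show ?thesis using 2 by (simp add: m cartan_order_def Let_def ij flip: i_def j_def)
          (simp add: st c eval_nat_numeral ij)
    next
      case 3
      then have "i \<in> {-2,-1,0}" "j \<in> {-2,-1,0}" using prod[of 2] ij by auto
      then have "i = -1 \<and> j = -2 \<or> i = -2 \<and> j = -1" using 3 by auto
      then show ?thesis using 3 by (simp add: m cartan_order_def Let_def ij flip: i_def j_def)
          (auto simp add: st c eval_nat_numeral ij)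
    next
      case 4
      then have "i \<in> {-3,-2,-1,0}" "j \<in> {-3,-2,-1,0}" using prod[of 3] ij by auto
      then have "i = -1 \<and> j = -3 \<or> i = -3 \<and> j = -1" using 4 by auto
      then show ?thesis using 4 by (simp add: m cartan_order_def Let_def ij flip: i_def j_def)
          (auto simp add: st c eval_nat_numeral ij)
    next
      case 5
      then have "i * j \<noteq> 0" "i * j \<noteq> 1" "i * j \<noteq> 2" "i * j \<noteq> 3" by auto
      then show ?thesis by (simp add: m cartan_order_def Let_def flip: i_def j_def)
    qed
  qed
  then have "coord (wact (concat (replicate (ord (s \<otimes> t)) [s, t])) v) = coord v" by (simp only: coord)
  then show ?thesis by (rule ext) (use other in blast)
qed

lemma congruence_wact:
  assumes "coxeter_congruence S (\<lambda>s t. ord (s \<otimes> t)) u v"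
  shows "wact u x = wact v x"
  using assms by (induction arbitrary: x) (auto simp: wact_append relator_trivial)

definition act :: "'a \<Rightarrow> ('a \<Rightarrow> real) \<Rightarrow> 'a \<Rightarrow> real" where
  "act x = wact (SOME u. u \<in> lists S \<and> wv u = x)"

text \<open>The presentation of W is what makes the action well defined: words of equal value are
  congruent, and congruent words act alike.\<close>

lemma act_wv: "u \<in> lists S \<Longrightarrow> act (wv u) v = wact u v"
proof -
  assume u: "u \<in> lists S"
  let ?u = "SOME u'. u' \<in> lists S \<and> wv u' = wv u"
  have "?u \<in> lists S \<and> wv ?u = wv u" by (rule someI[of _ u]) (use u in auto)
  then show ?thesis using u presentation[of ?u u] congruence_wact unfolding act_def by metis
qed

lemma act_one [simp]: "act \<one> v = v"
  using act_wv[of "[]"] by simp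

lemma act_gen: "s \<in> S \<Longrightarrow> act s v = refl s v"
  using act_wv[of "[s]"] by simp

lemma act_mult: "x \<in> carrier W \<Longrightarrow> y \<in> carrier W \<Longrightarrow> act (x \<otimes> y) v = act x (act y v)"
proof -
  assume x: "x \<in> carrier W" and y: "y \<in> carrier W"
  obtain u where u: "u \<in> lists S" "wv u = x" using ex_word[OF x] by auto
  obtain u' where u': "u' \<in> lists S" "wv u' = y" using ex_word[OF y] by auto
  have "act (wv (u @ u')) v = act (wv u) (act (wv u') v)" 
    using u u' by (subst act_wv) (auto simp: wact_append act_wv)
  then show ?thesis using u u' by (simp add: wv_append)
qed

lemma act_inv [simp]: "x \<in> carrier W \<Longrightarrow> act (inv x) (act x v) = v"
  "x \<in> carrier W \<Longrightarrow> act x (act (inv x) v) = v"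
  by (simp_all flip: act_mult)

lemma pair_lin: "pair s (\<lambda>r. a * v r + b * v' r) = a * pair s v + b * pair s v'"
  by (simp add: pair_def sum_distrib_left sum.distrib[symmetric] algebra_simps)

lemma act_lin:
  assumes "x \<in> carrier W"
  shows "act x (\<lambda>r. a * v r + b * v' r) = (\<lambda>r. a * act x v r + b * act x v' r)"
proof -
  have "wact u (\<lambda>r. a * v r + b * v' r) = (\<lambda>r. a * wact u v r + b * wact u v' r)" for u
  proof (induction u)
    case (Cons s u)
    then have "wact (s # u) (\<lambda>r. a * v r + b * v' r) = refl s (\<lambda>r. a * wact u v r + b * wact u v' r)"
      by (simp only: wact_Cons)
    then show ?case by (simp only: refl_def pair_lin) (auto simp: algebra_simps refl_def)
  qed simp
  then show ?thesis using ex_word[OF assms] act_wv by metis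
qed

lemma act_scale: "x \<in> carrier W \<Longrightarrow> act x (\<lambda>r. a * v r) = (\<lambda>r. a * act x v r)"
  using act_lin[of x a v 0 v] by simp

lemma act_uminus: "x \<in> carrier W \<Longrightarrow> act x (\<lambda>r. - v r) = (\<lambda>r. - act x v r)"
  using act_scale[of x "-1" v] by simp

lemma act_zero: "x \<in> carrier W \<Longrightarrow> act x (\<lambda>r. 0) = (\<lambda>r. 0)"
  using act_scale[of x 0 "\<lambda>r. 0"] by simp

lemma act_sum: "x \<in> carrier W \<Longrightarrow> act x (\<lambda>r. \<Sum>i\<in>I. c i * v i r) = (\<lambda>r. \<Sum>i\<in>I. c i * act x (v i) r)"
proof (induction I rule: infinite_finite_induct)
  case (insert i I)
  have "act x (\<lambda>r. c i * v i r + 1 * (\<Sum>i\<in>I. c i * v i r)) = 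
    (\<lambda>r. c i * act x (v i) r + 1 * (\<Sum>i\<in>I. c i * act x (v i) r))"
    by (subst act_lin) (use insert in auto)
  then show ?case using insert by simp
qed (auto simp: act_zero)

lemma act_inj: "x \<in> carrier W \<Longrightarrow> act x v = act x v' \<longleftrightarrow> v = v'"
  by (metis act_inv(1))

text \<open>The root lattice. Integrality keeps nonzero coefficients of roots away from 0, which
  later gives uniform bounds.\<close>

definition lattice :: "('a \<Rightarrow> real) set" where
  "lattice = {v. (\<forall>r. v r \<in> \<int>) \<and> (\<forall>r. r \<notin> S \<longrightarrow> v r = 0)}"

lemma lattice_act: 
  assumes "x \<in> carrier W" "v \<in> lattice"
  shows "act x v \<in> lattice"
proof -
  have "wact u v \<in> lattice" if "u \<in> lists S" for u
    using that by (induction u) (use assms in \<open>auto simp: lattice_def refl_def pair_def intro!: Ints_diff Ints_sum Ints_mult\<close>)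
  then show ?thesis using ex_word[OF assms(1)] act_wv by metis
qed

lemma sroot_lattice: "s \<in> S \<Longrightarrow> sroot s \<in> lattice"
  by (auto simp: lattice_def sroot_def)

lemma pair_sroot: "t \<in> S \<Longrightarrow> pair s (sroot t) = A s t"
  using finite_S by (simp add: pair_def sroot_def mult_delta_right)

lemma refl_sroot: "s \<in> S \<Longrightarrow> refl s (sroot s) = (\<lambda>r. - sroot s r)"
  by (rule ext) (auto simp: refl_def pair_sroot A_diag, simp_all add: sroot_def)

lemma refl_sroot': "t \<in> S \<Longrightarrow> refl s (sroot t) = (\<lambda>r. sroot t r - A s t * sroot s r)"
  by (rule ext) (simp add: refl_def pair_sroot sroot_def[of s])

end

section \<open>Dihedral subgroups and the sign of a root\<close>

lemma alternating_Suc: "alternating s t (Suc k) = alternating s t k @ [if even k then s else t]"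
  by (simp add: alternating_def)

lemma alternating_0 [simp]: "alternating s t 0 = []"
  by (simp add: alternating_def)

lemma alternating_Cons: "alternating s t (Suc k) = s # alternating t s k"
  by (induction k) (simp_all add: alternating_Suc)

lemma length_alternating [simp]: "length (alternating s t k) = k"
  by (simp add: alternating_def)

lemma alternating_in_lists: "s \<in> L \<Longrightarrow> t \<in> L \<Longrightarrow> alternating s t k \<in> lists L"
  by (auto simp: alternating_def in_lists_conv_set)

lemma alternating_double: "concat (replicate k [s, t]) = alternating s t (2 * k)"
proof (induction k)
  case (Suc k)
  have "concat (replicate (Suc k) [s, t]) = concat (replicate k [s, t]) @ [s, t]"
    by (simp flip: replicate_append_same)
  then show ?case using Suc by (simp add: alternating_Suc)
qed simp

text \<open>For either parity of k the first word ends in a letter different from the one the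
  reversed word starts with. Hence the braid relation is the relation (st)^m = 1 in another
  form.\<close>

lemma alternating_rev: "alternating s t k @ rev (alternating t s k) = alternating s t (2 * k)"
proof (rule nth_equalityI)
  fix i assume i: "i < length (alternating s t k @ rev (alternating t s k))"
  show "(alternating s t k @ rev (alternating t s k)) ! i = alternating s t (2 * k) ! i"
  proof (cases "i < k")
    case False
    then have "even (k - Suc (i - k)) \<longleftrightarrow> odd i" using i unfolding length_append length_rev length_alternating by presburger
    then show ?thesis using False i by (auto simp: nth_append rev_nth alternating_def)
  qed (auto simp: nth_append alternating_def)
qed simp_all

text \<open>Coefficients, at s and t, of the simple root of s after k reflections in t and s
  alternately, t coming first; a and b stand for the entries \<open>A s t\<close> and
  \<open>A t s\<close>.\<close>

primrec dihedral_coeffs :: "real \<Rightarrow> real \<Rightarrow> nat \<Rightarrow> real \<times> real" where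
  "dihedral_coeffs a b 0 = (1, 0)"
| "dihedral_coeffs a b (Suc k) = (case dihedral_coeffs a b k of (c, d) \<Rightarrow>
    if even k then (c, - d - b * c) else (- c - a * d, d))"

context km_weyl
begin

text \<open>Stripping letters s and t from the right as long as the length drops leaves v, the
  shortest element of the coset of x modulo the dihedral subgroup.\<close>

lemma decomp:
  assumes "x \<in> carrier W" "s \<in> S" "t \<in> S"
  obtains v c where "v \<in> carrier W" "c \<in> lists {s, t}" "x = v \<otimes> wv c" "len x = len v + length c"
    "len (v \<otimes> s) = len v + 1" "len (v \<otimes> t) = len v + 1"
proof -
  have "\<exists>v c. v \<in> carrier W \<and> c \<in> lists {s, t} \<and> x = v \<otimes> wv c \<and> len x = len v + length c \<and>
    len (v \<otimes> s) = len v + 1 \<and> len (v \<otimes> t) = len v + 1"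
    using assms(1)
  proof (induction "len x" arbitrary: x rule: less_induct)
    case less
    show ?case
    proof (cases "\<exists>r\<in>{s, t}. len x \<noteq> len (x \<otimes> r) - 1")
      case True
      then obtain r where r: "r \<in> {s, t}" "len x = len (x \<otimes> r) + 1"
        using len_mult_gen_cases[OF less.prems] assms by fastforce
      have rS: "r \<in> S" using r assms by auto
      obtain v c where vc: "v \<in> carrier W" "c \<in> lists {s, t}" "x \<otimes> r = v \<otimes> wv c"
        "len (x \<otimes> r) = len v + length c" "len (v \<otimes> s) = len v + 1" "len (v \<otimes> t) = len v + 1"
        using less.hyps[of "x \<otimes> r"] r rS less.prems by auto
      have c: "c \<in> lists S" using vc(2) assms by (auto simp: in_lists_conv_set)
      have "x = x \<otimes> r \<otimes> r" using rS less.prems by simp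
      also have "\<dots> = v \<otimes> wv (c @ [r])" using vc c rS by (simp add: wv_append m_assoc)
      finally show ?thesis using vc r c rS by (intro exI[of _ v] exI[of _ "c @ [r]"]) auto
    next
      case False
      then show ?thesis using less.prems len_mult_gen_cases[OF less.prems] assms
        by (intro exI[of _ x] exI[of _ "[]"]) force
    qed
  qed
  then show ?thesis using that by blast
qed

lemma reduced_alternating:
  assumes s: "s \<in> S" and t: "t \<in> S"
  shows "c \<in> lists {s, t} \<Longrightarrow> len (wv c) = length c \<Longrightarrow>
    c = rev (alternating s t (length c)) \<or> c = rev (alternating t s (length c))"
proof (induction c)
  case (Cons r c)
  have rS: "r \<in> S" and c: "c \<in> lists S" and r: "r = s \<or> r = t" using Cons.prems s t by (auto simp: in_lists_conv_set)
  have "len (wv (r # c)) \<le> 1 + len (wv c)" using len_mult_le[of r "wv c"] rS c by simp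
  then have "len (wv c) = length c" using Cons.prems len_le[OF c HOL.refl] by simp
  then have IH: "c = rev (alternating s t (length c)) \<or> c = rev (alternating t s (length c))"
    using Cons by simp
  show ?case
  proof (cases c)
    case Nil
    then show ?thesis using r by (auto simp: alternating_def)
  next
    case (Cons r' c')
    have "r \<noteq> r'"
    proof
      assume "r = r'"
      then have "wv (r # c) = wv c'" using c rS Cons by (auto simp: in_lists_conv_set)
      then have "len (wv (r # c)) \<le> length c'" using c Cons len_le[of c'] by simp
      then show False using \<open>len (wv (r # c)) = length (r # c)\<close> Cons by simp
    qed
    moreover have "r' = s \<or> r' = t" using Cons.prems Cons by simp
    ultimately show ?thesis using IH r Cons by (auto simp: alternating_Suc split: if_splits)
  qed
qed simp

lemma wv_power: "s \<in> S \<Longrightarrow> t \<in> S \<Longrightarrow> wv (concat (replicate k [s, t])) = (s \<otimes> t) [^] k"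
proof (induction k)
  case (Suc k)
  have "wv (concat (replicate (Suc k) [s, t])) = s \<otimes> t \<otimes> (s \<otimes> t) [^] k" using Suc by (simp add: m_assoc)
  also have "\<dots> = (s \<otimes> t) [^] Suc k" using Suc.prems by (simp only: nat_pow_Suc2 m_closed S_closed)
  finally show ?case .
qed simp

lemma braid:
  assumes "s \<in> S" "t \<in> S"
  shows "wv (alternating s t (ord (s \<otimes> t))) = wv (alternating t s (ord (s \<otimes> t)))"
proof -
  let ?m = "ord (s \<otimes> t)"
  have l: "alternating s t ?m \<in> lists S" "alternating t s ?m \<in> lists S"
    using assms by (simp_all add: alternating_in_lists)
  have "wv (alternating s t ?m @ rev (alternating t s ?m)) = \<one>"
    unfolding alternating_rev alternating_double[symmetric] using assms by (simp add: wv_power)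
  then have "wv (alternating s t ?m) \<otimes> inv (wv (alternating t s ?m)) = \<one>"
    using l by (simp add: wv_append wv_rev)
  then show ?thesis using l by (metis inv_equality inv_inv inv_closed wv_closed)
qed

lemma refl_lin: "refl s (\<lambda>r. a * v r + b * v' r) = (\<lambda>r. a * refl s v r + b * refl s v' r)"
  by (auto simp: refl_def pair_lin algebra_simps)

lemma dihedral_action:
  assumes "s \<in> S" "t \<in> S" "s \<noteq> t"
  shows "wact (rev (alternating t s k)) (sroot s) =
    (\<lambda>r. fst (dihedral_coeffs (A s t) (A t s) k) * sroot s r + snd (dihedral_coeffs (A s t) (A t s) k) * sroot t r)"
proof (induction k)
  case (Suc k)
  obtain c d where cd: "dihedral_coeffs (A s t) (A t s) k = (c, d)" by fastforce
  have "refl s (\<lambda>r. c * sroot s r + d * sroot t r) = (\<lambda>r. (- c - A s t * d) * sroot s r + d * sroot t r)"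
    "refl t (\<lambda>r. c * sroot s r + d * sroot t r) = (\<lambda>r. c * sroot s r + (- d - A t s * c) * sroot t r)"
    using assms by (simp_all add: refl_lin refl_sroot refl_sroot' algebra_simps)
  then show ?case using Suc cd by (simp add: alternating_Suc)
qed (simp add: alternating_def)

text \<open>If the product of the entries is below 4, the recursion is evaluated for each of the
  finitely many k below the order. Otherwise the order is infinite and an inductive inequality takes
  over.\<close>

lemma dihedral_coeffs_nonneg:
  assumes s: "s \<in> S" and t: "t \<in> S" and st: "s \<noteq> t" and k: "k < ord (s \<otimes> t) \<or> ord (s \<otimes> t) = 0"
  shows "fst (dihedral_coeffs (A s t) (A t s) k) \<ge> 0 \<and> snd (dihedral_coeffs (A s t) (A t s) k) \<ge> 0"
proof -
  define i j where "i = A s t" and "j = A t s"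
  have ij: "i \<le> 0" "j \<le> 0" "i = 0 \<longleftrightarrow> j = 0"
    using s t st by (auto simp: i_def j_def intro: A_nonpos A_zero)
  have prod: "- i \<le> k \<and> - j \<le> k" if "i * j = k" "k > 0" for k
  proof -
    have "i < 0" "j < 0" using ij that by (auto simp: order_less_le)
    then have "- i * 1 \<le> - i * - j" "1 * - j \<le> - i * - j" by (intro mult_mono; simp)+
    then show ?thesis using that by simp
  qed
  have m: "ord (s \<otimes> t) = cartan_order A s t" using s t st by (simp add: ord_cartan)
  have "i * j \<ge> 0" using ij by (simp add: mult_nonpos_nonpos)
  then consider "i * j = 0" | "i * j = 1" | "i * j = 2" | "i * j = 3" | "i * j \<ge> 4" by linarith
  then show ?thesis
  proof cases
    case 1
    then have "i = 0" "j = 0" "k < 2" using k ij by (auto simp: m cartan_order_def Let_def i_def j_def)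
    then show ?thesis by (auto simp: less_2_cases_iff i_def[symmetric] j_def[symmetric])
  next
    case 2
    then have "i \<in> {-1,0}" "j \<in> {-1,0}" using prod[of 1] ij by auto
    then have "i = -1" "j = -1" using 2 by auto
    moreover have "k < 3" using k 2 by (simp add: m cartan_order_def Let_def del: mult_eq_0_iff flip: i_def j_def)
    ultimately show ?thesis by (auto simp: less_Suc_eq numeral_eq_Suc i_def[symmetric] j_def[symmetric])
  next
    case 3
    then have "i \<in> {-2,-1,0}" "j \<in> {-2,-1,0}" using prod[of 2] ij by auto
    then have "i = -1 \<and> j = -2 \<or> i = -2 \<and> j = -1" using 3 by auto
    moreover have "k < 4" using k 3 by (simp add: m cartan_order_def Let_def del: mult_eq_0_iff flip: i_def j_def)
    ultimately show ?thesis by (auto simp: less_Suc_eq eval_nat_numeral i_def[symmetric] j_def[symmetric])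
  next
    case 4
    then have "i \<in> {-3,-2,-1,0}" "j \<in> {-3,-2,-1,0}" using prod[of 3] ij by auto
    then have "i = -1 \<and> j = -3 \<or> i = -3 \<and> j = -1" using 4 by auto
    moreover have "k < 6" using k 4 by (simp add: m cartan_order_def Let_def del: mult_eq_0_iff flip: i_def j_def)
    ultimately show ?thesis by (auto simp: less_Suc_eq eval_nat_numeral i_def[symmetric] j_def[symmetric])
  next
    case 5
    define a b where "a = real_of_int i" and "b = real_of_int j"
    have "real_of_int (i * j) \<ge> 4" using 5 by linarith
    then have ab: "a * b \<ge> 4" "a \<le> 0" "b \<le> 0" using ij by (auto simp: a_def b_def)
    \<comment> \<open>The added invariant says that the vector pairs nonnegatively with the coroot
      of the latest reflection. As a b is at least 4, it then pairs nonpositively with the other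
      coroot, so the next reflection does not decrease the coefficient it changes.\<close>
    have "case dihedral_coeffs a b k of (c, d) \<Rightarrow> c \<ge> 0 \<and> d \<ge> 0 \<and> (if even k then 2 * c \<ge> - a * d else 2 * d \<ge> - b * c)"
    proof (induction k)
      case (Suc k)
      obtain c d where cd: "dihedral_coeffs a b k = (c, d)" by fastforce
      show ?case
      proof (cases "even k")
        case True
        with Suc cd have h: "c \<ge> 0" "d \<ge> 0" "2 * c \<ge> - a * d" by auto
        have "- b * (2 * c) \<ge> - b * (- a * d)" using h ab by (intro mult_left_mono) auto
        moreover have "a * b * d \<ge> 4 * d" using h ab by (intro mult_right_mono) auto
        ultimately have "- b * c \<ge> 2 * d" by (simp add: algebra_simps)
        then show ?thesis using cd True h by simp
      next
        case False
        with Suc cd have h: "c \<ge> 0" "d \<ge> 0" "2 * d \<ge> - b * c" by auto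
        have "- a * (2 * d) \<ge> - a * (- b * c)" using h ab by (intro mult_left_mono) auto
        moreover have "a * b * c \<ge> 4 * c" using h ab by (intro mult_right_mono) auto
        ultimately have "- a * d \<ge> 2 * c" by (simp add: algebra_simps)
        then show ?thesis using cd False h by simp
      qed
    qed simp
    then show ?thesis by (auto simp: a_def b_def i_def j_def)
  qed
qed

text \<open>If c ended in s, or had at least m letters so that the braid relation could make it end
  in s, then x s would be shorter than x.\<close>

lemma dihedral_descent:
  assumes v: "v \<in> carrier W" and s: "s \<in> S" and t: "t \<in> S" and st: "s \<noteq> t" and c: "c \<in> lists {s, t}"
    and x: "x = v \<otimes> wv c" "len x = len v + length c" "len (x \<otimes> s) = len x + 1"
  shows "c = rev (alternating t s (length c)) \<and> (length c < ord (s \<otimes> t) \<or> ord (s \<otimes> t) = 0)"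
proof -
  have cS: "c \<in> lists S" using c s t by (auto simp: in_lists_conv_set)
  let ?k = "length c"
  have no: False if d: "d \<in> lists S" "wv c = wv (d @ [s])" "length d < length c" for d
  proof -
    have "x \<otimes> s = v \<otimes> wv d" using x d v s by (simp add: wv_append m_assoc)
    then have "len (x \<otimes> s) \<le> len v + length d" 
      using len_mult_le[of v "wv d"] len_le[of d "wv d"] v d by fastforce
    then show False using x d by simp
  qed
  have "len x \<le> len v + len (wv c)" using x(1) v cS len_mult_le by simp
  then have "len (wv c) = length c" using x(2) len_le[OF cS HOL.refl] by linarith
  then have c_alt: "c = rev (alternating s t ?k) \<or> c = rev (alternating t s ?k)"
    using reduced_alternating[OF s t c] by simp
  have rev_s: "?k = 0" if "c = rev (alternating s t ?k)"
  proof (rule ccontr)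
    assume "?k \<noteq> 0"
    then obtain k' where k': "?k = Suc k'" by (cases ?k) auto
    have "c = rev (alternating t s k') @ [s]" using that k' by (simp add: alternating_Cons)
    then show False using no[of "rev (alternating t s k')"] s t k' by (simp add: alternating_in_lists)
  qed
  have c_alt': "c = rev (alternating t s ?k)" using c_alt rev_s by (metis alternating_0)
  moreover have "?k < ord (s \<otimes> t)" if m: "ord (s \<otimes> t) \<noteq> 0"
  proof (rule ccontr)
    let ?m = "ord (s \<otimes> t)"
    assume "\<not> ?k < ?m"
    define d where "d = drop ?m (alternating t s ?k)"
    have "take ?m (alternating t s ?k) = alternating t s ?m" using \<open>\<not> ?k < ?m\<close>
      by (simp add: alternating_def take_map take_upt)
    then have d: "alternating t s ?k = alternating t s ?m @ d" by (metis append_take_drop_id d_def)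
    have ld: "length d = ?k - ?m" by (simp add: d_def)
    have dS: "d \<in> lists S" using d alternating_in_lists[OF t s, of ?k] by (metis append_in_lists_conv)
    obtain m' where m': "?m = Suc m'" using m by (cases ?m) auto
    have "wv c = wv (rev d) \<otimes> inv (wv (alternating t s ?m))"
      using c_alt' d dS s t by (metis alternating_in_lists rev_append wv_append wv_rev rev_in_lists)
    also have "\<dots> = wv (rev d) \<otimes> inv (wv (alternating s t ?m))" using braid[OF s t] by simp
    also have "\<dots> = wv ((rev d @ rev (alternating t s m')) @ [s])"
      unfolding m' alternating_Cons using dS s t
      by (simp add: wv_append wv_rev inv_mult_group alternating_in_lists m_assoc)
    finally have 1: "wv c = wv ((rev d @ rev (alternating t s m')) @ [s])" .
    have 2: "length (rev d @ rev (alternating t s m')) < length c"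
      using ld \<open>\<not> ?k < ?m\<close> m' by simp
    have 3: "rev d @ rev (alternating t s m') \<in> lists S" using dS s t by (simp add: alternating_in_lists)
    show False by (rule no[OF 3 1 2])
  qed
  ultimately show ?thesis by blast
qed

text \<open>Let t be the last letter of a reduced word of x and split x into v and a word c in s and
  t, with v shortest in its coset. The word c sends the root of s to a nonnegative combination of
  the roots of s and t, and v keeps both of these nonnegative by induction, being shorter than
  x.\<close>

lemma act_sroot_nonneg:
  "x \<in> carrier W \<Longrightarrow> s \<in> S \<Longrightarrow> len (x \<otimes> s) = len x + 1 \<Longrightarrow> act x (sroot s) r \<ge> 0"
proof (induction "len x" arbitrary: x s rule: less_induct)
  case less
  show ?case
  proof (cases "x = \<one>")
    case False
    then obtain k where k: "len x = Suc k" using less.prems len_0_iff by (cases "len x") auto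
    obtain u where u: "u \<in> lists S" "wv u = x" "length u = len x" using ex_reduced less.prems by metis
    obtain u' t where ut: "u = u' @ [t]" using u k by (metis length_Suc_conv_rev)
    have t: "t \<in> S" and u': "u' \<in> lists S" using u ut by auto
    have xt: "x \<otimes> t = wv u'" using u ut u' t by (auto simp: wv_append)
    have "len (x \<otimes> t) < len x" using xt len_le[OF u' HOL.refl] u ut by simp
    then have st: "s \<noteq> t" using less.prems by auto
    obtain v c where vc: "v \<in> carrier W" "c \<in> lists {s, t}" "x = v \<otimes> wv c" "len x = len v + length c"
      "len (v \<otimes> s) = len v + 1" "len (v \<otimes> t) = len v + 1" using decomp less.prems t by metis
    have "c \<noteq> []" using vc \<open>len (x \<otimes> t) < len x\<close> by auto
    then have lt: "len v < len x" using vc by simp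
    have c: "c = rev (alternating t s (length c))" "length c < ord (s \<otimes> t) \<or> ord (s \<otimes> t) = 0"
      using dihedral_descent[OF vc(1) less.prems(2) t st vc(2,3,4) less.prems(3)] by auto
    define p q where "p = fst (dihedral_coeffs (A s t) (A t s) (length c))" and
      "q = snd (dihedral_coeffs (A s t) (A t s) (length c))"
    have pq: "p \<ge> 0" "q \<ge> 0" unfolding p_def q_def 
      using dihedral_coeffs_nonneg[OF less.prems(2) t st c(2)] by auto
    have cS: "c \<in> lists S" using vc(2) less.prems t by (auto simp: in_lists_conv_set)
    have "act x (sroot s) = act v (wact c (sroot s))" using vc(1,3) cS by (simp add: act_mult act_wv)
    also have "wact c (sroot s) = (\<lambda>r. p * sroot s r + q * sroot t r)"
      by (subst c(1)) (use dihedral_action[OF less.prems(2) t st] p_def q_def in simp)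
    also have "act v \<dots> = (\<lambda>r. p * act v (sroot s) r + q * act v (sroot t) r)" using act_lin vc by simp
    finally show ?thesis using less.hyps[OF lt vc(1) less.prems(2) vc(5)] less.hyps[OF lt vc(1) t vc(6)] pq by simp
  qed (simp add: sroot_def)
qed

lemma act_sroot_nonpos:
  assumes "x \<in> carrier W" "s \<in> S" "len (x \<otimes> s) \<noteq> len x + 1"
  shows "act x (sroot s) r \<le> 0"
proof -
  have "len x = len (x \<otimes> s) + 1" using len_mult_gen_cases assms by blast
  then have "act (x \<otimes> s) (sroot s) r \<ge> 0" using assms by (intro act_sroot_nonneg) auto
  then show ?thesis using assms by (simp add: act_mult act_gen refl_sroot act_uminus)
qed

section \<open>Real roots, inversions and length\<close>

definition roots :: "('a \<Rightarrow> real) set" where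
  "roots = {act x (sroot s) | x s. x \<in> carrier W \<and> s \<in> S}"

definition proots :: "('a \<Rightarrow> real) set" where
  "proots = {\<beta> \<in> roots. \<forall>r. \<beta> r \<ge> 0}"

lemma rootsI: "x \<in> carrier W \<Longrightarrow> s \<in> S \<Longrightarrow> act x (sroot s) \<in> roots"
  by (auto simp: roots_def)

lemma rootsE:
  assumes "\<beta> \<in> roots"
  obtains x s where "x \<in> carrier W" "s \<in> S" "\<beta> = act x (sroot s)"
  using assms by (auto simp: roots_def)

lemma proots_roots: "\<beta> \<in> proots \<Longrightarrow> \<beta> \<in> roots"
  by (simp add: proots_def)

lemma sroot_roots: "s \<in> S \<Longrightarrow> sroot s \<in> roots"
  using rootsI[of \<one> s] by simp

lemma sroot_proots: "s \<in> S \<Longrightarrow> sroot s \<in> proots"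
  by (simp add: proots_def sroot_roots) (simp add: sroot_def)

lemma roots_act: "x \<in> carrier W \<Longrightarrow> \<beta> \<in> roots \<Longrightarrow> act x \<beta> \<in> roots"
  by (elim rootsE) (simp add: rootsI flip: act_mult)

lemma roots_lattice: "\<beta> \<in> roots \<Longrightarrow> \<beta> \<in> lattice"
  by (elim rootsE) (simp add: lattice_act sroot_lattice)

lemma root_nonzero: "\<beta> \<in> roots \<Longrightarrow> \<exists>r\<in>S. \<beta> r \<noteq> 0"
proof (rule ccontr)
  assume b: "\<beta> \<in> roots" and "\<not> (\<exists>r\<in>S. \<beta> r \<noteq> 0)"
  then have z: "\<beta> = (\<lambda>r. 0)" using roots_lattice[OF b] by (auto simp: lattice_def)
  obtain x s where x: "x \<in> carrier W" "s \<in> S" "\<beta> = act x (sroot s)" using b by (rule rootsE)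
  then have "sroot s = act (inv x) (\<lambda>r. 0)" using z by (metis act_inv(1))
  then show False using act_zero[of "inv x"] x by (metis inv_closed sroot_def zero_neq_one)
qed

lemma roots_uminus: "\<beta> \<in> roots \<Longrightarrow> (\<lambda>r. - \<beta> r) \<in> roots"
proof (elim rootsE)
  fix x s assume x: "x \<in> carrier W" "s \<in> S" "\<beta> = act x (sroot s)"
  then have "(\<lambda>r. - \<beta> r) = act (x \<otimes> s) (sroot s)" by (simp add: act_mult act_gen refl_sroot act_uminus)
  then show "(\<lambda>r. - \<beta> r) \<in> roots" using x by (simp add: rootsI)
qed

lemma proots_uminus: 
  assumes "\<beta> \<in> roots"
  shows "(\<lambda>r. - \<beta> r) \<in> proots \<longleftrightarrow> \<beta> \<notin> proots"
proof -
  obtain x s where x: "x \<in> carrier W" "s \<in> S" "\<beta> = act x (sroot s)" using assms by (rule rootsE)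
  obtain r where r: "\<beta> r \<noteq> 0" using root_nonzero assms by blast
  have "(\<forall>r. \<beta> r \<ge> 0) \<or> (\<forall>r. \<beta> r \<le> 0)" using act_sroot_nonneg act_sroot_nonpos x by blast
  moreover have "\<not> ((\<forall>r. \<beta> r \<ge> 0) \<and> (\<forall>r. \<beta> r \<le> 0))" using r by (metis order_antisym)
  ultimately show ?thesis using assms by (auto simp: proots_def roots_uminus)
qed

lemma act_sroot_proots_iff:
  assumes "x \<in> carrier W" "s \<in> S"
  shows "act x (sroot s) \<in> proots \<longleftrightarrow> len (x \<otimes> s) = len x + 1"
proof
  assume p: "act x (sroot s) \<in> proots"
  show "len (x \<otimes> s) = len x + 1"
  proof (rule ccontr)
    assume "len (x \<otimes> s) \<noteq> len x + 1"
    then have "(\<lambda>r. - act x (sroot s) r) \<in> proots" 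
      using act_sroot_nonpos assms by (simp add: proots_def roots_uminus rootsI)
    then show False using p proots_uminus[of "act x (sroot s)"] assms by (simp add: rootsI)
  qed
qed (use assms act_sroot_nonneg in \<open>simp add: proots_def rootsI\<close>)

lemma act_sroot_proots_iff':
  assumes "x \<in> carrier W" "s \<in> S"
  shows "act (inv x) (sroot s) \<in> proots \<longleftrightarrow> len (s \<otimes> x) = len x + 1"
  using act_sroot_proots_iff[of "inv x" s] len_gen_mult[of x s] assms by simp

text \<open>If the root is c times a simple root, moving it back to a simple root shows that c times
  an integral vector has a coefficient 1, so c = 1.\<close>

lemma root_multiple_simple:
  assumes "\<beta> \<in> proots" "s \<in> S" "\<And>r. r \<noteq> s \<Longrightarrow> \<beta> r = 0"
  shows "\<beta> = sroot s"
proof -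
  obtain x t where x: "x \<in> carrier W" "t \<in> S" "\<beta> = act x (sroot t)" 
    using proots_roots[OF assms(1)] by (rule rootsE)
  define c where "c = \<beta> s"
  have b: "\<beta> = (\<lambda>r. c * sroot s r)" using assms by (auto simp: c_def sroot_def)
  obtain r where "\<beta> r \<noteq> 0" using root_nonzero assms proots_roots by blast
  then have "c \<noteq> 0" using assms(3)[of r] c_def by metis
  have cZ: "c \<in> \<int>" "c \<ge> 0" using roots_lattice assms(1) by (auto simp: lattice_def proots_def c_def)
  have "act (inv x) \<beta> = sroot t" using x by simp
  then have *: "(\<lambda>r. c * act (inv x) (sroot s) r) = sroot t" 
    unfolding b using act_scale[of "inv x" c "sroot s"] x by simp
  then have "c * act (inv x) (sroot s) t = 1" by (metis sroot_def)
  moreover have "act (inv x) (sroot s) t \<in> \<int>" using lattice_act sroot_lattice x assms by (auto simp: lattice_def)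
  ultimately have "c = 1" using cZ \<open>c \<noteq> 0\<close>
    by (elim Ints_cases) (simp flip: of_int_mult add: zmult_eq_1_iff)
  then show ?thesis using b by simp
qed

lemma refl_proots: 
  assumes "\<beta> \<in> proots" "s \<in> S" "\<beta> \<noteq> sroot s"
  shows "refl s \<beta> \<in> proots"
proof (rule ccontr)
  assume n: "refl s \<beta> \<notin> proots"
  have r: "refl s \<beta> \<in> roots" using roots_act[of s \<beta>] assms proots_roots by (simp add: act_gen)
  then have neg: "(\<lambda>r. - refl s \<beta> r) \<in> proots" using n proots_uminus by simp
  have "\<beta> r = 0" if "r \<noteq> s" for r
  proof -
    have "refl s \<beta> r = \<beta> r" using that by (simp add: refl_def)
    moreover have "\<beta> r \<ge> 0" "- refl s \<beta> r \<ge> 0" using assms neg by (auto simp: proots_def)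
    ultimately show ?thesis by simp
  qed
  then show False using root_multiple_simple assms by blast
qed

definition inversions :: "'a \<Rightarrow> ('a \<Rightarrow> real) set" where
  "inversions x = {\<beta> \<in> proots. act (inv x) \<beta> \<notin> proots}"

text \<open>The simple root of s is the only positive root made negative by s, so passing from x to
  x s adds exactly its image under x.\<close>

lemma inversions_mult_gen:
  assumes "x \<in> carrier W" "s \<in> S" "len (x \<otimes> s) = len x + 1"
  shows "inversions (x \<otimes> s) = insert (act x (sroot s)) (inversions x)" "act x (sroot s) \<notin> inversions x"
proof -
  have inv: "act (inv (x \<otimes> s)) \<beta> = refl s (act (inv x) \<beta>)" for \<beta>
    using assms by (simp add: inv_mult_group act_mult act_gen)
  have p: "act x (sroot s) \<in> proots" using act_sroot_proots_iff assms by simp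
  show "act x (sroot s) \<notin> inversions x" using assms sroot_proots by (simp add: inversions_def)
  show "inversions (x \<otimes> s) = insert (act x (sroot s)) (inversions x)"
  proof (intro equalityI subsetI)
    fix \<beta> assume b: "\<beta> \<in> inversions (x \<otimes> s)"
    show "\<beta> \<in> insert (act x (sroot s)) (inversions x)"
    proof (cases "act (inv x) \<beta> \<in> proots")
      case True
      then have "act (inv x) \<beta> = sroot s" using b refl_proots[of "act (inv x) \<beta>" s] assms by (auto simp: inversions_def inv)
      then show ?thesis using assms(1) by (metis act_inv(2) insertI1)
    qed (use b in \<open>simp add: inversions_def\<close>)
  next
    fix \<beta> assume b: "\<beta> \<in> insert (act x (sroot s)) (inversions x)"
    then consider "\<beta> = act x (sroot s)" | "\<beta> \<in> inversions x" by auto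
    then show "\<beta> \<in> inversions (x \<otimes> s)"
    proof cases
      case 1
      then show ?thesis using p assms sroot_proots proots_uminus[of "sroot s"] sroot_roots
        by (simp add: inversions_def inv refl_sroot)
    next
      case 2
      have root: "act (inv x) \<beta> \<in> roots" using 2 roots_act assms by (simp add: inversions_def proots_roots)
      then have neg: "(\<lambda>r. - act (inv x) \<beta> r) \<in> proots" using 2 proots_uminus by (simp add: inversions_def)
      have "(\<lambda>r. - act (inv x) \<beta> r) \<noteq> sroot s"
      proof
        assume "(\<lambda>r. - act (inv x) \<beta> r) = sroot s"
        then have "sroot s = act (inv x) (\<lambda>r. - \<beta> r)" using assms by (simp add: act_uminus)
        then have "act x (sroot s) = (\<lambda>r. - \<beta> r)" using assms by simp
        then show False using p 2 proots_uminus[of \<beta>] by (simp add: inversions_def proots_roots)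
      qed
      then have "refl s (\<lambda>r. - act (inv x) \<beta> r) \<in> proots" using refl_proots neg assms by blast
      moreover have "refl s (\<lambda>r. - act (inv x) \<beta> r) = (\<lambda>r. - refl s (act (inv x) \<beta>) r)"
        using act_uminus[of s] assms by (simp add: act_gen)
      moreover have "refl s (act (inv x) \<beta>) \<in> roots" using roots_act[of s] root assms by (simp add: act_gen)
      ultimately show ?thesis using 2 proots_uminus by (simp add: inversions_def inv)
    qed
  qed
qed

lemma card_inversions: 
  assumes "x \<in> carrier W"
  shows "finite (inversions x) \<and> card (inversions x) = len x"
  using assms
proof (induction "len x" arbitrary: x)
  case 0
  then have "x = \<one>" using len_0_iff by simp
  then show ?case by (simp add: inversions_def)
next
  case (Suc k)
  obtain u where u: "u \<in> lists S" "wv u = x" "length u = len x" using ex_reduced Suc.prems by metis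
  obtain u' t where ut: "u = u' @ [t]" using u Suc(2) by (metis length_Suc_conv_rev)
  have t: "t \<in> S" and u': "u' \<in> lists S" using u ut by auto
  have y: "wv u' \<in> carrier W" "x = wv u' \<otimes> t" using u ut u' t by (auto simp: wv_append)
  have "len (wv u') \<le> k" using len_le[OF u' HOL.refl] u ut Suc(2) by simp
  then have ly: "len (wv u') = k" "len (wv u' \<otimes> t) = len (wv u') + 1" 
    using len_mult_gen_cases[OF y(1) t] y Suc(2) by auto
  have "finite (inversions (wv u')) \<and> card (inversions (wv u')) = k" using Suc.hyps(1)[of "wv u'"] ly y by auto
  then show ?case using inversions_mult_gen[OF y(1) t ly(2)] y(2) Suc(2) by simp
qed

lemma inversions_empty: "x \<in> carrier W \<Longrightarrow> inversions x = {} \<Longrightarrow> x = \<one>"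
  using card_inversions[of x] len_0_iff by simp

subsection \<open>Chambers\<close>

text \<open>An element x stands for the chamber to which it moves the fundamental one, and
  \<open>sg x\<close> is the sign of a root on that chamber. A wall between two chambers is recorded
  in \<open>sep x y\<close> by the one of its two roots that is positive on x.\<close>

definition sg :: "'a \<Rightarrow> ('a \<Rightarrow> real) \<Rightarrow> bool" where
  "sg x \<beta> \<longleftrightarrow> act (inv x) \<beta> \<in> proots"

definition sep :: "'a \<Rightarrow> 'a \<Rightarrow> ('a \<Rightarrow> real) set" where
  "sep x y = {\<beta> \<in> roots. sg x \<beta> \<and> \<not> sg y \<beta>}"

lemma sg_uminus: "x \<in> carrier W \<Longrightarrow> \<beta> \<in> roots \<Longrightarrow> sg x (\<lambda>r. - \<beta> r) \<longleftrightarrow> \<not> sg x \<beta>"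
  by (simp add: sg_def act_uminus proots_uminus roots_act)

lemma sg_mult: "g \<in> carrier W \<Longrightarrow> x \<in> carrier W \<Longrightarrow> sg (g \<otimes> x) \<beta> \<longleftrightarrow> sg x (act (inv g) \<beta>)"
  by (simp add: sg_def inv_mult_group act_mult)

lemma sg_one [simp]: "sg \<one> \<beta> \<longleftrightarrow> \<beta> \<in> proots"
  by (simp add: sg_def)

lemma sep_eq: 
  assumes "x \<in> carrier W" "y \<in> carrier W"
  shows "sep x y = act x ` inversions (inv x \<otimes> y)"
proof (intro equalityI subsetI)
  fix \<beta> assume "\<beta> \<in> sep x y"
  then show "\<beta> \<in> act x ` inversions (inv x \<otimes> y)" using assms
    by (intro image_eqI[of _ _ "act (inv x) \<beta>"])
      (auto simp: sep_def sg_def inversions_def inv_mult_group act_mult)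
next
  fix \<beta> assume "\<beta> \<in> act x ` inversions (inv x \<otimes> y)"
  then show "\<beta> \<in> sep x y" using assms
    by (auto simp: sep_def sg_def inversions_def inv_mult_group act_mult intro: roots_act proots_roots)
qed

lemma finite_sep: "x \<in> carrier W \<Longrightarrow> y \<in> carrier W \<Longrightarrow> finite (sep x y)"
  using card_inversions[of "inv x \<otimes> y"] by (simp add: sep_eq)

lemma card_sep:
  assumes "x \<in> carrier W" "y \<in> carrier W"
  shows "card (sep x y) = len (inv x \<otimes> y)"
proof -
  have "inj_on (act x) (inversions (inv x \<otimes> y))" using assms act_inj by (auto intro: inj_onI)
  then show ?thesis using assms card_inversions[of "inv x \<otimes> y"] by (simp add: sep_eq card_image)
qed

lemma sep_empty: "x \<in> carrier W \<Longrightarrow> y \<in> carrier W \<Longrightarrow> sep x y = {} \<Longrightarrow> x = y"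
  using card_sep[of x y] len_0_iff[of "inv x \<otimes> y"] by (simp add: inv_solve_left')

text \<open>The hypothesis excludes walls that have y on one side and x and z on the other, in one
  orientation; negating roots gives the other one. Thus no wall is crossed twice on the way from x
  over y to z.\<close>

lemma len_additive:
  assumes "x \<in> carrier W" "y \<in> carrier W" "z \<in> carrier W" "sep x y \<inter> sep z y = {}"
  shows "len (inv x \<otimes> z) = len (inv x \<otimes> y) + len (inv y \<otimes> z)"
proof -
  have *: "\<not> (sg x \<beta> \<and> \<not> sg y \<beta> \<and> sg z \<beta>)" if "\<beta> \<in> roots" for \<beta>
    using assms(4) that by (auto simp: sep_def)
  have "\<not> (\<not> sg x \<beta> \<and> sg y \<beta> \<and> \<not> sg z \<beta>)" if "\<beta> \<in> roots" for \<beta>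
    using *[OF roots_uminus[OF that]] assms that by (simp add: sg_uminus)
  then have "sep x z = sep x y \<union> sep y z" "sep x y \<inter> sep y z = {}"
    using * by (auto simp: sep_def)
  then have "card (sep x z) = card (sep x y) + card (sep y z)"
    using assms by (simp add: card_Un_disjoint finite_sep)
  then show ?thesis using assms by (simp add: card_sep)
qed

lemma sg_simple_flip:
  assumes "x \<in> carrier W" "s \<in> S" "\<beta> \<in> roots"
    "\<beta> \<noteq> act x (sroot s)" "\<beta> \<noteq> (\<lambda>r. - act x (sroot s) r)"
  shows "sg (x \<otimes> s) \<beta> \<longleftrightarrow> sg x \<beta>"
proof -
  define \<gamma> where "\<gamma> = act (inv x) \<beta>"
  have g: "\<gamma> \<in> roots" "\<gamma> \<noteq> sroot s" "(\<lambda>r. - \<gamma> r) \<noteq> sroot s"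
  proof -
    show "\<gamma> \<in> roots" using assms roots_act by (simp add: \<gamma>_def)
    show "\<gamma> \<noteq> sroot s" using assms(1,4) by (metis \<gamma>_def act_inv(2))
    have "(\<lambda>r. - \<gamma> r) = act (inv x) (\<lambda>r. - \<beta> r)" using assms by (simp add: \<gamma>_def act_uminus)
    moreover have "(\<lambda>r. - \<beta> r) \<noteq> act x (sroot s)"
    proof
      assume "(\<lambda>r. - \<beta> r) = act x (sroot s)"
      then have "\<beta> = (\<lambda>r. - act x (sroot s) r)" by (metis minus_minus)
      then show False using assms(5) by blast
    qed
    ultimately show "(\<lambda>r. - \<gamma> r) \<noteq> sroot s" using assms(1) by (metis act_inv(2))
  qed
  have "refl s \<gamma> \<in> proots \<longleftrightarrow> \<gamma> \<in> proots"
  proof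
    assume "refl s \<gamma> \<in> proots"
    show "\<gamma> \<in> proots"
    proof (rule ccontr)
      assume "\<gamma> \<notin> proots"
      then have "(\<lambda>r. - \<gamma> r) \<in> proots" using g proots_uminus by blast
      then have "refl s (\<lambda>r. - \<gamma> r) \<in> proots" using g refl_proots assms by blast
      then have "(\<lambda>r. - refl s \<gamma> r) \<in> proots" using act_uminus[of s \<gamma>] assms by (simp add: act_gen)
      then show False using \<open>refl s \<gamma> \<in> proots\<close> proots_uminus[of "refl s \<gamma>"] proots_roots by blast
    qed
  qed (use g refl_proots assms in blast)
  then show ?thesis using assms by (simp add: sg_def \<gamma>_def inv_mult_group act_mult act_gen)
qed

lemma sg_simple [simp]: "x \<in> carrier W \<Longrightarrow> s \<in> S \<Longrightarrow> sg x (act x (sroot s))"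
  by (simp add: sg_def sroot_proots)

lemma sg_simple' [simp]: "x \<in> carrier W \<Longrightarrow> s \<in> S \<Longrightarrow> \<not> sg (x \<otimes> s) (act x (sroot s))"
  using proots_uminus[of "sroot s"]
  by (simp add: sg_def sroot_proots inv_mult_group act_mult act_gen refl_sroot sroot_roots)

text \<open>The product g of s with the conjugate of t changes every vector by a multiple of the
  common root and fixes that root. A root inverted by g would have to be the common root itself, so
  g has no inversions and is trivial.\<close>

lemma simple_conjugate:
  assumes x: "x \<in> carrier W" and s: "s \<in> S" and t: "t \<in> S" and eq: "act x (sroot t) = sroot s"
  shows "x \<otimes> t = s \<otimes> x"
proof -
  define \<phi> where "\<phi> v = pair t (act (inv x) v)" for v
  define g where "g = s \<otimes> (x \<otimes> t \<otimes> inv x)"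
  have gc: "g \<in> carrier W" using x s t by (simp add: g_def)
  have refl_eq: "refl r v = (\<lambda>q. v q - pair r v * sroot r q)" for r v by (auto simp: refl_def sroot_def)
  have r: "act (x \<otimes> t \<otimes> inv x) v = (\<lambda>q. 1 * v q + (- \<phi> v) * sroot s q)" for v
  proof -
    have "act (x \<otimes> t \<otimes> inv x) v = act x (\<lambda>q. 1 * act (inv x) v q + (- \<phi> v) * sroot t q)"
      using x t by (simp add: act_mult act_gen refl_eq \<phi>_def)
    also have "\<dots> = (\<lambda>q. 1 * v q + (- \<phi> v) * sroot s q)" using x eq by (subst act_lin) auto
    finally show ?thesis .
  qed
  have g: "act g v = (\<lambda>q. v q + (\<phi> v - pair s v) * sroot s q)" for v
  proof -
    have "act g v = refl s (\<lambda>q. 1 * v q + (- \<phi> v) * sroot s q)"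
      using x s t r[of v] by (simp add: g_def act_mult act_gen)
    also have "\<dots> = (\<lambda>q. 1 * refl s v q + (- \<phi> v) * (- sroot s q))" using refl_sroot s by (subst refl_lin) auto
    finally show ?thesis by (auto simp: refl_eq algebra_simps)
  qed
  have "\<phi> (sroot s) = 2" using eq x t by (simp add: \<phi>_def pair_sroot A_diag flip: eq)
  then have gs: "act g (sroot s) = sroot s" using g[of "sroot s"] s by (simp add: pair_sroot A_diag)
  have "inversions g = {}"
  proof (rule ccontr)
    assume "inversions g \<noteq> {}"
    then obtain \<beta> where b: "\<beta> \<in> proots" "act (inv g) \<beta> \<notin> proots" by (auto simp: inversions_def)
    define \<gamma> where "\<gamma> = act (inv g) \<beta>"
    have "\<gamma> \<in> roots" using b gc roots_act proots_roots by (simp add: \<gamma>_def)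
    then have neg: "(\<lambda>r. - \<gamma> r) \<in> proots" using b proots_uminus by (simp add: \<gamma>_def)
    have "\<beta> = act g \<gamma>" using gc by (simp add: \<gamma>_def)
    then have bg: "\<beta> q = \<gamma> q + (\<phi> \<gamma> - pair s \<gamma>) * sroot s q" for q using g by simp
    have "\<beta> q = 0" if "q \<noteq> s" for q
    proof -
      have "\<beta> q = \<gamma> q" using bg that by (simp add: sroot_def)
      moreover have "\<beta> q \<ge> 0" "- \<gamma> q \<ge> 0" using b neg by (auto simp: proots_def)
      ultimately show ?thesis by simp
    qed
    then have "\<beta> = sroot s" using root_multiple_simple b s by blast
    then have "\<gamma> = sroot s" using gs gc \<gamma>_def by (metis act_inv(1))
    then show False using b s by (simp add: \<gamma>_def sroot_proots)
  qed
  then have "g = \<one>" using inversions_empty gc by blast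
  then have "x \<otimes> t \<otimes> inv x = s" using s x t
    by (metis g_def gen_cancel(1) m_closed inv_closed S_closed r_one)
  then show ?thesis using x t s by (metis S_closed inv_solve_right m_closed)
qed

section \<open>Linear functionals and the Tits cone\<close>

definition functional :: "(('a \<Rightarrow> real) \<Rightarrow> real) \<Rightarrow> bool" where
  "functional f \<longleftrightarrow> (\<exists>c. \<forall>v. f v = (\<Sum>s\<in>S. c s * v s))"

lemma functional_lin: "functional f \<Longrightarrow> f (\<lambda>r. a * v r + b * v' r) = a * f v + b * f v'"
proof -
  assume "functional f"
  then obtain c where "f v = (\<Sum>s\<in>S. c s * v s)" for v by (auto simp: functional_def)
  then show ?thesis by (simp add: sum_distrib_left algebra_simps flip: sum.distrib)
qed

lemma functional_uminus: "functional f \<Longrightarrow> f (\<lambda>r. - v r) = - f v"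
  using functional_lin[of f "-1" v 0 v] by simp

lemma functional_expand:
  assumes "functional f" "v \<in> lattice"
  shows "f v = (\<Sum>s\<in>S. v s * f (sroot s))"
proof -
  obtain c where c: "f v = (\<Sum>s\<in>S. c s * v s)" for v using assms by (auto simp: functional_def)
  have "f (sroot s) = c s" if "s \<in> S" for s
    using that finite_S by (simp add: c sroot_def mult_delta_right)
  then show ?thesis by (simp add: c mult.commute)
qed

lemma functional_combine: "functional f \<Longrightarrow> functional g \<Longrightarrow> functional (\<lambda>v. a * f v + b * g v)"
proof -
  assume "functional f" "functional g"
  then obtain c d where "\<forall>v. f v = (\<Sum>s\<in>S. c s * v s)" "\<forall>v. g v = (\<Sum>s\<in>S. d s * v s)" by (auto simp: functional_def)
  then show ?thesis unfolding functional_def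
    by (intro exI[of _ "\<lambda>s. a * c s + b * d s"]) (simp add: sum_distrib_left algebra_simps flip: sum.distrib)
qed

lemma functional_act: 
  assumes "functional f" "x \<in> carrier W"
  shows "functional (\<lambda>v. f (act x v))"
proof -
  have "functional (\<lambda>v. f (wact u v))" if "u \<in> lists S" for u
    using that assms(1)
  proof (induction u arbitrary: f)
    case (Cons s u)
    then obtain c where c: "f v = (\<Sum>r\<in>S. c r * v r)" for v by (auto simp: functional_def)
    have "functional (\<lambda>v. f (refl s v))"
      unfolding functional_def
    proof (intro exI[of _ "\<lambda>r. c r - c s * A s r"] allI)
      fix v
      have "f (refl s v) = (\<Sum>r\<in>S. c r * v r - (if r = s then c s * pair s v else 0))"
        unfolding c by (intro sum.cong) (auto simp: refl_def algebra_simps)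
      also have "\<dots> = (\<Sum>r\<in>S. c r * v r) - c s * pair s v" using Cons finite_S by (simp add: sum_subtractf)
      also have "\<dots> = (\<Sum>r\<in>S. (c r - c s * A s r) * v r)"
        by (simp add: pair_def sum_distrib_left algebra_simps flip: sum_subtractf)
      finally show "f (refl s v) = (\<Sum>r\<in>S. (c r - c s * A s r) * v r)" .
    qed
    then show ?case using Cons.IH Cons.hyps by simp
  qed simp
  moreover obtain u where "u \<in> lists S" "wv u = x" using ex_word[OF assms(2)] by blast
  moreover from this have "wact u v = act x v" for v using act_wv[of u v] by (simp only:)
  ultimately have "functional (\<lambda>v. f (wact u v))" and "\<And>v. wact u v = act x v"
    by blast+
  then show ?thesis by (simp only:)
qed

lemma functional_pos:
  assumes "functional f" "\<beta> \<in> proots" "\<And>s. s \<in> S \<Longrightarrow> f (sroot s) \<ge> 0"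
  shows "f \<beta> \<ge> 0"
  unfolding functional_expand[OF assms(1) roots_lattice[OF proots_roots[OF assms(2)]]]
  using assms(2,3) by (intro sum_nonneg mult_nonneg_nonneg) (auto simp: proots_def)

text \<open>A linear functional which is positive on almost all positive roots is a point in the interior
  of the Tits cone.\<close>

lemma chamber_exists:
  assumes "functional f" "finite {\<beta> \<in> proots. f \<beta> < 0}" "\<And>\<beta>. \<beta> \<in> roots \<Longrightarrow> f \<beta> \<noteq> 0"
  shows "\<exists>x \<in> carrier W. \<forall>\<beta> \<in> roots. sg x \<beta> \<longleftrightarrow> f \<beta> > 0"
  using assms
proof (induction "card {\<beta> \<in> proots. f \<beta> < 0}" arbitrary: f rule: less_induct)
  case less
  show ?case
  proof (cases "\<exists>s\<in>S. f (sroot s) < 0")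
    case True
    then obtain s where s: "s \<in> S" "f (sroot s) < 0" by blast
    define g where "g v = f (refl s v)" for v
    have gf: "functional g" using functional_act[OF less.prems(1), of s] s by (simp add: g_def[abs_def] act_gen)
    have rr: "refl s \<beta> \<in> roots" if "\<beta> \<in> roots" for \<beta> using roots_act[of s] that s by (simp add: act_gen)
    \<comment> \<open>Reflecting f in a simple root with negative value repairs that root, and s
      permutes the other positive roots, so the finite set of violated ones shrinks.\<close>
    have "{\<beta> \<in> proots. g \<beta> < 0} \<subseteq> refl s ` ({\<beta> \<in> proots. f \<beta> < 0} - {sroot s})"
    proof
      fix \<beta> assume b: "\<beta> \<in> {\<beta> \<in> proots. g \<beta> < 0}"
      have "g (sroot s) > 0" using s functional_uminus[OF less.prems(1)] by (simp add: g_def refl_sroot)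
      then have "\<beta> \<noteq> sroot s" using b by auto
      then have "refl s \<beta> \<in> proots" using refl_proots b s by blast
      moreover have "refl s \<beta> \<noteq> sroot s"
      proof
        assume "refl s \<beta> = sroot s"
        then have "\<beta> = (\<lambda>r. - sroot s r)" using s by (metis refl_refl refl_sroot)
        then show False using b s proots_uminus[of "sroot s"] sroot_proots sroot_roots by auto
      qed
      ultimately show "\<beta> \<in> refl s ` ({\<beta> \<in> proots. f \<beta> < 0} - {sroot s})"
        using b s by (intro image_eqI[of _ _ "refl s \<beta>"]) (auto simp: g_def)
    qed
    moreover have "card (refl s ` ({\<beta> \<in> proots. f \<beta> < 0} - {sroot s})) \<le> card ({\<beta> \<in> proots. f \<beta> < 0} - {sroot s})"
      using less.prems(2) by (intro card_image_le) auto
    moreover have "card ({\<beta> \<in> proots. f \<beta> < 0} - {sroot s}) < card {\<beta> \<in> proots. f \<beta> < 0}"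
      using s sroot_proots less.prems(2) by (intro card_Diff1_less) auto
    moreover have fin: "finite {\<beta> \<in> proots. g \<beta> < 0}" using calculation(1) less.prems(2) by (meson finite_Diff finite_imageI finite_subset)
    moreover have "card {\<beta> \<in> proots. g \<beta> < 0} \<le> card (refl s ` ({\<beta> \<in> proots. f \<beta> < 0} - {sroot s}))"
      using calculation(1) less.prems(2) by (intro card_mono) auto
    ultimately have "card {\<beta> \<in> proots. g \<beta> < 0} < card {\<beta> \<in> proots. f \<beta> < 0}" by linarith
    moreover have "g \<beta> \<noteq> 0" if "\<beta> \<in> roots" for \<beta> using less.prems(3) rr that by (simp add: g_def)
    ultimately obtain x where x: "x \<in> carrier W" "\<forall>\<beta> \<in> roots. sg x \<beta> \<longleftrightarrow> g \<beta> > 0"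
      using less.hyps[OF _ gf fin] by blast
    have "sg (s \<otimes> x) \<beta> \<longleftrightarrow> f \<beta> > 0" if "\<beta> \<in> roots" for \<beta>
      using x s that rr[OF that] by (simp add: sg_mult act_gen g_def)
    then show ?thesis using x s by (intro bexI[of _ "s \<otimes> x"]) auto
  next
    case False
    then have pos: "f \<beta> > 0" if "\<beta> \<in> proots" for \<beta>
      using functional_pos[OF less.prems(1) that] less.prems(3)[OF proots_roots[OF that]] by force
    have "sg \<one> \<beta> \<longleftrightarrow> f \<beta> > 0" if "\<beta> \<in> roots" for \<beta>
      using pos[of \<beta>] pos[of "\<lambda>r. - \<beta> r"] proots_uminus[OF that] functional_uminus[OF less.prems(1)] by force
    then show ?thesis by blast
  qed
qed

end

subsection \<open>Smoothing of sequences\<close>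

text \<open>A point on the moment curve does it, as every hyperplane meets the curve in finitely many points.\<close>

lemma generic_point:
  fixes Z :: "('a \<Rightarrow> real) set"
  assumes S: "finite S" and Z: "countable Z"
  shows "\<exists>c. (\<forall>s\<in>S. c s \<ge> 1) \<and> (\<forall>v\<in>Z. (\<Sum>s\<in>S. c s * v s) = 0 \<longrightarrow> (\<forall>s\<in>S. v s = 0))"
proof -
  obtain idx :: "'a \<Rightarrow> nat" where idx: "inj_on idx S" using finite_imp_inj_to_nat_seg[OF S] by blast
  define P where "P v = (\<Sum>s\<in>S. monom (v s) (idx s))" for v :: "'a \<Rightarrow> real"
  have poly: "poly (P v) t = (\<Sum>s\<in>S. t ^ idx s * v s)" for v t
    by (simp add: P_def poly_sum poly_monom mult.commute)
  have nz: "P v \<noteq> 0" if "s \<in> S" "v s \<noteq> 0" for v s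
  proof -
    have "coeff (P v) (idx s) = (\<Sum>r\<in>S. if r = s then v s else 0)"
      unfolding P_def coeff_sum using idx that by (intro sum.cong) (auto dest: inj_onD)
    then show ?thesis using that S by auto
  qed
  define B where "B = (\<Union>v \<in> {v\<in>Z. P v \<noteq> 0}. {t. poly (P v) t = 0})"
  have "countable B" unfolding B_def using Z by (intro countable_UN) (auto intro: countable_finite poly_roots_finite)
  \<comment> \<open>Countably many polynomials have countably many zeros, while the interval is
    uncountable. Its lower end 1 makes all powers of t at least 1.\<close>
  then obtain t where t: "t \<in> {1<..<2}" "t \<notin> B" 
    using uncountable_open_interval[of 1 2] by (metis countable_subset numeral_One numeral_less_iff semiring_norm(76) subsetI)
  have "(\<forall>s\<in>S. t ^ idx s \<ge> 1)" using t by simp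
  moreover have "\<forall>s\<in>S. v s = 0" if "v \<in> Z" "(\<Sum>s\<in>S. t ^ idx s * v s) = 0" for v
    using nz t that by (auto simp: B_def poly)
  ultimately show ?thesis by (intro exI[of _ "\<lambda>s. t ^ idx s"]) auto
qed

text \<open>If a lists the values of a functional along a w-orbit, this is the corresponding list
  after n applications of 1 + 2 w.\<close>

primrec smooth :: "nat \<Rightarrow> (int \<Rightarrow> real) \<Rightarrow> int \<Rightarrow> real" where
  "smooth 0 a = a"
| "smooth (Suc n) a = (\<lambda>i. smooth n a i + 2 * smooth n a (i + 1))"

lemma smooth_sum: "smooth n a i = (\<Sum>u\<le>n. real (n choose u) * 2 ^ u * a (i + int u))"
proof (induction n arbitrary: i)
  case (Suc n)
  have "(\<Sum>u\<le>Suc n. real (Suc n choose u) * 2 ^ u * a (i + int u)) =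
    a i + (\<Sum>u\<le>n. real (Suc n choose Suc u) * 2 ^ Suc u * a (i + int (Suc u)))"
    by (subst sum.atMost_Suc_shift) simp
  also have "\<dots> = a i + (\<Sum>u\<le>n. real (n choose Suc u) * 2 ^ Suc u * a (i + int (Suc u)))
     + (\<Sum>u\<le>n. real (n choose u) * 2 ^ Suc u * a (i + int (Suc u)))"
    by (simp add: algebra_simps sum.distrib)
  also have "a i + (\<Sum>u\<le>n. real (n choose Suc u) * 2 ^ Suc u * a (i + int (Suc u))) = 
    (\<Sum>u\<le>Suc n. real (n choose u) * 2 ^ u * a (i + int u))"
    unfolding sum.atMost_Suc_shift by simp
  also have "\<dots> = smooth n a i" by (simp add: Suc)
  also have "(\<Sum>u\<le>n. real (n choose u) * 2 ^ Suc u * a (i + int (Suc u))) = 2 * smooth n a (i + 1)"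
    by (simp add: Suc sum_distrib_left algebra_simps)
  finally show ?case by simp
qed simp

lemma smooth_lin: "smooth n (\<lambda>i. x * a i + y * b i) i = x * smooth n a i + y * smooth n b i"
  by (induction n arbitrary: i) (simp_all add: algebra_simps)

text \<open>Absorption, u (n+1 choose u) = (n+1) (n choose u-1), turns the first moment of the
  kernel of order n + 1 into the kernel of order n, shifted by one. It allows two neighbouring
  smoothed values to be compared.\<close>

lemma smooth_moment:
  "(\<Sum>u\<le>Suc n. real u * (real (Suc n choose u) * 2 ^ u) * a (i + int u)) = 2 * (real n + 1) * smooth n a (i + 1)"
proof -
  have *: "real (Suc u) * real (Suc n choose Suc u) = (real n + 1) * real (n choose u)" for u
  proof -
    have "Suc u * (Suc n choose Suc u) = Suc n * (n choose u)" by (rule Suc_times_binomial)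
    then show ?thesis by (metis of_nat_mult of_nat_Suc add.commute)
  qed
  have "(\<Sum>u\<le>Suc n. real u * (real (Suc n choose u) * 2 ^ u) * a (i + int u)) =
    (\<Sum>u\<le>n. (real (Suc u) * real (Suc n choose Suc u)) * 2 ^ Suc u * a (i + int (Suc u)))"
    by (subst sum.atMost_Suc_shift) (simp only: of_nat_0 mult_zero_left add_0_left mult.assoc)
  also have "\<dots> = (\<Sum>u\<le>n. 2 * (real n + 1) * (real (n choose u) * 2 ^ u * a (i + 1 + int u)))"
    unfolding * by (intro sum.cong) (simp_all add: algebra_simps)
  finally show ?thesis by (simp only: smooth_sum sum_distrib_left)
qed

lemma smooth_mass: "(\<Sum>u\<le>n. real (n choose u) * 2 ^ u) = 3 ^ n"
  using binomial_ring[of "2::real" 1 n] by simp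

text \<open>The usual bound of order 4^j / sqrt j, squared so that no root occurs. The left side
  grows in each step by the factor 4 (2j+1) (2j+3) / (j+1)^2, which is at most 16.\<close>

lemma central_binomial_square: "real (2 * j choose j) ^ 2 * (2 * real j + 1) \<le> 16 ^ j"
proof (induction j)
  case (Suc j)
  define x where "x = real (2 * j choose j)"
  have "Suc j * (2 * Suc j choose Suc j) = 2 * (2 * j + 1) * (2 * j choose j)"
  proof -
    have "Suc j * (Suc (Suc (2 * j)) choose Suc j) = Suc (Suc (2 * j)) * (Suc (2 * j) choose j)"
      by (rule Suc_times_binomial)
    moreover have "Suc j * (Suc (2 * j) choose Suc j) = Suc (2 * j) * (2 * j choose j)" by (rule Suc_times_binomial)
    moreover have "Suc (2 * j) choose j = (Suc (2 * j) choose Suc j)"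
      using binomial_symmetric[of j "Suc (2 * j)"] by simp
    ultimately show ?thesis by (simp add: algebra_simps)
  qed
  then have "(real j + 1) * real (2 * Suc j choose Suc j) = 2 * (2 * real j + 1) * x"
  proof -
    have "real (Suc j * a) = real (2 * (2 * j + 1) * b) \<Longrightarrow> (real j + 1) * real a = 2 * (2 * real j + 1) * real b" for a b
      by (simp add: algebra_simps)
    then show ?thesis using \<open>Suc j * (2 * Suc j choose Suc j) = _\<close> unfolding x_def by (simp only:)
  qed
  then have e: "real (2 * Suc j choose Suc j) = 2 * (2 * real j + 1) * x / (real j + 1)" by (simp add: field_simps)
  have "real (2 * Suc j choose Suc j) ^ 2 * (2 * real (Suc j) + 1) =
     (x ^ 2 * (2 * real j + 1)) * (4 * (2 * real j + 1) * (2 * real j + 3) / (real j + 1) ^ 2)"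
    unfolding e by (simp add: power2_eq_square field_simps)
  also have "\<dots> \<le> 16 ^ j * 16"
  proof (intro mult_mono)
    show "4 * (2 * real j + 1) * (2 * real j + 3) / (real j + 1) ^ 2 \<le> 16"
    proof -
      have "(real j + 1) ^ 2 > 0" by simp
      then show ?thesis by (simp only: pos_divide_le_eq) (simp add: algebra_simps power2_eq_square)
    qed
  qed (use Suc x_def in auto)
  finally show ?case by simp
qed simp

lemma binomial_square: "real (m choose k) ^ 2 * (real m + 1) \<le> 4 ^ m"
proof (cases "even m")
  case True
  then obtain j where j: "m = 2 * j" by (elim evenE)
  have "(m choose k) \<le> (2 * j choose j)" using binomial_maximum[of m k] j by simp
  then have "real (m choose k) ^ 2 * (real m + 1) \<le> real (2 * j choose j) ^ 2 * (2 * real j + 1)"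
    using j by (intro mult_mono power_mono) auto
  also have "\<dots> \<le> 4 ^ m" using central_binomial_square[of j] j by (simp add: power_mult)
  finally show ?thesis .
next
  case False
  then obtain j where j: "m = 2 * j + 1" by (elim oddE)
  have c: "2 * (m choose j) = (2 * Suc j choose Suc j)"
    using binomial_symmetric[of j "Suc (2 * j)"] by (simp add: j)
  have "(m choose k) \<le> (m choose j)" using binomial_maximum[of m k] j by simp
  then have "2 * real (m choose k) \<le> real (2 * Suc j choose Suc j)" using c by linarith
  then have "(2 * real (m choose k)) ^ 2 * (2 * real (Suc j) + 1) \<le> real (2 * Suc j choose Suc j) ^ 2 * (2 * real (Suc j) + 1)"
    by (intro mult_right_mono power_mono) auto
  also have "\<dots> \<le> 16 ^ Suc j" by (rule central_binomial_square)
  also have "16 ^ Suc j = 4 * (4::real) ^ m" by (simp add: j power_mult)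
  finally have "real (m choose k) ^ 2 * (2 * real (Suc j) + 1) \<le> 4 ^ m" by (simp add: power_mult_distrib)
  moreover have "real (m choose k) ^ 2 * (real m + 1) \<le> real (m choose k) ^ 2 * (2 * real (Suc j) + 1)"
    by (intro mult_left_mono) (auto simp: j)
  ultimately show ?thesis by linarith
qed

text \<open>The largest atom of a binomial law with parameter 2/3 tends to 0. Expanding 2^u by a row
  sum writes the weight as a mixture of plain binomial coefficients from the rows n - i. These are
  small by \<open>binomial_square\<close> unless n - i < J, and such rows contribute at most the
  share 2^J (2/3)^n.\<close>

lemma weight_small:
  assumes "\<epsilon> > 0"
  shows "\<exists>n0. \<forall>n\<ge>n0. \<forall>u. real (n choose u) * 2 ^ u \<le> \<epsilon> * 3 ^ n"
proof -
  obtain J :: nat where J: "1 / (\<epsilon> / 2) ^ 2 < real J" using reals_Archimedean2 by blast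
  have bJ: "real (m choose k) \<le> \<epsilon> / 2 * 2 ^ m" if "m \<ge> J" for m k
  proof -
    have "1 / (\<epsilon> / 2) ^ 2 < real m + 1" using J that by linarith
    then have "1 < (\<epsilon> / 2) ^ 2 * (real m + 1)" using assms by (simp add: field_simps)
    then have "4 ^ m * 1 \<le> 4 ^ m * ((\<epsilon> / 2) ^ 2 * (real m + 1))" by (intro mult_left_mono) auto
    then have "real (m choose k) ^ 2 * (real m + 1) \<le> (4 ^ m * (\<epsilon> / 2) ^ 2) * (real m + 1)"
      using binomial_square[of m k] by (simp only: mult_1_right mult.assoc)
    then have "real (m choose k) ^ 2 \<le> 4 ^ m * (\<epsilon> / 2) ^ 2" by (rule mult_right_le_imp_le) simp
    also have "\<dots> = (\<epsilon> / 2 * 2 ^ m) ^ 2" by (simp add: power_mult_distrib power2_eq_square flip: power_mult_distrib)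
    finally show ?thesis using assms by (simp add: power2_le_iff_abs_le)
  qed
  have lim: "(\<lambda>n. 2 ^ J * (2 / 3) ^ n :: real) \<longlonglongrightarrow> 2 ^ J * 0"
    by (intro tendsto_mult tendsto_const LIMSEQ_realpow_zero) auto
  have "eventually (\<lambda>n. 2 ^ J * (2 / 3) ^ n < \<epsilon> / 2) sequentially"
    using assms by (intro order_tendstoD(2)[OF lim]) auto
  then obtain n0 where n0: "\<And>n. n \<ge> n0 \<Longrightarrow> 2 ^ J * (2 / 3) ^ n < \<epsilon> / 2" by (auto simp: eventually_sequentially)
  have "real (n choose u) * 2 ^ u \<le> \<epsilon> * 3 ^ n" if n: "n \<ge> n0" for n u
  proof (cases "u \<le> n")
    case True
    have "real (n choose u) * 2 ^ u = (\<Sum>i\<le>u. real (n choose u) * real (u choose i))"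
      by (simp add: sum_distrib_left[symmetric] choose_row_sum flip: of_nat_sum)
    also have "\<dots> = (\<Sum>i\<le>u. real (n choose i) * real ((n - i) choose (u - i)))"
      by (intro sum.cong HOL.refl) (use True choose_mult in \<open>simp flip: of_nat_mult\<close>)
    also have "\<dots> \<le> (\<Sum>i\<le>u. real (n choose i) * (2 ^ J + \<epsilon> / 2 * 2 ^ (n - i)))"
    proof (intro sum_mono mult_left_mono)
      fix i
      show "real (n - i choose (u - i)) \<le> 2 ^ J + \<epsilon> / 2 * 2 ^ (n - i)"
      proof (cases "n - i \<ge> J")
        case False
        have "(n - i choose (u - i)) \<le> 2 ^ (n - i)" by (rule binomial_le_pow2)
        also have "\<dots> \<le> 2 ^ J" using False by (intro power_increasing) auto
        finally have "real (n - i choose (u - i)) \<le> 2 ^ J" by (metis of_nat_le_iff of_nat_numeral of_nat_power)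
        moreover have "\<epsilon> / 2 * 2 ^ (n - i) \<ge> 0" using assms by simp
        ultimately show ?thesis by linarith
      qed (use bJ[of "n - i" "u - i"] in \<open>simp add: add_increasing\<close>)
    qed simp
    also have "\<dots> \<le> (\<Sum>i\<le>n. real (n choose i) * (2 ^ J + \<epsilon> / 2 * 2 ^ (n - i)))"
      using True assms by (intro sum_mono2) auto
    also have "\<dots> = 2 ^ J * (\<Sum>i\<le>n. real (n choose i)) + \<epsilon> / 2 * (\<Sum>i\<le>n. real (n choose i) * 2 ^ (n - i))"
      by (simp add: sum_distrib_left sum.distrib algebra_simps)
    also have "(\<Sum>i\<le>n. real (n choose i)) = 2 ^ n" using choose_row_sum[of n] by (metis of_nat_sum of_nat_numeral of_nat_power)
    also have "(\<Sum>i\<le>n. real (n choose i) * 2 ^ (n - i)) = 3 ^ n" using binomial_ring[of 1 "2::real" n] by simp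
    also have "2 ^ J * 2 ^ n = (2 ^ J * (2 / 3) ^ n) * (3::real) ^ n" by (simp add: power_divide)
    also have "\<dots> + \<epsilon> / 2 * 3 ^ n \<le> \<epsilon> / 2 * 3 ^ n + \<epsilon> / 2 * 3 ^ n"
      using n0[OF n] by (intro add_right_mono mult_right_mono) auto
    finally show ?thesis by simp
  qed (use assms in \<open>simp add: binomial_eq_0\<close>)
  then show ?thesis by blast
qed

lemma window_mass:
  fixes M A :: nat
  assumes "C > 0"
  shows "\<exists>n0. \<forall>n\<ge>n0. \<forall>i. C * (\<Sum>u \<in> {u. u \<le> n \<and> \<bar>i + int u\<bar> \<le> int M}. real (n choose u) * 2 ^ u) < 3 ^ n"
proof -
  \<comment> \<open>A window of radius M contains at most 2 M + 1 indices; with this bound on each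
    weight, C times their sum stays below the total mass.\<close>
  define \<epsilon> where "\<epsilon> = 1 / (C * (2 * real M + 1) + 1)"
  have e: "\<epsilon> > 0" using assms by (simp add: \<epsilon>_def add_pos_nonneg)
  obtain n0 where n0: "\<And>n u. n \<ge> n0 \<Longrightarrow> real (n choose u) * 2 ^ u \<le> \<epsilon> * 3 ^ n" using weight_small[OF e] by blast
  have "C * (\<Sum>u \<in> {u. u \<le> n \<and> \<bar>i + int u\<bar> \<le> int M}. real (n choose u) * 2 ^ u) < 3 ^ n" if "n \<ge> n0" for n i
  proof -
    let ?U = "{u. u \<le> n \<and> \<bar>i + int u\<bar> \<le> int M}"
    have "card ?U \<le> card {- int M .. int M}"
      by (rule card_inj_on_le[of "\<lambda>u. i + int u"]) (auto intro: inj_onI)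
    then have "real (card ?U) \<le> 2 * real M + 1" by simp
    moreover have "(\<Sum>u \<in> ?U. real (n choose u) * 2 ^ u) \<le> real (card ?U) * (\<epsilon> * 3 ^ n)"
      using n0[OF that] by (intro sum_bounded_above) auto
    ultimately have "(\<Sum>u \<in> ?U. real (n choose u) * 2 ^ u) \<le> (2 * real M + 1) * (\<epsilon> * 3 ^ n)"
      using e by (smt (verit, best) mult_right_mono zero_le_power mult_nonneg_nonneg)
    then have "C * (\<Sum>u \<in> ?U. real (n choose u) * 2 ^ u) \<le> C * ((2 * real M + 1) * (\<epsilon> * 3 ^ n))"
      using assms by simp
    also have "\<dots> = (C * (2 * real M + 1) * \<epsilon>) * 3 ^ n" by simp
    also have "C * (2 * real M + 1) * \<epsilon> < 1" using assms by (simp add: \<epsilon>_def field_simps add_pos_nonneg)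
    then have "(C * (2 * real M + 1) * \<epsilon>) * 3 ^ n < 1 * 3 ^ n" by (intro mult_strict_right_mono) auto
    finally show ?thesis by simp
  qed
  then show ?thesis by blast
qed

text \<open>Compare g with the function that is 1 off P and -D on P: its weighted sum is the total
  mass minus 1 + D times the mass of P.\<close>

lemma weighted_sum_pos:
  fixes g k :: "nat \<Rightarrow> real"
  assumes "\<And>u. u \<le> n \<Longrightarrow> k u \<ge> 0" "\<And>u. u \<le> n \<Longrightarrow> \<not> P u \<Longrightarrow> g u \<ge> 1" "\<And>u. u \<le> n \<Longrightarrow> P u \<Longrightarrow> g u \<ge> - D"
    "(1 + D) * (\<Sum>u \<in> {u. u \<le> n \<and> P u}. k u) < (\<Sum>u\<le>n. k u)"
  shows "(\<Sum>u\<le>n. k u * g u) > 0"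
proof -
  have "(\<Sum>u\<le>n. k u) - (1 + D) * (\<Sum>u \<in> {u. u \<le> n \<and> P u}. k u) = (\<Sum>u\<le>n. k u * (if P u then - D else 1))"
  proof -
    have "(\<Sum>u \<in> {u. u \<le> n \<and> P u}. k u) = (\<Sum>u\<le>n. if P u then k u else 0)"
      by (rule sum.mono_neutral_cong_left) auto
    then show ?thesis by (auto simp: sum_distrib_left algebra_simps simp flip: sum_subtractf sum.distrib intro!: sum.cong)
  qed
  also have "\<dots> \<le> (\<Sum>u\<le>n. k u * g u)" using assms by (intro sum_mono mult_left_mono) auto
  finally show ?thesis using assms(4) by linarith
qed

lemma smooth_pos:
  fixes M :: nat and D :: real
  assumes "D \<ge> 0"
  shows "\<exists>n0. \<forall>n\<ge>n0. \<forall>a. (\<forall>i. \<bar>i\<bar> > int M \<longrightarrow> a i \<ge> 1) \<and> (\<forall>i. \<bar>i\<bar> \<le> int M \<longrightarrow> a i \<ge> - D) \<longrightarrow> (\<forall>i. smooth n a i > 0)"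
proof -
  obtain n0 where n0: "\<And>n i. n \<ge> n0 \<Longrightarrow> (1 + D) * (\<Sum>u \<in> {u. u \<le> n \<and> \<bar>i + int u\<bar> \<le> int M}. real (n choose u) * 2 ^ u) < 3 ^ n"
    using window_mass[of "1 + D" M] assms by fastforce
  show ?thesis
  proof (intro exI[of _ n0] allI impI)
    fix n a i assume n: "n \<ge> n0" and a: "(\<forall>i. \<bar>i\<bar> > int M \<longrightarrow> a i \<ge> 1) \<and> (\<forall>i. \<bar>i\<bar> \<le> int M \<longrightarrow> a i \<ge> - D)"
    show "smooth n a i > 0"
      unfolding smooth_sum
    proof (rule weighted_sum_pos[where D = D and P = "\<lambda>u. \<bar>i + int u\<bar> \<le> int M"])
      show "(1 + D) * (\<Sum>u \<in> {u. u \<le> n \<and> \<bar>i + int u\<bar> \<le> int M}. real (n choose u) * 2 ^ u) < (\<Sum>u\<le>n. real (n choose u) * 2 ^ u)"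
        using n0[OF n] by (simp add: smooth_mass)
    qed (use a in auto)
  qed
qed

lemma smooth_cong: "(\<And>u. u \<le> n \<Longrightarrow> a (i + int u) = b (i + int u)) \<Longrightarrow> smooth n a i = smooth n b i"
  by (simp add: smooth_sum)

lemma smooth_uminus: "smooth n (\<lambda>i. - a i) i = - smooth n a i"
  using smooth_lin[of n "-1" a 0 a i] by simp

text \<open>The smoothing kernel is log-concave and spreads out, so that a sequence which has opposite
  signs at the two ends is smoothed to one with a single sign change.\<close>

lemma smooth_single_sign_change:
  fixes M :: nat and D :: real
  assumes "D \<ge> 0" "M \<ge> 1"
  shows "\<exists>n0. \<forall>n\<ge>n0. \<forall>a. (\<forall>i \<ge> int M. a i \<ge> 1) \<and> (\<forall>i \<le> - int M. a i \<le> -1) \<and> (\<forall>i. \<bar>i\<bar> \<le> int M \<longrightarrow> \<bar>a i\<bar> \<le> D) \<longrightarrow>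
    (\<forall>i. smooth n a i \<ge> 0 \<longrightarrow> smooth n a (i + 1) > 0)"
proof -
  define D' where "D' = 2 * real M * D"
  have D': "D' \<ge> 0" using assms by (simp add: D'_def)
  obtain n1 where n1: "\<And>n i. n \<ge> n1 \<Longrightarrow> (1 + D') * (\<Sum>u \<in> {u. u \<le> n \<and> \<bar>i + int u\<bar> \<le> int M}. real (n choose u) * 2 ^ u) < 3 ^ n"
    using window_mass[of "1 + D'" M] D' by fastforce
  have "D + 1 \<ge> 0" using assms by simp
  then obtain n2 where n2': "\<forall>n\<ge>n2. \<forall>a. (\<forall>i. \<bar>i\<bar> > int M \<longrightarrow> a i \<ge> 1) \<and> (\<forall>i. \<bar>i\<bar> \<le> int M \<longrightarrow> a i \<ge> - (D + 1)) \<longrightarrow> (\<forall>i. smooth n a i > 0)"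
    using smooth_pos by blast
  then have n2: "smooth n a i > 0" if "n \<ge> n2" "\<forall>i. \<bar>i\<bar> > int M \<longrightarrow> a i \<ge> 1" "\<forall>i. \<bar>i\<bar> \<le> int M \<longrightarrow> a i \<ge> - (D + 1)" for n a i
    using that by blast
  show ?thesis
  proof (intro exI[of _ "max n1 n2"] allI impI)
    fix n a i
    assume n: "n \<ge> max n1 n2"
      and a: "(\<forall>i \<ge> int M. a i \<ge> 1) \<and> (\<forall>i \<le> - int M. a i \<le> -1) \<and> (\<forall>i. \<bar>i\<bar> \<le> int M \<longrightarrow> \<bar>a i\<bar> \<le> D)"
      and pos: "smooth n a i \<ge> 0"
    \<comment> \<open>The factor u - v is the signed distance of the index i + u from M. Multiplying
      by it makes the sequence positive on both sides of the window, so a weighted sum is positive,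
      and by \<open>smooth_moment\<close> this sum involves only the smoothed values at i and i +
      1.\<close>
    define v where "v = real M - real_of_int i"
    have "0 < (\<Sum>u\<le>Suc n. real (Suc n choose u) * 2 ^ u * ((real u - v) * a (i + int u)))"
    proof (rule weighted_sum_pos[where D = D' and P = "\<lambda>u. \<bar>i + int u\<bar> \<le> int M"])
      show "(1 + D') * (\<Sum>u \<in> {u. u \<le> Suc n \<and> \<bar>i + int u\<bar> \<le> int M}. real (Suc n choose u) * 2 ^ u) < (\<Sum>u\<le>Suc n. real (Suc n choose u) * 2 ^ u)"
        using n1[of "Suc n"] n unfolding smooth_mass by simp
    next
      fix u assume out: "\<not> \<bar>i + int u\<bar> \<le> int M"
      have uv: "real u - v = real_of_int (i + int u - int M)" by (simp add: v_def)
      show "(real u - v) * a (i + int u) \<ge> 1"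
      proof (cases "i + int u > int M")
        case True
        have "1 * 1 \<le> (real u - v) * a (i + int u)" unfolding uv using True a by (intro mult_mono) auto
        then show ?thesis by simp
      next
        case False
        then have "1 * 1 \<le> (- (real u - v)) * (- a (i + int u))" 
          unfolding uv using out a assms by (intro mult_mono) (auto simp: le_minus_iff[of 1])
        then show ?thesis by (simp only: minus_mult_minus mult_1_left)
      qed
    next
      fix u assume inn: "\<bar>i + int u\<bar> \<le> int M"
      have uv: "real u - v = real_of_int (i + int u - int M)" by (simp add: v_def)
      have "\<bar>(real u - v) * a (i + int u)\<bar> \<le> (2 * real M) * D"
        unfolding abs_mult uv using inn a by (intro mult_mono) auto
      then show "(real u - v) * a (i + int u) \<ge> - D'" by (simp add: D'_def)
    qed simp
    also have "\<dots> = (\<Sum>u\<le>Suc n. real u * (real (Suc n choose u) * 2 ^ u) * a (i + int u)) - v * smooth (Suc n) a i"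
      unfolding smooth_sum[of "Suc n"] sum_distrib_left sum_subtractf[symmetric] by (intro sum.cong) (simp_all add: algebra_simps)
    also have "\<dots> = 2 * (real n + 1 - v) * smooth n a (i + 1) - v * smooth n a i"
      unfolding smooth_moment by (simp add: algebra_simps)
    finally have main: "v * smooth n a i < 2 * (real n + 1 - v) * smooth n a (i + 1)" by simp
    \<comment> \<open>In the middle case both coefficients in \<open>main\<close> have a definite
      sign. For v < 0 the kernel meets only positive entries, and for v > n + 1 it stays to the left
      of M.\<close>
    consider "v < 0" | "0 \<le> v" "v \<le> real n + 1" | "v > real n + 1" by linarith
    then show "smooth n a (i + 1) > 0"
    proof cases
      case 1
      then have "i > int M" by (simp add: v_def)
      then have "a (i + 1 + int u) \<ge> 1" for u using a by simp
      then have "(\<Sum>u\<le>n. real (n choose u) * 2 ^ u * a (i + 1 + int u)) \<ge> (\<Sum>u\<le>n. real (n choose u) * 2 ^ u * 1)"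
        by (intro sum_mono mult_left_mono) auto
      then show ?thesis unfolding smooth_sum by (simp add: smooth_mass) (smt (verit) zero_less_power)
    next
      case 2
      then have "0 \<le> v * smooth n a i" using pos by simp
      then have "0 < 2 * (real n + 1 - v) * smooth n a (i + 1)" using main by linarith
      then show ?thesis using 2 by (simp add: zero_less_mult_iff)
    next
      case 3
      then have "i + int n + 1 < int M" by (simp add: v_def)
      then have small: "i + int u < int M" if "u \<le> n" for u using that by linarith
      \<comment> \<open>The sequence -a is continued by 1 from M on. This does not affect the
        smoothed value at i, which \<open>smooth_pos\<close> now shows to be negative for a,
        contrary to the assumption.\<close>
      define b where "b j = (if j < int M then - a j else 1)" for j
      have "smooth n b i = smooth n (\<lambda>j. - a j) i" using small by (intro smooth_cong) (auto simp: b_def)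
      moreover have "smooth n b i > 0"
      proof (rule n2)
        show "\<forall>j. \<bar>j\<bar> > int M \<longrightarrow> b j \<ge> 1" using a by (auto simp: b_def le_minus_iff[of 1])
        show "\<forall>j. \<bar>j\<bar> \<le> int M \<longrightarrow> b j \<ge> - (D + 1)" 
        proof (intro allI impI)
          fix j assume "\<bar>j\<bar> \<le> int M"
          then have "\<bar>a j\<bar> \<le> D" using a by blast
          then show "b j \<ge> - (D + 1)" using assms by (auto simp: b_def abs_le_iff)
        qed
      qed (use n in simp)
      ultimately show ?thesis using pos by (simp add: smooth_uminus)
    qed
  qed
qed

subsection \<open>Periodic sequences\<close>

definition freq :: "nat \<Rightarrow> nat \<Rightarrow> real" where
  "freq N k = 2 * pi * real k / real N"

definition dft :: "nat \<Rightarrow> (int \<Rightarrow> real) \<Rightarrow> nat \<Rightarrow> complex" where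
  "dft N a k = (\<Sum>j<N. of_real (a (int j)) * cis (- freq N k * real j)) / of_nat N"

lemma freq_range: "k < N \<Longrightarrow> 0 \<le> freq N k \<and> freq N k < 2 * pi"
  by (simp add: freq_def field_simps)

lemma cis_freq_inj:
  assumes "k < N" "l < N" "cis (freq N k) = cis (freq N l)"
  shows "k = l"
proof -
  have "cis (freq N k - freq N l) = 1" using assms by (simp flip: cis_divide)
  then have "cos (freq N k - freq N l) = 1" by (simp add: complex_eq_iff)
  then obtain n :: int where n: "freq N k - freq N l = real_of_int n * 2 * pi" using cos_one_2pi_int by blast
  have "\<bar>freq N k - freq N l\<bar> < 2 * pi" using freq_range[OF assms(1)] freq_range[OF assms(2)] by linarith
  then have "\<bar>real_of_int n\<bar> * (2 * pi) < 1 * (2 * pi)" unfolding n by (simp add: abs_mult)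
  then have "\<bar>real_of_int n\<bar> < 1" by (rule mult_right_less_imp_less) simp
  then have "n = 0" by linarith
  then have "freq N k = freq N l" using n by simp
  then show ?thesis using assms by (simp add: freq_def)
qed

lemma cis_freq_sum:
  assumes "N > 0"
  shows "(\<Sum>k<N. cis (freq N k * real_of_int m)) = (if int N dvd m then of_nat N else 0)"
proof -
  define z where "z = cis (2 * pi * real_of_int m / real N)"
  have zk: "cis (freq N k * real_of_int m) = z ^ k" for k
    by (simp add: z_def DeMoivre freq_def field_simps)
  have zN: "z ^ N = 1"
    using assms by (simp add: z_def DeMoivre cis_multiple_2pi)
  have z1: "z = 1 \<longleftrightarrow> int N dvd m"
  proof
    assume "z = 1"
    then have "cos (2 * pi * real_of_int m / real N) = 1" by (simp add: z_def complex_eq_iff)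
    then obtain n :: int where "2 * pi * real_of_int m / real N = real_of_int n * 2 * pi"
      using cos_one_2pi_int by blast
    then have "real_of_int m = real_of_int (n * int N)" using assms by (simp add: field_simps)
    then have "m = n * int N" by linarith
    then show "int N dvd m" by simp
  next
    assume "int N dvd m"
    then obtain n where "m = int N * n" by (elim dvdE)
    then have "2 * pi * real_of_int m / real N = 2 * pi * real_of_int n" using assms by simp
    then show "z = 1" unfolding z_def by (simp add: cis_multiple_2pi)
  qed
  show ?thesis
  proof (cases "z = 1")
    case False
    then have "(\<Sum>k<N. z ^ k) = (z ^ N - 1) / (z - 1)" by (simp add: geometric_sum)
    then show ?thesis using False z1 zN by (simp add: zk)
  qed (use z1 in \<open>simp add: zk\<close>)
qed

lemma dft_inverse:
  assumes N: "N > 0" and per: "\<And>i. a (i + int N) = a i"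
  shows "complex_of_real (a i) = (\<Sum>k<N. dft N a k * cis (freq N k * real_of_int i))"
proof -
  have perm: "a (i + int N * int n) = a i" for i n
  proof (induction n)
    case (Suc n)
    have "a (i + int N * int (Suc n)) = a ((i + int N * int n) + int N)" by (simp add: algebra_simps)
    then show ?case using per Suc by simp
  qed simp
  have amod: "a (i mod int N) = a i"
  proof (cases "i div int N \<ge> 0")
    case True
    then show ?thesis using perm[of "i mod int N" "nat (i div int N)"] by simp
  next
    case False
    then show ?thesis using perm[of i "nat (- (i div int N))"] minus_mult_div_eq_mod[of i "int N"] by simp
  qed
  define j0 where "j0 = nat (i mod int N)"
  have j0: "j0 < N" "int j0 = i mod int N" using N by (simp_all add: j0_def nat_less_iff)
  have "(\<Sum>k<N. dft N a k * cis (freq N k * real_of_int i)) =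
    (\<Sum>k<N. \<Sum>j<N. of_real (a (int j)) / of_nat N * cis (freq N k * real_of_int (i - int j)))"
  proof (intro sum.cong HOL.refl)
    fix k
    have "cis (freq N k * real_of_int (i - int j)) = cis (- freq N k * real j) * cis (freq N k * real_of_int i)" for j
      by (simp add: cis_mult algebra_simps)
    then show "dft N a k * cis (freq N k * real_of_int i) =
      (\<Sum>j<N. of_real (a (int j)) / of_nat N * cis (freq N k * real_of_int (i - int j)))"
      unfolding dft_def sum_divide_distrib sum_distrib_right by (intro sum.cong HOL.refl) simp
  qed
  also have "\<dots> = (\<Sum>j<N. of_real (a (int j)) / of_nat N * (\<Sum>k<N. cis (freq N k * real_of_int (i - int j))))"
    by (subst sum.swap) (simp add: sum_distrib_left)
  also have "\<dots> = (\<Sum>j<N. if j = j0 then of_real (a (int j)) else 0)"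
  proof (intro sum.cong HOL.refl)
    fix j assume j: "j \<in> {..<N}"
    have "int N dvd i - int j \<longleftrightarrow> j = j0"
    proof -
      have "int N dvd i - int j \<longleftrightarrow> i mod int N = int j mod int N" by (simp add: mod_eq_dvd_iff)
      also have "int j mod int N = int j" using j by simp
      finally show ?thesis using j0 by auto
    qed
    then show "of_real (a (int j)) / of_nat N * (\<Sum>k<N. cis (freq N k * real_of_int (i - int j))) =
      (if j = j0 then complex_of_real (a (int j)) else 0)"
      unfolding cis_freq_sum[OF N] using N by simp
  qed
  also have "\<dots> = of_real (a (int j0))" using j0 by simp
  finally show ?thesis using amod j0 by simp
qed

lemma dft_lin: "dft N (\<lambda>i. x * a i + y * b i) k = of_real x * dft N a k + of_real y * dft N b k"
  by (simp add: dft_def sum_distrib_left sum.distrib add_divide_distrib algebra_simps)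

text \<open>The factor by which one smoothing step multiplies the Fourier coefficient at k. Its norm
  grows with the cosine of the frequency.\<close>

definition mult_freq :: "nat \<Rightarrow> nat \<Rightarrow> complex" where
  "mult_freq N k = 1 + 2 * cis (freq N k)"

lemma norm_mult_freq: "norm (mult_freq N k) ^ 2 = 5 + 4 * cos (freq N k)"
proof -
  have "norm (mult_freq N k) ^ 2 = (1 + 2 * cos (freq N k)) ^ 2 + (2 * sin (freq N k)) ^ 2"
    by (simp add: mult_freq_def cmod_power2)
  also have "\<dots> = 1 + 4 * cos (freq N k) + 4 * (cos (freq N k) ^ 2 + sin (freq N k) ^ 2)"
    unfolding distrib_left by (simp add: power2_sum power_mult_distrib)
  finally show ?thesis by (simp only: sin_cos_squared_add2)
qed

lemma norm_mult_freq_pos: "norm (mult_freq N k) > 0"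
  using norm_mult_freq[of N k] cos_ge_minus_one[of "freq N k"] by (smt (verit) norm_ge_zero zero_power2)

lemma norm_mult_freq_less: "cos (freq N k) < cos (freq N l) \<Longrightarrow> norm (mult_freq N k) < norm (mult_freq N l)"
  by (rule power2_less_imp_less) (simp_all add: norm_mult_freq)

lemma smooth_dft:
  assumes "N > 0" "\<And>i. a (i + int N) = a i"
  shows "complex_of_real (smooth n a i) = (\<Sum>k<N. dft N a k * mult_freq N k ^ n * cis (freq N k * real_of_int i))"
proof (induction n arbitrary: i)
  case 0
  then show ?case using dft_inverse[where a = a, OF assms] by simp
next
  case (Suc n)
  have "cis (freq N k * real_of_int (i + 1)) = cis (freq N k) * cis (freq N k * real_of_int i)" for k
    by (simp add: cis_mult algebra_simps)
  then show ?case using Suc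
    by (simp add: sum_distrib_left mult_freq_def algebra_simps flip: sum.distrib)
qed

text \<open>The constant part is multiplied by 3 in each step and every other frequency by a factor
  of smaller norm, so eventually the mean decides all signs.\<close>

lemma smooth_mean_pos:
  assumes N: "N > 0" and per: "\<And>i. a (i + int N) = a i" and mean: "(\<Sum>j<N. a (int j)) > 0"
  shows "\<exists>n0. \<forall>n\<ge>n0. \<forall>i. smooth n a i > 0"
proof -
  define m where "m = (\<Sum>j<N. a (int j)) / real N"
  have m: "m > 0" using mean N by (simp add: m_def)
  have d0: "dft N a 0 = of_real m" by (simp add: dft_def m_def freq_def)
  define E where "E n = (\<Sum>k\<in>{1..<N}. norm (dft N a k) * (norm (mult_freq N k) / 3) ^ n)" for n
  have "E \<longlonglongrightarrow> (\<Sum>k\<in>{1..<N}. norm (dft N a k) * 0)"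
    unfolding E_def
  proof (intro tendsto_sum tendsto_mult tendsto_const LIMSEQ_realpow_zero)
    fix k assume k: "k \<in> {1..<N}"
    then have "cis (freq N k) \<noteq> cis (freq N 0)" using cis_freq_inj[of k N 0] by auto
    then have "cos (freq N k) \<noteq> 1" 
      by (metis cis_freq_inj cis.code cis_zero cos_one_sin_zero freq_def complex_eq_iff cis.sel mult_zero_right div_0 of_nat_0 one_complex.simps)
    then have "cos (freq N k) < 1" using cos_le_one[of "freq N k"] by linarith
    then have "cos (freq N k) < cos (freq N 0)" by (simp add: freq_def[of N 0])
    then have "norm (mult_freq N k) < norm (mult_freq N 0)" by (rule norm_mult_freq_less)
    then show "norm (mult_freq N k) / 3 < 1" by (simp add: mult_freq_def freq_def)
  qed simp
  then have "eventually (\<lambda>n. E n < m) sequentially" using m by (intro order_tendstoD) auto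
  then obtain n0 where n0: "\<And>n. n \<ge> n0 \<Longrightarrow> E n < m" by (auto simp: eventually_sequentially)
  show ?thesis
  proof (intro exI[of _ n0] allI impI)
    fix n i assume n: "n \<ge> n0"
    have "{..<N} = insert 0 {1..<N}" using N by auto
    then have "complex_of_real (smooth n a i) = of_real m * 3 ^ n + (\<Sum>k\<in>{1..<N}. dft N a k * mult_freq N k ^ n * cis (freq N k * real_of_int i))"
      using smooth_dft[where a = a, OF N per, of n i] by (simp add: d0 mult_freq_def[of N 0] freq_def[of N 0])
    then have "norm (complex_of_real (smooth n a i - m * 3 ^ n)) = norm (\<Sum>k\<in>{1..<N}. dft N a k * mult_freq N k ^ n * cis (freq N k * real_of_int i))"
      by simp
    also have "\<dots> \<le> (\<Sum>k\<in>{1..<N}. norm (dft N a k) * norm (mult_freq N k) ^ n)"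
      by (rule sum_norm_le) (simp add: norm_mult norm_power)
    also have "\<dots> = 3 ^ n * E n" by (simp add: E_def sum_distrib_left power_divide algebra_simps)
    also have "\<dots> < 3 ^ n * m" using n0[OF n] by simp
    finally show "smooth n a i > 0" unfolding norm_of_real by (simp add: abs_less_iff mult.commute)
  qed
qed

text \<open>After long smoothing the mixture is close to a pure wave of the frequency with the
  largest cosine c, for which e(i+1) + e(i-1) = 2 c e(i). At a zero the two neighbours are then
  almost opposite, and they are not both small, so one of them is negative. For n to be independent
  of \<tau> the amplitude must be bounded below, which holds because the two coefficients at this
  frequency are not real multiples of each other.\<close>

lemma smooth_elliptic:
  assumes N: "N > 0" and pa: "\<And>i. a (i + int N) = a i" and pb: "\<And>i. b (i + int N) = b i"
    and zero: "dft N a 0 = 0"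
    and support: "\<And>k. k < N \<Longrightarrow> dft N a k = 0 \<Longrightarrow> dft N b k = 0"
    and generic: "\<And>k. k < N \<Longrightarrow> dft N a k \<noteq> 0 \<Longrightarrow> sin (freq N k) \<noteq> 0 \<Longrightarrow> Im (dft N a k * cnj (dft N b k)) \<noteq> 0"
    and ex: "\<exists>k<N. dft N a k \<noteq> 0"
    and nflip: "\<not> (\<forall>i. a (i + 1) = - a i)"
  shows "\<exists>n0. \<forall>n\<ge>n0. \<forall>\<tau>\<in>{0..1}. \<forall>i. smooth n (\<lambda>i. (1 - \<tau>) * a i + \<tau> * b i) i = 0 \<longrightarrow>
    smooth n (\<lambda>i. (1 - \<tau>) * a i + \<tau> * b i) (i + 1) < 0 \<or> smooth n (\<lambda>i. (1 - \<tau>) * a i + \<tau> * b i) (i - 1) < 0"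
proof -
  define K where "K = {k. k < N \<and> dft N a k \<noteq> 0}"
  have finK: "finite K" and neK: "K \<noteq> {}" using ex by (auto simp: K_def)
  define c where "c = Max ((\<lambda>k. cos (freq N k)) ` K)"
  have "c \<in> (\<lambda>k. cos (freq N k)) ` K" unfolding c_def using finK neK by (intro Max_in) auto
  then obtain k0 where k0: "k0 \<in> K" "cos (freq N k0) = c" by auto
  have cmax: "cos (freq N k) \<le> c" if "k \<in> K" for k unfolding c_def using finK that by (intro Max_ge) auto
  have k0N: "k0 < N" and dk0: "dft N a k0 \<noteq> 0" using k0 by (auto simp: K_def)
  have cis_eqI: "cis x = cis y" if "cos x = cos y" "sin x = sin y" for x y using that by (simp add: complex_eq_iff)
  \<comment> \<open>Sine 0 leaves the angle 0, where the coefficient vanishes, and the angle pi,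
    which as the largest cosine would be the only frequency present and make the sequence
    alternate.\<close>
  have sin0: "sin (freq N k0) \<noteq> 0"
  proof
    assume s0: "sin (freq N k0) = 0"
    have "k0 \<noteq> 0" using dk0 zero by metis
    have "c = 1 \<or> c = -1" using s0 k0(2) sin_cos_squared_add[of "freq N k0"] by (simp add: power2_eq_1_iff)
    moreover have "c \<noteq> 1"
    proof
      assume "c = 1"
      then have "cis (freq N k0) = cis (freq N 0)" using s0 k0(2) by (intro cis_eqI) (simp_all add: freq_def[of N 0])
      then show False using cis_freq_inj[of k0 N 0] k0N \<open>k0 \<noteq> 0\<close> by auto
    qed
    ultimately have c1: "c = -1" by blast
    have only: "K = {k0}"
    proof -
      have "k = k0" if "k \<in> K" for k
      proof -
        have "cos (freq N k) = -1" using cmax[OF that] c1 cos_ge_minus_one[of "freq N k"] by linarith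
        then have "sin (freq N k) = 0" using sin_cos_squared_add[of "freq N k"] by simp
        then have "cis (freq N k) = cis (freq N k0)" using \<open>cos (freq N k) = -1\<close> s0 k0(2) c1 by (intro cis_eqI) auto
        then show ?thesis using cis_freq_inj that k0N by (auto simp: K_def)
      qed
      then show ?thesis using k0(1) by blast
    qed
    have "a (i + 1) = - a i" for i
    proof -
      have *: "complex_of_real (a i) = dft N a k0 * cis (freq N k0 * real_of_int i)" for i
      proof -
        have "complex_of_real (a i) = (\<Sum>k\<in>K. dft N a k * cis (freq N k * real_of_int i))"
          unfolding dft_inverse[where a = a, OF N pa] by (rule sum.mono_neutral_right) (auto simp: K_def)
        then show ?thesis by (simp add: only)
      qed
      have "cis (freq N k0 * real_of_int (i + 1)) = cis (freq N k0) * cis (freq N k0 * real_of_int i)"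
        by (simp add: cis_mult algebra_simps)
      also have "cis (freq N k0) = -1" using s0 k0(2) c1 by (simp add: complex_eq_iff)
      finally have "complex_of_real (a (i + 1)) = - complex_of_real (a i)" unfolding * by simp
      then show ?thesis by (metis of_real_eq_iff of_real_minus)
    qed
    then show False using nflip by blast
  qed
  define K2 where "K2 = {k \<in> K. cos (freq N k) \<noteq> c}"
  define K1 where "K1 = {k \<in> K. cos (freq N k) = c \<and> k \<noteq> k0}"
  have K_split: "K = insert k0 (K1 \<union> K2)" "K1 \<inter> K2 = {}" "k0 \<notin> K1 \<union> K2" "finite K1" "finite K2"
    using k0 finK by (auto simp: K1_def K2_def)
  have K1_conj: "cis (freq N k) = cnj (cis (freq N k0))" if "k \<in> K1" for k
  proof -
    have "sin (freq N k) ^ 2 = sin (freq N k0) ^ 2" using that k0 by (simp add: K1_def sin_squared_eq)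
    then have "sin (freq N k) = sin (freq N k0) \<or> sin (freq N k) = - sin (freq N k0)" by (simp add: power2_eq_iff)
    moreover have "sin (freq N k) \<noteq> sin (freq N k0)"
      using that k0 cis_eqI[of "freq N k" "freq N k0"] cis_freq_inj[of k N k0] by (auto simp: K1_def K_def)
    ultimately show ?thesis using that k0 by (simp add: K1_def complex_eq_iff)
  qed
  define \<mu> where "\<mu> = norm (mult_freq N k0)"
  have mu: "\<mu> > 0" unfolding \<mu>_def by (rule norm_mult_freq_pos)
  define E where "E n = (\<Sum>k\<in>K2. 4 * (norm (dft N a k) + norm (dft N b k)) * (norm (mult_freq N k) / \<mu>) ^ n)" for n
  have "E \<longlonglongrightarrow> (\<Sum>k\<in>K2. 4 * (norm (dft N a k) + norm (dft N b k)) * 0)"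
    unfolding E_def
  proof (intro tendsto_sum tendsto_mult[of "\<lambda>n. 4 * _"] tendsto_const LIMSEQ_realpow_zero)
    fix k assume k: "k \<in> K2"
    then have "cos (freq N k) < cos (freq N k0)" using cmax[of k] k0 by (simp add: K2_def)
    then show "norm (mult_freq N k) / \<mu> < 1" using norm_mult_freq_less mu by (simp add: \<mu>_def)
    show "norm (mult_freq N k) / \<mu> \<ge> 0" using mu by simp
  qed
  then have Elim: "E \<longlonglongrightarrow> 0" by simp
  \<comment> \<open>A lower bound for the distance of 0 from the segment between the two
    coefficients: the numerator is twice the area of the triangle that they span with 0.\<close>
  define I where "I = \<bar>Im (dft N a k0 * cnj (dft N b k0))\<bar> / (norm (dft N a k0) + norm (dft N b k0))"
  have npos: "norm (dft N a k0) + norm (dft N b k0) > 0" using dk0 by (simp add: add_pos_nonneg)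
  have I: "I > 0" unfolding I_def using generic[OF k0N dk0 sin0] npos by simp
  define d where "d \<tau> k = of_real (1 - \<tau>) * dft N a k + of_real \<tau> * dft N b k" for \<tau> k
  have dI: "norm (d \<tau> k0) \<ge> I" if t: "\<tau> \<in> {0..1}" for \<tau>
  proof -
    let ?J = "Im (dft N a k0 * cnj (dft N b k0))"
    have "Im (d \<tau> k0 * cnj (dft N b k0)) = (1 - \<tau>) * ?J"
      unfolding d_def by (simp add: algebra_simps)
    moreover have "Im (dft N a k0 * cnj (d \<tau> k0)) = \<tau> * ?J"
      unfolding d_def by (simp add: algebra_simps)
    moreover have "\<bar>Im (d \<tau> k0 * cnj (dft N b k0))\<bar> \<le> norm (d \<tau> k0) * norm (dft N b k0)"
      by (metis abs_Im_le_cmod complex_mod_cnj norm_mult)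
    moreover have "\<bar>Im (dft N a k0 * cnj (d \<tau> k0))\<bar> \<le> norm (dft N a k0) * norm (d \<tau> k0)"
      by (metis abs_Im_le_cmod complex_mod_cnj norm_mult)
    ultimately have "(1 - \<tau>) * \<bar>?J\<bar> + \<tau> * \<bar>?J\<bar> \<le> norm (d \<tau> k0) * norm (dft N b k0) + norm (dft N a k0) * norm (d \<tau> k0)"
      using t by (simp add: abs_mult)
    then have "\<bar>?J\<bar> \<le> norm (d \<tau> k0) * (norm (dft N a k0) + norm (dft N b k0))" by (simp add: algebra_simps)
    then show ?thesis unfolding I_def using npos by (simp add: divide_le_eq)
  qed
  have "eventually (\<lambda>n. E n < I * \<bar>sin (freq N k0)\<bar>) sequentially"
    using I sin0 by (intro order_tendstoD(2)[OF Elim]) simp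
  then obtain n0 where n0: "\<And>n. n \<ge> n0 \<Longrightarrow> E n < I * \<bar>sin (freq N k0)\<bar>" by (auto simp: eventually_sequentially)
  show ?thesis
  proof (intro exI[of _ n0] allI impI ballI, rule ccontr)
    fix n \<tau> i assume n: "n \<ge> n0" and t: "\<tau> \<in> {0..1::real}"
    define e where "e = smooth n (\<lambda>i. (1 - \<tau>) * a i + \<tau> * b i)"
    assume "smooth n (\<lambda>i. (1 - \<tau>) * a i + \<tau> * b i) i = 0"
      and "\<not> (smooth n (\<lambda>i. (1 - \<tau>) * a i + \<tau> * b i) (i + 1) < 0 \<or> smooth n (\<lambda>i. (1 - \<tau>) * a i + \<tau> * b i) (i - 1) < 0)"
    then have e0: "e i = 0" "e (i + 1) \<ge> 0" "e (i - 1) \<ge> 0" by (auto simp: e_def)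
    define w where "w k = d \<tau> k * mult_freq N k ^ n * cis (freq N k * real_of_int i)" for k
    have per: "(1 - \<tau>) * a (i + int N) + \<tau> * b (i + int N) = (1 - \<tau>) * a i + \<tau> * b i" for i by (simp add: pa pb)
    have eK: "complex_of_real (e (i + j)) = (\<Sum>k\<in>K. w k * cis (freq N k * real_of_int j))" for j
    proof -
      have "complex_of_real (e (i + j)) = (\<Sum>k<N. d \<tau> k * mult_freq N k ^ n * cis (freq N k * real_of_int (i + j)))"
        unfolding e_def d_def dft_lin[symmetric] by (rule smooth_dft[where a = "\<lambda>i. (1 - \<tau>) * a i + \<tau> * b i", OF N per])
      also have "\<dots> = (\<Sum>k<N. w k * cis (freq N k * real_of_int j))"
        by (intro sum.cong) (simp_all add: w_def cis_mult algebra_simps)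
      also have "\<dots> = (\<Sum>k\<in>K. w k * cis (freq N k * real_of_int j))"
        by (rule sum.mono_neutral_right) (auto simp: K_def w_def d_def support)
      finally show ?thesis .
    qed
    have nw: "norm (w k) \<le> (norm (dft N a k) + norm (dft N b k)) * norm (mult_freq N k) ^ n" for k
    proof -
      have "norm (d \<tau> k) \<le> norm (of_real (1 - \<tau>) * dft N a k) + norm (of_real \<tau> * dft N b k)"
        unfolding d_def by (rule norm_triangle_ineq)
      also have "\<dots> = (1 - \<tau>) * norm (dft N a k) + \<tau> * norm (dft N b k)" using t by (simp add: norm_mult del: of_real_diff)
      also have "\<dots> \<le> 1 * norm (dft N a k) + 1 * norm (dft N b k)" using t by (intro add_mono mult_right_mono) auto
      finally show ?thesis unfolding w_def by (simp add: norm_mult norm_power mult_right_mono)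
    qed
    have bound: "norm (\<Sum>k\<in>K2. w k * g k) \<le> \<mu> ^ n * E n" if g: "\<And>k. k \<in> K2 \<Longrightarrow> norm (g k) \<le> 4" for g
    proof -
      have "norm (\<Sum>k\<in>K2. w k * g k) \<le> (\<Sum>k\<in>K2. ((norm (dft N a k) + norm (dft N b k)) * norm (mult_freq N k) ^ n) * 4)"
        by (rule sum_norm_le) (simp add: norm_mult mult_mono nw g)
      also have "\<dots> = \<mu> ^ n * E n" using mu by (simp add: E_def sum_distrib_left power_divide algebra_simps)
      finally show ?thesis .
    qed
    define l where "l = cis (freq N k0)"
    \<comment> \<open>The recurrence annihilates all frequencies with cosine c, so only the
      subdominant set \<open>K2\<close> remains. The constant 4 in \<open>E\<close> bounds the
      factor that it leaves there.\<close>
    have "complex_of_real (e (i + 1) + e (i - 1) - 2 * c * e i) =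
      (\<Sum>k\<in>K. w k * (cis (freq N k) + cis (- freq N k) - 2 * c))"
      using eK[of 1] eK[of "-1"] eK[of 0]
      by (simp add: sum_distrib_left sum_distrib_right algebra_simps flip: sum.distrib sum_subtractf)
    also have "\<dots> = (\<Sum>k\<in>K2. w k * (cis (freq N k) + cis (- freq N k) - 2 * c))"
    proof (rule sum.mono_neutral_right)
      show "\<forall>k\<in>K - K2. w k * (cis (freq N k) + cis (- freq N k) - 2 * c) = 0"
        by (auto simp: K2_def complex_eq_iff)
    qed (use finK in \<open>auto simp: K2_def\<close>)
    finally have eq: "complex_of_real (e (i + 1) + e (i - 1) - 2 * c * e i) = (\<Sum>k\<in>K2. w k * (cis (freq N k) + cis (- freq N k) - 2 * c))" .
    have "norm (complex_of_real (e (i + 1) + e (i - 1) - 2 * c * e i)) \<le> \<mu> ^ n * E n"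
      unfolding eq
    proof (rule bound)
      fix k
      have "norm (cis (freq N k) + cis (- freq N k) - 2 * c) \<le> norm (cis (freq N k)) + norm (cis (- freq N k)) + norm (2 * complex_of_real c)"
        using norm_triangle_ineq4[of "cis (freq N k) + cis (- freq N k)" "2 * complex_of_real c"]
          norm_triangle_ineq[of "cis (freq N k)" "cis (- freq N k)"] by simp
      moreover have "\<bar>c\<bar> \<le> 1" using k0(2) abs_cos_le_one by metis
      ultimately show "norm (cis (freq N k) + cis (- freq N k) - 2 * c) \<le> 4" by (simp add: norm_mult)
    qed
    then have e1: "\<bar>e (i + 1)\<bar> \<le> \<mu> ^ n * E n" using e0 by (simp add: norm_of_real flip: of_real_add)
    \<comment> \<open>Since e(i) = 0, any multiple of it may be subtracted. The multiple chosen
      removes the conjugate frequency and isolates the amplitude at \<open>k0\<close>.\<close>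
    have "complex_of_real (e (i + 1)) = complex_of_real (e (i + 1)) - cnj l * complex_of_real (e i)" using e0 by simp
    also have "\<dots> = (\<Sum>k\<in>K. w k * (cis (freq N k) - cnj l))"
      using eK[of 1] eK[of 0] by (simp add: sum_distrib_left algebra_simps flip: sum_subtractf)
    also have "\<dots> = w k0 * (l - cnj l) + (\<Sum>k\<in>K1. w k * (cis (freq N k) - cnj l)) + (\<Sum>k\<in>K2. w k * (cis (freq N k) - cnj l))"
      using K_split by (simp add: sum.union_disjoint l_def algebra_simps)
    also have "(\<Sum>k\<in>K1. w k * (cis (freq N k) - cnj l)) = 0"
      using K1_conj by (intro sum.neutral) (auto simp: l_def)
    finally have *: "w k0 * (l - cnj l) = complex_of_real (e (i + 1)) - (\<Sum>k\<in>K2. w k * (cis (freq N k) - cnj l))" by (simp add: algebra_simps)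
    have "norm (w k0 * (l - cnj l)) \<le> \<bar>e (i + 1)\<bar> + norm (\<Sum>k\<in>K2. w k * (cis (freq N k) - cnj l))"
      unfolding * by (metis norm_of_real norm_triangle_ineq4 real_norm_def)
    also have "\<dots> \<le> \<mu> ^ n * E n + \<mu> ^ n * E n"
    proof (intro add_mono e1 bound)
      fix k
      have "norm (cis (freq N k) - cnj l) \<le> norm (cis (freq N k)) + norm (cnj l)" by (rule norm_triangle_ineq4)
      then show "norm (cis (freq N k) - cnj l) \<le> 4" by (simp add: l_def)
    qed
    finally have "norm (w k0 * (l - cnj l)) \<le> \<mu> ^ n * (2 * E n)" by (simp only: mult_2 distrib_left)
    moreover have "norm (w k0 * (l - cnj l)) = \<mu> ^ n * (2 * (norm (d \<tau> k0) * \<bar>sin (freq N k0)\<bar>))"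
    proof -
      have "l - cnj l = \<i> * of_real (2 * sin (freq N k0))" by (simp add: l_def complex_eq_iff)
      then show ?thesis by (simp add: w_def norm_mult norm_power \<mu>_def abs_mult del: of_real_mult)
    qed
    ultimately have "\<mu> ^ n * (2 * (norm (d \<tau> k0) * \<bar>sin (freq N k0)\<bar>)) \<le> \<mu> ^ n * (2 * E n)" by simp
    then have "norm (d \<tau> k0) * \<bar>sin (freq N k0)\<bar> \<le> E n" using mu by (simp only: mult_le_cancel_left_pos zero_less_power)
    moreover have "I * \<bar>sin (freq N k0)\<bar> \<le> norm (d \<tau> k0) * \<bar>sin (freq N k0)\<bar>" using dI[OF t] by (intro mult_right_mono) auto
    ultimately show False using n0[OF n] by linarith
  qed
qed

context km_weyl
begin

lemma inv_cancel [simp]: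
  assumes "x \<in> carrier W" "y \<in> carrier W"
  shows "inv x \<otimes> (x \<otimes> y) = y" "x \<otimes> (inv x \<otimes> y) = y"
  using assms by (simp_all flip: m_assoc)

subsection \<open>Paths of conjugations\<close>

text \<open>The element \<open>w\<close> as it is seen from the chamber \<open>x\<close>: moving \<open>x\<close> conjugates it.\<close>

definition conjg :: "'a \<Rightarrow> 'a \<Rightarrow> 'a" where
  "conjg w x = inv x \<otimes> w \<otimes> x"

definition shift_step :: "'a \<Rightarrow> ('a \<times> 'a) set" where
  "shift_step w = {(x, x \<otimes> s) | x s. x \<in> carrier W \<and> s \<in> S \<and>
    (len (s \<otimes> conjg w x) < len (conjg w x) \<or> len (conjg w x \<otimes> s) < len (conjg w x))}"

text \<open>With u the old and u' the new conjugate, u z = z u'. As u and u' have equal length, the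
  product z u' is length additive as well.\<close>

definition strong_step :: "'a \<Rightarrow> ('a \<times> 'a) set" where
  "strong_step w = {(x, x \<otimes> z) | x z. x \<in> carrier W \<and> z \<in> carrier W \<and>
    len (conjg w x \<otimes> z) = len (conjg w x) + len z \<and> len (conjg w (x \<otimes> z)) = len (conjg w x)}"

definition conj_step :: "'a \<Rightarrow> ('a \<times> 'a) set" where
  "conj_step w = shift_step w \<union> strong_step w"

lemma conjg_closed [simp]: "w \<in> carrier W \<Longrightarrow> x \<in> carrier W \<Longrightarrow> conjg w x \<in> carrier W"
  by (simp add: conjg_def)

lemma conjg_mult: "w \<in> carrier W \<Longrightarrow> x \<in> carrier W \<Longrightarrow> y \<in> carrier W \<Longrightarrow> 
    conjg w (x \<otimes> y) = inv y \<otimes> conjg w x \<otimes> y"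
  by (simp add: conjg_def inv_mult_group m_assoc)

text \<open>The hypothesis says that the wall between x and x s separates x from w^-1 x or from w x.
  Seen from x these chambers are at u^-1 and u, where u is the current conjugate, so s is a right or
  a left descent of u.\<close>

lemma shift_stepI:
  assumes w: "w \<in> carrier W" and x: "x \<in> carrier W" and s: "s \<in> S"
    and "\<not> sg x (act w (act x (sroot s))) \<or> \<not> sg x (act (inv w) (act x (sroot s)))"
  shows "(x, x \<otimes> s) \<in> shift_step w"
proof -
  let ?u = "conjg w x"
  have "len (?u \<otimes> s) < len ?u" if "\<not> sg x (act w (act x (sroot s)))"
  proof -
    have "act ?u (sroot s) \<notin> proots" using that w x s by (simp add: sg_def conjg_def act_mult)
    then show ?thesis using act_sroot_proots_iff[of ?u s] len_mult_gen_cases[of ?u s] w x s by auto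
  qed
  moreover have "len (s \<otimes> ?u) < len ?u" if "\<not> sg x (act (inv w) (act x (sroot s)))"
  proof -
    have "inv ?u = inv x \<otimes> (inv w \<otimes> x)" using w x by (simp add: conjg_def inv_mult_group)
    then have "act (inv ?u) (sroot s) \<notin> proots" using that w x s by (simp add: sg_def act_mult)
    then show ?thesis using act_sroot_proots_iff'[of ?u s] len_gen_mult_cases[of ?u s] w x s by auto
  qed
  ultimately show ?thesis using assms by (auto simp: shift_step_def)
qed

lemma shift_step_closed: "(x, y) \<in> shift_step w \<Longrightarrow> x \<in> carrier W \<and> y \<in> carrier W"
  by (auto simp: shift_step_def)

lemma shift_step_le:
  assumes w: "w \<in> carrier W" and "(x, y) \<in> shift_step w"
  shows "len (conjg w y) \<le> len (conjg w x)"
proof -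
  obtain s where s: "x \<in> carrier W" "s \<in> S" "y = x \<otimes> s" 
    "len (s \<otimes> conjg w x) < len (conjg w x) \<or> len (conjg w x \<otimes> s) < len (conjg w x)"
    using assms by (auto simp: shift_step_def)
  let ?u = "conjg w x"
  have u: "?u \<in> carrier W" using w s by simp
  have y: "conjg w y = s \<otimes> ?u \<otimes> s" using s w by (simp add: conjg_mult)
  have "len (s \<otimes> ?u \<otimes> s) \<le> len (s \<otimes> ?u) + 1" using len_mult_le[of "s \<otimes> ?u" s] u s by simp
  moreover have "len (s \<otimes> (?u \<otimes> s)) \<le> len (?u \<otimes> s) + 1" using len_mult_le[of s "?u \<otimes> s"] u s by simp
  ultimately show ?thesis unfolding y using s(4) u s by (auto simp: m_assoc)
qed

text \<open>For u' = s u s one has s u' = u s and u' s = s u. If the lengths of u and u' agree, a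
  descent on one side of u is a descent on the other side of u'.\<close>

lemma shift_step_sym:
  assumes w: "w \<in> carrier W" and "(x, y) \<in> shift_step w" "len (conjg w y) = len (conjg w x)"
  shows "(y, x) \<in> shift_step w"
proof -
  obtain s where s: "x \<in> carrier W" "s \<in> S" "y = x \<otimes> s" 
    "len (s \<otimes> conjg w x) < len (conjg w x) \<or> len (conjg w x \<otimes> s) < len (conjg w x)"
    using assms by (auto simp: shift_step_def)
  let ?u = "conjg w x"
  have u: "?u \<in> carrier W" using w s by simp
  have y: "conjg w y = s \<otimes> ?u \<otimes> s" using s w by (simp add: conjg_mult)
  have e: "s \<otimes> conjg w y = ?u \<otimes> s" "conjg w y \<otimes> s = s \<otimes> ?u" unfolding y using u s by (simp_all add: m_assoc)
  have xy: "x = y \<otimes> s" "y \<in> carrier W" using s by auto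
  have "len (s \<otimes> conjg w y) < len (conjg w y) \<or> len (conjg w y \<otimes> s) < len (conjg w y)"
    unfolding e assms(3) using s(4) by blast
  then show ?thesis unfolding shift_step_def using xy s(2) by blast
qed

lemma shift_rtrancl_le:
  assumes "w \<in> carrier W" "(x, y) \<in> (shift_step w)\<^sup>*"
  shows "len (conjg w y) \<le> len (conjg w x)"
  using assms(2) by induction (use shift_step_le[OF assms(1)] in \<open>auto intro: order_trans\<close>)

lemma shift_rtrancl_sym:
  assumes "w \<in> carrier W" "(x, y) \<in> (shift_step w)\<^sup>*" "len (conjg w y) = len (conjg w x)"
  shows "(y, x) \<in> (shift_step w)\<^sup>*"
  using assms(2,3)
proof (induction)
  case (step y z)
  have "len (conjg w z) \<le> len (conjg w y)" "len (conjg w y) \<le> len (conjg w x)"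
    using shift_step_le[OF assms(1) step(2)] shift_rtrancl_le[OF assms(1) step(1)] by auto
  then have "len (conjg w y) = len (conjg w x)" "len (conjg w z) = len (conjg w y)" using step(4) by linarith+
  then show ?case using shift_step_sym[OF assms(1) step(2)] step by (meson converse_rtrancl_into_rtrancl)
qed simp

text \<open>The length condition places y on a geodesic from x to w^-1 x. Its first letter s is a
  right descent of the current conjugate, so moving to x s is a shift. Unless the conjugate gets
  shorter, the triangle inequality forces y to lie on a geodesic from x s to w^-1 x s again.\<close>

lemma shift_along_geodesic:
  assumes w: "w \<in> carrier W"
  shows "x \<in> carrier W \<Longrightarrow> y \<in> carrier W \<Longrightarrow> 
    len (inv (conjg w x)) = len (inv x \<otimes> y) + len (inv y \<otimes> x \<otimes> inv (conjg w x)) \<Longrightarrow>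
    (x, y) \<in> (shift_step w)\<^sup>* \<or> (\<exists>z. (x, z) \<in> (shift_step w)\<^sup>* \<and> len (conjg w z) < len (conjg w x))"
proof (induction "len (inv x \<otimes> y)" arbitrary: x)
  case 0
  then have "inv x \<otimes> y = \<one>" using len_0_iff by simp
  then have "x = y" using 0 inv_solve_left' by fastforce
  then show ?case by simp
next
  case (Suc k)
  let ?u = "conjg w x" and ?z = "inv x \<otimes> y"
  define r where "r = inv y \<otimes> x \<otimes> inv (conjg w x)"
  have u: "?u \<in> carrier W" "?z \<in> carrier W" "r \<in> carrier W" using w Suc.prems by (auto simp: r_def)
  have ur: "inv ?u = ?z \<otimes> r" using u(1) Suc.prems by (simp add: r_def m_assoc)
  obtain v where v: "v \<in> lists S" "wv v = ?z" "length v = len ?z" using ex_reduced u by metis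
  then obtain s v' where sv: "v = s # v'" using Suc(2) by (cases v) auto
  have s: "s \<in> S" and v': "v' \<in> lists S" using v sv by auto
  have lz': "len (s \<otimes> ?z) = k"
  proof -
    have zz: "?z = s \<otimes> wv v'" using v(2) sv by simp
    have "s \<otimes> ?z = wv v'" unfolding zz using s v' by simp
    then have "len (s \<otimes> ?z) \<le> k" using len_le[OF v' HOL.refl] v sv Suc(2) by simp
    then show ?thesis using len_gen_mult_cases[of ?z s] u s Suc(2) by auto
  qed
  have "len (s \<otimes> inv ?u) \<le> len (s \<otimes> ?z) + len r" unfolding ur using len_mult_le[of "s \<otimes> ?z" r] u s by (simp add: m_assoc)
  also have "\<dots> < len (inv ?u)" using Suc.prems(3) lz' Suc(2) unfolding r_def by simp
  finally have lt: "len (?u \<otimes> s) < len ?u" using len_gen_mult[of "inv ?u" s] len_inv u s by simp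
  then have st: "(x, x \<otimes> s) \<in> shift_step w" using Suc.prems s by (auto simp: shift_step_def)
  show ?case
  proof (cases "len (conjg w (x \<otimes> s)) < len ?u")
    case True
    then show ?thesis using st by blast
  next
    case False
    have xs: "x \<otimes> s \<in> carrier W" using Suc.prems s by simp
    have z': "inv (x \<otimes> s) \<otimes> y = s \<otimes> ?z" using Suc.prems s by (simp add: inv_mult_group m_assoc)
    have leq: "len (conjg w (x \<otimes> s)) = len ?u" using False shift_step_le[OF w st] by simp
    have r': "inv y \<otimes> (x \<otimes> s) \<otimes> inv (conjg w (x \<otimes> s)) = r \<otimes> s"
    proof -
      have "inv (conjg w (x \<otimes> s)) = s \<otimes> inv ?u \<otimes> s" using w Suc.prems s by (simp add: conjg_mult inv_mult_group m_assoc)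
      then show ?thesis using w Suc.prems s by (simp add: m_assoc r_def)
    qed
    have "len (inv (conjg w (x \<otimes> s))) \<le> len (s \<otimes> ?z) + len (r \<otimes> s)"
    proof -
      have "inv (conjg w (x \<otimes> s)) = (s \<otimes> ?z) \<otimes> (r \<otimes> s)"
        using w Suc.prems s u by (simp add: conjg_mult inv_mult_group ur m_assoc)
      then show ?thesis using len_mult_le[of "s \<otimes> ?z" "r \<otimes> s"] u s by simp
    qed
    moreover have "len (r \<otimes> s) \<le> len r + 1" using len_mult_le[of r s] u s by simp
    moreover have "len (inv (conjg w (x \<otimes> s))) = len (inv ?u)" using leq w xs Suc.prems by simp
    ultimately have eq: "len (inv (conjg w (x \<otimes> s))) = len (inv (x \<otimes> s) \<otimes> y) + len (inv y \<otimes> (x \<otimes> s) \<otimes> inv (conjg w (x \<otimes> s)))"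
      unfolding z' r' using Suc.prems(3) lz' Suc(2) unfolding r_def by linarith
    have "(x \<otimes> s, y) \<in> (shift_step w)\<^sup>* \<or> (\<exists>z. (x \<otimes> s, z) \<in> (shift_step w)\<^sup>* \<and> len (conjg w z) < len (conjg w (x \<otimes> s)))"
      using Suc.hyps(1)[OF _ xs Suc.prems(2) eq] lz' z' by simp
    then show ?thesis using st leq by (metis converse_rtrancl_into_rtrancl)
  qed
qed

text \<open>No wall has y on one side and both x and w^-1 x on the other, so y is on a geodesic
  between them.\<close>

lemma shift_to_between:
  assumes w: "w \<in> carrier W" and x: "x \<in> carrier W" and y: "y \<in> carrier W"
    and between: "\<And>\<beta>. \<beta> \<in> roots \<Longrightarrow> sg x \<beta> \<Longrightarrow> sg x (act w \<beta>) \<Longrightarrow> sg y \<beta>"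
  shows "(x, y) \<in> (shift_step w)\<^sup>* \<or> (\<exists>z. (x, z) \<in> (shift_step w)\<^sup>* \<and> len (conjg w z) < len (conjg w x))"
proof (rule shift_along_geodesic[OF w x y])
  have "sep x y \<inter> sep (inv w \<otimes> x) y = {}"
    using between sg_mult[of "inv w" x] w x by (auto simp: sep_def)
  then have "len (inv x \<otimes> (inv w \<otimes> x)) = len (inv x \<otimes> y) + len (inv y \<otimes> (inv w \<otimes> x))"
    using len_additive w x y by simp
  moreover have "inv (conjg w x) = inv x \<otimes> (inv w \<otimes> x)" using w x by (simp add: conjg_def inv_mult_group)
  moreover have "inv y \<otimes> (inv w \<otimes> x) = inv y \<otimes> x \<otimes> (inv x \<otimes> (inv w \<otimes> x))" using w x y by (simp add: m_assoc)
  ultimately show "len (inv (conjg w x)) = len (inv x \<otimes> y) + len (inv y \<otimes> x \<otimes> inv (conjg w x))" by simp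
qed

text \<open>By finiteness and injectivity w permutes the roots separating x from y. Hence no wall is
  crossed twice on the way from x over w x to w y, and the walls between y and w y are those between
  x and w x.\<close>

lemma strong_stepI:
  assumes w: "w \<in> carrier W" and x: "x \<in> carrier W" and y: "y \<in> carrier W"
    and stable: "\<And>\<beta>. \<beta> \<in> sep x y \<Longrightarrow> act w \<beta> \<in> sep x y"
  shows "(x, y) \<in> strong_step w"
proof -
  have fin: "finite (sep x y)" using finite_sep x y by simp
  have "act w ` sep x y \<subseteq> sep x y" using stable by blast
  moreover have "inj_on (act w) (sep x y)" using act_inj[OF w] by (auto intro: inj_onI)
  ultimately have surj: "act w ` sep x y = sep x y" using fin by (metis endo_inj_surj)
  have stable': "act (inv w) \<beta> \<in> sep x y" if "\<beta> \<in> sep x y" for \<beta> 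
  proof -
    obtain \<gamma> where "\<gamma> \<in> sep x y" "\<beta> = act w \<gamma>" using surj \<open>\<beta> \<in> sep x y\<close> by blast
    then show ?thesis using w by simp
  qed
  let ?z = "inv x \<otimes> y"
  have z: "?z \<in> carrier W" "x \<otimes> ?z = y" using x y by (simp_all)
  have sgw: "sg (w \<otimes> v) \<beta> \<longleftrightarrow> sg v (act (inv w) \<beta>)" if "v \<in> carrier W" for v \<beta> using sg_mult w that by simp
  have neg: "\<beta> \<in> sep y x \<longleftrightarrow> (\<lambda>r. - \<beta> r) \<in> sep x y" if "\<beta> \<in> roots" for \<beta>
    using that x y by (auto simp: sep_def sg_uminus roots_uminus)
  have "sep x (w \<otimes> x) \<inter> sep (w \<otimes> y) (w \<otimes> x) = {}"
  proof (rule ccontr)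
    assume "sep x (w \<otimes> x) \<inter> sep (w \<otimes> y) (w \<otimes> x) \<noteq> {}"
    then obtain \<beta> where b: "\<beta> \<in> roots" "sg x \<beta>" "\<not> sg x (act (inv w) \<beta>)" "sg y (act (inv w) \<beta>)"
      using sgw x y by (auto simp: sep_def)
    define \<gamma> where "\<gamma> = act (inv w) \<beta>"
    have g: "\<gamma> \<in> roots" "act w \<gamma> = \<beta>" using b w by (simp_all add: \<gamma>_def roots_act)
    have "\<gamma> \<in> sep y x" using b g by (simp add: sep_def \<gamma>_def)
    then have "(\<lambda>r. - \<gamma> r) \<in> sep x y" using neg g by simp
    then have "act w (\<lambda>r. - \<gamma> r) \<in> sep x y" by (rule stable)
    then have "(\<lambda>r. - \<beta> r) \<in> sep x y" using act_uminus[OF w, of \<gamma>] g by simp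
    then show False using b x by (simp add: sep_def sg_uminus)
  qed
  then have "len (inv x \<otimes> (w \<otimes> y)) = len (inv x \<otimes> (w \<otimes> x)) + len (inv (w \<otimes> x) \<otimes> (w \<otimes> y))"
    using len_additive[of x "w \<otimes> x" "w \<otimes> y"] w x y by simp
  moreover have "inv x \<otimes> (w \<otimes> x) = conjg w x" "inv x \<otimes> (w \<otimes> y) = conjg w x \<otimes> ?z" "inv (w \<otimes> x) \<otimes> (w \<otimes> y) = ?z"
    using w x y by (simp_all add: conjg_def m_assoc inv_mult_group)
  ultimately have 1: "len (conjg w x \<otimes> ?z) = len (conjg w x) + len ?z" by simp
  have "sep y (w \<otimes> y) = sep x (w \<otimes> x)"
  proof -
    have "(sg y \<beta> \<and> \<not> sg y (act (inv w) \<beta>)) \<longleftrightarrow> (sg x \<beta> \<and> \<not> sg x (act (inv w) \<beta>))" if b: "\<beta> \<in> roots" for \<beta>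
    proof -
      have ib: "act (inv w) \<beta> \<in> roots" using b w by (simp add: roots_act)
      consider "\<beta> \<in> sep x y" | "(\<lambda>r. - \<beta> r) \<in> sep x y" 
        | "act (inv w) \<beta> \<notin> sep x y" "(\<lambda>r. - act (inv w) \<beta> r) \<notin> sep x y" "\<beta> \<notin> sep x y" "(\<lambda>r. - \<beta> r) \<notin> sep x y"
      proof -
        have "\<beta> \<in> sep x y" if "act (inv w) \<beta> \<in> sep x y" using stable[OF that] w by simp
        moreover have "(\<lambda>r. - \<beta> r) \<in> sep x y" if "(\<lambda>r. - act (inv w) \<beta> r) \<in> sep x y"
          using stable[OF that] act_uminus[OF w, of "act (inv w) \<beta>"] w by simp
        ultimately show ?thesis using that by blast
      qed
      then show ?thesis
      proof cases
        case 1
        then show ?thesis using stable'[OF 1] by (simp add: sep_def)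
      next
        case 2
        have "act (inv w) (\<lambda>r. - \<beta> r) \<in> sep x y" by (rule stable'[OF 2])
        then show ?thesis using 2 b ib x y act_uminus[of "inv w" \<beta>] w by (auto simp: sep_def sg_uminus)
      next
        case 3
        then show ?thesis using b ib x y by (auto simp: sep_def sg_uminus roots_uminus)
      qed
    qed
    then show ?thesis using sgw x y by (auto simp: sep_def)
  qed
  then have "len (inv y \<otimes> (w \<otimes> y)) = len (inv x \<otimes> (w \<otimes> x))"
    using card_sep[of y "w \<otimes> y"] card_sep[of x "w \<otimes> x"] w x y by simp
  then have 2: "len (conjg w (x \<otimes> ?z)) = len (conjg w x)" using z w x y by (simp add: conjg_def m_assoc)
  show ?thesis unfolding strong_step_def using 1 2 z x by (auto intro!: exI[of _ ?z])
qed

section \<open>Points in the interior of the Tits cone\<close>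

definition almost_pos :: "(('a \<Rightarrow> real) \<Rightarrow> real) \<Rightarrow> bool" where
  "almost_pos f \<longleftrightarrow> finite {\<beta> \<in> proots. f \<beta> \<le> 0}"

lemma almost_pos_combine:
  assumes "almost_pos f" "almost_pos g" "a \<ge> 0" "b \<ge> 0" "a + b > 0"
  shows "almost_pos (\<lambda>v. a * f v + b * g v)"
proof -
  have "{\<beta> \<in> proots. a * f \<beta> + b * g \<beta> \<le> 0} \<subseteq> {\<beta> \<in> proots. f \<beta> \<le> 0} \<union> {\<beta> \<in> proots. g \<beta> \<le> 0}"
  proof
    fix \<beta> assume b: "\<beta> \<in> {\<beta> \<in> proots. a * f \<beta> + b * g \<beta> \<le> 0}"
    show "\<beta> \<in> {\<beta> \<in> proots. f \<beta> \<le> 0} \<union> {\<beta> \<in> proots. g \<beta> \<le> 0}"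
    proof (rule ccontr)
      assume "\<not> ?thesis"
      then have p: "f \<beta> > 0" "g \<beta> > 0" using b by auto
      have "a > 0 \<or> b > 0" using assms by linarith
      then have "a * f \<beta> + b * g \<beta> > 0" using p assms(3,4) by (auto intro: add_pos_nonneg add_nonneg_pos)
      then show False using b by simp
    qed
  qed
  then show ?thesis using assms unfolding almost_pos_def by (meson finite_UnI finite_subset)
qed

lemma almost_pos_act:
  assumes "almost_pos f" "w \<in> carrier W"
  shows "almost_pos (\<lambda>v. f (act w v))"
proof -
  have "{\<beta> \<in> proots. f (act w \<beta>) \<le> 0} \<subseteq> inversions (inv w) \<union> act (inv w) ` {\<beta> \<in> proots. f \<beta> \<le> 0}"
  proof
    fix \<beta> assume b: "\<beta> \<in> {\<beta> \<in> proots. f (act w \<beta>) \<le> 0}"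
    have "\<beta> \<in> act (inv w) ` {\<beta> \<in> proots. f \<beta> \<le> 0}" if "act w \<beta> \<in> proots"
      using that b assms by (intro image_eqI[of _ _ "act w \<beta>"]) auto
    then show "\<beta> \<in> inversions (inv w) \<union> act (inv w) ` {\<beta> \<in> proots. f \<beta> \<le> 0}"
      using b assms by (auto simp: inversions_def)
  qed
  then show ?thesis using assms card_inversions[of "inv w"] unfolding almost_pos_def 
    by (meson finite_UnI finite_imageI finite_subset inv_closed)
qed

lemma chamber_of:
  assumes "functional f" "almost_pos f" "\<And>\<beta>. \<beta> \<in> roots \<Longrightarrow> f \<beta> \<noteq> 0"
  obtains x where "x \<in> carrier W" "\<And>\<beta>. \<beta> \<in> roots \<Longrightarrow> sg x \<beta> \<longleftrightarrow> f \<beta> > 0"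
proof -
  have "finite {\<beta> \<in> proots. f \<beta> < 0}" 
    using assms(2) unfolding almost_pos_def by (rule rev_finite_subset) auto
  then show ?thesis using chamber_exists assms that by blast
qed

text \<open>Although f may take infinitely many values, only finitely many roots with f positive can
  have h nonpositive: a negative root with f positive is the negative of a member of the finite set
  \<open>B\<close>. One bound for these suffices.\<close>

lemma perturb_small:
  assumes f: "functional f" "almost_pos f" and h: "functional h" "almost_pos h"
  shows "\<exists>\<epsilon>0>0. \<forall>\<epsilon>. 0 < \<epsilon> \<longrightarrow> \<epsilon> < \<epsilon>0 \<longrightarrow> (\<forall>\<beta>\<in>roots. f \<beta> > 0 \<longrightarrow> f \<beta> + \<epsilon> * h \<beta> > 0)"
proof -
  define B where "B = {\<beta> \<in> proots. f \<beta> \<le> 0} \<union> {\<beta> \<in> proots. h \<beta> \<le> 0}"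
  define B' where "B' = {\<beta> \<in> B \<union> (\<lambda>\<beta> r. - \<beta> r) ` B. f \<beta> > 0}"
  have fin: "finite B'" using f h by (simp add: B'_def B_def almost_pos_def)
  define \<epsilon>0 where "\<epsilon>0 = Min (insert 1 ((\<lambda>\<beta>. f \<beta> / (\<bar>h \<beta>\<bar> + 1)) ` B'))"
  have "\<epsilon>0 > 0" using fin by (auto simp: \<epsilon>0_def B'_def)
  moreover have "f \<beta> + \<epsilon> * h \<beta> > 0" if e: "0 < \<epsilon>" "\<epsilon> < \<epsilon>0" and b: "\<beta> \<in> roots" "f \<beta> > 0" for \<epsilon> \<beta>
  proof (cases "\<beta> \<in> B'")
    case True
    then have "\<epsilon>0 \<le> f \<beta> / (\<bar>h \<beta>\<bar> + 1)" using fin by (auto simp: \<epsilon>0_def)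
    then have "\<epsilon> < f \<beta> / (\<bar>h \<beta>\<bar> + 1)" using e by linarith
    then have "\<epsilon> * (\<bar>h \<beta>\<bar> + 1) < f \<beta>" by (simp add: pos_less_divide_eq add_nonneg_pos)
    moreover have "- (\<epsilon> * h \<beta>) \<le> \<epsilon> * \<bar>h \<beta>\<bar>" using e by (metis abs_ge_minus_self abs_mult abs_of_pos)
    ultimately show ?thesis using e by (simp add: algebra_simps)
  next
    case False
    show ?thesis
    proof (cases "\<beta> \<in> proots")
      case True
      then have "h \<beta> > 0" using False b by (auto simp: B'_def B_def)
      then show ?thesis using e b by (simp add: add_pos_nonneg)
    next
      case nb: False
      then have "(\<lambda>r. - \<beta> r) \<in> proots" using b proots_uminus by simp
      moreover have "f (\<lambda>r. - \<beta> r) < 0" using b functional_uminus[OF f(1)] by simp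
      ultimately have "(\<lambda>r. - \<beta> r) \<in> B" by (simp add: B_def)
      then have "\<beta> \<in> (\<lambda>\<beta> r. - \<beta> r) ` B" by (intro image_eqI[of _ _ "\<lambda>r. - \<beta> r"]) auto
      then show ?thesis using False b by (simp add: B'_def)
    qed
  qed
  ultimately show ?thesis by blast
qed

text \<open>A point of the open chamber of \<open>x\<close>, with coordinates \<open>c\<close>, as a functional on the roots.\<close>

definition pt :: "('a \<Rightarrow> real) \<Rightarrow> 'a \<Rightarrow> ('a \<Rightarrow> real) \<Rightarrow> real" where
  "pt c x v = (\<Sum>s\<in>S. c s * act (inv x) v s)"

lemma functional_pt: "x \<in> carrier W \<Longrightarrow> functional (pt c x)"
proof -
  assume x: "x \<in> carrier W"
  have "functional (\<lambda>v. \<Sum>s\<in>S. c s * v s)" by (auto simp: functional_def)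
  from functional_act[OF this, of "inv x"] show ?thesis using x by (simp add: pt_def[abs_def])
qed

lemma pt_ge_one:
  assumes "x \<in> carrier W" "\<And>s. s \<in> S \<Longrightarrow> c s \<ge> 1" "sg x \<beta>"
  shows "pt c x \<beta> \<ge> 1"
proof -
  let ?v = "act (inv x) \<beta>"
  have v: "?v \<in> proots" using assms by (simp add: sg_def)
  obtain r where r: "r \<in> S" "?v r \<noteq> 0" using root_nonzero[OF proots_roots[OF v]] by blast
  have "?v r \<in> \<int>" "?v r \<ge> 0" using v roots_lattice by (auto simp: proots_def lattice_def)
  then have vr: "?v r \<ge> 1" using r(2) Ints_nonzero_abs_ge1[of "?v r"] by simp
  have "1 * 1 \<le> c r * ?v r" using assms(2)[OF r(1)] vr by (intro mult_mono) auto
  also have "\<dots> \<le> (\<Sum>s\<in>S. c s * ?v s)" using finite_S r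
  proof (intro member_le_sum)
    fix s assume "s \<in> S - {r}"
    then have "c s \<ge> 1" using assms by blast
    moreover have "?v s \<ge> 0" using v by (simp add: proots_def)
    ultimately show "0 \<le> c s * ?v s" by simp
  qed auto
  finally show ?thesis by (simp add: pt_def)
qed

lemma pt_le_minus_one:
  assumes "x \<in> carrier W" "\<And>s. s \<in> S \<Longrightarrow> c s \<ge> 1" "\<beta> \<in> roots" "\<not> sg x \<beta>"
  shows "pt c x \<beta> \<le> -1"
  using pt_ge_one[of x c "\<lambda>r. - \<beta> r"] assms functional_uminus[OF functional_pt[of x c]] by (simp add: sg_uminus)

lemma almost_pos_pt:
  assumes "x \<in> carrier W" "\<And>s. s \<in> S \<Longrightarrow> c s \<ge> 1"
  shows "almost_pos (pt c x)"
proof -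
  have "{\<beta> \<in> proots. pt c x \<beta> \<le> 0} \<subseteq> inversions x"
    using pt_ge_one[OF assms] by (fastforce simp: inversions_def sg_def)
  then show ?thesis using card_inversions[of x] assms unfolding almost_pos_def by (meson finite_subset)
qed

text \<open>The chambers met by a segment in the Tits cone. The walls crossed at one moment are either all
  preserved by \<open>w\<close> together with their position, which allows one strong step, or each of them can be
  crossed by a shift.\<close>

lemma conj_path_line:
  fixes f0 f1 :: "('a \<Rightarrow> real) \<Rightarrow> real"
  defines "f \<equiv> \<lambda>\<tau> v. (1 - \<tau>) * f0 v + \<tau> * f1 v"
  assumes w: "w \<in> carrier W" and z: "z \<in> carrier W"
    and f0: "functional f0" "almost_pos f0" and f1: "functional f1" "almost_pos f1"
    and z1: "\<And>\<beta>. \<beta> \<in> roots \<Longrightarrow> f1 \<beta> > 0 \<Longrightarrow> sg z \<beta>"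
    and zero: "\<And>\<beta>. \<beta> \<in> roots \<Longrightarrow> f0 \<beta> = 0 \<Longrightarrow> f1 \<beta> = 0"
    and crossing: "\<And>\<tau>. 0 \<le> \<tau> \<Longrightarrow> \<tau> < 1 \<Longrightarrow>
      (\<forall>\<beta>\<in>roots. f \<tau> \<beta> = 0 \<and> f1 \<beta> \<noteq> 0 \<longrightarrow> f0 (act w \<beta>) = f0 \<beta> \<and> f1 (act w \<beta>) = f1 \<beta>) \<or>
      (\<forall>\<beta>\<in>roots. f \<tau> \<beta> = 0 \<and> f1 \<beta> < 0 \<longrightarrow>
        f \<tau> (act w \<beta>) < 0 \<or> f \<tau> (act (inv w) \<beta>) < 0 \<or> act w \<beta> = (\<lambda>r. - \<beta> r))"
    and x: "x \<in> carrier W" and x0: "\<And>\<beta>. \<beta> \<in> roots \<Longrightarrow> f0 \<beta> > 0 \<Longrightarrow> sg x \<beta>"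
    and xz: "\<And>\<beta>. \<beta> \<in> roots \<Longrightarrow> f1 \<beta> = 0 \<Longrightarrow> sg z \<beta> \<longleftrightarrow> sg x \<beta>"
  shows "(x, z) \<in> (conj_step w)\<^sup>*"
proof -
  define cluster where "cluster \<tau> \<longleftrightarrow> 
    (\<forall>\<beta>\<in>roots. f \<tau> \<beta> = 0 \<and> f1 \<beta> \<noteq> 0 \<longrightarrow> f0 (act w \<beta>) = f0 \<beta> \<and> f1 (act w \<beta>) = f1 \<beta>)" for \<tau>
  have fneg: "f \<tau> (\<lambda>r. - \<beta> r) = - f \<tau> \<beta>" for \<tau> \<beta>
    using functional_uminus[OF f0(1)] functional_uminus[OF f1(1)] by (simp add: f_def)
  have f1neg: "f1 (\<lambda>r. - \<beta> r) = - f1 \<beta>" for \<beta> using functional_uminus[OF f1(1)] by simp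
  have f_func: "functional (f \<tau>)" for \<tau> unfolding f_def using f0 f1 by (intro functional_combine)
  have f_one: "f 1 \<beta> = f1 \<beta>" for \<beta> by (simp add: f_def)
  have f_diff: "(1 - \<tau>) * f \<tau>' \<beta> = (1 - \<tau>') * f \<tau> \<beta> + (\<tau>' - \<tau>) * f1 \<beta>" for \<tau> \<tau>' \<beta>
    by (simp add: f_def algebra_simps)
  have dec: "f \<tau>' \<beta> < 0" if "f \<tau> \<beta> \<le> 0" "f1 \<beta> < 0" "\<tau> < \<tau>'" "\<tau>' \<le> 1" for \<tau> \<tau>' \<beta>
  proof -
    have "(1 - \<tau>') * f \<tau> \<beta> \<le> 0" using that by (simp add: mult_nonneg_nonpos)
    moreover have "(\<tau>' - \<tau>) * f1 \<beta> < 0" using that by (simp add: mult_pos_neg)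
    ultimately have "(1 - \<tau>) * f \<tau>' \<beta> < 0" using f_diff[of \<tau> \<tau>' \<beta>] by linarith
    then show ?thesis using that by (simp add: mult_less_0_iff)
  qed
  \<comment> \<open>Induction on the number of walls still separating x from z. The invariant: the
    point at \<tau>0 lies in the closed chamber of x, and a cluster at \<tau>0 has already been
    crossed.\<close>
  have main: "(x, z) \<in> (conj_step w)\<^sup>*"
    if "x \<in> carrier W" "0 \<le> \<tau>0" "\<tau>0 < 1"
      "\<And>\<beta>. \<beta> \<in> roots \<Longrightarrow> f \<tau>0 \<beta> > 0 \<Longrightarrow> sg x \<beta>"
      "\<And>\<beta>. \<beta> \<in> roots \<Longrightarrow> f1 \<beta> = 0 \<Longrightarrow> sg z \<beta> \<longleftrightarrow> sg x \<beta>"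
      "cluster \<tau>0 \<Longrightarrow> (\<And>\<beta>. \<beta> \<in> roots \<Longrightarrow> f \<tau>0 \<beta> = 0 \<Longrightarrow> f1 \<beta> < 0 \<Longrightarrow> \<not> sg x \<beta>)" for x \<tau>0
    using that
  proof (induction "card (sep x z)" arbitrary: x \<tau>0 rule: less_induct)
    case less
    note xc = less.prems(1) and t0 = less.prems(2,3) and A = less.prems(4) and B = less.prems(5) and C = less.prems(6)
    show ?case
    proof (cases "x = z")
      case False
      have ne: "sep x z \<noteq> {}" using sep_empty[OF xc z] False by blast
      have fin: "finite (sep x z)" using finite_sep xc z by simp
      have sepD: "\<beta> \<in> roots" "sg x \<beta>" "f1 \<beta> < 0" "f \<tau>0 \<beta> \<ge> 0" if "\<beta> \<in> sep x z" for \<beta>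
      proof -
        show b: "\<beta> \<in> roots" and s: "sg x \<beta>" using that by (auto simp: sep_def)
        show "f1 \<beta> < 0" using z1[OF b] B[OF b] that by (force simp: sep_def)
        show "f \<tau>0 \<beta> \<ge> 0"
        proof (rule ccontr)
          assume "\<not> f \<tau>0 \<beta> \<ge> 0"
          then have "sg x (\<lambda>r. - \<beta> r)" using A[OF roots_uminus[OF b]] by (simp add: fneg)
          then show False using s b xc by (simp add: sg_uminus)
        qed
      qed
      define t where "t \<beta> = f0 \<beta> / (f0 \<beta> - f1 \<beta>)" for \<beta>
      have tD: "\<tau>0 \<le> t \<beta>" "t \<beta> < 1" "f (t \<beta>) \<beta> = 0" if "\<beta> \<in> sep x z" for \<beta>
      proof -
        note b = sepD[OF that]
        have "(1 - \<tau>0) * f0 \<beta> \<ge> - \<tau>0 * f1 \<beta>" using b(4) by (simp add: f_def)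
        moreover have "- \<tau>0 * f1 \<beta> \<ge> 0" using b(3) t0 by (simp add: mult_nonneg_nonpos)
        ultimately have f00: "f0 \<beta> \<ge> 0" using t0 by (smt (verit) mult_pos_neg)
        have d: "f0 \<beta> - f1 \<beta> > 0" using f00 b by simp
        show ft: "f (t \<beta>) \<beta> = 0" using d by (simp add: f_def t_def field_simps)
        show "t \<beta> < 1" using d b by (simp add: t_def)
        show "\<tau>0 \<le> t \<beta>"
        proof (rule ccontr)
          assume "\<not> \<tau>0 \<le> t \<beta>"
          then show False using dec[of "t \<beta>" \<beta> \<tau>0] ft b t0 by simp
        qed
      qed
      define \<tau>1 where "\<tau>1 = Min (t ` sep x z)"
      have "\<tau>1 \<in> t ` sep x z" unfolding \<tau>1_def using fin ne by (intro Min_in) auto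
      then obtain \<beta>0 where b0: "\<beta>0 \<in> sep x z" "\<tau>1 = t \<beta>0" by blast
      have min: "\<tau>1 \<le> t \<beta>" if "\<beta> \<in> sep x z" for \<beta> unfolding \<tau>1_def using fin that by (intro Min_le) auto
      have t1: "\<tau>0 \<le> \<tau>1" "\<tau>1 < 1" "0 \<le> \<tau>1" using tD[OF b0(1)] b0(2) t0 by auto
      have fb0: "f \<tau>1 \<beta>0 = 0" using tD[OF b0(1)] b0(2) by simp
      \<comment> \<open>As \<tau>1 is the first moment at which a separating wall is met, the point
        at \<tau>1 still lies in the closed chamber of x.\<close>
      have A1: "sg x \<beta>" if b: "\<beta> \<in> roots" "f \<tau>1 \<beta> > 0" for \<beta>
      proof (rule ccontr)
        assume ns: "\<not> sg x \<beta>"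
        let ?g = "\<lambda>r. - \<beta> r"
        have g: "?g \<in> roots" "sg x ?g" "f \<tau>1 ?g < 0" using ns b xc by (auto simp: sg_uminus roots_uminus fneg)
        have "f \<tau>0 ?g \<ge> 0" using A[OF b(1)] ns by (force simp: fneg)
        then have "f1 ?g < 0"
          using g(3) f_diff[of \<tau>0 \<tau>1 ?g] t0 t1 
          by (smt (verit) mult_nonneg_nonneg mult_pos_neg)
        then have "sg z \<beta>" using z1[OF b(1)] by (simp add: f1neg)
        then have "?g \<in> sep x z" using g b z by (simp add: sep_def sg_uminus)
        from min[OF this] tD(3)[OF this] dec[of \<tau>1 ?g "t ?g"] tD(2)[OF this] \<open>f1 ?g < 0\<close> g(3)
        show False by (cases "\<tau>1 = t ?g") auto
      qed
      have A1n: "\<not> sg x \<beta>" if "\<beta> \<in> roots" "f \<tau>1 \<beta> < 0" for \<beta>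
        using A1[OF roots_uminus[OF that(1)]] that xc by (simp add: fneg sg_uminus)
      show ?thesis
      proof (cases "cluster \<tau>1")
        case False
        then have good: "f \<tau>1 (act w \<beta>) < 0 \<or> f \<tau>1 (act (inv w) \<beta>) < 0 \<or> act w \<beta> = (\<lambda>r. - \<beta> r)"
          if "\<beta> \<in> roots" "f \<tau>1 \<beta> = 0" "f1 \<beta> < 0" for \<beta>
          using crossing[OF t1(3,2)] that unfolding cluster_def by blast
        have ge: "f \<tau>1 (act x (sroot s)) \<ge> 0" if "s \<in> S" for s
          using A1n[of "act x (sroot s)"] that xc rootsI by force
        define \<gamma> where "\<gamma> = act (inv x) \<beta>0"
        have gp: "\<gamma> \<in> proots" using sepD[OF b0(1)] by (simp add: \<gamma>_def sg_def)
        have glat: "\<gamma> \<in> lattice" by (rule roots_lattice[OF proots_roots[OF gp]])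
        have gnn: "\<gamma> s \<ge> 0" for s using gp by (simp add: proots_def)
        have expand: "g \<beta>0 = (\<Sum>s\<in>S. \<gamma> s * g (act x (sroot s)))" if "functional g" for g
        proof -
          have "g \<beta>0 = g (act x \<gamma>)" using xc by (simp add: \<gamma>_def)
          also have "\<dots> = (\<Sum>s\<in>S. \<gamma> s * g (act x (sroot s)))" 
            using functional_expand[OF functional_act[OF that xc] glat] .
          finally show ?thesis .
        qed
        \<comment> \<open>Some wall of the chamber x itself must be crossed now. The root \<beta>0
          is a nonnegative combination of the simple roots of x, on which the point at \<tau>1 is
          nonnegative; those occurring in \<beta>0 vanish there, and one of them must become
          negative because \<beta>0 does.\<close>
        have "\<exists>s\<in>S. f \<tau>1 (act x (sroot s)) = 0 \<and> f1 (act x (sroot s)) < 0"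
        proof (rule ccontr)
          assume n: "\<not> ?thesis"
          have "(\<Sum>s\<in>S. \<gamma> s * f \<tau>1 (act x (sroot s))) = 0" using expand[OF f_func] fb0 by simp
          then have all0: "\<forall>s\<in>S. \<gamma> s * f \<tau>1 (act x (sroot s)) = 0"
            using ge gnn finite_S by (subst (asm) sum_nonneg_eq_0_iff) auto
          have "f1 \<beta>0 \<ge> 0" unfolding expand[OF f1(1)]
          proof (rule sum_nonneg)
            fix s assume s: "s \<in> S"
            show "\<gamma> s * f1 (act x (sroot s)) \<ge> 0"
            proof (cases "\<gamma> s = 0")
              case False
              then have "f \<tau>1 (act x (sroot s)) = 0" using all0 s by auto
              then have "f1 (act x (sroot s)) \<ge> 0" using n s by force
              then show ?thesis using gnn by simp
            qed simp
          qed
          then show False using sepD(3)[OF b0(1)] by simp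
        qed
        then obtain s where s: "s \<in> S" "f \<tau>1 (act x (sroot s)) = 0" "f1 (act x (sroot s)) < 0" by blast
        define \<beta> where "\<beta> = act x (sroot s)"
        have b: "\<beta> \<in> roots" "sg x \<beta>" "f \<tau>1 \<beta> = 0" "f1 \<beta> < 0" using s xc by (auto simp: \<beta>_def rootsI)
        have wb: "act w \<beta> \<in> roots" "act (inv w) \<beta> \<in> roots" using b w by (auto simp: roots_act)
        have "\<not> sg x (act w \<beta>) \<or> \<not> sg x (act (inv w) \<beta>)"
          using good[OF b(1,3,4)] A1n[OF wb(1)] A1n[OF wb(2)] b xc by (auto simp: sg_uminus)
        then have st: "(x, x \<otimes> s) \<in> conj_step w" using shift_stepI[OF w xc s(1)] by (simp add: \<beta>_def conj_step_def)
        have xs: "x \<otimes> s \<in> carrier W" using xc s by simp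
        have flip: "sg (x \<otimes> s) \<gamma> \<longleftrightarrow> sg x \<gamma>" if "\<gamma> \<in> roots" "\<gamma> \<noteq> \<beta>" "\<gamma> \<noteq> (\<lambda>r. - \<beta> r)" for \<gamma>
          using sg_simple_flip[OF xc s(1)] that by (simp add: \<beta>_def)
        have nb: "\<not> sg (x \<otimes> s) \<beta>" using sg_simple'[OF xc s(1)] by (simp add: \<beta>_def)
        have bz: "\<beta> \<in> sep x z"
        proof -
          have "sg z (\<lambda>r. - \<beta> r)" using z1[OF roots_uminus[OF b(1)]] b by (simp add: f1neg)
          then show ?thesis using b z by (simp add: sep_def sg_uminus)
        qed
        have sub: "sep (x \<otimes> s) z \<subseteq> sep x z - {\<beta>}"
        proof
          fix \<gamma> assume g: "\<gamma> \<in> sep (x \<otimes> s) z"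
          then have g': "\<gamma> \<in> roots" "sg (x \<otimes> s) \<gamma>" "\<not> sg z \<gamma>" by (auto simp: sep_def)
          have "\<gamma> \<noteq> \<beta>" using g' nb by auto
          moreover have "\<gamma> \<noteq> (\<lambda>r. - \<beta> r)" using g' bz b z by (auto simp: sep_def sg_uminus)
          ultimately show "\<gamma> \<in> sep x z - {\<beta>}" using g' flip by (simp add: sep_def)
        qed
        have "card (sep (x \<otimes> s) z) < card (sep x z)"
          using sub bz fin by (intro psubset_card_mono) auto
        moreover have "sg (x \<otimes> s) \<gamma>" if "\<gamma> \<in> roots" "f \<tau>1 \<gamma> > 0" for \<gamma>
          using flip[OF that(1)] A1[OF that] that b by (force simp: fneg)
        moreover have "sg z \<gamma> \<longleftrightarrow> sg (x \<otimes> s) \<gamma>" if "\<gamma> \<in> roots" "f1 \<gamma> = 0" for \<gamma>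
          using flip[OF that(1)] B[OF that] that b by (force simp: f1neg)
        ultimately have "(x \<otimes> s, z) \<in> (conj_step w)\<^sup>*"
          using less.hyps[of "x \<otimes> s" \<tau>1] xs t1 False by blast
        then show ?thesis using st by (rule converse_rtrancl_into_rtrancl[rotated])
      next
        case True
        \<comment> \<open>A cluster at \<tau>0 would already be behind x, whereas \<beta>0 is still
          in front of it.\<close>
        have t01: "\<tau>0 < \<tau>1"
        proof (rule ccontr)
          assume "\<not> \<tau>0 < \<tau>1"
          then have "\<tau>0 = \<tau>1" using t1 by simp
          then show False using C[of \<beta>0] True fb0 sepD[OF b0(1)] by simp
        qed
        have clpos: "sg x \<beta>" if "\<beta> \<in> roots" "f \<tau>1 \<beta> = 0" "f1 \<beta> < 0" for \<beta>
        proof (rule A[OF that(1)], rule ccontr)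
          assume "\<not> f \<tau>0 \<beta> > 0"
          then show False using dec[of \<tau>0 \<beta> \<tau>1] that t01 t1 by simp
        qed
        have ap: "almost_pos (f \<tau>1)" unfolding f_def using f0 f1 t1 by (intro almost_pos_combine) auto
        \<comment> \<open>The chamber behind the cluster is found by a two-stage perturbation: the
          point at \<tau>1 is moved slightly towards f1, and f1 in turn slightly towards x. Roots
          vanishing at both \<tau>1 and the end thereby keep their sign on x.\<close>
        define h where "h = pt (\<lambda>_. 1) x"
        have h: "functional h" "almost_pos h" using functional_pt almost_pos_pt xc by (auto simp: h_def)
        have hs: "sg x \<beta> \<Longrightarrow> h \<beta> \<ge> 1" "\<beta> \<in> roots \<Longrightarrow> \<not> sg x \<beta> \<Longrightarrow> h \<beta> \<le> -1" for \<beta>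
          using pt_ge_one[OF xc] pt_le_minus_one[OF xc] by (auto simp: h_def)
        obtain e1 where e1: "e1 > 0" "\<And>\<epsilon> \<beta>. 0 < \<epsilon> \<Longrightarrow> \<epsilon> < e1 \<Longrightarrow> \<beta> \<in> roots \<Longrightarrow> f1 \<beta> > 0 \<Longrightarrow> f1 \<beta> + \<epsilon> * h \<beta> > 0"
          using perturb_small[OF f1 h] by blast
        define g where "g = (\<lambda>v. 1 * f1 v + (e1 / 2) * h v)"
        have g: "functional g" "almost_pos g" unfolding g_def
          using e1(1) by (intro functional_combine almost_pos_combine f1 h; simp)+
        have gneg: "g (\<lambda>r. - \<beta> r) = - g \<beta>" for \<beta> using functional_uminus[OF g(1)] by simp
        have gpos: "g \<beta> > 0" if "\<beta> \<in> roots" "f1 \<beta> > 0" for \<beta> using e1(2)[of "e1 / 2" \<beta>] e1(1) that by (simp add: g_def)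
        obtain e2 where e2: "e2 > 0" "\<And>\<epsilon> \<beta>. 0 < \<epsilon> \<Longrightarrow> \<epsilon> < e2 \<Longrightarrow> \<beta> \<in> roots \<Longrightarrow> f \<tau>1 \<beta> > 0 \<Longrightarrow> f \<tau>1 \<beta> + \<epsilon> * g \<beta> > 0"
          using perturb_small[OF f_func ap g] by blast
        define k where "k = (\<lambda>v. 1 * f \<tau>1 v + (e2 / 2) * g v)"
        have k: "functional k" "almost_pos k" unfolding k_def
          using e2(1) by (intro functional_combine almost_pos_combine f_func ap g; simp)+
        have kneg: "k (\<lambda>r. - \<beta> r) = - k \<beta>" for \<beta> using functional_uminus[OF k(1)] by simp
        have kpos: "k \<beta> > 0" if "\<beta> \<in> roots" "f \<tau>1 \<beta> > 0" for \<beta>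
          using e2(2)[of "e2 / 2" \<beta>] e2(1) that by (simp add: k_def)
        have kpos1: "k \<beta> > 0" if "\<beta> \<in> roots" "f \<tau>1 \<beta> = 0" "f1 \<beta> > 0" for \<beta>
          using gpos[of \<beta>] e2(1) that by (simp add: k_def)
        have kpos2: "k \<beta> > 0" if "\<beta> \<in> roots" "f \<tau>1 \<beta> = 0" "f1 \<beta> = 0" "sg x \<beta>" for \<beta>
        proof -
          have "h \<beta> > 0" using hs(1)[OF that(4)] by simp
          then have "g \<beta> > 0" using that e1(1) by (simp add: g_def)
          then show ?thesis using that e2(1) by (simp add: k_def)
        qed
        have kcase: "k \<beta> > 0 \<or> k (\<lambda>r. - \<beta> r) > 0" if b: "\<beta> \<in> roots" for \<beta>
        proof -
          have nb: "(\<lambda>r. - \<beta> r) \<in> roots" using b by (rule roots_uminus)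
          consider "f \<tau>1 \<beta> > 0" | "f \<tau>1 \<beta> < 0" | "f \<tau>1 \<beta> = 0" "f1 \<beta> > 0" | "f \<tau>1 \<beta> = 0" "f1 \<beta> < 0"
            | "f \<tau>1 \<beta> = 0" "f1 \<beta> = 0" by linarith
          then show ?thesis
          proof cases
            case 5
            then show ?thesis using kpos2[OF b] kpos2[OF nb] b xc by (auto simp: fneg f1neg sg_uminus)
          qed (use kpos[OF b] kpos[OF nb] kpos1[OF b] kpos1[OF nb] in \<open>auto simp: fneg f1neg\<close>)
        qed
        have "k \<beta> \<noteq> 0" if "\<beta> \<in> roots" for \<beta> using kcase[OF that] by (auto simp: kneg)
        then obtain y where y: "y \<in> carrier W" "\<And>\<beta>. \<beta> \<in> roots \<Longrightarrow> sg y \<beta> \<longleftrightarrow> k \<beta> > 0"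
          using chamber_of[OF k] by blast
        have sepxy: "sep x y = {\<beta> \<in> roots. f \<tau>1 \<beta> = 0 \<and> f1 \<beta> < 0}"
        proof (intro equalityI subsetI CollectI conjI)
          fix \<beta> assume "\<beta> \<in> sep x y"
          then have b: "\<beta> \<in> roots" "sg x \<beta>" "\<not> k \<beta> > 0" using y by (auto simp: sep_def)
          show "\<beta> \<in> roots" by (rule b)
          show f0: "f \<tau>1 \<beta> = 0" using b kpos[of \<beta>] A1n[of \<beta>] by force
          show "f1 \<beta> < 0" using b kpos1[of \<beta>] kpos2[of \<beta>] f0 by force
        next
          fix \<beta> assume "\<beta> \<in> {\<beta> \<in> roots. f \<tau>1 \<beta> = 0 \<and> f1 \<beta> < 0}"
          then have b: "\<beta> \<in> roots" "f \<tau>1 \<beta> = 0" "f1 \<beta> < 0" by auto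
          have "k (\<lambda>r. - \<beta> r) > 0" using b by (intro kpos1) (auto simp: fneg f1neg roots_uminus)
          then show "\<beta> \<in> sep x y" using b clpos y by (simp add: sep_def kneg)
        qed
        have "(x, y) \<in> strong_step w"
        proof (rule strong_stepI[OF w xc y(1)])
          fix \<beta> assume "\<beta> \<in> sep x y"
          then show "act w \<beta> \<in> sep x y" using True w unfolding sepxy cluster_def by (auto simp: roots_act f_def)
        qed
        then have st: "(x, y) \<in> conj_step w" by (simp add: conj_step_def)
        have sub: "sep y z \<subseteq> sep x z - {\<beta>0}"
        proof
          fix \<gamma> assume "\<gamma> \<in> sep y z"
          then have g: "\<gamma> \<in> roots" "sg y \<gamma>" "\<not> sg z \<gamma>" by (auto simp: sep_def)
          have "\<beta>0 \<in> sep x y" using sepD[OF b0(1)] fb0 by (simp add: sepxy)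
          then have "\<gamma> \<noteq> \<beta>0" using g by (auto simp: sep_def)
          moreover have "sg x \<gamma>"
          proof (rule ccontr)
            assume "\<not> sg x \<gamma>"
            then have "(\<lambda>r. - \<gamma> r) \<in> sep x y" using g xc y by (simp add: sep_def sg_uminus roots_uminus)
            then have "f1 \<gamma> > 0" by (simp add: sepxy f1neg)
            then show False using z1 g by blast
          qed
          ultimately show "\<gamma> \<in> sep x z - {\<beta>0}" using g by (simp add: sep_def)
        qed
        have "card (sep y z) < card (sep x z)" using sub b0 fin by (intro psubset_card_mono) auto
        moreover have "sg y \<gamma>" if "\<gamma> \<in> roots" "f \<tau>1 \<gamma> > 0" for \<gamma> using y kpos that by blast
        moreover have "sg z \<gamma> \<longleftrightarrow> sg y \<gamma>" if g: "\<gamma> \<in> roots" "f1 \<gamma> = 0" for \<gamma>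
        proof -
          have "\<gamma> \<notin> sep x y" "(\<lambda>r. - \<gamma> r) \<notin> sep x y" using g by (auto simp: sepxy f1neg)
          then have "sg x \<gamma> \<longleftrightarrow> sg y \<gamma>" using g xc y(1) by (auto simp: sep_def sg_uminus roots_uminus)
          then show ?thesis using B[OF g] by simp
        qed
        moreover have "\<not> sg y \<gamma>" if "\<gamma> \<in> roots" "f \<tau>1 \<gamma> = 0" "f1 \<gamma> < 0" for \<gamma>
        proof -
          have "\<gamma> \<in> sep x y" using that by (simp add: sepxy)
          then show ?thesis by (simp add: sep_def)
        qed
        ultimately have "(y, z) \<in> (conj_step w)\<^sup>*"
          using less.hyps[of y \<tau>1] y(1) t1 by blast
        then show ?thesis using st by (rule converse_rtrancl_into_rtrancl[rotated])
      qed
    qed simp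
  qed
  show ?thesis
  proof (rule main[OF x, of 0])
    fix \<beta> assume "\<beta> \<in> roots" "f 0 \<beta> = 0" "f1 \<beta> < 0"
    then show "\<not> sg x \<beta>" using zero[of \<beta>] by (simp add: f_def)
  qed (use x0 xz in \<open>auto simp: f_def\<close>)
qed

end

text \<open>Every admissible mixture inherits the signs at both ends with absolute value at least 1,
  since the coefficients add up to at least 1, and a common bound on the window. Hence one n serves
  all mixtures: with equal signs no zero remains, with opposite signs a single transversal one can
  occur.\<close>

lemma smooth_mix_sign_changes:
  fixes a b :: "int \<Rightarrow> real" and M N :: nat and \<sigma> \<sigma>' :: real
  assumes s: "\<sigma> \<in> {1, -1}" "\<sigma>' \<in> {1, -1}" and N: "N \<ge> 1"
    and right: "\<And>i. i \<ge> int M \<Longrightarrow> \<sigma> * a i \<ge> 1 \<and> \<sigma> * b i \<ge> 1"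
    and left: "\<And>i. i \<le> - int M \<Longrightarrow> \<sigma>' * a i \<ge> 1 \<and> \<sigma>' * b i \<ge> 1"
  shows "\<exists>n0. \<forall>n\<ge>n0. \<forall>p q r s. 0 \<le> p \<and> p \<le> 1 \<and> 0 \<le> q \<and> q \<le> 1 \<and> 0 \<le> r \<and> r \<le> 1 \<and> 0 \<le> s \<and> s \<le> 1 \<and> p + q + r + s \<ge> 1 \<longrightarrow>
    (\<forall>i. let e = smooth n (\<lambda>i. p * a i + q * (\<Sum>j<N. a (i + int j)) + r * b i + s * (\<Sum>j<N. b (i + int j)))
      in e i = 0 \<longrightarrow> e (i + 1) * e (i - 1) < 0)"
proof -
  \<comment> \<open>The inner sums look fewer than N places ahead, so the window is enlarged by N to
    keep the left end negative or positive throughout.\<close>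
  define M' where "M' = M + N"
  define D0 where "D0 = (\<Sum>k\<in>{- int (M' + N)..int (M' + N)}. \<bar>a k\<bar> + \<bar>b k\<bar>)"
  define D where "D = 2 * (1 + real N) * D0"
  have D0: "\<bar>a k\<bar> \<le> D0" "\<bar>b k\<bar> \<le> D0" if "\<bar>k\<bar> \<le> int (M' + N)" for k
  proof -
    have "\<bar>a k\<bar> + \<bar>b k\<bar> \<le> D0" unfolding D0_def using that by (intro member_le_sum) auto
    then show "\<bar>a k\<bar> \<le> D0" "\<bar>b k\<bar> \<le> D0" by linarith+
  qed
  have D0nn: "D0 \<ge> 0" unfolding D0_def by (intro sum_nonneg) auto
  then have Dnn: "D \<ge> 0" by (simp add: D_def)
  define e0 where "e0 p q r s i = p * a i + q * (\<Sum>j<N. a (i + int j)) + r * b i + s * (\<Sum>j<N. b (i + int j))" for p q r s i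
  define ok where "ok p q r s \<longleftrightarrow> 0 \<le> p \<and> p \<le> 1 \<and> 0 \<le> q \<and> q \<le> 1 \<and> 0 \<le> r \<and> r \<le> 1 \<and> 0 \<le> s \<and> s \<le> 1 \<and> p + q + r + s \<ge> 1" for p q r s :: real
  have lower: "t * e0 p q r s i \<ge> 1" if "ok p q r s" "\<And>j. j \<le> N \<Longrightarrow> t * a (i + int j) \<ge> 1 \<and> t * b (i + int j) \<ge> 1" for t p q r s i
  proof -
    have suma: "(\<Sum>j<N. t * a (i + int j)) \<ge> (\<Sum>j<N. 1)" "(\<Sum>j<N. t * b (i + int j)) \<ge> (\<Sum>j<N. 1)"
      using that(2) by (intro sum_mono; simp)+
    then have suma1: "(\<Sum>j<N. t * a (i + int j)) \<ge> 1" "(\<Sum>j<N. t * b (i + int j)) \<ge> 1" using N by auto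
    have "t * a i \<ge> 1" "t * b i \<ge> 1" using that(2)[of 0] by simp_all
    then have "p * (t * a i) \<ge> p * 1" "r * (t * b i) \<ge> r * 1" using that(1) unfolding ok_def by (intro mult_left_mono; simp)+
    moreover have "q * (\<Sum>j<N. t * a (i + int j)) \<ge> q * 1" "s * (\<Sum>j<N. t * b (i + int j)) \<ge> s * 1"
      using that(1) suma1 unfolding ok_def by (intro mult_left_mono; simp)+
    moreover have "t * e0 p q r s i = p * (t * a i) + q * (\<Sum>j<N. t * a (i + int j)) + r * (t * b i) + s * (\<Sum>j<N. t * b (i + int j))"
      by (simp add: e0_def sum_distrib_left algebra_simps)
    ultimately show ?thesis using that(1) by (simp add: ok_def)
  qed
  have R: "\<sigma> * e0 p q r s i \<ge> 1" if "ok p q r s" "i \<ge> int M'" for p q r s i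
    using that(2) right by (intro lower[OF that(1)]) (simp add: M'_def)
  have L: "\<sigma>' * e0 p q r s i \<ge> 1" if "ok p q r s" "i \<le> - int M'" for p q r s i
    using that(2) left by (intro lower[OF that(1)]) (simp add: M'_def)
  have bound: "\<bar>e0 p q r s i\<bar> \<le> D" if "ok p q r s" "\<bar>i\<bar> \<le> int M'" for p q r s i
  proof -
    have t: "\<bar>x * y\<bar> \<le> z" if "0 \<le> x" "x \<le> 1" "\<bar>y\<bar> \<le> z" for x y z :: real
      using that mult_mono[of "\<bar>x\<bar>" 1 "\<bar>y\<bar>" z] by (simp add: abs_mult)
    have "\<bar>\<Sum>j<N. a (i + int j)\<bar> \<le> (\<Sum>j<N. D0)" "\<bar>\<Sum>j<N. b (i + int j)\<bar> \<le> (\<Sum>j<N. D0)"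
      using that(2) by (intro order_trans[OF sum_abs] sum_mono D0; auto)+
    then have "\<bar>p * a i\<bar> \<le> D0" "\<bar>r * b i\<bar> \<le> D0" "\<bar>q * (\<Sum>j<N. a (i + int j))\<bar> \<le> real N * D0" "\<bar>s * (\<Sum>j<N. b (i + int j))\<bar> \<le> real N * D0"
      using that D0[of i] by (auto simp: ok_def intro!: t)
    then show ?thesis unfolding e0_def D_def by (simp add: algebra_simps)
  qed
  have lin: "smooth n (\<lambda>i. t * e i) i = t * smooth n e i" for n t e i using smooth_lin[of n t e 0 e i] by simp
  have key: "\<exists>n0. \<forall>n\<ge>n0. \<forall>p q r s. ok p q r s \<longrightarrow> (\<forall>i. smooth n (e0 p q r s) i = 0 \<longrightarrow> 
      smooth n (e0 p q r s) (i + 1) * smooth n (e0 p q r s) (i - 1) < 0)"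
  proof (cases "\<sigma> = \<sigma>'")
    case True
    obtain n0 where n0: "\<forall>n\<ge>n0. \<forall>a. (\<forall>i. \<bar>i\<bar> > int M' \<longrightarrow> a i \<ge> 1) \<and> (\<forall>i. \<bar>i\<bar> \<le> int M' \<longrightarrow> a i \<ge> - D) \<longrightarrow> (\<forall>i. smooth n a i > 0)"
      using smooth_pos[OF Dnn] by blast
    show ?thesis
    proof (intro exI[of _ n0] allI impI)
      fix n p q r s i assume n: "n \<ge> n0" and o: "ok p q r s" and z: "smooth n (e0 p q r s) i = 0"
      have 1: "\<forall>i. \<bar>i\<bar> > int M' \<longrightarrow> \<sigma> * e0 p q r s i \<ge> 1"
      proof (intro allI impI)
        fix i assume "\<bar>i\<bar> > int M'"
        then have "i \<ge> int M' \<or> i \<le> - int M'" by linarith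
        then show "\<sigma> * e0 p q r s i \<ge> 1" using R[OF o] L[OF o] True by blast
      qed
      have 2: "\<forall>i. \<bar>i\<bar> \<le> int M' \<longrightarrow> \<sigma> * e0 p q r s i \<ge> - D"
      proof (intro allI impI)
        fix i assume "\<bar>i\<bar> \<le> int M'"
        then have "\<bar>e0 p q r s i\<bar> \<le> D" by (rule bound[OF o])
        then show "\<sigma> * e0 p q r s i \<ge> - D" using s by (auto simp: abs_le_iff)
      qed
      have "smooth n (\<lambda>i. \<sigma> * e0 p q r s i) i > 0" using n0[rule_format, OF n, of "\<lambda>i. \<sigma> * e0 p q r s i"] 1 2 by blast
      then show "smooth n (e0 p q r s) (i + 1) * smooth n (e0 p q r s) (i - 1) < 0" using z by (simp add: lin)
    qed
  next
    case False
    then have ss: "\<sigma>' = - \<sigma>" using s by auto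
    have M1: "M' \<ge> 1" using N by (simp add: M'_def)
    obtain n0 where n0: "\<forall>n\<ge>n0. \<forall>a. (\<forall>i \<ge> int M'. a i \<ge> 1) \<and> (\<forall>i \<le> - int M'. a i \<le> -1) \<and> (\<forall>i. \<bar>i\<bar> \<le> int M' \<longrightarrow> \<bar>a i\<bar> \<le> D) \<longrightarrow>
      (\<forall>i. smooth n a i \<ge> 0 \<longrightarrow> smooth n a (i + 1) > 0)"
      using smooth_single_sign_change[OF Dnn M1] by blast
    show ?thesis
    proof (intro exI[of _ n0] allI impI)
      fix n p q r s i assume n: "n \<ge> n0" and o: "ok p q r s" and z: "smooth n (e0 p q r s) i = 0"
      let ?a = "\<lambda>i. \<sigma> * e0 p q r s i"
      have 1: "\<forall>i \<ge> int M'. ?a i \<ge> 1" using R[OF o] by blast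
      have 2: "\<forall>i \<le> - int M'. ?a i \<le> -1" using L[OF o] ss by force
      have 3: "\<forall>i. \<bar>i\<bar> \<le> int M' \<longrightarrow> \<bar>?a i\<bar> \<le> D" using bound[OF o] s by (auto simp: abs_mult)
      have mono: "smooth n ?a i \<ge> 0 \<longrightarrow> smooth n ?a (i + 1) > 0" for i using n0[rule_format, OF n, of ?a] 1 2 3 by blast
      have p1: "\<sigma> * smooth n (e0 p q r s) (i + 1) > 0" using mono[of i] z by (simp add: lin)
      have p2: "\<sigma> * smooth n (e0 p q r s) (i - 1) < 0" using mono[of "i - 1"] z by (simp add: lin)
      have "(\<sigma> * smooth n (e0 p q r s) (i + 1)) * (\<sigma> * smooth n (e0 p q r s) (i - 1)) < 0"
        using p1 p2 by (rule mult_pos_neg)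
      then show "smooth n (e0 p q r s) (i + 1) * smooth n (e0 p q r s) (i - 1) < 0" using s by auto
    qed
  qed
  then show ?thesis unfolding e0_def ok_def Let_def .
qed

context km_weyl
begin

section \<open>Smoothing and averaging along w-orbits\<close>

definition orbseq :: "'a \<Rightarrow> (('a \<Rightarrow> real) \<Rightarrow> real) \<Rightarrow> ('a \<Rightarrow> real) \<Rightarrow> int \<Rightarrow> real" where
  "orbseq w f v i = f (act (w [^] i) v)"

text \<open>Adding a nonnegative multiple of \<open>f \<circ> w\<close> to \<open>f\<close> does not leave the region reached by shifts, so a
  point may be replaced by its iterated smoothing.\<close>

primrec fsm :: "'a \<Rightarrow> nat \<Rightarrow> (('a \<Rightarrow> real) \<Rightarrow> real) \<Rightarrow> ('a \<Rightarrow> real) \<Rightarrow> real" where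
  "fsm w 0 f = f"
| "fsm w (Suc n) f = (\<lambda>v. fsm w n f v + 2 * fsm w n f (act w v))"

definition favg :: "'a \<Rightarrow> nat \<Rightarrow> (('a \<Rightarrow> real) \<Rightarrow> real) \<Rightarrow> ('a \<Rightarrow> real) \<Rightarrow> real" where
  "favg w N f v = (\<Sum>j<N. f (act (w [^] j) v))"

text \<open>The transposes of \<open>fsm\<close> and \<open>favg\<close>. Conditions on a smoothed
  or averaged point become conditions on the point at vectors that are known before the point is
  chosen.\<close>

primrec vsm :: "'a \<Rightarrow> nat \<Rightarrow> ('a \<Rightarrow> real) \<Rightarrow> 'a \<Rightarrow> real" where
  "vsm w 0 v = v"
| "vsm w (Suc n) v = (\<lambda>r. vsm w n v r + 2 * vsm w n (act w v) r)"

definition vavg :: "'a \<Rightarrow> nat \<Rightarrow> ('a \<Rightarrow> real) \<Rightarrow> 'a \<Rightarrow> real" where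
  "vavg w N v = (\<lambda>r. \<Sum>j<N. act (w [^] j) v r)"

lemma act_pow_Suc:
  assumes "w \<in> carrier W"
  shows "act (w [^] (i + 1 :: int)) v = act w (act (w [^] i) v)" "act (w [^] (i + 1 :: int)) v = act (w [^] i) (act w v)"
proof -
  have e: "w [^] (i + 1) = w \<otimes> w [^] i" "w [^] (i + 1) = w [^] i \<otimes> w"
    using assms int_pow_mult[of w 1 i] int_pow_mult[of w i 1] by (simp_all add: add.commute)
  show "act (w [^] (i + 1 :: int)) v = act w (act (w [^] i) v)" by (subst e(1)) (use assms in \<open>simp add: act_mult\<close>)
  show "act (w [^] (i + 1 :: int)) v = act (w [^] i) (act w v)" by (subst e(2)) (use assms in \<open>simp add: act_mult\<close>)
qed

lemma act_pow_add: "w \<in> carrier W \<Longrightarrow> act (w [^] (i + j :: int)) v = act (w [^] i) (act (w [^] j) v)"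
  by (simp add: int_pow_mult act_mult)

lemma orbseq_shift: "w \<in> carrier W \<Longrightarrow> orbseq w f (act (w [^] (j::int)) v) i = orbseq w f v (i + j)"
  by (simp add: orbseq_def act_pow_add)

lemma orbseq_act: "w \<in> carrier W \<Longrightarrow> orbseq w f (act w v) i = orbseq w f v (i + 1)"
  by (simp add: orbseq_def act_pow_Suc(2))

lemma orbseq_0 [simp]: "orbseq w f v 0 = f v"
  by (simp add: orbseq_def)

lemma orbseq_1: "w \<in> carrier W \<Longrightarrow> orbseq w f v 1 = f (act w v)"
  using orbseq_act[of w f v 0] by simp

lemma orbseq_minus_1: "w \<in> carrier W \<Longrightarrow> orbseq w f v (-1) = f (act (inv w) v)"
  using orbseq_act[of w f "act (inv w) v" "-1"] by simp

lemma orbseq_fsm: "w \<in> carrier W \<Longrightarrow> orbseq w (fsm w n f) v i = smooth n (orbseq w f v) i"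
proof (induction n arbitrary: i v)
  case (Suc n)
  have "orbseq w (fsm w (Suc n) f) v i = orbseq w (fsm w n f) v i + 2 * orbseq w (fsm w n f) v (i + 1)"
    using Suc.prems by (simp add: orbseq_def act_pow_Suc(1))
  then show ?case using Suc by simp
qed simp

lemma fsm_smooth: "w \<in> carrier W \<Longrightarrow> fsm w n f v = smooth n (orbseq w f v) 0"
  using orbseq_fsm[of w n f v 0] by simp

lemma orbseq_favg: "w \<in> carrier W \<Longrightarrow> orbseq w (favg w N f) v i = (\<Sum>j<N. orbseq w f v (i + int j))"
  by (simp add: orbseq_def favg_def act_pow_add[symmetric] int_pow_int[symmetric] add.commute)

lemma fsm_lin: "fsm w n (\<lambda>v. a * f v + b * g v) v = a * fsm w n f v + b * fsm w n g v"
  by (induction n arbitrary: v) (simp_all add: algebra_simps)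

lemma functional_sum: 
  assumes "\<And>i. i \<in> I \<Longrightarrow> functional (f i)"
  shows "functional (\<lambda>v. \<Sum>i\<in>I. f i v)"
  using assms
proof (induction I rule: infinite_finite_induct)
  case (insert i I)
  then show ?case using functional_combine[of "f i" "\<lambda>v. \<Sum>i\<in>I. f i v" 1 1] by simp
qed (auto simp: functional_def intro!: exI[of _ "\<lambda>_. 0"])

lemma functional_fsm: "functional f \<Longrightarrow> w \<in> carrier W \<Longrightarrow> functional (fsm w n f)"
proof (induction n)
  case (Suc n)
  then show ?case using functional_combine[OF Suc.IH functional_act[OF Suc.IH, of w], of 1 2] by simp
qed simp

lemma functional_favg: "functional f \<Longrightarrow> w \<in> carrier W \<Longrightarrow> functional (favg w N f)"
  unfolding favg_def[abs_def] by (intro functional_sum functional_act) auto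

lemma almost_pos_fsm: "almost_pos f \<Longrightarrow> w \<in> carrier W \<Longrightarrow> almost_pos (fsm w n f)"
proof (induction n)
  case (Suc n)
  then show ?case using almost_pos_combine[OF Suc.IH almost_pos_act[OF Suc.IH, of w], of 1 2] by simp
qed simp

lemma almost_pos_favg: "almost_pos f \<Longrightarrow> w \<in> carrier W \<Longrightarrow> N \<ge> 1 \<Longrightarrow> almost_pos (favg w N f)"
proof (induction N)
  case (Suc N)
  have a: "almost_pos (\<lambda>v. f (act (w [^] N) v))" using Suc by (intro almost_pos_act) auto
  show ?case
  proof (cases "N = 0")
    case True
    then show ?thesis using Suc by (simp add: favg_def[abs_def])
  next
    case False
    then have b: "almost_pos (favg w N f)" using Suc by simp
    show ?thesis using almost_pos_combine[OF b a, of 1 1] by (simp add: favg_def[abs_def])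
  qed
qed simp

lemma functional_zero: "functional f \<Longrightarrow> f (\<lambda>r. 0) = 0"
  using functional_lin[of f 0 "\<lambda>r. 0" 0 "\<lambda>r. 0"] by simp

lemma functional_apply_sum: "functional f \<Longrightarrow> f (\<lambda>r. \<Sum>i\<in>I. c i * v i r) = (\<Sum>i\<in>I. c i * f (v i))"
proof (induction I rule: infinite_finite_induct)
  case (insert i I)
  then show ?case using functional_lin[of f "c i" "v i" 1 "\<lambda>r. \<Sum>i\<in>I. c i * v i r"] by simp
qed (simp_all add: functional_zero)

lemma functional_vsm: "functional f \<Longrightarrow> f (vsm w n v) = fsm w n f v"
proof (induction n arbitrary: v)
  case (Suc n)
  then show ?case using functional_lin[of f 1 "vsm w n v" 2 "vsm w n (act w v)"] by simp
qed simp

lemma functional_vavg: "functional f \<Longrightarrow> f (vavg w N v) = favg w N f v"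
  unfolding vavg_def favg_def using functional_apply_sum[of f "\<lambda>_. 1" "\<lambda>j. act (w [^] j) v" "{..<N}"] by simp

lemma functional_vavg_vsm:
  "functional f \<Longrightarrow> w \<in> carrier W \<Longrightarrow> f (vavg w N (vsm w n v)) = fsm w n (favg w N f) v"
  by (simp add: functional_vavg functional_vsm[symmetric] functional_favg)

lemma act_vsm: "w \<in> carrier W \<Longrightarrow> act w (vsm w n v) = vsm w n (act w v)"
proof (induction n arbitrary: v)
  case (Suc n)
  then show ?case using act_lin[of w 1 "vsm w n v" 2 "vsm w n (act w v)"] by simp
qed simp

lemma act_pow_comm: "w \<in> carrier W \<Longrightarrow> act w (act (w [^] (j::nat)) v) = act (w [^] j) (act w v)"
  using act_pow_Suc[of w "int j" v] by (simp add: int_pow_int)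

lemma act_vavg: "w \<in> carrier W \<Longrightarrow> act w (vavg w N v) = vavg w N (act w v)"
  using act_sum[of w "\<lambda>_. 1" "\<lambda>j. act (w [^] j) v" "{..<N}"] by (simp add: vavg_def act_pow_comm)

section \<open>Generic points of chambers\<close>

definition vsupp :: "('a \<Rightarrow> real) set" where
  "vsupp = {v. \<forall>r. r \<notin> S \<longrightarrow> v r = 0}"

lemma vsupp_act: "x \<in> carrier W \<Longrightarrow> v \<in> vsupp \<Longrightarrow> act x v \<in> vsupp"
proof -
  assume x: "x \<in> carrier W" and v: "v \<in> vsupp"
  have "wact u v \<in> vsupp" if "u \<in> lists S" for u
    using that by (induction u) (use v in \<open>auto simp: vsupp_def refl_def\<close>)
  moreover obtain u where "u \<in> lists S" "wv u = x" using ex_word[OF x] by blast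
  ultimately show "act x v \<in> vsupp" using act_wv[of u v] by metis
qed

lemma roots_vsupp: "\<beta> \<in> roots \<Longrightarrow> \<beta> \<in> vsupp"
  using roots_lattice by (auto simp: vsupp_def lattice_def)

lemma vsupp_lin: "v \<in> vsupp \<Longrightarrow> v' \<in> vsupp \<Longrightarrow> (\<lambda>r. a * v r + b * v' r) \<in> vsupp"
  by (simp add: vsupp_def)

lemma vsupp_sum: "(\<And>i. i \<in> I \<Longrightarrow> v i \<in> vsupp) \<Longrightarrow> (\<lambda>r. \<Sum>i\<in>I. c i * v i r) \<in> vsupp"
  by (simp add: vsupp_def)

lemma vsupp_vsm: "w \<in> carrier W \<Longrightarrow> v \<in> vsupp \<Longrightarrow> vsm w n v \<in> vsupp"
proof (induction n arbitrary: v)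
  case (Suc n)
  then show ?case using vsupp_lin[of "vsm w n v" "vsm w n (act w v)" 1 2] vsupp_act by simp
qed simp

lemma vsupp_vavg: "w \<in> carrier W \<Longrightarrow> v \<in> vsupp \<Longrightarrow> vavg w N v \<in> vsupp"
  using vsupp_sum[of "{..<N}" "\<lambda>j. act (w [^] j) v" "\<lambda>_. 1"] vsupp_act by (simp add: vavg_def)

lemma generic_pt:
  assumes x: "x \<in> carrier W" and Z: "countable Z" "Z \<subseteq> vsupp"
  obtains c where "\<And>s. s \<in> S \<Longrightarrow> c s \<ge> 1" "\<And>v. v \<in> Z \<Longrightarrow> pt c x v = 0 \<Longrightarrow> v = (\<lambda>r. 0)"
proof -
  obtain c where c: "\<forall>s\<in>S. c s \<ge> 1" "\<forall>v\<in>act (inv x) ` Z. (\<Sum>s\<in>S. c s * v s) = 0 \<longrightarrow> (\<forall>s\<in>S. v s = 0)"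
    using generic_point[OF finite_S, of "act (inv x) ` Z"] Z(1) by blast
  have "v = (\<lambda>r. 0)" if v: "v \<in> Z" "pt c x v = 0" for v
  proof -
    have "\<forall>s\<in>S. act (inv x) v s = 0" using c(2) v by (simp add: pt_def)
    moreover have "act (inv x) v \<in> vsupp" using vsupp_act v Z x by blast
    ultimately have "act (inv x) v = (\<lambda>r. 0)" by (auto simp: vsupp_def)
    then have "v = act x (\<lambda>r. 0)" using x by (metis act_inv(2))
    then show ?thesis using act_zero x by simp
  qed
  then show ?thesis using c that by blast
qed

lemma countable_roots: "countable roots"
proof -
  have "carrier W \<subseteq> wv ` lists S" using ex_word by blast
  then have "countable (carrier W)" using countable_lists finite_S by (meson countable_finite countable_image countable_subset)
  moreover have "roots = (\<lambda>(x, s). act x (sroot s)) ` (carrier W \<times> S)" by (auto simp: roots_def)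
  ultimately show ?thesis using finite_S by (simp add: countable_finite)
qed

text \<open>A lattice vector killed by 1 + 2 w is twice a lattice vector with the same property. It
  is therefore divisible by every power of 2, hence zero.\<close>

lemma vsm_nonzero:
  assumes w: "w \<in> carrier W" and b: "\<beta> \<in> lattice" "\<beta> \<noteq> (\<lambda>r. 0)"
  shows "vsm w n \<beta> \<noteq> (\<lambda>r. 0)"
proof -
  have step: "v = (\<lambda>r. 0)" if v: "v \<in> lattice" "(\<lambda>r. v r + 2 * act w v r) = (\<lambda>r. 0)" for v
  proof -
    have div: "\<exists>u\<in>lattice. v = (\<lambda>r. 2 ^ k * u r) \<and> (\<lambda>r. u r + 2 * act w u r) = (\<lambda>r. 0)" for k
    proof (induction k)
      case (Suc k)
      then obtain u where u: "u \<in> lattice" "v = (\<lambda>r. 2 ^ k * u r)" "(\<lambda>r. u r + 2 * act w u r) = (\<lambda>r. 0)" by blast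
      define u' where "u' = (\<lambda>r. - act w u r)"
      have ul: "u' \<in> lattice" using lattice_act[OF w u(1)] by (auto simp: u'_def lattice_def)
      have uu: "u = (\<lambda>r. 2 * u' r)"
      proof
        fix r
        have "u r + 2 * act w u r = 0" using u(3) by (rule fun_cong)
        then show "u r = 2 * u' r" by (simp add: u'_def)
      qed
      have "act w u = (\<lambda>r. 2 * act w u' r)" unfolding uu using act_scale w by simp
      then have e: "2 * u' r + 2 * (2 * act w u' r) = 0" for r using fun_cong[OF u(3), of r] by (simp add: uu)
      have "u' r + 2 * act w u' r = 0" for r using e[of r] by linarith
      then show ?case using ul u(2) uu by (intro bexI[of _ u']) auto
    qed (use v in auto)
    show ?thesis
    proof
      fix r
      obtain k :: nat where k: "\<bar>v r\<bar> < 2 ^ k" using real_arch_pow[of 2 "\<bar>v r\<bar>"] by auto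
      obtain u where u: "u \<in> lattice" "v = (\<lambda>r. 2 ^ k * u r)" using div by blast
      show "v r = 0"
      proof (rule ccontr)
        assume "v r \<noteq> 0"
        then have "\<bar>u r\<bar> \<ge> 1" using u by (intro Ints_nonzero_abs_ge1) (auto simp: lattice_def)
        then have "\<bar>v r\<bar> \<ge> 2 ^ k * 1" unfolding u(2) abs_mult by (intro mult_mono) auto
        then show False using k by simp
      qed
    qed
  qed
  have lat: "vsm w n \<beta> \<in> lattice" for n
  proof -
    have "vsm w n v \<in> lattice" if "v \<in> lattice" for v
      using that
    proof (induction n arbitrary: v)
      case (Suc n)
      have "vsm w n v \<in> lattice" "vsm w n (act w v) \<in> lattice" using Suc lattice_act[OF w] by auto
      then show ?case by (auto simp: lattice_def)
    qed simp
    then show ?thesis using b by blast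
  qed
  show ?thesis
  proof (induction n)
    case (Suc n)
    show ?case
    proof
      assume "vsm w (Suc n) \<beta> = (\<lambda>r. 0)"
      then have "(\<lambda>r. vsm w n \<beta> r + 2 * act w (vsm w n \<beta>) r) = (\<lambda>r. 0)" using w by (simp add: act_vsm)
      then show False using step lat Suc by blast
    qed
  qed (use b in simp)
qed

section \<open>Finite and infinite orbits of roots\<close>

definition periodic :: "'a \<Rightarrow> ('a \<Rightarrow> real) \<Rightarrow> bool" where
  "periodic w v \<longleftrightarrow> (\<exists>k>0. act (w [^] (k::nat)) v = v)"

lemma act_pow_mult:
  assumes "w \<in> carrier W" "act (w [^] (k::nat)) v = v"
  shows "act (w [^] (k * m :: nat)) v = v"
proof (induction m)
  case (Suc m)
  have "w [^] (k * Suc m) = w [^] (k * m) \<otimes> w [^] k" using assms by (simp add: nat_pow_mult add.commute)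
  then show ?case using assms Suc by (simp add: act_mult)
qed simp

lemma common_period:
  assumes "w \<in> carrier W" "finite B"
  shows "\<exists>N>0. \<forall>\<beta>\<in>B. periodic w \<beta> \<longrightarrow> act (w [^] (N::nat)) \<beta> = \<beta>"
  using assms(2)
proof (induction B)
  case (insert \<beta> B)
  then obtain N where N: "N > 0" "\<forall>\<beta>\<in>B. periodic w \<beta> \<longrightarrow> act (w [^] (N::nat)) \<beta> = \<beta>" by blast
  show ?case
  proof (cases "periodic w \<beta>")
    case True
    then obtain k where k: "k > 0" "act (w [^] (k::nat)) \<beta> = \<beta>" by (auto simp: periodic_def)
    have "\<forall>\<gamma>\<in>insert \<beta> B. periodic w \<gamma> \<longrightarrow> act (w [^] (N * k)) \<gamma> = \<gamma>"
      using act_pow_mult[OF assms(1), of N _ k] act_pow_mult[OF assms(1) k(2), of N] N(2) by (auto simp: mult.commute)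
    then show ?thesis using N(1) k(1) by (intro exI[of _ "N * k"]) auto
  qed (use N in blast)
qed auto

lemma orbit_inj:
  assumes w: "w \<in> carrier W" and b: "\<not> periodic w \<beta>"
  shows "inj (\<lambda>i::int. act (w [^] i) \<beta>)"
proof -
  have ne: "act (w [^] i) \<beta> \<noteq> act (w [^] j) \<beta>" if "i < j" for i j :: int
  proof
    assume e: "act (w [^] i) \<beta> = act (w [^] j) \<beta>"
    have "act (w [^] j) \<beta> = act (w [^] i) (act (w [^] (j - i)) \<beta>)" using act_pow_add[OF w, of i "j - i"] by simp
    then have "act (w [^] (j - i)) \<beta> = \<beta>" using e act_inj[of "w [^] i"] w by simp
    then have "act (w [^] (nat (j - i))) \<beta> = \<beta>" using that int_pow_int[of W w "nat (j - i)"] by simp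
    then have "periodic w \<beta>" using that unfolding periodic_def by (intro exI[of _ "nat (j - i)"]) auto
    then show False using b by simp
  qed
  show ?thesis by (rule injI) (metis ne linorder_neqE)
qed

lemma int_const_up: 
  fixes P :: "int \<Rightarrow> bool"
  assumes "\<And>i. i \<ge> m \<Longrightarrow> P (i + 1) \<longleftrightarrow> P i" "i \<ge> m"
  shows "P i \<longleftrightarrow> P m"
  using assms(2) by (induction i rule: int_ge_induct) (use assms(1) in auto)

lemma int_const_down: 
  fixes P :: "int \<Rightarrow> bool"
  assumes "\<And>i. i < m \<Longrightarrow> P (i + 1) \<longleftrightarrow> P i" "i \<le> m"
  shows "P i \<longleftrightarrow> P m"
  using assms(2)
proof (induction i rule: int_le_induct)
  case (step i)
  then show ?case using assms(1)[of "i - 1"] by simp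
qed simp

lemma sg_orbit_step:
  assumes "w \<in> carrier W" "x \<in> carrier W" "\<beta> \<in> roots"
    and "act (w [^] i) \<beta> \<notin> sep x (inv w \<otimes> x) \<union> sep (inv w \<otimes> x) x"
  shows "sg x (act (w [^] (i + 1 :: int)) \<beta>) \<longleftrightarrow> sg x (act (w [^] i) \<beta>)"
  using assms roots_act[of "w [^] i" \<beta>] by (auto simp: act_pow_Suc(1) sep_def sg_mult)

text \<open>The sign on x changes between consecutive members of the orbit only at roots separating
  x from w^-1 x, and it differs from the sign on y only at roots separating x from y. These are
  finitely many, and an infinite orbit meets each of them at most once.\<close>

lemma infinite_orbit_signs:
  assumes w: "w \<in> carrier W" and x: "x \<in> carrier W" and y: "y \<in> carrier W" and b: "\<beta> \<in> roots"
    and inf: "\<not> periodic w \<beta>" and c: "\<And>s. s \<in> S \<Longrightarrow> c s \<ge> 1" and d: "\<And>s. s \<in> S \<Longrightarrow> d s \<ge> 1"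
  shows "\<exists>M \<sigma> \<sigma>'. \<sigma> \<in> {1, -1} \<and> \<sigma>' \<in> {1, -1} \<and>
    (\<forall>i \<ge> int M. \<sigma> * orbseq w (pt c x) \<beta> i \<ge> 1 \<and> \<sigma> * orbseq w (pt d y) \<beta> i \<ge> 1) \<and>
    (\<forall>i \<le> - int M. \<sigma>' * orbseq w (pt c x) \<beta> i \<ge> 1 \<and> \<sigma>' * orbseq w (pt d y) \<beta> i \<ge> 1)"
proof -
  define B where "B = sep x (inv w \<otimes> x) \<union> sep (inv w \<otimes> x) x \<union> (sep x y \<union> sep y x)"
  have "finite B" using finite_sep w x y by (simp add: B_def)
  then have fin: "finite {i::int. act (w [^] i) \<beta> \<in> B}"
    using finite_vimageI[OF _ orbit_inj[OF w inf], of B] by (simp add: vimage_def)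
  define M where "M = Suc (nat (Max (insert 0 (abs ` {i::int. act (w [^] i) \<beta> \<in> B}))))"
  have M: "act (w [^] i) \<beta> \<notin> B" if "\<bar>i\<bar> \<ge> int M" for i :: int
  proof
    assume "act (w [^] i) \<beta> \<in> B"
    then have "\<bar>i\<bar> \<le> Max (insert 0 (abs ` {i::int. act (w [^] i) \<beta> \<in> B}))" using fin by (intro Max_ge) auto
    moreover have "0 \<le> Max (insert 0 (abs ` {i::int. act (w [^] i) \<beta> \<in> B}))" using fin by (intro Max_ge) auto
    ultimately show False using that unfolding M_def by linarith
  qed
  have rt: "act (w [^] (i::int)) \<beta> \<in> roots" for i using roots_act b w by simp
  have step: "sg x (act (w [^] (i + 1 :: int)) \<beta>) \<longleftrightarrow> sg x (act (w [^] i) \<beta>)" if "\<bar>i\<bar> \<ge> int M" for i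
    using sg_orbit_step[OF w x b, of i] M[OF that] by (simp add: B_def)
  have xy: "sg y (act (w [^] i) \<beta>) \<longleftrightarrow> sg x (act (w [^] i) \<beta>)" if "\<bar>i\<bar> \<ge> int M" for i :: int
  proof -
    have "act (w [^] i) \<beta> \<notin> sep x y" "act (w [^] i) \<beta> \<notin> sep y x" using M[OF that] by (simp_all add: B_def)
    then show ?thesis using rt[of i] by (simp add: sep_def) blast
  qed
  have R: "sg x (act (w [^] i) \<beta>) \<longleftrightarrow> sg x (act (w [^] int M) \<beta>)" if "i \<ge> int M" for i
    by (rule int_const_up[where P = "\<lambda>i. sg x (act (w [^] i) \<beta>)"]) (use step that in auto)
  have L: "sg x (act (w [^] i) \<beta>) \<longleftrightarrow> sg x (act (w [^] (- int M)) \<beta>)" if "i \<le> - int M" for i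
    by (rule int_const_down[where P = "\<lambda>i. sg x (act (w [^] i) \<beta>)"]) (use step that in auto)
  have val: "(if s then 1 else -1) * orbseq w (pt c x) \<beta> i \<ge> 1 \<and> (if s then 1 else -1) * orbseq w (pt d y) \<beta> i \<ge> 1"
    if "\<bar>i\<bar> \<ge> int M" "s \<longleftrightarrow> sg x (act (w [^] i) \<beta>)" for s i
  proof (cases s)
    case True
    then have "sg x (act (w [^] i) \<beta>)" "sg y (act (w [^] i) \<beta>)" using that xy by auto
    then show ?thesis using pt_ge_one[OF x c] pt_ge_one[OF y d] True by (simp add: orbseq_def)
  next
    case False
    then have "\<not> sg x (act (w [^] i) \<beta>)" "\<not> sg y (act (w [^] i) \<beta>)" using that xy by auto
    then have "pt c x (act (w [^] i) \<beta>) \<le> -1" "pt d y (act (w [^] i) \<beta>) \<le> -1"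
      using pt_le_minus_one[OF x c rt] pt_le_minus_one[OF y d rt] by auto
    then show ?thesis using False by (simp add: orbseq_def)
  qed
  define \<sigma> \<sigma>' :: real where "\<sigma> = (if sg x (act (w [^] int M) \<beta>) then 1 else -1)"
    and "\<sigma>' = (if sg x (act (w [^] (- int M)) \<beta>) then 1 else -1)"
  have "\<forall>i \<ge> int M. \<sigma> * orbseq w (pt c x) \<beta> i \<ge> 1 \<and> \<sigma> * orbseq w (pt d y) \<beta> i \<ge> 1"
  proof (intro allI impI)
    fix i assume i: "i \<ge> int M"
    have "\<bar>i\<bar> \<ge> int M" using i by simp
    then show "\<sigma> * orbseq w (pt c x) \<beta> i \<ge> 1 \<and> \<sigma> * orbseq w (pt d y) \<beta> i \<ge> 1"
      unfolding \<sigma>_def by (rule val) (simp only: R[OF i])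
  qed
  moreover have "\<forall>i \<le> - int M. \<sigma>' * orbseq w (pt c x) \<beta> i \<ge> 1 \<and> \<sigma>' * orbseq w (pt d y) \<beta> i \<ge> 1"
  proof (intro allI impI)
    fix i assume i: "i \<le> - int M"
    have "\<bar>i\<bar> \<ge> int M" using i by simp
    then show "\<sigma>' * orbseq w (pt c x) \<beta> i \<ge> 1 \<and> \<sigma>' * orbseq w (pt d y) \<beta> i \<ge> 1"
      unfolding \<sigma>'_def by (rule val) (simp only: L[OF i])
  qed
  moreover have "\<sigma> \<in> {1, -1}" "\<sigma>' \<in> {1, -1}" by (simp_all add: \<sigma>_def \<sigma>'_def)
  ultimately show ?thesis by blast
qed

text \<open>A root positive at f and at f o w is positive at f + 2 (f o w), so each smoothing leads
  to a chamber between the present one and its image under w^-1. \<open>noless\<close> rules out the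
  alternative that a shift shortens the conjugate.\<close>

lemma smooth_reachable:
  assumes w: "w \<in> carrier W" and x: "x \<in> carrier W" and c: "\<And>s. s \<in> S \<Longrightarrow> c s \<ge> 1"
    and reg: "\<And>n \<beta>. \<beta> \<in> roots \<Longrightarrow> fsm w n (pt c x) \<beta> \<noteq> 0"
    and noless: "\<And>z. (x, z) \<in> (shift_step w)\<^sup>* \<Longrightarrow> len (conjg w x) \<le> len (conjg w z)"
  shows "\<exists>z. (x, z) \<in> (shift_step w)\<^sup>* \<and> z \<in> carrier W \<and> (\<forall>\<beta>\<in>roots. sg z \<beta> \<longleftrightarrow> fsm w n (pt c x) \<beta> > 0)"
proof (induction n)
  case 0
  have "sg x \<beta> \<longleftrightarrow> pt c x \<beta> > 0" if "\<beta> \<in> roots" for \<beta>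
    using pt_ge_one[OF x, of c \<beta>] pt_le_minus_one[OF x, of c \<beta>] c that by force
  then show ?case using x by auto
next
  case (Suc n)
  then obtain z where z: "(x, z) \<in> (shift_step w)\<^sup>*" "z \<in> carrier W" "\<And>\<beta>. \<beta> \<in> roots \<Longrightarrow> sg z \<beta> \<longleftrightarrow> fsm w n (pt c x) \<beta> > 0" by blast
  have "functional (fsm w (Suc n) (pt c x))" "almost_pos (fsm w (Suc n) (pt c x))"
    by (intro functional_fsm functional_pt x w) (intro almost_pos_fsm almost_pos_pt x w c)
  then obtain z' where z': "z' \<in> carrier W" "\<And>\<beta>. \<beta> \<in> roots \<Longrightarrow> sg z' \<beta> \<longleftrightarrow> fsm w (Suc n) (pt c x) \<beta> > 0"
    using chamber_of reg by metis
  have "sg z' \<beta>" if "\<beta> \<in> roots" "sg z \<beta>" "sg z (act w \<beta>)" for \<beta>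
    using z(3)[OF that(1)] z(3)[of "act w \<beta>"] z'(2)[OF that(1)] that w by (simp add: roots_act)
  from shift_to_between[OF w z(2) z'(1) this]
  have "(z, z') \<in> (shift_step w)\<^sup>*"
  proof
    assume "\<exists>v. (z, v) \<in> (shift_step w)\<^sup>* \<and> len (conjg w v) < len (conjg w z)"
    then obtain v where v: "(z, v) \<in> (shift_step w)\<^sup>*" "len (conjg w v) < len (conjg w z)" by blast
    have "(x, v) \<in> (shift_step w)\<^sup>*" using z(1) v(1) by (rule rtrancl_trans)
    then show ?thesis using noless[of v] v(2) shift_rtrancl_le[OF w z(1)] by simp
  qed
  then have "(x, z') \<in> (shift_step w)\<^sup>*" using rtrancl_trans[OF z(1)] by blast
  then show ?case using z' by blast
qed

text \<open>Real and imaginary part of the component of \<open>v\<close> on which \<open>w\<close> rotates by a fixed frequency.\<close>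

definition rot_cos :: "'a \<Rightarrow> nat \<Rightarrow> nat \<Rightarrow> ('a \<Rightarrow> real) \<Rightarrow> 'a \<Rightarrow> real" where
  "rot_cos w N k v = (\<lambda>r. \<Sum>j<N. cos (freq N k * real j) * act (w [^] j) v r)"

definition rot_sin :: "'a \<Rightarrow> nat \<Rightarrow> nat \<Rightarrow> ('a \<Rightarrow> real) \<Rightarrow> 'a \<Rightarrow> real" where
  "rot_sin w N k v = (\<lambda>r. \<Sum>j<N. sin (freq N k * real j) * act (w [^] j) v r)"

lemma dft_orbseq:
  assumes f: "functional f" and w: "w \<in> carrier W"
  shows "dft N (orbseq w f v) k = Complex (f (rot_cos w N k v)) (- f (rot_sin w N k v)) / of_nat N"
proof -
  have 1: "f (rot_cos w N k v) = (\<Sum>j<N. cos (freq N k * real j) * f (act (w [^] j) v))"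
    "f (rot_sin w N k v) = (\<Sum>j<N. sin (freq N k * real j) * f (act (w [^] j) v))"
    unfolding rot_cos_def rot_sin_def by (rule functional_apply_sum[OF f])+
  have "(\<Sum>j<N. of_real (orbseq w f v (int j)) * cis (- freq N k * real j)) =
    Complex (f (rot_cos w N k v)) (- f (rot_sin w N k v))"
    unfolding 1 by (simp add: complex_eq_iff orbseq_def int_pow_int sum_negf mult.commute)
  then show ?thesis by (simp add: dft_def)
qed

lemma cyclic_sum:
  fixes g :: "nat \<Rightarrow> real"
  assumes "g N = g 0"
  shows "(\<Sum>j<N. g (Suc j)) = (\<Sum>j<N. g j)"
proof -
  have "g 0 + (\<Sum>j<N. g (Suc j)) = (\<Sum>j<N. g j) + g N"
    by (metis sum.lessThan_Suc sum.lessThan_Suc_shift)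
  then show ?thesis using assms by simp
qed

lemma cos_sin_freq_period:
  assumes "N > 0"
  shows "cos (freq N k * (real N - 1)) = cos (freq N k)" "sin (freq N k * (real N - 1)) = - sin (freq N k)"
proof -
  have "freq N k * (real N - 1) = 2 * real k * pi - freq N k"
    using assms by (simp add: freq_def field_simps)
  then show "cos (freq N k * (real N - 1)) = cos (freq N k)" "sin (freq N k * (real N - 1)) = - sin (freq N k)"
    by (simp_all only: cos_diff sin_diff cos_2npi sin_2npi)
qed

text \<open>Applying w shifts the summation index, the addition theorems turn the shift into a
  rotation, and periodicity closes the sum.\<close>

lemma act_rot:
  assumes w: "w \<in> carrier W" and N: "N > 0" and per: "act (w [^] N) v = v"
  shows "act w (rot_cos w N k v) = (\<lambda>r. cos (freq N k) * rot_cos w N k v r + sin (freq N k) * rot_sin w N k v r)"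
    "act w (rot_sin w N k v) = (\<lambda>r. cos (freq N k) * rot_sin w N k v r - sin (freq N k) * rot_cos w N k v r)"
proof -
  let ?t = "freq N k"
  have aS: "act w (act (w [^] j) v) = act (w [^] Suc j) v" for j using w by (simp add: act_mult act_pow_comm)
  have p: "cos (?t * (real N - 1)) = cos (?t * (real 0 - 1))" "sin (?t * (real N - 1)) = sin (?t * (real 0 - 1))"
    using cos_sin_freq_period[OF N] by simp_all
  show "act w (rot_cos w N k v) = (\<lambda>r. cos (freq N k) * rot_cos w N k v r + sin (freq N k) * rot_sin w N k v r)"
  proof
    fix r
    have "act w (rot_cos w N k v) r = (\<Sum>j<N. cos (?t * (real (Suc j) - 1)) * act (w [^] Suc j) v r)"
      unfolding rot_cos_def act_sum[OF w] aS by simp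
    also have "\<dots> = (\<Sum>j<N. cos (?t * (real j - 1)) * act (w [^] j) v r)"
      by (rule cyclic_sum[of "\<lambda>j. cos (?t * (real j - 1)) * act (w [^] j) v r"]) (simp only: p per, simp)
    also have "\<dots> = cos ?t * rot_cos w N k v r + sin ?t * rot_sin w N k v r"
      unfolding rot_cos_def rot_sin_def sum_distrib_left sum.distrib[symmetric]
      by (intro sum.cong) (simp_all add: right_diff_distrib cos_diff algebra_simps)
    finally show "act w (rot_cos w N k v) r = cos ?t * rot_cos w N k v r + sin ?t * rot_sin w N k v r" .
  qed
  show "act w (rot_sin w N k v) = (\<lambda>r. cos (freq N k) * rot_sin w N k v r - sin (freq N k) * rot_cos w N k v r)"
  proof
    fix r
    have "act w (rot_sin w N k v) r = (\<Sum>j<N. sin (?t * (real (Suc j) - 1)) * act (w [^] Suc j) v r)"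
      unfolding rot_sin_def act_sum[OF w] aS by simp
    also have "\<dots> = (\<Sum>j<N. sin (?t * (real j - 1)) * act (w [^] j) v r)"
      by (rule cyclic_sum[of "\<lambda>j. sin (?t * (real j - 1)) * act (w [^] j) v r"]) (simp only: p per, simp)
    also have "\<dots> = cos ?t * rot_sin w N k v r - sin ?t * rot_cos w N k v r"
      unfolding rot_cos_def rot_sin_def sum_distrib_left sum_subtractf[symmetric]
      by (intro sum.cong) (simp_all add: right_diff_distrib sin_diff algebra_simps)
    finally show "act w (rot_sin w N k v) r = cos ?t * rot_sin w N k v r - sin ?t * rot_cos w N k v r" .
  qed
qed

text \<open>Linearly dependent real and imaginary parts span at most a line. A rotation by an angle
  that is no multiple of pi stabilizes no line, so both parts vanish.\<close>

lemma rot_degenerate: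
  assumes w: "w \<in> carrier W" and N: "N > 0" and per: "act (w [^] N) v = v" and s: "sin (freq N k) \<noteq> 0"
    and eq: "(\<lambda>r. a * rot_sin w N k v r - b * rot_cos w N k v r) = (\<lambda>r. 0)" and ab: "a \<noteq> 0 \<or> b \<noteq> 0"
  shows "rot_cos w N k v = (\<lambda>r. 0)" "rot_sin w N k v = (\<lambda>r. 0)"
proof -
  let ?g = "rot_cos w N k v" and ?h = "rot_sin w N k v" and ?C = "cos (freq N k)" and ?D = "sin (freq N k)"
  have e: "a * ?h r = b * ?g r" for r using fun_cong[OF eq, of r] by simp
  have "act w (\<lambda>r. a * ?h r + (- b) * ?g r) = (\<lambda>r. a * act w ?h r + (- b) * act w ?g r)" by (rule act_lin[OF w])
  then have "(\<lambda>r. a * act w ?h r - b * act w ?g r) = (\<lambda>r. 0)" using eq act_zero[OF w] by simp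
  then have "a * act w ?h r = b * act w ?g r" for r using fun_cong[of _ _ r] by fastforce
  then have e2: "a * (?C * ?h r - ?D * ?g r) = b * (?C * ?g r + ?D * ?h r)" for r
    unfolding act_rot[OF w N per] by simp
  have "?D * (a * ?g r + b * ?h r) = ?C * (a * ?h r - b * ?g r)" for r
    using e2[of r] by (simp add: algebra_simps)
  then have "?D * (a * ?g r + b * ?h r) = 0" for r using e[of r] by simp
  then have e3: "a * ?g r + b * ?h r = 0" for r using s by simp
  have alg: "(a * a + b * b) * h = 0 \<and> (a * a + b * b) * g = 0" if "a * h = b * g" "a * g + b * h = 0" for g h
  proof -
    have "(a * a + b * b) * h = a * (a * h) + b * (b * h)" by (simp add: algebra_simps)
    also have "\<dots> = b * (a * g + b * h)" unfolding that(1) by (simp add: algebra_simps)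
    finally have 1: "(a * a + b * b) * h = 0" using that(2) by simp
    have "(a * a + b * b) * g = a * (a * g) + b * (b * g)" by (simp add: algebra_simps)
    also have "\<dots> = a * (a * g + b * h)" unfolding that(1)[symmetric] by (simp add: algebra_simps)
    finally show ?thesis using 1 that(2) by simp
  qed
  have h: "(a * a + b * b) * ?h r = 0" for r using alg e[of r] e3[of r] by blast
  have g: "(a * a + b * b) * ?g r = 0" for r using alg e[of r] e3[of r] by blast
  have nz: "a * a + b * b \<noteq> 0" using ab by (simp add: sum_squares_eq_zero_iff)
  show "?g = (\<lambda>r. 0)" by (rule ext) (use g nz in \<open>metis mult_eq_0_iff\<close>)
  show "?h = (\<lambda>r. 0)" by (rule ext) (use h nz in \<open>metis mult_eq_0_iff\<close>)
qed

lemma vsupp_rot: "w \<in> carrier W \<Longrightarrow> v \<in> vsupp \<Longrightarrow> rot_cos w N k v \<in> vsupp \<and> rot_sin w N k v \<in> vsupp"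
  unfolding rot_cos_def rot_sin_def by (intro conjI vsupp_sum vsupp_act) auto

lemma fsm_lin4: "fsm w n (\<lambda>v. p * f1 v + q * f2 v + r * f3 v + s * f4 v) v =
    p * fsm w n f1 v + q * fsm w n f2 v + r * fsm w n f3 v + s * fsm w n f4 v"
  by (induction n arbitrary: v) (simp_all add: algebra_simps)

lemma vavg_act_periodic:
  assumes w: "w \<in> carrier W" and per: "act (w [^] (N::nat)) v = v"
  shows "vavg w N (act w v) = vavg w N v"
proof
  fix r
  have "(\<Sum>j<N. act (w [^] Suc j) v r) = (\<Sum>j<N. act (w [^] j) v r)"
    by (rule cyclic_sum[of "\<lambda>j. act (w [^] j) v r"]) (simp add: per)
  then show "vavg w N (act w v) r = vavg w N v r" using w by (simp add: vavg_def act_mult)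
qed

lemma act_pow_comm_int:
  assumes w: "w \<in> carrier W"
  shows "act (w [^] (k::nat)) (act (w [^] (i::int)) v) = act (w [^] i) (act (w [^] k) v)"
  using act_pow_add[OF w, of "int k" i v] act_pow_add[OF w, of i "int k" v]
  by (simp add: int_pow_int add.commute)

lemma vavg_orbit:
  assumes w: "w \<in> carrier W" and per: "act (w [^] (N::nat)) v = v"
  shows "vavg w N (act (w [^] (i::int)) v) = vavg w N v"
proof -
  have step: "vavg w N (act (w [^] (i + 1 :: int)) v) = vavg w N (act (w [^] i) v)" for i :: int
    unfolding act_pow_Suc(1)[OF w] by (rule vavg_act_periodic[OF w]) (simp add: act_pow_comm_int[OF w] per)
  show ?thesis
  proof (induction i rule: int_induct[where k = 0])
    case (step1 i) then show ?case using step[of i] by simp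
  next
    case (step2 i) then show ?case using step[of "i - 1"] by simp
  qed simp
qed

lemma periodic_orbit: 
  assumes w: "w \<in> carrier W"
  shows "periodic w (act (w [^] (i::int)) v) \<longleftrightarrow> periodic w v"
proof -
  have "act (w [^] (k::nat)) (act (w [^] i) v) = act (w [^] i) v \<longleftrightarrow> act (w [^] k) v = v" for k
    unfolding act_pow_comm_int[OF w] using act_inj[of "w [^] i"] w by simp
  then show ?thesis by (simp add: periodic_def)
qed

text \<open>The sum over a full period is invariant under w, and 1 + 2 w acts on invariants as
  3.\<close>

lemma fsm_favg_periodic:
  assumes f: "functional f" and w: "w \<in> carrier W"
  shows "act (w [^] (N::nat)) v = v \<Longrightarrow> fsm w n (favg w N f) v = 3 ^ n * favg w N f v"
proof (induction n arbitrary: v)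
  case (Suc n)
  have "act (w [^] N) (act w v) = act w (act (w [^] N) v)" by (rule act_pow_comm[OF w, symmetric])
  also have "\<dots> = act w v" by (simp only: Suc.prems)
  finally have "act (w [^] N) (act w v) = act w v" .
  then have "fsm w n (favg w N f) (act w v) = 3 ^ n * favg w N f (act w v)" by (rule Suc.IH)
  moreover have "favg w N f (act w v) = favg w N f v"
    using vavg_act_periodic[OF w Suc.prems] functional_vavg[OF f, of w N "act w v"] functional_vavg[OF f, of w N v] by simp
  ultimately show ?case using Suc by simp
qed simp

lemma smooth_pos_all: "(\<And>i. a i > 0) \<Longrightarrow> smooth n a i > 0"
  by (induction n arbitrary: i) (simp_all add: add_pos_pos)

lemma fsm_pos_all:
  assumes "w \<in> carrier W" "\<And>i. \<sigma> * orbseq w f v i > 0" "N > 0"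
  shows "\<sigma> * fsm w n f v > 0" "\<sigma> * fsm w n (favg w N f) v > 0"
proof -
  have *: "\<sigma> * smooth n a i = smooth n (\<lambda>i. \<sigma> * a i) i" for a i using smooth_lin[of n \<sigma> a 0 a i] by simp
  show "\<sigma> * fsm w n f v > 0" unfolding fsm_smooth[OF assms(1)] * by (rule smooth_pos_all) (rule assms)
  have "\<sigma> * orbseq w (favg w N f) v i > 0" for i
    unfolding orbseq_favg[OF assms(1)] sum_distrib_left using assms by (intro sum_pos) auto
  then show "\<sigma> * fsm w n (favg w N f) v > 0" unfolding fsm_smooth[OF assms(1)] * by (rule smooth_pos_all)
qed

text \<open>What a long smoothing achieves on the \<open>w\<close>-orbit of \<open>\<beta>\<close>, simultaneously for all points of the
  segments that will be used: on an infinite orbit the values change sign transversally, on a finite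
  one they have the sign of the mean, and if the mean vanishes each zero has a negative neighbour.\<close>

definition well_smoothed :: "'a \<Rightarrow> nat \<Rightarrow> (('a \<Rightarrow> real) \<Rightarrow> real) \<Rightarrow> (('a \<Rightarrow> real) \<Rightarrow> real) \<Rightarrow> nat \<Rightarrow> ('a \<Rightarrow> real) \<Rightarrow> bool" where
  "well_smoothed w N f g n \<beta> \<longleftrightarrow>
    (\<not> periodic w \<beta> \<longrightarrow> (\<forall>p q r s. 0 \<le> p \<and> p \<le> 1 \<and> 0 \<le> q \<and> q \<le> 1 \<and> 0 \<le> r \<and> r \<le> 1 \<and> 0 \<le> s \<and> s \<le> 1 \<and> p + q + r + s \<ge> 1 \<longrightarrow>
      (\<forall>i. let e = orbseq w (fsm w n (\<lambda>v. p * f v + q * favg w N f v + r * g v + s * favg w N g v)) \<beta>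
        in e i = 0 \<longrightarrow> e (i + 1) * e (i - 1) < 0))) \<and>
    (\<forall>\<sigma>\<in>{1,-1}. periodic w \<beta> \<longrightarrow> \<sigma> * favg w N f \<beta> > 0 \<longrightarrow> (\<forall>i. \<sigma> * orbseq w (fsm w n f) \<beta> i > 0)) \<and>
    (\<forall>\<sigma>\<in>{1,-1}. periodic w \<beta> \<longrightarrow> \<sigma> * favg w N g \<beta> > 0 \<longrightarrow> (\<forall>i. \<sigma> * orbseq w (fsm w n g) \<beta> i > 0)) \<and>
    (periodic w \<beta> \<longrightarrow> favg w N f \<beta> = 0 \<longrightarrow> act w \<beta> = (\<lambda>r. - \<beta> r) \<or>
      (\<forall>\<tau>\<in>{0..1}. \<forall>i. let e = orbseq w (fsm w n (\<lambda>v. (1 - \<tau>) * f v + \<tau> * g v)) \<beta>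
        in e i = 0 \<longrightarrow> e (i + 1) < 0 \<or> e (i - 1) < 0))"

text \<open>The genericity conditions feed \<open>smooth_elliptic\<close>: Fourier coefficients of
  the first point vanish only where the components of the root do, those of the two points are not
  real multiples of each other at rotating frequencies, and values alternate in sign only if w
  negates the root.\<close>

lemma smooth_uniform:
  assumes w: "w \<in> carrier W" and x: "x \<in> carrier W" and y: "y \<in> carrier W" and N: "N > 0"
    and c: "\<And>s. s \<in> S \<Longrightarrow> c s \<ge> 1" and d: "\<And>s. s \<in> S \<Longrightarrow> d s \<ge> 1"
    and b: "\<beta> \<in> roots" and perN: "periodic w \<beta> \<Longrightarrow> act (w [^] N) \<beta> = \<beta>"
    and generic: "\<And>k. pt c x (rot_cos w N k \<beta>) = 0 \<Longrightarrow> rot_cos w N k \<beta> = (\<lambda>r. 0)"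
      "\<And>k. pt c x (rot_sin w N k \<beta>) = 0 \<Longrightarrow> rot_sin w N k \<beta> = (\<lambda>r. 0)"
      "\<And>k. pt d y (\<lambda>r. pt c x (rot_cos w N k \<beta>) * rot_sin w N k \<beta> r - pt c x (rot_sin w N k \<beta>) * rot_cos w N k \<beta> r) = 0 \<Longrightarrow>
        (\<lambda>r. pt c x (rot_cos w N k \<beta>) * rot_sin w N k \<beta> r - pt c x (rot_sin w N k \<beta>) * rot_cos w N k \<beta> r) = (\<lambda>r. 0)"
      "pt c x (\<lambda>r. \<beta> r + act w \<beta> r) = 0 \<Longrightarrow> (\<lambda>r. \<beta> r + act w \<beta> r) = (\<lambda>r. 0)"
  shows "eventually (\<lambda>n. well_smoothed w N (pt c x) (pt d y) n \<beta>) sequentially"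
  unfolding well_smoothed_def
proof (intro eventually_conj)
  let ?a = "orbseq w (pt c x) \<beta>" and ?b = "orbseq w (pt d y) \<beta>"
  have fx: "functional (pt c x)" and fy: "functional (pt d y)" using functional_pt x y by auto
  show "eventually (\<lambda>n. \<not> periodic w \<beta> \<longrightarrow> (\<forall>p q r s. 0 \<le> p \<and> p \<le> 1 \<and> 0 \<le> q \<and> q \<le> 1 \<and> 0 \<le> r \<and> r \<le> 1 \<and> 0 \<le> s \<and> s \<le> 1 \<and> p + q + r + s \<ge> 1 \<longrightarrow>
      (\<forall>i. let e = orbseq w (fsm w n (\<lambda>v. p * pt c x v + q * favg w N (pt c x) v + r * pt d y v + s * favg w N (pt d y) v)) \<beta>
        in e i = 0 \<longrightarrow> e (i + 1) * e (i - 1) < 0))) sequentially"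
  proof (cases "periodic w \<beta>")
    case False
    obtain M \<sigma> \<sigma>' where M: "\<sigma> \<in> {1, -1}" "\<sigma>' \<in> {1, -1}" "\<forall>i \<ge> int M. \<sigma> * ?a i \<ge> 1 \<and> \<sigma> * ?b i \<ge> 1"
      "\<forall>i \<le> - int M. \<sigma>' * ?a i \<ge> 1 \<and> \<sigma>' * ?b i \<ge> 1"
      using infinite_orbit_signs[where c = c and d = d, OF w x y b False] c d by blast
    have e: "orbseq w (fsm w n (\<lambda>v. p * pt c x v + q * favg w N (pt c x) v + r * pt d y v + s * favg w N (pt d y) v)) \<beta> =
      smooth n (\<lambda>i. p * ?a i + q * (\<Sum>j<N. ?a (i + int j)) + r * ?b i + s * (\<Sum>j<N. ?b (i + int j)))" for n p q r s
    proof -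
      have "orbseq w (\<lambda>v. p * pt c x v + q * favg w N (pt c x) v + r * pt d y v + s * favg w N (pt d y) v) \<beta> =
        (\<lambda>i. p * ?a i + q * (\<Sum>j<N. ?a (i + int j)) + r * ?b i + s * (\<Sum>j<N. ?b (i + int j)))"
        using orbseq_favg[OF w, of N "pt c x" \<beta>] orbseq_favg[OF w, of N "pt d y" \<beta>] by (auto simp: orbseq_def)
      then show ?thesis using orbseq_fsm[OF w] by auto
    qed
    have N1: "N \<ge> 1" using N by simp
    have R: "\<sigma> * ?a i \<ge> 1 \<and> \<sigma> * ?b i \<ge> 1" if "i \<ge> int M" for i using M(3) that by simp
    have L: "\<sigma>' * ?a i \<ge> 1 \<and> \<sigma>' * ?b i \<ge> 1" if "i \<le> - int M" for i using M(4) that by simp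
    have "\<not> periodic w \<beta> \<longleftrightarrow> True" using False by simp
    then show ?thesis unfolding e eventually_sequentially 
      using smooth_mix_sign_changes[OF M(1,2) N1 R L] by (simp only: simp_thms)
  qed simp
  have D: "eventually (\<lambda>n. \<forall>\<sigma>\<in>{1,-1}. periodic w \<beta> \<longrightarrow> \<sigma> * favg w N f \<beta> > 0 \<longrightarrow> (\<forall>i. \<sigma> * orbseq w (fsm w n f) \<beta> i > 0)) sequentially" for f
  proof (cases "periodic w \<beta>")
    case True
    have per: "act (w [^] (i + int N)) \<beta> = act (w [^] i) \<beta>" for i
      using act_pow_add[OF w, of i "int N" \<beta>] perN[OF True] by (simp add: int_pow_int)
    have "eventually (\<lambda>n. \<sigma> * favg w N f \<beta> > 0 \<longrightarrow> (\<forall>i. \<sigma> * orbseq w (fsm w n f) \<beta> i > 0)) sequentially" for \<sigma>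
    proof (cases "\<sigma> * favg w N f \<beta> > 0")
      case True
      let ?g = "\<lambda>i. \<sigma> * orbseq w f \<beta> i"
      have "(\<Sum>j<N. ?g (int j)) > 0" using True by (simp add: favg_def orbseq_def int_pow_int sum_distrib_left)
      then have "\<exists>n0. \<forall>n\<ge>n0. \<forall>i. smooth n ?g i > 0"
        by (intro smooth_mean_pos[OF N]) (simp add: orbseq_def per)
      moreover have "smooth n ?g i = \<sigma> * orbseq w (fsm w n f) \<beta> i" for n i
        using smooth_lin[of n \<sigma> "orbseq w f \<beta>" 0 "orbseq w f \<beta>" i] orbseq_fsm[OF w] by simp
      ultimately show ?thesis by (simp add: eventually_sequentially)
    qed simp
    from eventually_conj[OF this[of 1] this[of "-1"]] show ?thesis by (rule eventually_mono) auto
  qed simp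
  show "eventually (\<lambda>n. \<forall>\<sigma>\<in>{1,-1}. periodic w \<beta> \<longrightarrow> \<sigma> * favg w N (pt c x) \<beta> > 0 \<longrightarrow> (\<forall>i. \<sigma> * orbseq w (fsm w n (pt c x)) \<beta> i > 0)) sequentially"
    "eventually (\<lambda>n. \<forall>\<sigma>\<in>{1,-1}. periodic w \<beta> \<longrightarrow> \<sigma> * favg w N (pt d y) \<beta> > 0 \<longrightarrow> (\<forall>i. \<sigma> * orbseq w (fsm w n (pt d y)) \<beta> i > 0)) sequentially"
    by (rule D)+
  show "eventually (\<lambda>n. periodic w \<beta> \<longrightarrow> favg w N (pt c x) \<beta> = 0 \<longrightarrow> act w \<beta> = (\<lambda>r. - \<beta> r) \<or>
      (\<forall>\<tau>\<in>{0..1}. \<forall>i. let e = orbseq w (fsm w n (\<lambda>v. (1 - \<tau>) * pt c x v + \<tau> * pt d y v)) \<beta>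
        in e i = 0 \<longrightarrow> e (i + 1) < 0 \<or> e (i - 1) < 0)) sequentially"
  proof (cases "periodic w \<beta> \<and> favg w N (pt c x) \<beta> = 0 \<and> act w \<beta> \<noteq> (\<lambda>r. - \<beta> r)")
    case True
    then have per: "act (w [^] N) \<beta> = \<beta>" using perN by blast
    have per': "act (w [^] (i + int N)) \<beta> = act (w [^] i) \<beta>" for i
      using act_pow_add[OF w, of i "int N" \<beta>] per by (simp add: int_pow_int)
    have pa: "?a (i + int N) = ?a i" and pb: "?b (i + int N) = ?b i" for i by (simp_all add: orbseq_def per')
    have dx: "dft N ?a k = Complex (pt c x (rot_cos w N k \<beta>)) (- pt c x (rot_sin w N k \<beta>)) / of_nat N" for k
      by (rule dft_orbseq[OF fx w])
    have dy: "dft N ?b k = Complex (pt d y (rot_cos w N k \<beta>)) (- pt d y (rot_sin w N k \<beta>)) / of_nat N" for k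
      by (rule dft_orbseq[OF fy w])
    have dx0: "pt c x (rot_cos w N k \<beta>) = 0 \<and> pt c x (rot_sin w N k \<beta>) = 0" if "dft N ?a k = 0" for k
      using that N unfolding dx by (simp add: complex_eq_iff)
    have "\<exists>n0. \<forall>n\<ge>n0. \<forall>\<tau>\<in>{0..1}. \<forall>i. smooth n (\<lambda>i. (1 - \<tau>) * ?a i + \<tau> * ?b i) i = 0 \<longrightarrow>
      smooth n (\<lambda>i. (1 - \<tau>) * ?a i + \<tau> * ?b i) (i + 1) < 0 \<or> smooth n (\<lambda>i. (1 - \<tau>) * ?a i + \<tau> * ?b i) (i - 1) < 0"
    proof (rule smooth_elliptic[where a = ?a and b = ?b, OF N pa pb])
      show "dft N ?a 0 = 0"
      proof -
        have "(\<Sum>j<N. ?a (int j)) = 0" using True by (simp add: favg_def orbseq_def int_pow_int)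
        then show ?thesis by (simp add: dft_def freq_def flip: of_real_sum)
      qed
    next
      fix k assume "dft N ?a k = 0"
      then have "rot_cos w N k \<beta> = (\<lambda>r. 0)" "rot_sin w N k \<beta> = (\<lambda>r. 0)" using dx0 generic by auto
      then show "dft N ?b k = 0" unfolding dy using functional_zero[OF fy] by (simp add: complex_eq_iff)
    next
      fix k assume nz: "dft N ?a k \<noteq> 0" and s: "sin (freq N k) \<noteq> 0"
      let ?g = "rot_cos w N k \<beta>" and ?h = "rot_sin w N k \<beta>"
      have nz': "pt c x ?g \<noteq> 0 \<or> pt c x ?h \<noteq> 0" using nz N unfolding dx by (auto simp: complex_eq_iff)
      have "Im (dft N ?a k * cnj (dft N ?b k)) = (pt c x ?g * pt d y ?h - pt c x ?h * pt d y ?g) / (real N * real N)"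
        unfolding dx dy using N by (simp add: field_simps)
      moreover have "pt c x ?g * pt d y ?h - pt c x ?h * pt d y ?g \<noteq> 0"
      proof
        assume z: "pt c x ?g * pt d y ?h - pt c x ?h * pt d y ?g = 0"
        have "pt d y (\<lambda>r. pt c x ?g * ?h r - pt c x ?h * ?g r) = 0"
          using functional_lin[OF fy, of "pt c x ?g" ?h "- pt c x ?h" ?g] z by simp
        from generic(3)[OF this] have "(\<lambda>r. pt c x ?g * ?h r - pt c x ?h * ?g r) = (\<lambda>r. 0)" .
        from rot_degenerate[OF w N per s this nz'] have "?g = (\<lambda>r. 0)" "?h = (\<lambda>r. 0)" .
        then show False using nz' functional_zero[OF fx] by simp
      qed
      ultimately show "Im (dft N ?a k * cnj (dft N ?b k)) \<noteq> 0" using N by simp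
    next
      show "\<exists>k<N. dft N ?a k \<noteq> 0"
      proof (rule ccontr)
        assume "\<not> ?thesis"
        then have "complex_of_real (?a 0) = 0" using dft_inverse[where a = ?a and i = 0, OF N pa] by simp
        then have "pt c x \<beta> = 0" by simp
        then show False using pt_ge_one[OF x, of c \<beta>] pt_le_minus_one[OF x, of c \<beta>] c b by force
      qed
    next
      show "\<not> (\<forall>i. ?a (i + 1) = - ?a i)"
      proof
        assume "\<forall>i. ?a (i + 1) = - ?a i"
        from spec[OF this, of 0] have "pt c x (act w \<beta>) = - pt c x \<beta>" using orbseq_1[OF w] by simp
        then have "pt c x (\<lambda>r. \<beta> r + act w \<beta> r) = 0" using functional_lin[OF fx, of 1 \<beta> 1 "act w \<beta>"] by simp
        from fun_cong[OF generic(4)[OF this]] have e: "\<beta> r + act w \<beta> r = 0" for r .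
        have "act w \<beta> = (\<lambda>r. - \<beta> r)" by (rule ext) (use e in \<open>simp add: eq_neg_iff_add_eq_0 add.commute\<close>)
        then show False using True by blast
      qed
    qed
    moreover have "orbseq w (fsm w n (\<lambda>v. (1 - \<tau>) * pt c x v + \<tau> * pt d y v)) \<beta> = smooth n (\<lambda>i. (1 - \<tau>) * ?a i + \<tau> * ?b i)" for n \<tau>
    proof -
      have "orbseq w (\<lambda>v. (1 - \<tau>) * pt c x v + \<tau> * pt d y v) \<beta> = (\<lambda>i. (1 - \<tau>) * ?a i + \<tau> * ?b i)"
        by (rule ext) (simp add: orbseq_def)
      moreover have "orbseq w (fsm w n (\<lambda>v. (1 - \<tau>) * pt c x v + \<tau> * pt d y v)) \<beta> =
        smooth n (orbseq w (\<lambda>v. (1 - \<tau>) * pt c x v + \<tau> * pt d y v) \<beta>)"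
        by (rule ext) (rule orbseq_fsm[OF w])
      ultimately show ?thesis by (simp only:)
    qed
    ultimately show ?thesis using True by (simp add: eventually_sequentially Let_def)
  qed auto
qed

definition sepw :: "'a \<Rightarrow> 'a \<Rightarrow> ('a \<Rightarrow> real) set" where
  "sepw w x = sep x (inv w \<otimes> x) \<union> sep (inv w \<otimes> x) x"

text \<open>A root whose whole \<open>w\<close>-orbit has \<open>x\<close> and \<open>y\<close> on one side; all but finitely many orbits are such.\<close>

definition quiet :: "'a \<Rightarrow> 'a \<Rightarrow> 'a \<Rightarrow> ('a \<Rightarrow> real) \<Rightarrow> bool" where
  "quiet w x y \<beta> \<longleftrightarrow> (\<forall>i::int. (sg x (act (w [^] i) \<beta>) \<longleftrightarrow> sg x \<beta>) \<and> (sg y (act (w [^] i) \<beta>) \<longleftrightarrow> sg x \<beta>))"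

lemma sg_orbit_const:
  assumes w: "w \<in> carrier W" and x: "x \<in> carrier W" and b: "\<beta> \<in> roots"
    and "\<And>i::int. act (w [^] i) \<beta> \<notin> sepw w x"
  shows "sg x (act (w [^] (i::int)) \<beta>) \<longleftrightarrow> sg x \<beta>"
proof -
  have step: "sg x (act (w [^] (i + 1 :: int)) \<beta>) \<longleftrightarrow> sg x (act (w [^] i) \<beta>)" for i :: int
    using sg_orbit_step[OF w x b] assms(4)[of i] by (simp add: sepw_def)
  show ?thesis
  proof (induction i rule: int_induct[where k = 0])
    case (step1 i) then show ?case using step[of i] by simp
  next
    case (step2 i) then show ?case using step[of "i - 1"] by simp
  qed simp
qed

lemma not_quiet:
  assumes w: "w \<in> carrier W" and x: "x \<in> carrier W" and y: "y \<in> carrier W" and b: "\<beta> \<in> roots"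
    and "\<not> quiet w x y \<beta>"
  shows "\<exists>i::int. act (w [^] i) \<beta> \<in> sepw w x \<union> sepw w y \<union> (sep x y \<union> sep y x)"
proof (rule ccontr)
  assume n: "\<not> ?thesis"
  have PX: "sg x (act (w [^] i) \<beta>) \<longleftrightarrow> sg x \<beta>" for i :: int by (rule sg_orbit_const[OF w x b]) (use n in blast)
  have PY: "sg y (act (w [^] i) \<beta>) \<longleftrightarrow> sg y \<beta>" for i :: int by (rule sg_orbit_const[OF w y b]) (use n in blast)
  have "act (w [^] (0::int)) \<beta> \<notin> sep x y \<union> sep y x" using n by blast
  then have "sg y \<beta> \<longleftrightarrow> sg x \<beta>" using b by (auto simp: sep_def)
  then show False using PX PY assms(5) by (simp add: quiet_def)
qed

section \<open>The path to a minimal conjugate\<close>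

theorem minimal_conj_path:
  assumes w: "w \<in> carrier W" and x: "x \<in> carrier W" and y: "y \<in> carrier W"
    and min: "\<And>v. v \<in> carrier W \<Longrightarrow> len (conjg w y) \<le> len (conjg w v)"
  shows "(x, y) \<in> (conj_step w)\<^sup>*"
  using x
proof (induction "len (conjg w x)" arbitrary: x rule: less_induct)
  case less
  note x = less.prems
  have shift_conj: "(shift_step w)\<^sup>* \<subseteq> (conj_step w)\<^sup>*" by (rule rtrancl_mono) (simp add: conj_step_def)
  show ?case
  proof (cases "\<exists>z. (x, z) \<in> (shift_step w)\<^sup>* \<and> len (conjg w z) < len (conjg w x)")
    case True
    then obtain z where z: "(x, z) \<in> (shift_step w)\<^sup>*" "len (conjg w z) < len (conjg w x)" by blast
    have "z \<in> carrier W" using z(1) x by induction (use shift_step_closed in auto)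
    then have "(z, y) \<in> (conj_step w)\<^sup>*" using less.hyps z by blast
    then show ?thesis using z(1) shift_conj by (meson rtrancl_trans subsetD)
  next
    case False
    then have nolx: "len (conjg w x) \<le> len (conjg w z)" if "(x, z) \<in> (shift_step w)\<^sup>*" for z using that by force
    have noly: "len (conjg w y) \<le> len (conjg w z)" if "(y, z) \<in> (shift_step w)\<^sup>*" for z
    proof -
      have "z \<in> carrier W" using that y by induction (use shift_step_closed in auto)
      then show ?thesis by (rule min)
    qed
    \<comment> \<open>Every orbit that is not quiet meets this finite set, so finitely many roots
      determine a sufficient period N and a sufficient amount n of smoothing.\<close>
    define B where "B = sepw w x \<union> sepw w y \<union> (sep x y \<union> sep y x)"
    have finB: "finite B" using finite_sep w x y by (simp add: B_def sepw_def)
    have Broots: "B \<subseteq> roots" by (auto simp: B_def sepw_def sep_def)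
    obtain N :: nat where N: "N > 0" and perB: "\<And>\<beta>. \<beta> \<in> B \<Longrightarrow> periodic w \<beta> \<Longrightarrow> act (w [^] N) \<beta> = \<beta>"
      using common_period[OF w finB] by blast
    \<comment> \<open>Vectors at which the point of x must not vanish unless they are zero: smoothed
      roots, so that smoothed points lie inside chambers; their averages; the Fourier components;
      and the sums that detect negation by w.\<close>
    define Z1 where "Z1 = (\<lambda>(n, \<beta>). vsm w n \<beta>) ` (UNIV \<times> roots)"
    define Z2 where "Z2 = (\<lambda>(n, \<beta>). vavg w N (vsm w n \<beta>)) ` (UNIV \<times> roots)"
    define Z3 where "Z3 = (\<lambda>(k, \<beta>). rot_cos w N k \<beta>) ` (UNIV \<times> roots)"
    define Z4 where "Z4 = (\<lambda>(k, \<beta>). rot_sin w N k \<beta>) ` (UNIV \<times> roots)"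
    define Z5 where "Z5 = (\<lambda>\<beta> r. \<beta> r + act w \<beta> r) ` roots"
    define Zx where "Zx = Z1 \<union> Z2 \<union> Z3 \<union> Z4 \<union> Z5"
    have ctZ: "countable Z1" "countable Z2" "countable Z3" "countable Z4" "countable Z5"
      unfolding Z1_def Z2_def Z3_def Z4_def Z5_def using countable_roots by auto
    then have Zx_count: "countable Zx" by (simp add: Zx_def)
    have sub1: "Z1 \<subseteq> vsupp" using vsupp_vsm[OF w roots_vsupp] by (auto simp: Z1_def)
    have sub2: "Z2 \<subseteq> vsupp" using vsupp_vavg[OF w vsupp_vsm[OF w roots_vsupp]] by (auto simp: Z2_def)
    have sub34: "Z3 \<subseteq> vsupp" "Z4 \<subseteq> vsupp" using vsupp_rot[OF w roots_vsupp] by (auto simp: Z3_def Z4_def)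
    have sub5: "Z5 \<subseteq> vsupp" using vsupp_lin[OF roots_vsupp vsupp_act[OF w roots_vsupp], of _ _ 1 1] by (auto simp: Z5_def)
    have Zx_supp: "Zx \<subseteq> vsupp" using sub1 sub2 sub34 sub5 by (simp add: Zx_def)
    obtain c where c: "\<And>s. s \<in> S \<Longrightarrow> c s \<ge> 1" and gx: "\<And>v. v \<in> Zx \<Longrightarrow> pt c x v = 0 \<Longrightarrow> v = (\<lambda>r. 0)"
      using generic_pt[OF x Zx_count Zx_supp] by blast
    define px where "px = pt c x"
    \<comment> \<open>The point of y is chosen after that of x and in general position to it. By
      \<open>Z6\<close>, two roots whose averages vanish at the same moment between the averaged
      points have proportional averages; \<open>Z7\<close> does the same for the two Fourier
      components of one root.\<close>
    define Z6 where "Z6 = (\<lambda>(v, v') r. px v * v' r - px v' * v r) ` (Z2 \<times> Z2)"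
    define Z7 where "Z7 = (\<lambda>(k, \<beta>) r. px (rot_cos w N k \<beta>) * rot_sin w N k \<beta> r - px (rot_sin w N k \<beta>) * rot_cos w N k \<beta> r) ` (UNIV \<times> roots)"
    define Zy where "Zy = Zx \<union> Z6 \<union> Z7"
    have "countable Z6" "countable Z7" unfolding Z6_def Z7_def using ctZ(2) countable_roots by auto
    then have Zy_count: "countable Zy" using Zx_count by (simp add: Zy_def)
    have sub6: "Z6 \<subseteq> vsupp"
    proof
      fix u assume "u \<in> Z6"
      then obtain v v' where u: "v \<in> Z2" "v' \<in> Z2" "u = (\<lambda>r. px v * v' r - px v' * v r)" by (auto simp: Z6_def)
      then have "v \<in> vsupp" "v' \<in> vsupp" using sub2 by auto
      then show "u \<in> vsupp" by (simp add: u(3) vsupp_def)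
    qed
    have sub7: "Z7 \<subseteq> vsupp" using vsupp_rot[OF w roots_vsupp] by (auto simp: Z7_def vsupp_def)
    have Zy_supp: "Zy \<subseteq> vsupp" using Zx_supp sub6 sub7 by (simp add: Zy_def)
    obtain d where d: "\<And>s. s \<in> S \<Longrightarrow> d s \<ge> 1" and gy: "\<And>v. v \<in> Zy \<Longrightarrow> pt d y v = 0 \<Longrightarrow> v = (\<lambda>r. 0)"
      using generic_pt[OF y Zy_count Zy_supp] by blast
    define py where "py = pt d y"
    have fx: "functional px" and fy: "functional py" using functional_pt x y by (auto simp: px_def py_def)
    have apx: "almost_pos px" and apy: "almost_pos py" unfolding px_def py_def
      by (rule almost_pos_pt[OF x c], assumption) (rule almost_pos_pt[OF y d], assumption)
    have inZ1: "vsm w n \<beta> \<in> Z1" if "\<beta> \<in> roots" for n \<beta> using that by (auto simp: Z1_def)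
    have inZ2: "vavg w N (vsm w n \<beta>) \<in> Z2" if "\<beta> \<in> roots" for n \<beta> using that by (auto simp: Z2_def)
    have rootnz: "\<beta> \<noteq> (\<lambda>r. 0)" if "\<beta> \<in> roots" for \<beta> using root_nonzero[OF that] by auto
    have regx: "fsm w n px \<beta> \<noteq> 0" and regy: "fsm w n py \<beta> \<noteq> 0" if b: "\<beta> \<in> roots" for n \<beta>
    proof -
      have nz: "vsm w n \<beta> \<noteq> (\<lambda>r. 0)" using vsm_nonzero[OF w roots_lattice[OF b] rootnz[OF b]] .
      show "fsm w n px \<beta> \<noteq> 0"
        using gx[of "vsm w n \<beta>"] nz inZ1[OF b, of n] functional_vsm[OF fx, of w n \<beta>] by (auto simp: Zx_def px_def)
      show "fsm w n py \<beta> \<noteq> 0"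
        using gy[of "vsm w n \<beta>"] nz inZ1[OF b, of n] functional_vsm[OF fy, of w n \<beta>] by (auto simp: Zy_def Zx_def py_def)
    qed
    have avgx: "vavg w N (vsm w n \<beta>) = (\<lambda>r. 0)" if "\<beta> \<in> roots" "fsm w n (favg w N px) \<beta> = 0" for n \<beta>
      using gx[of "vavg w N (vsm w n \<beta>)"] inZ2[OF that(1), of n] that(2) functional_vavg_vsm[OF fx w, of N n \<beta>]
      by (auto simp: Zx_def px_def)
    have avgy: "vavg w N (vsm w n \<beta>) = (\<lambda>r. 0)" if "\<beta> \<in> roots" "fsm w n (favg w N py) \<beta> = 0" for n \<beta>
      using gy[of "vavg w N (vsm w n \<beta>)"] inZ2[OF that(1), of n] that(2) functional_vavg_vsm[OF fy w, of N n \<beta>]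
      by (auto simp: Zy_def Zx_def py_def)
    have "\<forall>\<beta>\<in>B. eventually (\<lambda>n. well_smoothed w N px py n \<beta>) sequentially"
    proof
      fix \<beta> assume bB: "\<beta> \<in> B"
      then have b: "\<beta> \<in> roots" using Broots by blast
      have in3: "rot_cos w N k \<beta> \<in> Zx" "rot_sin w N k \<beta> \<in> Zx" for k using b by (auto simp: Zx_def Z3_def Z4_def)
      have in5: "(\<lambda>r. \<beta> r + act w \<beta> r) \<in> Zx" using b by (auto simp: Zx_def Z5_def)
      have in7: "(\<lambda>r. pt c x (rot_cos w N k \<beta>) * rot_sin w N k \<beta> r - pt c x (rot_sin w N k \<beta>) * rot_cos w N k \<beta> r) \<in> Zy" for k
      proof -
        have "(\<lambda>r. px (rot_cos w N k \<beta>) * rot_sin w N k \<beta> r - px (rot_sin w N k \<beta>) * rot_cos w N k \<beta> r) \<in> Z7"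
          unfolding Z7_def using b by (intro image_eqI[of _ _ "(k, \<beta>)"]) auto
        then show ?thesis by (simp add: Zy_def px_def)
      qed
      show "eventually (\<lambda>n. well_smoothed w N px py n \<beta>) sequentially"
        unfolding px_def py_def
      proof (rule smooth_uniform[OF w x y N])
        show "s \<in> S \<Longrightarrow> 1 \<le> c s" "s \<in> S \<Longrightarrow> 1 \<le> d s" for s by (fact c, fact d)
        show "\<beta> \<in> roots" by (fact b)
        show "periodic w \<beta> \<Longrightarrow> act (w [^] N) \<beta> = \<beta>" by (rule perB[OF bB])
      qed (rule gx[OF in3(1)], assumption, rule gx[OF in3(2)], assumption, rule gy[OF in7], assumption, rule gx[OF in5], assumption)
    qed
    then have "eventually (\<lambda>n. \<forall>\<beta>\<in>B. well_smoothed w N px py n \<beta>) sequentially"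
      by (rule eventually_ball_finite[OF finB])
    then obtain n where n: "\<forall>\<beta>\<in>B. well_smoothed w N px py n \<beta>"
      unfolding eventually_sequentially by blast
    define PX PY AX AY where "PX = fsm w n px" and "PY = fsm w n py" and "AX = fsm w n (favg w N px)" and "AY = fsm w n (favg w N py)"
    have fX: "functional PX" "functional PY" "functional AX" "functional AY"
      unfolding PX_def PY_def AX_def AY_def using fx fy w by (simp_all add: functional_fsm functional_favg)
    have N1: "N \<ge> 1" using N by simp
    have aX: "almost_pos PX" "almost_pos PY" "almost_pos AX" "almost_pos AY"
      unfolding PX_def PY_def AX_def AY_def using apx apy w N1 by (simp_all add: almost_pos_fsm almost_pos_favg)
    have orbB: "\<exists>i::int. act (w [^] i) \<beta> \<in> B" if "\<beta> \<in> roots" "\<not> quiet w x y \<beta>" for \<beta>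
      unfolding B_def by (rule not_quiet[OF w x y that])
    \<comment> \<open>The effect of smoothing is known at a representative in \<open>B\<close> of
      the orbit; reading the sequence at index -i brings it back to the given root.\<close>
    have orb_back: "orbseq w f (act (w [^] (i::int)) \<beta>) (- i) = f \<beta>" 
      "orbseq w f (act (w [^] (i::int)) \<beta>) (- i + 1) = f (act w \<beta>)"
      "orbseq w f (act (w [^] (i::int)) \<beta>) (- i - 1) = f (act (inv w) \<beta>)" for f \<beta> i
      using orbseq_1[OF w, of f \<beta>] orbseq_minus_1[OF w, of f \<beta>] by (simp_all add: orbseq_shift[OF w])
    \<comment> \<open>Infinite orbits: at a zero of any mixture of the four smoothed or averaged
      points, one of the two neighbours is negative because they have opposite signs.\<close>
    have I: "(p * PX (act w \<beta>) + q * AX (act w \<beta>) + r * PY (act w \<beta>) + s * AY (act w \<beta>)) *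
        (p * PX (act (inv w) \<beta>) + q * AX (act (inv w) \<beta>) + r * PY (act (inv w) \<beta>) + s * AY (act (inv w) \<beta>)) < 0"
      if b: "\<beta> \<in> roots" "\<not> quiet w x y \<beta>" "\<not> periodic w \<beta>"
        and co: "0 \<le> p" "p \<le> 1" "0 \<le> q" "q \<le> 1" "0 \<le> r" "r \<le> 1" "0 \<le> s" "s \<le> 1" "p + q + r + s \<ge> 1"
        and z: "p * PX \<beta> + q * AX \<beta> + r * PY \<beta> + s * AY \<beta> = 0" for \<beta> p q r s
    proof -
      obtain i :: int where i: "act (w [^] i) \<beta> \<in> B" using orbB[OF b(1,2)] by blast
      have np: "\<not> periodic w (act (w [^] i) \<beta>)" using b(3) periodic_orbit[OF w] by simp
      define G where "G = fsm w n (\<lambda>v. p * px v + q * favg w N px v + r * py v + s * favg w N py v)"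
      have G: "G v = p * PX v + q * AX v + r * PY v + s * AY v" for v
        unfolding G_def PX_def PY_def AX_def AY_def by (rule fsm_lin4)
      have "orbseq w G (act (w [^] i) \<beta>) (- i) = 0 \<longrightarrow> 
        orbseq w G (act (w [^] i) \<beta>) (- i + 1) * orbseq w G (act (w [^] i) \<beta>) (- i - 1) < 0"
        using n[unfolded well_smoothed_def, rule_format, OF i] np co unfolding G_def Let_def by blast
      then have "G \<beta> = 0 \<longrightarrow> G (act w \<beta>) * G (act (inv w) \<beta>) < 0" by (simp only: orb_back)
      then show ?thesis using z by (simp only: G simp_thms)
    qed
    have perN: "act (w [^] N) \<beta> = \<beta>" if b: "\<beta> \<in> roots" "\<not> quiet w x y \<beta>" "periodic w \<beta>" for \<beta>
    proof -
      obtain i :: int where i: "act (w [^] i) \<beta> \<in> B" using orbB[OF b(1,2)] by blast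
      have "act (w [^] N) (act (w [^] i) \<beta>) = act (w [^] i) \<beta>" using perB[OF i] b(3) periodic_orbit[OF w] by simp
      then show ?thesis unfolding act_pow_comm_int[OF w] using act_inj[of "w [^] i"] w by simp
    qed
    \<comment> \<open>The mean is constant along a finite orbit, so a condition on it may be
      transferred to the representative in \<open>B\<close>.\<close>
    have avg_orbit: "favg w N f (act (w [^] (i::int)) \<beta>) = favg w N f \<beta>"
      if "\<beta> \<in> roots" "\<not> quiet w x y \<beta>" "periodic w \<beta>" "functional f" for f \<beta> i
      using vavg_orbit[OF w perN[OF that(1-3)], of i] functional_vavg[OF that(4), of w N] by metis
    have F: "\<sigma> * PX \<beta> > 0" if b: "\<beta> \<in> roots" "\<not> quiet w x y \<beta>" "periodic w \<beta>" "\<sigma> \<in> {1,-1}" "\<sigma> * favg w N px \<beta> > 0" for \<sigma> \<beta>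
    proof -
      obtain i :: int where i: "act (w [^] i) \<beta> \<in> B" using orbB[OF b(1,2)] by blast
      have "periodic w (act (w [^] i) \<beta>)" "\<sigma> * favg w N px (act (w [^] i) \<beta>) > 0"
        using b avg_orbit[OF b(1-3) fx, of i] periodic_orbit[OF w] by simp_all
      then have "\<sigma> * orbseq w (fsm w n px) (act (w [^] i) \<beta>) (- i) > 0"
        using n[unfolded well_smoothed_def, rule_format, OF i] b(4) by blast
      then show ?thesis unfolding orb_back PX_def .
    qed
    have FY: "\<sigma> * PY \<beta> > 0" if b: "\<beta> \<in> roots" "\<not> quiet w x y \<beta>" "periodic w \<beta>" "\<sigma> \<in> {1,-1}" "\<sigma> * favg w N py \<beta> > 0" for \<sigma> \<beta>
    proof -
      obtain i :: int where i: "act (w [^] i) \<beta> \<in> B" using orbB[OF b(1,2)] by blast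
      have "periodic w (act (w [^] i) \<beta>)" "\<sigma> * favg w N py (act (w [^] i) \<beta>) > 0"
        using b avg_orbit[OF b(1-3) fy, of i] periodic_orbit[OF w] by simp_all
      then have "\<sigma> * orbseq w (fsm w n py) (act (w [^] i) \<beta>) (- i) > 0"
        using n[unfolded well_smoothed_def, rule_format, OF i] b(4) by blast
      then show ?thesis unfolding orb_back PY_def .
    qed
    have E: "act w \<beta> = (\<lambda>r. - \<beta> r) \<or> (1 - \<tau>) * PX (act w \<beta>) + \<tau> * PY (act w \<beta>) < 0 \<or>
        (1 - \<tau>) * PX (act (inv w) \<beta>) + \<tau> * PY (act (inv w) \<beta>) < 0"
      if b: "\<beta> \<in> roots" "\<not> quiet w x y \<beta>" "periodic w \<beta>" "favg w N px \<beta> = 0"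
        and t: "\<tau> \<in> {0..1}" and z: "(1 - \<tau>) * PX \<beta> + \<tau> * PY \<beta> = 0" for \<beta> \<tau>
    proof -
      obtain i :: int where i: "act (w [^] i) \<beta> \<in> B" using orbB[OF b(1,2)] by blast
      have p: "periodic w (act (w [^] i) \<beta>)" "favg w N px (act (w [^] i) \<beta>) = 0"
        using b avg_orbit[OF b(1-3) fx, of i] periodic_orbit[OF w] by simp_all
      define G where "G = fsm w n (\<lambda>v. (1 - \<tau>) * px v + \<tau> * py v)"
      have G: "G v = (1 - \<tau>) * PX v + \<tau> * PY v" for v unfolding G_def PX_def PY_def by (rule fsm_lin)
      have "act w (act (w [^] i) \<beta>) = (\<lambda>r. - act (w [^] i) \<beta> r) \<or>
        (orbseq w G (act (w [^] i) \<beta>) (- i) = 0 \<longrightarrow> 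
        orbseq w G (act (w [^] i) \<beta>) (- i + 1) < 0 \<or> orbseq w G (act (w [^] i) \<beta>) (- i - 1) < 0)"
        using n[unfolded well_smoothed_def, rule_format, OF i] p t unfolding G_def Let_def by blast
      then have "act w (act (w [^] i) \<beta>) = (\<lambda>r. - act (w [^] i) \<beta> r) \<or> G (act w \<beta>) < 0 \<or> G (act (inv w) \<beta>) < 0"
        using z by (simp only: orb_back G simp_thms)
      moreover have "act w \<beta> = (\<lambda>r. - \<beta> r)" if h: "act w (act (w [^] i) \<beta>) = (\<lambda>r. - act (w [^] i) \<beta> r)"
      proof -
        have "act (w [^] i) (act w \<beta>) = act w (act (w [^] i) \<beta>)" using act_pow_Suc[OF w, of i \<beta>] by simp
        also have "\<dots> = act (w [^] i) (\<lambda>r. - \<beta> r)" unfolding h using act_uminus[of "w [^] i"] w by simp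
        finally show ?thesis using act_inj[of "w [^] i"] w by simp
      qed
      ultimately show ?thesis unfolding G by blast
    qed
    have Q: "\<exists>\<sigma>\<in>{1,-1}. \<sigma> * PX \<beta> > 0 \<and> \<sigma> * AX \<beta> > 0 \<and> \<sigma> * PY \<beta> > 0 \<and> \<sigma> * AY \<beta> > 0"
      if b: "\<beta> \<in> roots" "quiet w x y \<beta>" for \<beta>
    proof -
      define \<sigma> :: real where "\<sigma> = (if sg x \<beta> then 1 else -1)"
      have rt: "act (w [^] i) \<beta> \<in> roots" for i :: int using b w roots_act by simp
      have px: "\<sigma> * orbseq w px \<beta> i > 0" for i
      proof (cases "sg x \<beta>")
        case True
        then have "px (act (w [^] i) \<beta>) \<ge> 1" using b(2) pt_ge_one[OF x, of c] c unfolding quiet_def px_def by blast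
        then show ?thesis using True by (simp add: orbseq_def \<sigma>_def)
      next
        case False
        then have "px (act (w [^] i) \<beta>) \<le> -1" using b(2) pt_le_minus_one[OF x, of c] c rt unfolding quiet_def px_def by blast
        then show ?thesis using False by (simp add: orbseq_def \<sigma>_def)
      qed
      have py: "\<sigma> * orbseq w py \<beta> i > 0" for i
      proof (cases "sg x \<beta>")
        case True
        then have "py (act (w [^] i) \<beta>) \<ge> 1" using b(2) pt_ge_one[OF y, of d] d unfolding quiet_def py_def by blast
        then show ?thesis using True by (simp add: orbseq_def \<sigma>_def)
      next
        case False
        then have "py (act (w [^] i) \<beta>) \<le> -1" using b(2) pt_le_minus_one[OF y, of d] d rt unfolding quiet_def py_def by blast
        then show ?thesis using False by (simp add: orbseq_def \<sigma>_def)
      qed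
      have "\<sigma> * PX \<beta> > 0 \<and> \<sigma> * AX \<beta> > 0 \<and> \<sigma> * PY \<beta> > 0 \<and> \<sigma> * AY \<beta> > 0"
        unfolding PX_def PY_def AX_def AY_def using fsm_pos_all[OF w px N] fsm_pos_all[OF w py N] by simp
      moreover have "\<sigma> \<in> {1,-1}" by (simp add: \<sigma>_def)
      ultimately show ?thesis by blast
    qed
    have AXp: "AX \<beta> = 3 ^ n * favg w N px \<beta>" and AYp: "AY \<beta> = 3 ^ n * favg w N py \<beta>"
      if b: "\<beta> \<in> roots" "\<not> quiet w x y \<beta>" "periodic w \<beta>" for \<beta>
      unfolding AX_def AY_def using fsm_favg_periodic[OF fx w perN[OF b]] fsm_favg_periodic[OF fy w perN[OF b]] by auto
    have Xnz: "PX \<beta> \<noteq> 0" and Ynz: "PY \<beta> \<noteq> 0" if "\<beta> \<in> roots" for \<beta>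
      unfolding PX_def PY_def using regx regy that by auto
    have nonzero_combo: "(1 - \<tau>) * PX \<beta> + \<tau> * AX \<beta> \<noteq> 0" if b: "\<beta> \<in> roots" "\<not> (\<not> quiet w x y \<beta> \<and> \<not> periodic w \<beta>)"
      "AX \<beta> < 0" "0 \<le> \<tau>" "\<tau> < 1" for \<beta> \<tau>
    proof -
      have "PX \<beta> < 0"
      proof (cases "quiet w x y \<beta>")
        case True
        then show ?thesis using Q[OF b(1)] b(3) by auto
      next
        case False
        then have p: "periodic w \<beta>" using b(2) by blast
        have "favg w N px \<beta> < 0" using AXp[OF b(1) False p] b(3) by (simp add: mult_less_0_iff)
        then show ?thesis using F[OF b(1) False p, of "-1"] by simp
      qed
      then have "(1 - \<tau>) * PX \<beta> < 0" "\<tau> * AX \<beta> \<le> 0" using b by (auto simp: mult_pos_neg mult_nonneg_nonpos)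
      then show ?thesis by linarith
    qed
    obtain xn where xn: "(x, xn) \<in> (shift_step w)\<^sup>*" "xn \<in> carrier W" "\<And>\<beta>. \<beta> \<in> roots \<Longrightarrow> sg xn \<beta> \<longleftrightarrow> PX \<beta> > 0"
      using smooth_reachable[where c = c and n = n, OF w x c] regx nolx unfolding PX_def px_def by blast
    obtain yn where yn: "(y, yn) \<in> (shift_step w)\<^sup>*" "yn \<in> carrier W" "\<And>\<beta>. \<beta> \<in> roots \<Longrightarrow> sg yn \<beta> \<longleftrightarrow> PY \<beta> > 0"
      using smooth_reachable[where c = d and n = n, OF w y d] regy noly unfolding PY_def py_def by blast
    \<comment> \<open>Here the minimality at y enters: shifts starting from y preserve the length
      and can be reversed, so that the path may end at y.\<close>
    have "len (conjg w yn) = len (conjg w y)" using shift_rtrancl_le[OF w yn(1)] noly[OF yn(1)] by simp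
    then have yny: "(yn, y) \<in> (shift_step w)\<^sup>*" using shift_rtrancl_sym[OF w yn(1)] by simp
    obtain e1 where e1: "e1 > 0" "\<And>\<epsilon> \<beta>. 0 < \<epsilon> \<Longrightarrow> \<epsilon> < e1 \<Longrightarrow> \<beta> \<in> roots \<Longrightarrow> AX \<beta> > 0 \<Longrightarrow> AX \<beta> + \<epsilon> * PX \<beta> > 0"
      using perturb_small[OF fX(3) aX(3) fX(1) aX(1)] by blast
    obtain e2 where e2: "e2 > 0" "\<And>\<epsilon> \<beta>. 0 < \<epsilon> \<Longrightarrow> \<epsilon> < e2 \<Longrightarrow> \<beta> \<in> roots \<Longrightarrow> AY \<beta> > 0 \<Longrightarrow> AY \<beta> + \<epsilon> * PX \<beta> > 0"
      using perturb_small[OF fX(4) aX(4) fX(1) aX(1)] by blast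
    obtain e3 where e3: "e3 > 0" "\<And>\<epsilon> \<beta>. 0 < \<epsilon> \<Longrightarrow> \<epsilon> < e3 \<Longrightarrow> \<beta> \<in> roots \<Longrightarrow> AY \<beta> > 0 \<Longrightarrow> AY \<beta> + \<epsilon> * PY \<beta> > 0"
      using perturb_small[OF fX(4) aX(4) fX(2) aX(2)] by blast
    define \<epsilon> where "\<epsilon> = min 1 (min e1 (min e2 e3)) / 2"
    have eps: "0 < \<epsilon>" "\<epsilon> < e1" "\<epsilon> < e2" "\<epsilon> < e3" "\<epsilon> \<le> 1" using e1(1) e2(1) e3(1) by (auto simp: \<epsilon>_def min_def)
    \<comment> \<open>Averages may lie on walls. A small multiple of a smoothed point selects an
      adjacent chamber; \<open>k2\<close> and \<open>k3\<close> are both close to the average of y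
      and differ only in this choice.\<close>
    define k1 k2 k3 where "k1 = (\<lambda>v. 1 * AX v + \<epsilon> * PX v)" and "k2 = (\<lambda>v. 1 * AY v + \<epsilon> * PX v)" and "k3 = (\<lambda>v. 1 * AY v + \<epsilon> * PY v)"
    have fk: "functional k1" "functional k2" "functional k3"
      unfolding k1_def k2_def k3_def using fX by (auto intro: functional_combine simp del: mult_1_left mult_1)
    have ak: "almost_pos k1" "almost_pos k2" "almost_pos k3"
      unfolding k1_def k2_def k3_def using eps(1) by (intro almost_pos_combine aX; simp)+
    have k1s: "\<sigma> * k1 \<beta> > 0" if "\<beta> \<in> roots" "\<sigma> \<in> {1,-1}" "\<sigma> * AX \<beta> > 0 \<or> AX \<beta> = 0 \<and> \<sigma> * PX \<beta> > 0" for \<sigma> \<beta>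
    proof (cases "AX \<beta> = 0")
      case True
      then have "\<epsilon> * (\<sigma> * PX \<beta>) > 0" using that eps by simp
      then show ?thesis using True by (simp add: k1_def mult.left_commute)
    next
      case False
      then show ?thesis using that e1(2)[OF eps(1,2), of \<beta>] e1(2)[OF eps(1,2) roots_uminus, of \<beta>]
        functional_uminus[OF fX(3), of \<beta>] functional_uminus[OF fX(1), of \<beta>] by (auto simp: k1_def)
    qed
    have k2s: "\<sigma> * k2 \<beta> > 0" if "\<beta> \<in> roots" "\<sigma> \<in> {1,-1}" "\<sigma> * AY \<beta> > 0 \<or> AY \<beta> = 0 \<and> \<sigma> * PX \<beta> > 0" for \<sigma> \<beta>
    proof (cases "AY \<beta> = 0")
      case True
      then have "\<epsilon> * (\<sigma> * PX \<beta>) > 0" using that eps by simp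
      then show ?thesis using True by (simp add: k2_def mult.left_commute)
    next
      case False
      then show ?thesis using that e2(2)[OF eps(1,3), of \<beta>] e2(2)[OF eps(1,3) roots_uminus, of \<beta>]
        functional_uminus[OF fX(4), of \<beta>] functional_uminus[OF fX(1), of \<beta>] by (auto simp: k2_def)
    qed
    have k3s: "\<sigma> * k3 \<beta> > 0" if "\<beta> \<in> roots" "\<sigma> \<in> {1,-1}" "\<sigma> * AY \<beta> > 0 \<or> AY \<beta> = 0 \<and> \<sigma> * PY \<beta> > 0" for \<sigma> \<beta>
    proof (cases "AY \<beta> = 0")
      case True
      then have "\<epsilon> * (\<sigma> * PY \<beta>) > 0" using that eps by simp
      then show ?thesis using True by (simp add: k3_def mult.left_commute)
    next
      case False
      then show ?thesis using that e3(2)[OF eps(1,4), of \<beta>] e3(2)[OF eps(1,4) roots_uminus, of \<beta>]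
        functional_uminus[OF fX(4), of \<beta>] functional_uminus[OF fX(2), of \<beta>] by (auto simp: k3_def)
    qed
    have sgn: "\<exists>\<sigma>\<in>{1,-1}. \<sigma> * t > 0" if "t \<noteq> 0" for t :: real
      using that by (cases "t > 0") auto
    have k1nz: "k1 \<beta> \<noteq> 0" and k2nz: "k2 \<beta> \<noteq> 0" and k3nz: "k3 \<beta> \<noteq> 0" if b: "\<beta> \<in> roots" for \<beta>
    proof -
      obtain \<sigma> \<sigma>' where s: "\<sigma> \<in> {1,-1}" "\<sigma> * PX \<beta> > 0" "\<sigma>' \<in> {1,-1}" "\<sigma>' * PY \<beta> > 0" using sgn Xnz[OF b] Ynz[OF b] by metis
      show "k1 \<beta> \<noteq> 0" using k1s[OF b] s sgn[of "AX \<beta>"] by (cases "AX \<beta> = 0") force+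
      show "k2 \<beta> \<noteq> 0" using k2s[OF b] s sgn[of "AY \<beta>"] by (cases "AY \<beta> = 0") force+
      show "k3 \<beta> \<noteq> 0" using k3s[OF b] s sgn[of "AY \<beta>"] by (cases "AY \<beta> = 0") force+
    qed
    obtain z1 where z1: "z1 \<in> carrier W" "\<And>\<beta>. \<beta> \<in> roots \<Longrightarrow> sg z1 \<beta> \<longleftrightarrow> k1 \<beta> > 0"
      using chamber_of[OF fk(1) ak(1) k1nz] by blast
    obtain z2 where z2: "z2 \<in> carrier W" "\<And>\<beta>. \<beta> \<in> roots \<Longrightarrow> sg z2 \<beta> \<longleftrightarrow> k2 \<beta> > 0"
      using chamber_of[OF fk(2) ak(2) k2nz] by blast
    obtain z3 where z3: "z3 \<in> carrier W" "\<And>\<beta>. \<beta> \<in> roots \<Longrightarrow> sg z3 \<beta> \<longleftrightarrow> k3 \<beta> > 0"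
      using chamber_of[OF fk(3) ak(3) k3nz] by blast
    \<comment> \<open>On quiet and on finite orbits a smoothed point has the sign of its average
      wherever the latter is nonzero. Hence only walls of infinite orbits are crossed, which are
      shifts.\<close>
    have seg1: "(xn, z1) \<in> (conj_step w)\<^sup>*"
    proof (rule conj_path_line[OF w z1(1) fX(1) aX(1) fX(3) aX(3)])
      fix \<beta> assume b: "\<beta> \<in> roots"
      show "0 < AX \<beta> \<Longrightarrow> sg z1 \<beta>" using z1(2)[OF b] k1s[OF b, of 1] by simp
      show "PX \<beta> = 0 \<Longrightarrow> AX \<beta> = 0" using Xnz[OF b] by simp
      show "0 < PX \<beta> \<Longrightarrow> sg xn \<beta>" using xn(3)[OF b] by simp
      show "AX \<beta> = 0 \<Longrightarrow> sg z1 \<beta> \<longleftrightarrow> sg xn \<beta>"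
        using z1(2)[OF b] xn(3)[OF b] k1s[OF b, of 1] k1s[OF b, of "-1"] Xnz[OF b] by force
    next
      fix \<tau> :: real assume t: "0 \<le> \<tau>" "\<tau> < 1"
      have "(1 - \<tau>) * PX (act w \<beta>) + \<tau> * AX (act w \<beta>) < 0 \<or> (1 - \<tau>) * PX (act (inv w) \<beta>) + \<tau> * AX (act (inv w) \<beta>) < 0"
        if b: "\<beta> \<in> roots" "(1 - \<tau>) * PX \<beta> + \<tau> * AX \<beta> = 0" "AX \<beta> < 0" for \<beta>
      proof -
        have "\<not> quiet w x y \<beta> \<and> \<not> periodic w \<beta>" using nonzero_combo[of \<beta> \<tau>] b t by blast
        then show ?thesis using I[of \<beta> "1 - \<tau>" \<tau> 0 0] b t by (auto simp: mult_less_0_iff)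
      qed
      then show "(\<forall>\<beta>\<in>roots. (1 - \<tau>) * PX \<beta> + \<tau> * AX \<beta> = 0 \<and> AX \<beta> \<noteq> 0 \<longrightarrow> PX (act w \<beta>) = PX \<beta> \<and> AX (act w \<beta>) = AX \<beta>) \<or>
        (\<forall>\<beta>\<in>roots. (1 - \<tau>) * PX \<beta> + \<tau> * AX \<beta> = 0 \<and> AX \<beta> < 0 \<longrightarrow>
          (1 - \<tau>) * PX (act w \<beta>) + \<tau> * AX (act w \<beta>) < 0 \<or> (1 - \<tau>) * PX (act (inv w) \<beta>) + \<tau> * AX (act (inv w) \<beta>) < 0 \<or>
          act w \<beta> = (\<lambda>r. - \<beta> r))" by blast
    qed (rule xn(2))
    have AXv: "AX \<beta> = px (vavg w N (vsm w n \<beta>))" and AYv: "AY \<beta> = py (vavg w N (vsm w n \<beta>))" for \<beta>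
      unfolding AX_def AY_def using functional_vavg_vsm[OF fx w] functional_vavg_vsm[OF fy w] by auto
    have AXY: "AX \<beta> = 0 \<longleftrightarrow> AY \<beta> = 0" if b: "\<beta> \<in> roots" for \<beta>
      using avgx[OF b, of n] avgy[OF b, of n] AXv AYv functional_zero[OF fx] functional_zero[OF fy] unfolding AX_def AY_def by metis
    \<comment> \<open>All roots vanishing at one moment and not at the end have proportional
      averages. If one of them has a finite orbit, its average is fixed by w, hence so are the
      averages of the others, and together they form a cluster. Otherwise all orbits involved are
      infinite and the crossings are shifts.\<close>
    have seg2: "(z1, z2) \<in> (conj_step w)\<^sup>*"
    proof (rule conj_path_line[OF w z2(1) fX(3) aX(3) fX(4) aX(4)])
      fix \<beta> assume b: "\<beta> \<in> roots"
      show "0 < AY \<beta> \<Longrightarrow> sg z2 \<beta>" using z2(2)[OF b] k2s[OF b, of 1] by simp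
      show "AX \<beta> = 0 \<Longrightarrow> AY \<beta> = 0" using AXY[OF b] by simp
      show "0 < AX \<beta> \<Longrightarrow> sg z1 \<beta>" using z1(2)[OF b] k1s[OF b, of 1] by simp
      show "AY \<beta> = 0 \<Longrightarrow> sg z2 \<beta> \<longleftrightarrow> sg z1 \<beta>"
        using AXY[OF b] z1(2)[OF b] z2(2)[OF b] k1s[OF b, of 1] k1s[OF b, of "-1"] k2s[OF b, of 1] k2s[OF b, of "-1"] Xnz[OF b] by force
    next
      fix \<tau> :: real assume t: "0 \<le> \<tau>" "\<tau> < 1"
      show "(\<forall>\<beta>\<in>roots. (1 - \<tau>) * AX \<beta> + \<tau> * AY \<beta> = 0 \<and> AY \<beta> \<noteq> 0 \<longrightarrow> AX (act w \<beta>) = AX \<beta> \<and> AY (act w \<beta>) = AY \<beta>) \<or>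
        (\<forall>\<beta>\<in>roots. (1 - \<tau>) * AX \<beta> + \<tau> * AY \<beta> = 0 \<and> AY \<beta> < 0 \<longrightarrow>
          (1 - \<tau>) * AX (act w \<beta>) + \<tau> * AY (act w \<beta>) < 0 \<or> (1 - \<tau>) * AX (act (inv w) \<beta>) + \<tau> * AY (act (inv w) \<beta>) < 0 \<or>
          act w \<beta> = (\<lambda>r. - \<beta> r))" (is "?C \<or> ?G")
      proof (cases ?C)
        case False
        then obtain \<beta>1 where b1: "\<beta>1 \<in> roots" "(1 - \<tau>) * AX \<beta>1 + \<tau> * AY \<beta>1 = 0" "AY \<beta>1 \<noteq> 0"
          "\<not> (AX (act w \<beta>1) = AX \<beta>1 \<and> AY (act w \<beta>1) = AY \<beta>1)" by blast
        define v1 where "v1 = vavg w N (vsm w n \<beta>1)"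
        have AXw: "AX (act w \<beta>) = px (act w (vavg w N (vsm w n \<beta>)))" and AYw: "AY (act w \<beta>) = py (act w (vavg w N (vsm w n \<beta>)))" for \<beta>
          unfolding AXv AYv act_vavg[OF w] act_vsm[OF w] by auto
        have "(1 - \<tau>) * AX (act w \<beta>) + \<tau> * AY (act w \<beta>) < 0 \<or> (1 - \<tau>) * AX (act (inv w) \<beta>) + \<tau> * AY (act (inv w) \<beta>) < 0"
          if b: "\<beta> \<in> roots" "(1 - \<tau>) * AX \<beta> + \<tau> * AY \<beta> = 0" "AY \<beta> < 0" for \<beta>
        proof -
          have nq: "\<not> quiet w x y \<beta>"
          proof
            assume "quiet w x y \<beta>"
            then have "AX \<beta> < 0" using Q[OF b(1)] b(3) by auto
            then have "(1 - \<tau>) * AX \<beta> < 0" "\<tau> * AY \<beta> \<le> 0" using b t by (auto simp: mult_pos_neg mult_nonneg_nonpos)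
            then show False using b by linarith
          qed
          have "\<not> periodic w \<beta>"
          proof
            assume p: "periodic w \<beta>"
            define v where "v = vavg w N (vsm w n \<beta>)"
            have pn: "act (w [^] N) \<beta> = \<beta>" by (rule perN[OF b(1) nq p])
            have wv: "act w v = v"
            proof -
              have vp: "act (w [^] N) (vsm w n v') = vsm w n v'" if "act (w [^] N) v' = v'" for v' n
                using that
              proof (induction n arbitrary: v')
                case (Suc n)
                have "act (w [^] N) (act w v') = act w (act (w [^] N) v')" by (rule act_pow_comm[OF w, symmetric])
                then have "act (w [^] N) (act w v') = act w v'" using Suc.prems by (simp only:)
                then show ?case using Suc act_lin[of "w [^] N" 1 "vsm w n v'" 2 "vsm w n (act w v')"] w by simp
              qed simp
              show ?thesis unfolding v_def act_vavg[OF w] by (rule vavg_act_periodic[OF w vp[OF pn]])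
            qed
            have AXb: "AX \<beta> = px v" "AY \<beta> = py v" "AX \<beta>1 = px v1" "AY \<beta>1 = py v1" by (simp_all add: AXv AYv v_def v1_def)
            have nzv: "px v \<noteq> 0" using AXY[OF b(1)] b(3) AXb by auto
            have det: "px v * py v1 - px v1 * py v = 0"
            proof -
              have "(1 - \<tau>) * px v = - \<tau> * py v" "(1 - \<tau>) * px v1 = - \<tau> * py v1" using b(2) b1(2) AXb by auto
              then have "(1 - \<tau>) * (px v * py v1 - px v1 * py v) = 0"
                by (simp add: right_diff_distrib mult.assoc[symmetric])
              then show ?thesis using t by simp
            qed
            have "(\<lambda>r. px v * v1 r - px v1 * v r) \<in> Z6"
              unfolding Z6_def v_def v1_def using inZ2[OF b(1), of n] inZ2[OF b1(1), of n] by (intro image_eqI[of _ _ "(vavg w N (vsm w n \<beta>), vavg w N (vsm w n \<beta>1))"]) auto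
            then have inZ: "(\<lambda>r. px v * v1 r - px v1 * v r) \<in> Zy" by (simp add: Zy_def)
            have "py (\<lambda>r. px v * v1 r - px v1 * v r) = 0"
              using functional_lin[OF fy, of "px v" v1 "- px v1" v] det by simp
            then have "(\<lambda>r. px v * v1 r - px v1 * v r) = (\<lambda>r. 0)" using gy[OF inZ] by (simp add: py_def)
            then have e: "px v * v1 r = px v1 * v r" for r using fun_cong[of _ _ r] by fastforce
            have v1e: "v1 = (\<lambda>r. (px v1 / px v) * v r)"
              by (rule ext) (use e nzv in \<open>simp add: field_simps\<close>)
            have "act w v1 = (\<lambda>r. (px v1 / px v) * act w v r)" by (subst v1e) (rule act_scale[OF w])
            then have "act w v1 = v1" using v1e wv by simp
            then have "AX (act w \<beta>1) = AX \<beta>1 \<and> AY (act w \<beta>1) = AY \<beta>1" unfolding AXw AYw AXb by (simp flip: v1_def)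
            then show False using b1(4) by blast
          qed
          then show ?thesis using I[of \<beta> 0 "1 - \<tau>" 0 \<tau>] nq b t by (auto simp: mult_less_0_iff)
        qed
        then show ?thesis by blast
      qed blast
    qed (rule z1(1))
    \<comment> \<open>Only roots with average zero distinguish the two ends. On them the segment is
      \<epsilon> times the one from \<open>PX\<close> to \<open>PY\<close>, and their orbits are
      finite since the averaged point already excludes infinite ones. So \<open>E\<close>
      applies.\<close>
    have seg3: "(z2, z3) \<in> (conj_step w)\<^sup>*"
    proof (rule conj_path_line[OF w z3(1) fk(2) ak(2) fk(3) ak(3)])
      fix \<beta> assume b: "\<beta> \<in> roots"
      show "0 < k3 \<beta> \<Longrightarrow> sg z3 \<beta>" using z3(2)[OF b] by simp
      show "k2 \<beta> = 0 \<Longrightarrow> k3 \<beta> = 0" using k2nz[OF b] by simp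
      show "0 < k2 \<beta> \<Longrightarrow> sg z2 \<beta>" using z2(2)[OF b] by simp
      show "k3 \<beta> = 0 \<Longrightarrow> sg z3 \<beta> \<longleftrightarrow> sg z2 \<beta>" using k3nz[OF b] by simp
    next
      fix \<tau> :: real assume t: "0 \<le> \<tau>" "\<tau> < 1"
      have "(1 - \<tau>) * k2 (act w \<beta>) + \<tau> * k3 (act w \<beta>) < 0 \<or> (1 - \<tau>) * k2 (act (inv w) \<beta>) + \<tau> * k3 (act (inv w) \<beta>) < 0 \<or> act w \<beta> = (\<lambda>r. - \<beta> r)"
        if b: "\<beta> \<in> roots" "(1 - \<tau>) * k2 \<beta> + \<tau> * k3 \<beta> = 0" for \<beta>
      proof -
        have A0: "AY \<beta> = 0"
        proof (rule ccontr)
          assume "AY \<beta> \<noteq> 0"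
          then obtain \<sigma> where s: "\<sigma> \<in> {1,-1}" "\<sigma> * AY \<beta> > 0" using sgn by blast
          have "\<sigma> * k2 \<beta> > 0" "\<sigma> * k3 \<beta> > 0" using k2s[OF b(1) s(1)] k3s[OF b(1) s(1)] s by auto
          then have "(1 - \<tau>) * (\<sigma> * k2 \<beta>) > 0" "\<tau> * (\<sigma> * k3 \<beta>) \<ge> 0" using t by auto
          moreover have "(1 - \<tau>) * (\<sigma> * k2 \<beta>) + \<tau> * (\<sigma> * k3 \<beta>) = \<sigma> * ((1 - \<tau>) * k2 \<beta> + \<tau> * k3 \<beta>)" by (simp add: algebra_simps)
          ultimately show False using b(2) by simp
        qed
        have v0: "vavg w N (vsm w n \<beta>) = (\<lambda>r. 0)" using avgy[OF b(1)] A0 by (simp add: AY_def)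
        have Aw: "AY (act w \<beta>) = 0" "AY (act (inv w) \<beta>) = 0"
        proof -
          have "vavg w N (vsm w n (act w \<beta>)) = act w (\<lambda>r. 0)" unfolding v0[symmetric] act_vavg[OF w] act_vsm[OF w] ..
          then show "AY (act w \<beta>) = 0" unfolding AYv act_zero[OF w] using functional_zero[OF fy] by simp
          have "act w (vavg w N (vsm w n (act (inv w) \<beta>))) = vavg w N (vsm w n \<beta>)" unfolding act_vavg[OF w] act_vsm[OF w] using w by simp
          then have "act w (vavg w N (vsm w n (act (inv w) \<beta>))) = act w (\<lambda>r. 0)" using v0 act_zero[OF w] by simp
          then have "vavg w N (vsm w n (act (inv w) \<beta>)) = (\<lambda>r. 0)" using act_inj[OF w] by blast
          then show "AY (act (inv w) \<beta>) = 0" unfolding AYv using functional_zero[OF fy] by simp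
        qed
        have nq: "\<not> quiet w x y \<beta>" using Q[OF b(1)] A0 by auto
        have p: "periodic w \<beta>"
        proof (rule ccontr)
          assume "\<not> periodic w \<beta>"
          then show False using I[OF b(1) nq, of 0 0 0 1] A0 Aw by simp
        qed
        have fav: "favg w N px \<beta> = 0" using AXp[OF b(1) nq p] AXY[OF b(1)] A0 by simp
        have ek: "(1 - \<tau>) * k2 v + \<tau> * k3 v = \<epsilon> * ((1 - \<tau>) * PX v + \<tau> * PY v)" if "AY v = 0" for v
          using that by (simp add: k2_def k3_def algebra_simps)
        have "(1 - \<tau>) * PX \<beta> + \<tau> * PY \<beta> = 0" using b(2) ek[OF A0] eps by simp
        then have "act w \<beta> = (\<lambda>r. - \<beta> r) \<or> (1 - \<tau>) * PX (act w \<beta>) + \<tau> * PY (act w \<beta>) < 0 \<or>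
          (1 - \<tau>) * PX (act (inv w) \<beta>) + \<tau> * PY (act (inv w) \<beta>) < 0"
          using E[OF b(1) nq p fav] t by simp
        then show ?thesis unfolding ek[OF Aw(1)] ek[OF Aw(2)] using eps by (auto simp: mult_less_0_iff)
      qed
      then show "(\<forall>\<beta>\<in>roots. (1 - \<tau>) * k2 \<beta> + \<tau> * k3 \<beta> = 0 \<and> k3 \<beta> \<noteq> 0 \<longrightarrow> k2 (act w \<beta>) = k2 \<beta> \<and> k3 (act w \<beta>) = k3 \<beta>) \<or>
        (\<forall>\<beta>\<in>roots. (1 - \<tau>) * k2 \<beta> + \<tau> * k3 \<beta> = 0 \<and> k3 \<beta> < 0 \<longrightarrow>
          (1 - \<tau>) * k2 (act w \<beta>) + \<tau> * k3 (act w \<beta>) < 0 \<or> (1 - \<tau>) * k2 (act (inv w) \<beta>) + \<tau> * k3 (act (inv w) \<beta>) < 0 \<or>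
          act w \<beta> = (\<lambda>r. - \<beta> r))" by blast
    qed (rule z2(1))
    have seg4: "(z3, yn) \<in> (conj_step w)\<^sup>*"
    proof (rule conj_path_line[OF w yn(2) fk(3) ak(3) fX(2) aX(2)])
      fix \<beta> assume b: "\<beta> \<in> roots"
      show "0 < PY \<beta> \<Longrightarrow> sg yn \<beta>" using yn(3)[OF b] by simp
      show "k3 \<beta> = 0 \<Longrightarrow> PY \<beta> = 0" using k3nz[OF b] by simp
      show "0 < k3 \<beta> \<Longrightarrow> sg z3 \<beta>" using z3(2)[OF b] by simp
      show "PY \<beta> = 0 \<Longrightarrow> sg yn \<beta> \<longleftrightarrow> sg z3 \<beta>" using Ynz[OF b] by simp
    next
      fix \<tau> :: real assume t: "0 \<le> \<tau>" "\<tau> < 1"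
      \<comment> \<open>Rewritten as a mixture of \<open>PY\<close> and \<open>AY\<close>, the
        segment leads from near the average of y back to y. Its coefficients r and 1 - \<tau> lie in
        the unit interval and have sum at least 1, as \<open>I\<close> requires.\<close>
      define r where "r = (1 - \<tau>) * \<epsilon> + \<tau>"
      have r: "0 < r" "r \<le> 1" "r + (1 - \<tau>) \<ge> 1"
      proof -
        define u where "u = (1 - \<tau>) * \<epsilon>"
        have "u > 0" "u \<le> 1 - \<tau>" using t eps mult_left_mono[of \<epsilon> 1 "1 - \<tau>"] by (simp_all add: u_def)
        then show "0 < r" "r \<le> 1" "r + (1 - \<tau>) \<ge> 1" using t unfolding r_def u_def[symmetric] by linarith+
      qed
      have ek: "(1 - \<tau>) * k3 v + \<tau> * PY v = r * PY v + (1 - \<tau>) * AY v" for v by (simp add: k3_def r_def algebra_simps)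
      have "r * PY (act w \<beta>) + (1 - \<tau>) * AY (act w \<beta>) < 0 \<or> r * PY (act (inv w) \<beta>) + (1 - \<tau>) * AY (act (inv w) \<beta>) < 0"
        if b: "\<beta> \<in> roots" "r * PY \<beta> + (1 - \<tau>) * AY \<beta> = 0" for \<beta>
      proof -
        have same: "\<not> (\<sigma> * PY \<beta> > 0 \<and> \<sigma> * AY \<beta> \<ge> 0)" for \<sigma>
        proof
          assume "\<sigma> * PY \<beta> > 0 \<and> \<sigma> * AY \<beta> \<ge> 0"
          then have "r * (\<sigma> * PY \<beta>) > 0" "(1 - \<tau>) * (\<sigma> * AY \<beta>) \<ge> 0" using r t by auto
          moreover have "r * (\<sigma> * PY \<beta>) + (1 - \<tau>) * (\<sigma> * AY \<beta>) = \<sigma> * (r * PY \<beta> + (1 - \<tau>) * AY \<beta>)" by (simp add: algebra_simps)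
          ultimately show False using b(2) by simp
        qed
        have nq: "\<not> quiet w x y \<beta>" using Q[OF b(1)] same by (meson less_imp_le)
        have np: "\<not> periodic w \<beta>"
        proof
          assume p: "periodic w \<beta>"
          show False
          proof (cases "AY \<beta> = 0")
            case True
            then show ?thesis using same sgn[OF Ynz[OF b(1)]] by auto
          next
            case False
            then obtain \<sigma> where s: "\<sigma> \<in> {1,-1}" "\<sigma> * AY \<beta> > 0" using sgn by blast
            then have "3 ^ n * (\<sigma> * favg w N py \<beta>) > 0" using AYp[OF b(1) nq p] by (simp add: mult.left_commute)
            then have "\<sigma> * favg w N py \<beta> > 0" by (simp add: zero_less_mult_iff)
            then have "\<sigma> * PY \<beta> > 0" by (rule FY[OF b(1) nq p s(1)])
            then show ?thesis using same s by (meson less_imp_le)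
          qed
        qed
        show ?thesis using I[OF b(1) nq np, of 0 0 r "1 - \<tau>"] b(2) t r by (auto simp: mult_less_0_iff)
      qed
      then show "(\<forall>\<beta>\<in>roots. (1 - \<tau>) * k3 \<beta> + \<tau> * PY \<beta> = 0 \<and> PY \<beta> \<noteq> 0 \<longrightarrow> k3 (act w \<beta>) = k3 \<beta> \<and> PY (act w \<beta>) = PY \<beta>) \<or>
        (\<forall>\<beta>\<in>roots. (1 - \<tau>) * k3 \<beta> + \<tau> * PY \<beta> = 0 \<and> PY \<beta> < 0 \<longrightarrow>
          (1 - \<tau>) * k3 (act w \<beta>) + \<tau> * PY (act w \<beta>) < 0 \<or> (1 - \<tau>) * k3 (act (inv w) \<beta>) + \<tau> * PY (act (inv w) \<beta>) < 0 \<or>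
          act w \<beta> = (\<lambda>r. - \<beta> r))" unfolding ek by blast
    qed (rule z3(1))
    have "(x, xn) \<in> (conj_step w)\<^sup>*" "(yn, y) \<in> (conj_step w)\<^sup>*" using xn(1) yny shift_conj by blast+
    then show ?thesis using seg1 seg2 seg3 seg4 by (meson rtrancl_trans)
  qed
qed

end

subsection \<open>Matsumoto's theorem\<close>

context km_weyl
begin

lemma ord_swap: "s \<in> S \<Longrightarrow> t \<in> S \<Longrightarrow> ord (t \<otimes> s) = ord (s \<otimes> t)"
  using ord_inv[of "s \<otimes> t"] by (simp add: inv_mult_group)

text \<open>Below the order, the dihedral word sends the root of the next letter to a nonnegative
  combination of the roots of s and t. Both stay positive under v, so each letter adds 1 to the
  length.\<close>

lemma len_coset_alternating:
  assumes v: "v \<in> carrier W"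
  shows "\<lbrakk>s \<in> S; t \<in> S; s \<noteq> t; len (v \<otimes> s) = len v + 1; len (v \<otimes> t) = len v + 1;
    k \<le> ord (s \<otimes> t) \<or> ord (s \<otimes> t) = 0\<rbrakk>
    \<Longrightarrow> len (v \<otimes> wv (rev (alternating s t k))) = len v + k"
proof (induction k arbitrary: s t)
  case (Suc k)
  let ?x = "v \<otimes> wv (rev (alternating t s k))"
  have alt: "rev (alternating t s k) \<in> lists S" using Suc.prems by (simp add: alternating_in_lists)
  have "len ?x = len v + k"
    by (rule Suc.IH) (use Suc.prems ord_swap[of s t] in auto)
  moreover have "len (?x \<otimes> s) = len ?x + 1"
  proof -
    define p q where "p = fst (dihedral_coeffs (A s t) (A t s) k)" and
      "q = snd (dihedral_coeffs (A s t) (A t s) k)"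
    have pq: "p \<ge> 0" "q \<ge> 0" unfolding p_def q_def
      using dihedral_coeffs_nonneg[of s t k] Suc.prems by auto
    have "act ?x (sroot s) = act v (\<lambda>r. p * sroot s r + q * sroot t r)"
      using act_mult[OF v, of "wv (rev (alternating t s k))"] act_wv[OF alt] dihedral_action[of s t k] alt Suc.prems
      by (simp add: p_def q_def)
    also have "\<dots> = (\<lambda>r. p * act v (sroot s) r + q * act v (sroot t) r)" using v by (simp add: act_lin)
    finally have "act ?x (sroot s) \<in> proots"
      using pq Suc.prems act_sroot_nonneg[of v s] act_sroot_nonneg[of v t] v
        rootsI[of ?x s] alt by (simp add: proots_def)
    then show ?thesis using act_sroot_proots_iff[of ?x s] v alt Suc.prems by auto
  qed
  moreover have "?x \<otimes> s = v \<otimes> wv (rev (alternating s t (Suc k)))"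
    using Suc.prems v alt by (simp add: alternating_Cons wv_append m_assoc)
  ultimately show ?case by simp
qed (use v in simp)

lemma len_alternating:
  assumes "s \<in> S" "t \<in> S" "s \<noteq> t"
  shows "len (wv (alternating s t (ord (s \<otimes> t)))) = ord (s \<otimes> t)"
proof -
  have "alternating s t (ord (s \<otimes> t)) \<in> lists S" using assms by (simp add: alternating_in_lists)
  then show ?thesis using len_coset_alternating[of \<one> s t "ord (s \<otimes> t)"] assms
    by (simp add: wv_rev)
qed

lemma reduced_tl: 
  assumes "s # u \<in> reduced_words W S w" "w \<in> carrier W"
  shows "u \<in> reduced_words W S (s \<otimes> w)" "len w = len (s \<otimes> w) + 1" "s \<in> S"
proof -
  have *: "s \<in> S" "u \<in> lists S" "w = s \<otimes> wv u" "len w = length u + 1"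
    using assms by (auto simp: reduced_words_def)
  then have sw: "s \<otimes> w = wv u" by simp
  have "length u \<le> len (wv u)" using * len_gen_mult_cases[of "wv u" s] by auto
  then show "u \<in> reduced_words W S (s \<otimes> w)" "len w = len (s \<otimes> w) + 1" "s \<in> S"
    using * len_le[OF *(2) HOL.refl] sw by (auto simp: reduced_words_def)
qed

text \<open>If s and t are both left descents of w, the dihedral part of w^-1 has to be the longest
  element of the dihedral group. The order is therefore finite, and w has reduced words beginning
  with either side of the braid relation.\<close>

lemma reduced_braid_prefix:
  assumes w: "w \<in> carrier W" and s: "s \<in> S" and t: "t \<in> S" and st: "s \<noteq> t"
    and ls: "len w = len (s \<otimes> w) + 1" and lt: "len w = len (t \<otimes> w) + 1"
  obtains r where "ord (s \<otimes> t) \<noteq> 0" "r \<in> lists S"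
    "alternating s t (ord (s \<otimes> t)) @ r \<in> reduced_words W S w"
    "alternating t s (ord (s \<otimes> t)) @ r \<in> reduced_words W S w"
proof -
  let ?m = "ord (s \<otimes> t)"
  have iw: "inv w \<in> carrier W" using w by simp
  obtain v c where vc: "v \<in> carrier W" "c \<in> lists {s, t}" "inv w = v \<otimes> wv c" "len (inv w) = len v + length c"
    "len (v \<otimes> s) = len v + 1" "len (v \<otimes> t) = len v + 1" using decomp[OF iw s t] by metis
  have cS: "c \<in> lists S" using vc s t by (auto simp: in_lists_conv_set)
  have down: "len (inv w \<otimes> s) < len (inv w)" "len (inv w \<otimes> t) < len (inv w)"
    using ls lt w s t by (simp_all add: len_gen_mult)
  have "len (inv w) \<le> len v + len (wv c)" using vc cS len_mult_le[of v "wv c"] by simp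
  then have "len (wv c) = length c" using vc(4) len_le[OF cS HOL.refl] by linarith
  then have c_alt: "c = rev (alternating s t (length c)) \<or> c = rev (alternating t s (length c))"
    using reduced_alternating[OF s t vc(2)] by simp
  have *: "?m \<noteq> 0 \<and> (\<exists>r \<in> lists S. alternating a b ?m @ r \<in> reduced_words W S w)"
    if ab: "a \<in> S" "b \<in> S" "a \<noteq> b" and c: "c = rev (alternating a b k)" and m: "ord (a \<otimes> b) = ?m"
      and up: "len (v \<otimes> a) = len v + 1" "len (v \<otimes> b) = len v + 1" "len (inv w \<otimes> b) < len (inv w)" for a b k
  proof -
    have lk: "length c = k" using c by simp
    \<comment> \<open>An alternating word shorter than the order could be prolonged by b with
      increasing length, although b is a descent.\<close>
    have km: "\<not> (k < ?m \<or> ?m = 0)"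
    proof
      assume "k < ?m \<or> ?m = 0"
      then have "len (v \<otimes> wv (rev (alternating b a (Suc k)))) = len v + Suc k"
        using len_coset_alternating[OF vc(1), of b a "Suc k"] ab up m ord_swap[of b a] by auto
      moreover have "inv w \<otimes> b = v \<otimes> (wv (rev (alternating a b k)) \<otimes> b)"
        using ab vc(1,3) c alternating_in_lists[of a S b k] by (simp add: m_assoc)
      then have "v \<otimes> wv (rev (alternating b a (Suc k))) = inv w \<otimes> b"
        using ab vc(1) alternating_in_lists[of a S b k] by (simp add: alternating_Cons wv_append)
      ultimately show False using up vc lk by simp
    qed
    define d where "d = drop ?m (alternating a b k)"
    have "take ?m (alternating a b k) = alternating a b ?m" using km
      by (simp add: alternating_def take_map take_upt)
    then have d: "alternating a b k = alternating a b ?m @ d" by (metis append_take_drop_id d_def)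
    have ld: "length d = k - ?m" by (simp add: d_def)
    have dS: "d \<in> lists S" using d alternating_in_lists[OF ab(1,2), of k] by (metis append_in_lists_conv)
    obtain e where e: "e \<in> lists S" "wv e = inv v" "length e = len (inv v)"
      using ex_reduced[of "inv v"] vc by auto
    have "w = inv (v \<otimes> wv c)" using vc w by (metis inv_inv)
    also have "\<dots> = wv (rev c) \<otimes> wv e" using vc(1) cS e by (simp add: inv_mult_group wv_rev)
    also have "\<dots> = wv (alternating a b k @ e)" using c cS e 
      using alternating_in_lists[OF ab(1,2)] by (simp add: wv_append)
    finally have 1: "w = wv (alternating a b ?m @ d @ e)" using d by simp
    have 2: "?m + (length d + length e) = len w" using ld km lk e vc(1,4) len_inv[OF w] len_inv[OF vc(1)] by linarith
    have "alternating a b ?m @ d @ e \<in> reduced_words W S w"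
    proof -
      have "alternating a b ?m @ d @ e \<in> lists S"
        using dS e(1) alternating_in_lists[OF ab(1,2)] by simp
      moreover have "length (alternating a b ?m @ d @ e) = len w" using 2 by simp
      ultimately show ?thesis unfolding reduced_words_def using 1 by blast
    qed
    moreover have "d @ e \<in> lists S" using dS e(1) by simp
    ultimately have "\<exists>r \<in> lists S. alternating a b ?m @ r \<in> reduced_words W S w" by (rule rev_bexI[rotated])
    then show ?thesis using km by simp
  qed
  have swap: "alternating b a ?m @ r \<in> reduced_words W S w"
    if "a \<in> S" "b \<in> S" "ord (a \<otimes> b) = ?m" "r \<in> lists S" "alternating a b ?m @ r \<in> reduced_words W S w" for a b r
    using that braid[of a b] by (simp add: reduced_words_def wv_append alternating_in_lists)
  from c_alt show thesis
  proof
    assume c: "c = rev (alternating s t (length c))"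
    have m: "?m \<noteq> 0" and "\<exists>r \<in> lists S. alternating s t ?m @ r \<in> reduced_words W S w"
      using *[OF s t st c HOL.refl vc(5,6) down(2)] by simp_all
    then obtain r where r: "r \<in> lists S" "alternating s t ?m @ r \<in> reduced_words W S w" by (elim bexE)
    show thesis by (rule that[OF m r swap[OF s t HOL.refl r]])
  next
    assume c: "c = rev (alternating t s (length c))"
    have m: "?m \<noteq> 0" and "\<exists>r \<in> lists S. alternating t s ?m @ r \<in> reduced_words W S w"
      using *[OF t s st[symmetric] c ord_swap[OF s t] vc(6,5) down(1)] by simp_all
    then obtain r where r: "r \<in> lists S" "alternating t s ?m @ r \<in> reduced_words W S w" by (elim bexE)
    show thesis by (rule that[OF m r(1) swap[OF t s ord_swap[OF s t] r] r(2)])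
  qed
qed

text \<open>Two reduced words with the same first letter are compared after deleting it. If the
  first letters s and t differ, both are left descents, and the words are joined through two reduced
  words that start with the two sides of the braid relation.\<close>

theorem matsumoto:
  assumes refl: "\<And>u. u \<in> lists S \<Longrightarrow> rel u u"
    and trans: "\<And>u v x. rel u v \<Longrightarrow> rel v x \<Longrightarrow> rel u x"
    and cons: "\<And>s u v. s \<in> S \<Longrightarrow> u \<in> lists S \<Longrightarrow> v \<in> lists S \<Longrightarrow> rel u v \<Longrightarrow> rel (s # u) (s # v)"
    and braid_rel: "\<And>s t r. \<lbrakk>s \<in> S; t \<in> S; s \<noteq> t; ord (s \<otimes> t) \<noteq> 0; r \<in> lists S\<rbrakk> \<Longrightarrow>
      rel (alternating s t (ord (s \<otimes> t)) @ r) (alternating t s (ord (s \<otimes> t)) @ r)"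
  shows "w \<in> carrier W \<Longrightarrow> u \<in> reduced_words W S w \<Longrightarrow> v \<in> reduced_words W S w \<Longrightarrow> rel u v"
proof (induction "len w" arbitrary: w u v rule: less_induct)
  case less
  show ?case
  proof (cases "u = [] \<or> v = []")
    case True
    have "length u = length v" using less.prems(2,3) by (simp add: reduced_words_def)
    then have "u = []" "v = []" using True by auto
    then show ?thesis using refl[of "[]"] by simp
  next
    case False
    then obtain s u' t v' where uv: "u = s # u'" "v = t # v'" by (cases u; cases v) auto
    note u' = reduced_tl[OF less.prems(2)[unfolded uv] less.prems(1)]
    note v' = reduced_tl[OF less.prems(3)[unfolded uv] less.prems(1)]
    have same: "rel (a # x) (a # y)" if "a # x \<in> reduced_words W S w" "a # y \<in> reduced_words W S w" for a x y
    proof -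
      note x = reduced_tl[OF that(1) less.prems(1)] and y = reduced_tl[OF that(2) less.prems(1)]
      have "rel x y" by (rule less.hyps[OF _ _ x(1) y(1)]) (use x less.prems in auto)
      moreover have "x \<in> lists S" "y \<in> lists S" using x(1) y(1) by (simp_all add: reduced_words_def)
      ultimately show ?thesis using cons[OF x(3)] by blast
    qed
    show ?thesis
    proof (cases "s = t")
      case True
      then show ?thesis using same[of s u' v'] less.prems(2,3) uv by simp
    next
      case False
      obtain r where r: "ord (s \<otimes> t) \<noteq> 0" "r \<in> lists S"
        "alternating s t (ord (s \<otimes> t)) @ r \<in> reduced_words W S w"
        "alternating t s (ord (s \<otimes> t)) @ r \<in> reduced_words W S w"
        by (rule reduced_braid_prefix[OF less.prems(1) u'(3) v'(3) False u'(2) v'(2)])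
      obtain k where k: "ord (s \<otimes> t) = Suc k" using r(1) by (cases "ord (s \<otimes> t)") auto
      have "rel u (alternating s t (ord (s \<otimes> t)) @ r)"
        using same[of s u' "alternating t s k @ r"] less.prems(2) uv(1) r(3) by (simp add: k alternating_Cons)
      moreover have "rel (alternating t s (ord (s \<otimes> t)) @ r) v"
        using same[of t "alternating s t k @ r" v'] less.prems(3) uv(2) r(4) by (simp add: k alternating_Cons)
      ultimately show ?thesis
        using trans[OF _ trans[OF braid_rel[OF u'(3) v'(3) False r(1,2)]]] by blast
    qed
  qed
qed

end

subsection \<open>The free algebra\<close>

definition mon :: "'s list \<Rightarrow> 's free_alg" where
  "mon u = Poly_Mapping.single (Word u) 1"

lemma mon_Nil [simp]: "mon [] = 1"
  by (simp add: mon_def flip: zero_word_def)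

lemma mon_append: "mon (u @ v) = mon u * mon v"
  by (simp add: mon_def mult_single plus_word_def)

lemma mon_Cons: "mon (s # u) = gen s * mon u"
  using mon_append[of "[s]" u] by (simp add: mon_def gen_def)

lemma prod_list_gen: "prod_list (map gen u) = mon u"
  by (induction u) (simp_all add: mon_Cons)

lemma scalar_simps: 
  "scalar (a + b) = scalar a + scalar b" "scalar (a - b) = scalar a - scalar b" 
  "scalar (- a) = - scalar a" "scalar (a * b) = scalar a * scalar b"
  by (simp_all add: scalar_def single_add single_diff single_uminus mult_single)

lemma scalar_0 [simp]: "scalar 0 = 0" and scalar_1 [simp]: "scalar 1 = 1"
  by (simp_all add: scalar_def)

lemma single_eq_scalar: "Poly_Mapping.single (Word u) a = scalar a * mon u"
  by (simp add: scalar_def mon_def mult_single zero_word_def plus_word_def)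

lemma free_alg_induct [case_names zero mon add]:
  assumes "P 0" and mon: "\<And>u a. letters u \<in> L \<Longrightarrow> P (scalar a * mon (letters u))"
    and add: "\<And>f g. \<lbrakk>P f; P g; letters ` Poly_Mapping.keys f \<subseteq> L; letters ` Poly_Mapping.keys g \<subseteq> L\<rbrakk> \<Longrightarrow> P (f + g)"
  shows "letters ` Poly_Mapping.keys f \<subseteq> L \<Longrightarrow> P f"
proof (induction f rule: update_induct)
  case (update f u a)
  have u: "Poly_Mapping.lookup f u = 0" using update.hyps by (simp add: in_keys_iff)
  have eq: "Poly_Mapping.update u a f = f + scalar a * mon (letters u)"
    using u by (intro poly_mapping_eqI)
      (auto simp: lookup_update lookup_add lookup_single simp flip: single_eq_scalar)
  have k: "letters u \<in> L" "letters ` Poly_Mapping.keys f \<subseteq> L"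
    using update.prems update.hyps by (auto simp: keys_update)
  have "letters ` Poly_Mapping.keys (scalar a * mon (letters u)) \<subseteq> L"
    using k by (simp flip: single_eq_scalar)
  then show ?case unfolding eq using k update.IH mon by (intro add) auto
qed (use assms in simp)

lemma scalar_commute: "f * scalar a = scalar a * f"
proof (induction f rule: free_alg_induct[where L = UNIV])
  case (mon u b)
  have "mon (letters u) * scalar a = scalar a * mon (letters u)"
    by (simp add: scalar_def mon_def mult_single)
  then have "scalar b * mon (letters u) * scalar a = scalar (b * a) * mon (letters u)"
    by (simp add: mult.assoc scalar_simps)
  also have "\<dots> = scalar a * (scalar b * mon (letters u))"
    by (simp add: scalar_simps mult.assoc mult.commute[of b a])
  finally show ?case .
qed (simp_all add: distrib_left distrib_right)

lemma scalar_left_commute: "f * (scalar a * g) = scalar a * (f * g)"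
  by (simp add: scalar_commute[of f] flip: mult.assoc)

text \<open>The extension of a function on words to a linear form on the free algebra.\<close>

definition lin :: "('s list \<Rightarrow> laurent) \<Rightarrow> 's free_alg \<Rightarrow> laurent" where
  "lin \<phi> f = (\<Sum>u\<in>Poly_Mapping.keys f. Poly_Mapping.lookup f u * \<phi> (letters u))"

lemma lin_superset:
  "finite B \<Longrightarrow> Poly_Mapping.keys f \<subseteq> B \<Longrightarrow> lin \<phi> f = (\<Sum>u\<in>B. Poly_Mapping.lookup f u * \<phi> (letters u))"
  unfolding lin_def by (rule sum.mono_neutral_left) (auto simp: in_keys_iff)

lemma lin_add: "lin \<phi> (f + g) = lin \<phi> f + lin \<phi> g"
proof -
  have "lin \<phi> h = (\<Sum>u\<in>Poly_Mapping.keys f \<union> Poly_Mapping.keys g. Poly_Mapping.lookup h u * \<phi> (letters u))"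
    if "h \<in> {f, g, f + g}" for h
    using that keys_add[of f g] by (intro lin_superset) auto
  then show ?thesis by (simp add: lookup_add algebra_simps sum.distrib)
qed

lemma lin_0 [simp]: "lin \<phi> 0 = 0"
  by (simp add: lin_def)

lemma lin_uminus: "lin \<phi> (- f) = - lin \<phi> f"
  using lin_add[of \<phi> f "- f"] by (simp add: eq_neg_iff_add_eq_0 add.commute)

lemma lin_diff: "lin \<phi> (f - g) = lin \<phi> f - lin \<phi> g"
  using lin_add[of \<phi> f "- g"] by (simp add: lin_uminus)

lemma lin_scalar_mon: "lin \<phi> (scalar a * mon u) = a * \<phi> u"
  unfolding single_eq_scalar[symmetric] by (cases "a = 0") (simp_all add: lin_def)

lemma lin_mon: "lin \<phi> (mon u) = \<phi> u"
  using lin_scalar_mon[of \<phi> 1 u] by simp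

lemma lin_scalar: "lin \<phi> (scalar a * f) = a * lin \<phi> f"
proof (induction f rule: free_alg_induct[where L = UNIV])
  case (mon u b)
  have "lin \<phi> (scalar (a * b) * mon (letters u)) = a * lin \<phi> (scalar b * mon (letters u))"
    unfolding lin_scalar_mon by simp
  then show ?case by (simp add: scalar_simps mult.assoc)
qed (simp_all add: lin_add algebra_simps)

abbreviation FA :: "'s set \<Rightarrow> 's free_alg set" where
  "FA S \<equiv> carrier (free_algebra S)"

lemma FA_iff: "f \<in> FA S \<longleftrightarrow> letters ` Poly_Mapping.keys f \<subseteq> lists S"
  unfolding free_algebra_def image_subset_iff by simp

lemma FA_add [simp]: "f \<in> FA S \<Longrightarrow> g \<in> FA S \<Longrightarrow> f + g \<in> FA S"
  using image_mono[OF keys_add[of f g], of letters] unfolding FA_iff image_Un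
  by (rule order_trans[OF _ Un_least])

lemma FA_uminus [simp]: "f \<in> FA S \<Longrightarrow> - f \<in> FA S"
  by (simp add: FA_iff)

lemma FA_diff [simp]: "f \<in> FA S \<Longrightarrow> g \<in> FA S \<Longrightarrow> f - g \<in> FA S"
  using FA_add[of f S "- g"] by simp

lemma FA_mult [simp]: "f \<in> FA S \<Longrightarrow> g \<in> FA S \<Longrightarrow> f * g \<in> FA S"
proof (unfold FA_iff image_subset_iff, intro ballI)
  fix u assume *: "\<forall>u\<in>Poly_Mapping.keys f. letters u \<in> lists S" "\<forall>u\<in>Poly_Mapping.keys g. letters u \<in> lists S"
    "u \<in> Poly_Mapping.keys (f * g)"
  then obtain v w where "u = v + w" "v \<in> Poly_Mapping.keys f" "w \<in> Poly_Mapping.keys g"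
    using keys_mult[of f g] by blast
  then show "letters u \<in> lists S" using * by (simp add: plus_word_def)
qed

lemma FA_0 [simp]: "0 \<in> FA S"
  by (simp add: FA_iff)

lemma FA_scalar [simp]: "scalar a \<in> FA S"
  by (simp add: FA_iff scalar_def zero_word_def)

lemma FA_1 [simp]: "1 \<in> FA S"
  using FA_scalar[of 1] by simp

lemma FA_mon [simp]: "u \<in> lists S \<Longrightarrow> mon u \<in> FA S"
  by (simp add: FA_iff mon_def)

lemma FA_gen [simp]: "s \<in> S \<Longrightarrow> gen s \<in> FA S"
  by (simp add: FA_iff gen_def)

lemma FA_sum: "(\<And>i. i \<in> B \<Longrightarrow> f i \<in> FA S) \<Longrightarrow> sum f B \<in> FA S"
  by (induction B rule: infinite_finite_induct) auto

lemma FA_induct [consumes 1, case_names zero mon add]: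
  assumes "f \<in> FA S" "P 0" and "\<And>u a. u \<in> lists S \<Longrightarrow> P (scalar a * mon u)"
    and "\<And>f g. \<lbrakk>f \<in> FA S; g \<in> FA S; P f; P g\<rbrakk> \<Longrightarrow> P (f + g)"
  shows "P f"
proof (rule free_alg_induct[where L = "lists S"])
  show "P (f + g)" if "P f" "P g" "letters ` Poly_Mapping.keys f \<subseteq> lists S"
    "letters ` Poly_Mapping.keys g \<subseteq> lists S" for f g
    using that assms(4)[of f g] unfolding FA_iff by simp
  show "letters ` Poly_Mapping.keys f \<subseteq> lists S" using assms(1) unfolding FA_iff .
qed (use assms(2,3) in simp_all)

lemma free_algebra_simps:
  "x \<oplus>\<^bsub>free_algebra S\<^esub> y = x + y" "x \<otimes>\<^bsub>free_algebra S\<^esub> y = x * y" "a \<odot>\<^bsub>free_algebra S\<^esub> y = scalar a * y"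
  "\<zero>\<^bsub>free_algebra S\<^esub> = 0" "\<one>\<^bsub>free_algebra S\<^esub> = 1"
  by (simp_all add: free_algebra_def)

lemma free_algebra_ring: "ring (free_algebra S)"
proof (rule ringI)
  show "abelian_group (free_algebra S)"
  proof (rule abelian_groupI)
    fix x assume x: "x \<in> FA S"
    show "\<exists>y\<in>FA S. y \<oplus>\<^bsub>free_algebra S\<^esub> x = \<zero>\<^bsub>free_algebra S\<^esub>"
      by (rule bexI[of _ "- x"]) (use x in \<open>simp_all add: free_algebra_simps\<close>)
  qed (simp_all add: free_algebra_simps add.assoc add.commute)
  show "Group.monoid (free_algebra S)"
    by (rule monoidI) (simp_all add: free_algebra_simps mult.assoc)
qed (simp_all add: free_algebra_simps distrib_left distrib_right)

lemma free_algebra_uminus: "x \<in> FA S \<Longrightarrow> \<ominus>\<^bsub>free_algebra S\<^esub> x = - x"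
proof -
  assume x: "x \<in> FA S"
  interpret ring "free_algebra S" by (rule free_algebra_ring)
  show ?thesis by (rule minus_equality[of "- x"]) (use x in \<open>auto simp: free_algebra_simps\<close>)
qed

lemma free_algebra_module: "Module.module laurent_ring (free_algebra S)"
proof (rule moduleI)
  show "cring laurent_ring" by (rule cring_from_type_algebra)
  show "abelian_group (free_algebra S)" using free_algebra_ring ring_def by blast
qed (auto simp: free_algebra_simps ring_of_type_algebra_def scalar_simps algebra_simps)

subsection \<open>The regular representation\<close>

abbreviation q :: laurent where "q \<equiv> q_var"

context km_weyl
begin

text \<open>Outside the carrier the value is chosen so that the quadratic relation holds everywhere.\<close>

definition lop :: "'a \<Rightarrow> ('a \<Rightarrow> laurent) \<Rightarrow> 'a \<Rightarrow> laurent" where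
  "lop s \<phi> x = (if x \<in> carrier W then if len (s \<otimes> x) < len x then \<phi> (s \<otimes> x) + (q - 1) * \<phi> x 
    else q * \<phi> (s \<otimes> x) else q * \<phi> x)"

definition rop :: "'a \<Rightarrow> ('a \<Rightarrow> laurent) \<Rightarrow> 'a \<Rightarrow> laurent" where
  "rop s \<phi> x = (if x \<in> carrier W then if len (x \<otimes> s) < len x then \<phi> (x \<otimes> s) + (q - 1) * \<phi> x 
    else q * \<phi> (x \<otimes> s) else q * \<phi> x)"

definition delta :: "'a \<Rightarrow> 'a \<Rightarrow> laurent" where
  "delta w x = (if x = w then 1 else 0)"

lemma lop_quadratic: 
  assumes s: "s \<in> S"
  shows "lop s (lop s \<phi>) x = (q - 1) * lop s \<phi> x + q * \<phi> x"
  using s len_gen_mult_cases[of x s] by (auto simp: lop_def algebra_simps)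

text \<open>Whether s lengthens x from the left is the sign of the root x^-1(s). Multiplying by t
  from the right reflects this root in t, which changes the sign only of t's own root and its
  negative; these two cases mean s x = x t.\<close>

lemma ups_and_downs_commute:
  assumes x: "x \<in> carrier W" and s: "s \<in> S" and t: "t \<in> S" and ne: "s \<otimes> x \<noteq> x \<otimes> t"
  shows "len (s \<otimes> (x \<otimes> t)) < len (x \<otimes> t) \<longleftrightarrow> len (s \<otimes> x) < len x"
    and "len (s \<otimes> (x \<otimes> t)) < len (s \<otimes> x) \<longleftrightarrow> len (x \<otimes> t) < len x"
proof -
  define \<beta> where "\<beta> = act (inv x) (sroot s)"
  have root: "\<beta> \<in> roots" using x s by (simp add: \<beta>_def rootsI)
  have ax: "act x \<beta> = sroot s" using x act_inv by (simp add: \<beta>_def)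
  have n1: "\<beta> \<noteq> sroot t"
    using simple_conjugate[OF x s t] ax ne by auto
  have n2: "(\<lambda>r. - \<beta> r) \<noteq> sroot t"
  proof
    assume "(\<lambda>r. - \<beta> r) = sroot t"
    then have "act x (sroot t) = (\<lambda>r. - sroot s r)" using ax x act_uminus[of x \<beta>] by simp
    then have "act (s \<otimes> x) (sroot t) = sroot s"
      using x s act_uminus[of s "sroot s"] by (simp add: act_mult act_gen refl_sroot)
    then have "s \<otimes> x \<otimes> t = x" using simple_conjugate[of "s \<otimes> x" s t] x s t by simp
    then have "s \<otimes> x = x \<otimes> t" using x s t by (metis gen_cancel(2) S_closed m_closed)
    then show False using ne by simp
  qed
  have "refl t \<beta> \<in> proots \<longleftrightarrow> \<beta> \<in> proots"
  proof (cases "\<beta> \<in> proots")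
    case True
    then show ?thesis using refl_proots[OF _ t n1] by simp
  next
    case False
    then have "(\<lambda>r. - \<beta> r) \<in> proots" using root proots_uminus by simp
    then have "refl t (\<lambda>r. - \<beta> r) \<in> proots" using refl_proots[OF _ t n2] by simp
    then have "(\<lambda>r. - refl t \<beta> r) \<in> proots" using act_uminus[of t \<beta>] t by (simp add: act_gen)
    moreover have "refl t \<beta> \<in> roots" using roots_act[of t \<beta>] t root by (simp add: act_gen)
    ultimately show ?thesis using proots_uminus[of "refl t \<beta>"] False by simp
  qed
  moreover have "act (inv (x \<otimes> t)) (sroot s) = refl t \<beta>"
    using x t by (simp add: inv_mult_group act_mult act_gen \<beta>_def)
  ultimately have *: "len (s \<otimes> (x \<otimes> t)) = len (x \<otimes> t) + 1 \<longleftrightarrow> len (s \<otimes> x) = len x + 1"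
    using act_sroot_proots_iff'[of "x \<otimes> t" s] act_sroot_proots_iff'[of x s] x s t by (simp add: \<beta>_def)
  have sx: "s \<otimes> x \<in> carrier W" and xt: "x \<otimes> t \<in> carrier W" using x s t by auto
  note c = len_gen_mult_cases[OF xt s] len_gen_mult_cases[OF x s] len_mult_gen_cases[OF x t]
  show 1: "len (s \<otimes> (x \<otimes> t)) < len (x \<otimes> t) \<longleftrightarrow> len (s \<otimes> x) < len x" using * c by linarith
  show "len (s \<otimes> (x \<otimes> t)) < len (s \<otimes> x) \<longleftrightarrow> len (x \<otimes> t) < len x" using * c by linarith
qed

text \<open>If s x and x t differ, the length changes on the two sides are independent. If they
  coincide, both composites involve only the values at x and s x, with the same
  coefficients.\<close>

lemma lop_rop_commute:
  assumes s: "s \<in> S" and t: "t \<in> S"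
  shows "lop s (rop t \<phi>) = rop t (lop s \<phi>)"
proof
  fix x
  show "lop s (rop t \<phi>) x = rop t (lop s \<phi>) x"
  proof (cases "x \<in> carrier W")
    case x: True
    have assoc: "s \<otimes> x \<otimes> t = s \<otimes> (x \<otimes> t)" using x s t by (simp add: m_assoc)
    show ?thesis
    proof (cases "s \<otimes> x = x \<otimes> t")
      case True
      have 1: "s \<otimes> (x \<otimes> t) = x" using True x s by (metis gen_cancel(1))
      have 2: "x \<otimes> t \<otimes> t = x" using x t by simp
      show ?thesis using len_mult_gen_cases[OF x t] x s t True 1 2
        by (auto simp: lop_def rop_def algebra_simps)
    next
      case False
      then show ?thesis using ups_and_downs_commute[OF x s t False] x s t assoc
        by (simp add: lop_def rop_def algebra_simps)
    qed
  qed (simp add: lop_def rop_def)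
qed

lemma lop_lin: "lop s (\<lambda>x. a * \<phi> x + b * \<psi> x) = (\<lambda>x. a * lop s \<phi> x + b * lop s \<psi> x)"
  by (auto simp: lop_def algebra_simps fun_eq_iff)

definition reg :: "'a list \<Rightarrow> 'a \<Rightarrow> laurent" where
  "reg u = foldr lop u (delta \<one>)"

lemma reg_Cons [simp]: "reg (s # u) = lop s (reg u)"
  by (simp add: reg_def)

lemma foldr_lop_rop: 
  "u \<in> lists S \<Longrightarrow> v \<in> lists S \<Longrightarrow> foldr lop u (foldr rop v \<phi>) = foldr rop v (foldr lop u \<phi>)"
proof (induction u)
  case (Cons s u)
  have "lop s (foldr rop v \<psi>) = foldr rop v (lop s \<psi>)" for \<psi>
    using \<open>v \<in> lists S\<close> by (induction v) (use Cons.prems in \<open>simp_all add: lop_rop_commute\<close>)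
  then show ?case using Cons by simp
qed simp

lemma lop_delta:
  assumes "s \<in> S" "w \<in> carrier W" "len (s \<otimes> w) = len w + 1"
  shows "lop s (delta w) = delta (s \<otimes> w)"
proof
  fix x
  have "x \<in> carrier W \<Longrightarrow> s \<otimes> x = w \<longleftrightarrow> x = s \<otimes> w" using assms by auto
  then show "lop s (delta w) x = delta (s \<otimes> w) x" using assms by (auto simp: lop_def delta_def)
qed

lemma reg_reduced: "u \<in> lists S \<Longrightarrow> len (wv u) = length u \<Longrightarrow> reg u = delta (wv u)"
proof (induction u)
  case (Cons s u)
  have u: "s \<in> S" "u \<in> lists S" using Cons.prems by auto
  have "len (wv u) = length u" 
    using Cons.prems len_le[OF u(2) HOL.refl] len_gen_mult_cases[of "wv u" s] u by auto
  then show ?case using Cons u by (simp add: lop_delta)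
qed (simp add: reg_def)

text \<open>On the cyclic vector, left multiplication by a word is right multiplication by its reverse,
  so operators from the left that agree on \<open>delta \<one>\<close> agree on the whole cyclic module.\<close>

lemma reg_eq_rop: "u \<in> lists S \<Longrightarrow> reg u = foldr rop (rev u) (delta \<one>)"
proof (induction u)
  case (Cons s u)
  have s: "s \<in> S" and u: "rev u \<in> lists S" using Cons.prems by auto
  have "rop s (delta \<one>) = delta s"
  proof
    fix x
    have "x \<in> carrier W \<Longrightarrow> x \<otimes> s = \<one> \<longleftrightarrow> x = s" using s gens_involution by (metis gen_cancel(2) S_closed l_one)
    then show "rop s (delta \<one>) x = delta s x" using s gens_nontrivial by (auto simp: rop_def delta_def)
  qed
  then have "lop s (delta \<one>) = rop s (delta \<one>)" using lop_delta[of s \<one>] s by simp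
  then show ?case using Cons foldr_lop_rop[of "[s]" "rev u" "delta \<one>"] s u by simp
qed (simp add: reg_def)

lemma reg_append_cong:
  assumes "u \<in> lists S" "u' \<in> lists S" "v \<in> lists S" "x \<in> lists S" "reg u = reg u'"
  shows "reg (x @ u @ v) = reg (x @ u' @ v)"
proof -
  have "reg (y @ v) = foldr rop (rev v) (reg y)" if "y \<in> lists S" for y
  proof -
    have "reg (y @ v) = foldr lop y (reg v)" by (simp add: reg_def)
    also have "\<dots> = foldr rop (rev v) (reg y)" unfolding reg_eq_rop[OF assms(3)]
      using foldr_lop_rop[of y "rev v"] that assms by (simp add: reg_def)
    finally show ?thesis .
  qed
  then have "reg (u @ v) = reg (u' @ v)" using assms by simp
  moreover have "reg (x @ y) = foldr lop x (reg y)" for y by (simp add: reg_def)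
  ultimately show ?thesis by simp
qed

lemma reg_quadratic:
  assumes "s \<in> S"
  shows "reg (x @ s # s # v) w = (q - 1) * reg (x @ s # v) w + q * reg (x @ v) w"
proof -
  have "reg (s # s # v) = (\<lambda>w. (q - 1) * reg (s # v) w + q * reg v w)"
    using lop_quadratic[OF assms] by (simp add: fun_eq_iff)
  moreover have "foldr lop x (\<lambda>w. a * \<phi> w + b * \<psi> w) = (\<lambda>w. a * foldr lop x \<phi> w + b * foldr lop x \<psi> w)" 
    for a b \<phi> \<psi> by (induction x) (simp_all add: lop_lin)
  moreover have "reg (x @ y) = foldr lop x (reg y)" for y by (simp add: reg_def)
  ultimately show ?thesis by simp
qed

text \<open>The coefficient of f at T_w: the free algebra acts by the left operators, and f is
  applied to the unit vector at the identity.\<close>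

definition ev :: "'a free_alg \<Rightarrow> 'a \<Rightarrow> laurent" where
  "ev f w = lin (\<lambda>u. reg u w) f"

lemma ev_simps [simp]:
  "ev 0 w = 0" "ev (f + g) w = ev f w + ev g w" "ev (f - g) w = ev f w - ev g w"
  "ev (- f) w = - ev f w" "ev (scalar a * f) w = a * ev f w"
  by (simp_all add: ev_def lin_add lin_diff lin_uminus lin_scalar)

lemma ev_mon: "ev (mon u) w = reg u w"
  by (simp add: ev_def lin_mon)

end

subsection \<open>The standard basis of the Hecke algebra\<close>

definition add_closed :: "'b::ab_group_add set \<Rightarrow> bool" where
  "add_closed N \<longleftrightarrow> 0 \<in> N \<and> (\<forall>x\<in>N. \<forall>y\<in>N. x - y \<in> N)"

lemma add_closedD:
  assumes "add_closed N"
  shows "0 \<in> N" "x \<in> N \<Longrightarrow> y \<in> N \<Longrightarrow> x - y \<in> N" "x \<in> N \<Longrightarrow> - x \<in> N" "x \<in> N \<Longrightarrow> y \<in> N \<Longrightarrow> x + y \<in> N"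
proof -
  show 1: "0 \<in> N" using assms by (simp add: add_closed_def)
  have 2: "x - y \<in> N" if "x \<in> N" "y \<in> N" for x y using assms that by (simp add: add_closed_def)
  have 3: "- x \<in> N" if "x \<in> N" for x using 2[OF 1 that] by simp
  show "x \<in> N \<Longrightarrow> y \<in> N \<Longrightarrow> x - y \<in> N" "x \<in> N \<Longrightarrow> - x \<in> N" using 2 3 by simp_all
  show "x + y \<in> N" if "x \<in> N" "y \<in> N" using 2[OF that(1) 3[OF that(2)]] by simp
qed

text \<open>Congruence of \<open>x\<close> and \<open>y\<close> modulo \<open>N\<close> is written \<open>x - y \<in> N\<close> throughout.\<close>

lemma cong_trans: "add_closed N \<Longrightarrow> x - y \<in> N \<Longrightarrow> y - z \<in> N \<Longrightarrow> x - z \<in> N"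
  using add_closedD(4)[of N "x - y" "y - z"] by simp

lemma cong_sym: "add_closed N \<Longrightarrow> x - y \<in> N \<Longrightarrow> y - x \<in> N"
  using add_closedD(3)[of N "x - y"] by simp

lemma cong_add: "add_closed N \<Longrightarrow> x - y \<in> N \<Longrightarrow> x' - y' \<in> N \<Longrightarrow> (x + x') - (y + y') \<in> N"
  using add_closedD(4)[of N "x - y" "x' - y'"] by (simp add: algebra_simps)

lemma add_closed_sum: "add_closed N \<Longrightarrow> (\<And>i. i \<in> B \<Longrightarrow> f i \<in> N) \<Longrightarrow> sum f B \<in> N"
  by (induction B rule: infinite_finite_induct) (auto simp: add_closedD)

definition two_sided :: "'s set \<Rightarrow> 's free_alg set \<Rightarrow> bool" where
  "two_sided S N \<longleftrightarrow> add_closed N \<and> N \<subseteq> FA S \<and> (\<forall>f\<in>FA S. \<forall>x\<in>N. f * x \<in> N \<and> x * f \<in> N)"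

context km_weyl
begin

abbreviation F where "F \<equiv> FA S"
abbreviation HI where "HI \<equiv> hecke_ideal W S"

lemma relators_closed: "hecke_relators W S \<subseteq> F"
  by (auto simp: hecke_relators_def prod_list_gen alternating_in_lists)

lemma HI_ideal: "ideal HI (free_algebra S)"
  unfolding hecke_ideal_def by (rule ring.genideal_ideal[OF free_algebra_ring relators_closed])

lemma HI_two_sided: "two_sided S HI"
proof -
  interpret H: ideal HI "free_algebra S" by (rule HI_ideal)
  have sub: "HI \<subseteq> F" using H.a_subset by simp
  have "x - y \<in> HI" if "x \<in> HI" "y \<in> HI" for x y
  proof -
    have "x \<oplus>\<^bsub>free_algebra S\<^esub> (- 1) \<otimes>\<^bsub>free_algebra S\<^esub> y \<in> HI" 
      using that by (intro additive_subgroup.a_closed[OF H.is_additive_subgroup] H.I_l_closed) simp_all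
    then show ?thesis by (simp add: free_algebra_simps)
  qed
  moreover have "0 \<in> HI" 
    using additive_subgroup.zero_closed[OF H.is_additive_subgroup] by (simp add: free_algebra_simps)
  moreover have "f * x \<in> HI \<and> x * f \<in> HI" if "f \<in> F" "x \<in> HI" for f x
    using that H.I_l_closed[of x f] H.I_r_closed[of x f] by (simp add: free_algebra_simps)
  ultimately show ?thesis using sub by (simp add: two_sided_def add_closed_def)
qed

lemma HI_F: "f \<in> HI \<Longrightarrow> f \<in> F"
  and HI_add_closed: "add_closed HI"
  and HI_left: "f \<in> F \<Longrightarrow> g \<in> HI \<Longrightarrow> f * g \<in> HI"
  and HI_right: "f \<in> F \<Longrightarrow> g \<in> HI \<Longrightarrow> g * f \<in> HI"
  using HI_two_sided by (auto simp: two_sided_def)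

lemma relators_HI: "hecke_relators W S \<subseteq> HI"
  unfolding hecke_ideal_def by (rule ring.genideal_self[OF free_algebra_ring relators_closed])

lemma relator_quadratic_eq:
  "(gen s + 1) * (gen s - scalar q) = gen s * gen s - (scalar (q - 1) * gen s + scalar q)"
  by (simp add: scalar_simps algebra_simps scalar_commute[of "gen s"])

lemma HI_quadratic: "s \<in> S \<Longrightarrow> gen s * gen s - (scalar (q - 1) * gen s + scalar q) \<in> HI"
  using relators_HI relator_quadratic_eq[of s] by (auto simp: hecke_relators_def)

lemma HI_braid:
  "\<lbrakk>s \<in> S; t \<in> S; s \<noteq> t; ord (s \<otimes> t) \<noteq> 0\<rbrakk> \<Longrightarrow>
    mon (alternating s t (ord (s \<otimes> t))) - mon (alternating t s (ord (s \<otimes> t))) \<in> HI"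
  using relators_HI unfolding hecke_relators_def prod_list_gen by fast

text \<open>Vanishing of \<open>ev\<close> is not two-sided by its form. The set \<open>J\<close> of
  elements all of whose two-sided word multiples are killed is an ideal, and commuting right
  operators show that it contains the relators.\<close>

lemma ev_HI:
  assumes "f \<in> HI"
  shows "ev f w = 0"
proof -
  define J where "J = {f \<in> F. \<forall>u\<in>lists S. \<forall>v\<in>lists S. \<forall>w. ev (mon u * f * mon v) w = 0}"
  have J: "f \<in> J \<longleftrightarrow> f \<in> F \<and> (\<forall>u\<in>lists S. \<forall>v\<in>lists S. \<forall>w. ev (mon u * f * mon v) w = 0)" for f
    by (simp add: J_def)
  have "ideal J (free_algebra S)"
  proof (rule idealI[OF free_algebra_ring])
    show "subgroup J (add_monoid (free_algebra S))"
    proof (rule group.subgroupI)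
      show "Group.group (add_monoid (free_algebra S))"
        using free_algebra_ring abelian_group.a_group ring.is_abelian_group by blast
      have "0 \<in> J" by (simp add: J)
      then show "J \<noteq> {}" by blast
      fix a assume a: "a \<in> J"
      then have "inv\<^bsub>add_monoid (free_algebra S)\<^esub> a = - a" 
        using free_algebra_uminus[of a S] by (simp add: a_inv_def J)
      then show "inv\<^bsub>add_monoid (free_algebra S)\<^esub> a \<in> J" using a by (simp add: J)
      fix b assume b: "b \<in> J"
      show "a \<otimes>\<^bsub>add_monoid (free_algebra S)\<^esub> b \<in> J" using a b
        by (simp add: J free_algebra_simps distrib_left distrib_right)
    qed (auto simp: J)
    fix a x assume a: "a \<in> J" and x: "x \<in> F"
    have aF: "a \<in> F" using a by (simp add: J)
    have "ev (mon u * (x * a) * mon v) w = 0" if u: "u \<in> lists S" and v: "v \<in> lists S" for u v w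
      using x
    proof (induction x rule: FA_induct)
      case (mon y b)
      have "mon u * (scalar b * mon y * a) * mon v = scalar b * (mon (u @ y) * a * mon v)"
        by (simp add: mon_append mult.assoc scalar_left_commute)
      then show ?case using a u v mon by (simp add: J)
    qed (simp_all add: distrib_left distrib_right)
    then show "x \<otimes>\<^bsub>free_algebra S\<^esub> a \<in> J" using x aF by (simp add: J free_algebra_simps)
    have "ev (mon u * (a * x) * mon v) w = 0" if u: "u \<in> lists S" and v: "v \<in> lists S" for u v w
      using x
    proof (induction x rule: FA_induct)
      case (mon y b)
      have "mon u * (a * (scalar b * mon y)) * mon v = scalar b * (mon u * a * mon (y @ v))"
        by (simp add: mon_append mult.assoc scalar_left_commute)
      then show ?case using a u v mon by (simp add: J)
    qed (simp_all add: distrib_left distrib_right)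
    then show "a \<otimes>\<^bsub>free_algebra S\<^esub> x \<in> J" using x aF by (simp add: J free_algebra_simps)
  qed
  moreover have "r \<in> J" if r: "r \<in> hecke_relators W S" for r
  proof -
    consider s where "s \<in> S" "r = (gen s + 1) * (gen s - scalar q)" |
      s t where "s \<in> S" "t \<in> S" "s \<noteq> t" "ord (s \<otimes> t) \<noteq> 0"
        "r = mon (alternating s t (ord (s \<otimes> t))) - mon (alternating t s (ord (s \<otimes> t)))"
      using r unfolding hecke_relators_def prod_list_gen by blast
    then show ?thesis
    proof cases
      case 1
      have "ev (mon u * r * mon v) w = 0" for u v w
      proof -
        have "mon u * r * mon v = mon (u @ s # s # v) - (scalar (q - 1) * mon (u @ s # v) + scalar q * mon (u @ v))"
          unfolding 1(2) relator_quadratic_eq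
          by (simp add: mon_append mon_Cons mult.assoc scalar_left_commute scalar_commute[of "mon u"] algebra_simps)
        then show ?thesis using reg_quadratic[OF 1(1)] by (simp add: ev_mon)
      qed
      then show ?thesis using 1 by (simp add: J)
    next
      case 2
      let ?a = "alternating s t (ord (s \<otimes> t))" and ?b = "alternating t s (ord (s \<otimes> t))"
      have l: "?a \<in> lists S" "?b \<in> lists S" using 2 by (simp_all add: alternating_in_lists)
      have "len (wv ?a) = length ?a" using len_alternating[of s t] 2 by simp
      then have "reg ?a = reg ?b"
        using reg_reduced[OF l(1)] reg_reduced[OF l(2)] braid[of s t] 2 by simp
      then have "ev (mon u * r * mon v) w = 0" if "u \<in> lists S" "v \<in> lists S" for u v w
      proof -
        have "mon u * r * mon v = mon (u @ ?a @ v) - mon (u @ ?b @ v)"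
          unfolding 2(5) by (simp add: mon_append algebra_simps)
        then show ?thesis 
          using reg_append_cong[OF l that(2,1) \<open>reg ?a = reg ?b\<close>] by (simp add: ev_mon)
      qed
      then show ?thesis using 2 l by (simp add: J)
    qed
  qed
  ultimately have "HI \<subseteq> J" unfolding hecke_ideal_def
    by (intro ring.genideal_minimal[OF free_algebra_ring]) auto
  then have "f \<in> J" using assms by auto
  then have "ev (mon [] * f * mon []) w = 0" unfolding J by blast
  then show ?thesis by simp
qed

text \<open>A lift of T_w to the free algebra. By Matsumoto's theorem the chosen reduced word does
  not matter modulo \<open>HI\<close>.\<close>

definition Tm :: "'a \<Rightarrow> 'a free_alg" where
  "Tm w = mon (SOME u. u \<in> reduced_words W S w)"

lemma some_reduced: "w \<in> carrier W \<Longrightarrow> (SOME u. u \<in> reduced_words W S w) \<in> reduced_words W S w"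
  by (rule someI_ex) (auto simp: reduced_words_def elim!: ex_reduced)

lemma Tm_F [simp]: "w \<in> carrier W \<Longrightarrow> Tm w \<in> F"
  unfolding Tm_def using some_reduced[of w] by (intro FA_mon) (simp add: reduced_words_def)

lemma mon_cong_reduced:
  assumes "w \<in> carrier W" "u \<in> reduced_words W S w" "v \<in> reduced_words W S w"
  shows "mon u - mon v \<in> HI"
proof (rule matsumoto[where rel = "\<lambda>u v. mon u - mon v \<in> HI", OF _ _ _ _ assms])
  show "mon u - mon u \<in> HI" if "u \<in> lists S" for u :: "'a list" using add_closedD(1)[OF HI_add_closed] by simp
  show "mon u - mon x \<in> HI" if "mon u - mon v \<in> HI" "mon v - mon x \<in> HI" for u v x :: "'a list"
    by (rule cong_trans[OF HI_add_closed that])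
  show "mon (s # u) - mon (s # v) \<in> HI" if "s \<in> S" "mon u - mon v \<in> HI" for s :: 'a and u v
    using HI_left[OF FA_gen[OF that(1)] that(2)] by (simp add: mon_Cons algebra_simps)
  show "mon (alternating s t (ord (s \<otimes> t)) @ r) - mon (alternating t s (ord (s \<otimes> t)) @ r) \<in> HI"
    if "s \<in> S" "t \<in> S" "s \<noteq> t" "ord (s \<otimes> t) \<noteq> 0" "r \<in> lists S" for s t r
    using HI_right[OF FA_mon[OF that(5)] HI_braid[OF that(1-4)]] by (simp add: mon_append algebra_simps)
qed

lemma mon_cong_Tm: "w \<in> carrier W \<Longrightarrow> u \<in> reduced_words W S w \<Longrightarrow> mon u - Tm w \<in> HI"
  unfolding Tm_def by (rule mon_cong_reduced) (auto intro: some_reduced)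

lemma Tm_one [simp]: "Tm \<one> = 1"
  using some_reduced[of \<one>] by (simp add: Tm_def reduced_words_def)

lemma Tm_gen [simp]: "s \<in> S \<Longrightarrow> Tm s = gen s"
proof -
  assume s: "s \<in> S"
  define u where "u = (SOME u. u \<in> reduced_words W S s)"
  have u: "u \<in> lists S" "wv u = s" "length u = 1" 
    using some_reduced[of s] s by (simp_all add: u_def reduced_words_def)
  then obtain t where "u = [t]" by (auto simp: length_Suc_conv)
  then have "u = [s]" using u by auto
  then show ?thesis by (simp add: Tm_def u_def mon_Cons)
qed

lemma Tm_mult:
  assumes x: "x \<in> carrier W" and y: "y \<in> carrier W" and l: "len (x \<otimes> y) = len x + len y"
  shows "Tm x * Tm y - Tm (x \<otimes> y) \<in> HI"
proof -
  have "(SOME u. u \<in> reduced_words W S x) @ (SOME u. u \<in> reduced_words W S y) \<in> reduced_words W S (x \<otimes> y)"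
    using some_reduced[OF x] some_reduced[OF y] l by (simp add: reduced_words_def wv_append)
  from mon_cong_Tm[OF _ this] show ?thesis using x y by (simp add: mon_append Tm_def)
qed

lemma gen_Tm_up:
  assumes "s \<in> S" "w \<in> carrier W" "len (s \<otimes> w) = len w + 1"
  shows "gen s * Tm w - Tm (s \<otimes> w) \<in> HI"
  using Tm_mult[of s w] assms by simp

lemma gen_Tm_down:
  assumes s: "s \<in> S" and w: "w \<in> carrier W" and l: "len w = len (s \<otimes> w) + 1"
  shows "gen s * Tm w - (scalar (q - 1) * Tm w + scalar q * Tm (s \<otimes> w)) \<in> HI"
proof -
  let ?v = "s \<otimes> w"
  note N = HI_add_closed
  have v: "?v \<in> carrier W" "s \<otimes> ?v = w" using s w by auto
  have 1: "gen s * Tm ?v - Tm w \<in> HI" using gen_Tm_up[of s ?v] s v l by simp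
  have "gen s * Tm w - gen s * (gen s * Tm ?v) \<in> HI"
    using cong_sym[OF N HI_left[OF FA_gen[OF s] 1, unfolded right_diff_distrib]] by simp
  moreover have "gen s * (gen s * Tm ?v) - (scalar (q - 1) * gen s + scalar q) * Tm ?v \<in> HI"
    using HI_right[OF Tm_F[OF v(1)] HI_quadratic[OF s]] by (simp add: left_diff_distrib mult.assoc)
  moreover have "(scalar (q - 1) * gen s + scalar q) * Tm ?v - (scalar (q - 1) * Tm w + scalar q * Tm ?v) \<in> HI"
    using HI_left[OF FA_scalar 1, of "q - 1"] by (simp add: algebra_simps)
  ultimately show ?thesis using cong_trans[OF N] by blast
qed

lemma ev_Tm: "w \<in> carrier W \<Longrightarrow> ev (Tm w) = delta w"
  unfolding Tm_def using some_reduced[of w] reg_reduced[of "SOME u. u \<in> reduced_words W S w"]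
  by (auto simp: fun_eq_iff ev_mon reduced_words_def)

lemma reg_support: 
  "u \<in> lists S \<Longrightarrow> finite {w. reg u w \<noteq> 0} \<and> {w. reg u w \<noteq> 0} \<subseteq> carrier W"
proof (induction u)
  case Nil
  have "{w. reg [] w \<noteq> 0} = {\<one>}" by (auto simp: reg_def delta_def)
  then show ?case by simp
next
  case (Cons s u)
  let ?B = "{w. reg u w \<noteq> 0}"
  have s: "s \<in> S" and u: "finite ?B" "?B \<subseteq> carrier W" using Cons by auto
  have "{w. reg (s # u) w \<noteq> 0} \<subseteq> ?B \<union> (\<otimes>) s ` ?B"
  proof
    fix w assume w: "w \<in> {w. reg (s # u) w \<noteq> 0}"
    have "w \<in> carrier W" using w u by (auto simp: lop_def split: if_splits)
    then have "w \<in> ?B \<or> s \<otimes> w \<in> ?B" using w by (auto simp: lop_def split: if_splits)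
    moreover have "w = s \<otimes> (s \<otimes> w)" using s \<open>w \<in> carrier W\<close> by simp
    ultimately show "w \<in> ?B \<union> (\<otimes>) s ` ?B" by blast
  qed
  moreover have "?B \<union> (\<otimes>) s ` ?B \<subseteq> carrier W" using s u by auto
  moreover have "finite (?B \<union> (\<otimes>) s ` ?B)" using u by simp
  ultimately show ?case by (meson finite_subset subset_trans)
qed

lemma ev_support:
  assumes "f \<in> F"
  shows "finite {w. ev f w \<noteq> 0}" "{w. ev f w \<noteq> 0} \<subseteq> carrier W"
proof -
  have "finite {w. ev f w \<noteq> 0} \<and> {w. ev f w \<noteq> 0} \<subseteq> carrier W"
    using assms
  proof (induction f rule: FA_induct)
    case (mon u a)
    have "{w. ev (scalar a * mon u) w \<noteq> 0} \<subseteq> {w. reg u w \<noteq> 0}" by (auto simp: ev_mon)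
    then show ?case using reg_support[OF mon] by (meson finite_subset subset_trans)
  next
    case (add f g)
    have "{w. ev (f + g) w \<noteq> 0} \<subseteq> {w. ev f w \<noteq> 0} \<union> {w. ev g w \<noteq> 0}" by auto
    moreover have "finite ({w. ev f w \<noteq> 0} \<union> {w. ev g w \<noteq> 0})" using add by simp
    moreover have "{w. ev f w \<noteq> 0} \<union> {w. ev g w \<noteq> 0} \<subseteq> carrier W" using add by simp
    ultimately show ?case by (meson finite_subset subset_trans)
  qed simp
  then show "finite {w. ev f w \<noteq> 0}" "{w. ev f w \<noteq> 0} \<subseteq> carrier W" by simp_all
qed

text \<open>The linear map on H with T_w sent to g w, evaluated at the class of f.\<close>

definition tlin :: "('a \<Rightarrow> 'a free_alg) \<Rightarrow> 'a free_alg \<Rightarrow> 'a free_alg" where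
  "tlin g f = (\<Sum>w | ev f w \<noteq> 0. scalar (ev f w) * g w)"

lemma tlin_superset: "finite B \<Longrightarrow> {w. ev f w \<noteq> 0} \<subseteq> B \<Longrightarrow> tlin g f = (\<Sum>w\<in>B. scalar (ev f w) * g w)"
  unfolding tlin_def by (rule sum.mono_neutral_left) auto

lemma tlin_add:
  assumes "f \<in> F" "f' \<in> F"
  shows "tlin g (f + f') = tlin g f + tlin g f'"
proof -
  let ?B = "{w. ev f w \<noteq> 0} \<union> {w. ev f' w \<noteq> 0}"
  have B: "finite ?B" using assms ev_support by simp
  have "tlin g h = (\<Sum>w\<in>?B. scalar (ev h w) * g w)" if "h \<in> {f, f', f + f'}" for h
    by (rule tlin_superset[OF B]) (use that in auto)
  then show ?thesis by (simp add: scalar_simps algebra_simps sum.distrib)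
qed

lemma tlin_scalar:
  assumes "f \<in> F"
  shows "tlin g (scalar a * f) = scalar a * tlin g f"
proof -
  have "tlin g (scalar a * f) = (\<Sum>w | ev f w \<noteq> 0. scalar (ev (scalar a * f) w) * g w)"
    by (rule tlin_superset) (use assms ev_support in auto)
  then show ?thesis by (simp add: tlin_def scalar_simps sum_distrib_left mult.assoc)
qed

lemma tlin_HI: "f \<in> HI \<Longrightarrow> tlin g f = 0"
  by (simp add: tlin_def ev_HI)

lemma tlin_diff:
  assumes "f \<in> F" "f' \<in> F"
  shows "tlin g (f - f') = tlin g f - tlin g f'"
  using tlin_add[of "f - f'" f' g] assms by simp

lemma tlin_cong_HI: 
  assumes "f - f' \<in> HI" "f \<in> F" "f' \<in> F"
  shows "tlin g f = tlin g f'"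
  using tlin_HI[OF assms(1), of g] tlin_diff[OF assms(2,3), of g] by simp

lemma tlin_Tm: "w \<in> carrier W \<Longrightarrow> tlin g (Tm w) = g w"
proof -
  assume w: "w \<in> carrier W"
  have "{x. delta w x \<noteq> 0} = {w}" by (auto simp: delta_def)
  then show ?thesis using w by (simp add: tlin_def ev_Tm) (simp add: delta_def)
qed

lemma tlin_mem:
  assumes "add_closed N" "\<And>a n. n \<in> N \<Longrightarrow> scalar a * n \<in> N" "\<And>w. w \<in> carrier W \<Longrightarrow> g w \<in> N" "f \<in> F"
  shows "tlin g f \<in> N"
  unfolding tlin_def using assms ev_support(2)[OF assms(4)] by (intro add_closed_sum) auto

text \<open>The \<open>Tm w\<close> span: the set of \<open>f\<close> for which this holds is a left ideal containing \<open>1\<close>.\<close>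

lemma cong_tlin_Tm:
  assumes "f \<in> F"
  shows "f - tlin Tm f \<in> HI"
proof -
  note N = HI_add_closed
  define P where "P f \<longleftrightarrow> f \<in> F \<and> f - tlin Tm f \<in> HI" for f
  have P_add: "P (f + g)" if "P f" "P g" for f g
    using that cong_add[OF N, of f "tlin Tm f" g "tlin Tm g"] by (simp add: P_def tlin_add)
  have P_scalar: "P (scalar a * f)" if "P f" for f a
    using that HI_left[OF FA_scalar, of "f - tlin Tm f" a] by (simp add: P_def tlin_scalar right_diff_distrib)
  have P_Tm: "P (Tm w)" if "w \<in> carrier W" for w
    using that add_closedD(1)[OF N] by (simp add: P_def tlin_Tm)
  have P_cong: "P f" if "f - g \<in> HI" "P g" "f \<in> F" for f g
    using cong_trans[OF N that(1), of "tlin Tm g"] tlin_cong_HI[OF that(1)] that(2,3) by (simp add: P_def)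
  have P_0: "P 0" using add_closedD(1)[OF N] by (simp add: P_def tlin_def)
  have P_sum: "P (\<Sum>w\<in>B. scalar (a w) * f w)" if "\<And>w. w \<in> B \<Longrightarrow> P (f w)" for a B and f :: "'a \<Rightarrow> 'a free_alg"
    using that
    by (induction B rule: infinite_finite_induct)
      (simp_all add: P_0 P_add P_scalar)
  have P_gen: "P (gen s * f)" if s: "s \<in> S" and f: "P f" for s f
  proof -
    have gT: "P (gen s * Tm w)" if w: "w \<in> carrier W" for w
    proof (cases "len (s \<otimes> w) = len w + 1")
      case True
      then show ?thesis using P_cong[OF gen_Tm_up[OF s w True] P_Tm] s w by simp
    next
      case False
      then have l: "len w = len (s \<otimes> w) + 1" using len_gen_mult_cases[OF w s] by auto
      show ?thesis using P_cong[OF gen_Tm_down[OF s w l] P_add[OF P_scalar P_scalar]] P_Tm s w by simp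
    qed
    have "gen s * f - gen s * tlin Tm f \<in> HI"
      using HI_left[OF FA_gen[OF s], of "f - tlin Tm f"] f by (simp add: P_def right_diff_distrib)
    moreover have "gen s * tlin Tm f = (\<Sum>w | ev f w \<noteq> 0. scalar (ev f w) * (gen s * Tm w))"
      by (simp add: tlin_def sum_distrib_left scalar_left_commute)
    moreover have "P (\<Sum>w | ev f w \<noteq> 0. scalar (ev f w) * (gen s * Tm w))"
      using f ev_support(2)[of f] gT by (intro P_sum) (auto simp: P_def)
    ultimately show ?thesis using P_cong f s by (simp add: P_def)
  qed
  have P_mon: "P (mon u)" if "u \<in> lists S" for u
    using that by (induction u) (use P_Tm[of \<one>] in \<open>simp_all add: mon_Cons P_gen\<close>)
  have "P f" using assms
    by (induction f rule: FA_induct) (simp_all add: P_0 P_add P_scalar P_mon)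
  then show ?thesis by (simp add: P_def)
qed

lemma HI_iff_ev: 
  assumes "f \<in> F" 
  shows "f \<in> HI \<longleftrightarrow> (\<forall>w. ev f w = 0)"
proof
  assume "\<forall>w. ev f w = 0"
  then show "f \<in> HI" using cong_tlin_Tm[OF assms] by (simp add: tlin_def)
qed (simp add: ev_HI)

end

subsection \<open>Commutators modulo \<open>q - 1\<close>\<close>

definition brk :: "'b::ring \<Rightarrow> 'b \<Rightarrow> 'b" where
  "brk f g = f * g - g * f"

context km_weyl
begin

text \<open>The preimage in the free algebra of the span of the commutators of the Hecke algebra.\<close>

inductive_set NF :: "'a free_alg set" where
  NF_HI: "f \<in> HI \<Longrightarrow> f \<in> NF"
| NF_brk: "f \<in> F \<Longrightarrow> g \<in> F \<Longrightarrow> brk f g \<in> NF"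
| NF_add: "f \<in> NF \<Longrightarrow> g \<in> NF \<Longrightarrow> f + g \<in> NF"

lemma NF_F: "f \<in> NF \<Longrightarrow> f \<in> F"
  by (induction rule: NF.induct) (auto simp: HI_F brk_def)

lemma NF_scalar: "f \<in> NF \<Longrightarrow> scalar a * f \<in> NF"
proof (induction rule: NF.induct)
  case (NF_brk f g)
  then have "brk (scalar a * f) g \<in> NF" by (intro NF.NF_brk) auto
  then show ?case by (simp add: brk_def right_diff_distrib scalar_left_commute mult.assoc)
qed (auto simp: distrib_left HI_left intro: NF.intros)

lemma NF_add_closed: "add_closed NF"
  unfolding add_closed_def
proof (intro conjI ballI)
  show "0 \<in> NF" using add_closedD(1)[OF HI_add_closed] by (rule NF_HI)
  fix x y assume "x \<in> NF" "y \<in> NF"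
  then show "x - y \<in> NF" using NF_add[of x "scalar (- 1) * y"] NF_scalar[of y "- 1"] by (simp add: scalar_simps)
qed

text \<open>For \<open>N = F\<close> this is the kernel of the map from the free algebra onto the group ring of \<open>W\<close>.\<close>

definition q1 :: "'a free_alg set \<Rightarrow> 'a free_alg set" where
  "q1 N = {f + scalar (q - 1) * g | f g. f \<in> HI \<and> g \<in> N}"

lemma q1I: "f \<in> HI \<Longrightarrow> g \<in> N \<Longrightarrow> f + scalar (q - 1) * g \<in> q1 N"
  by (auto simp: q1_def)

lemma q1_HI: "add_closed N \<Longrightarrow> f \<in> HI \<Longrightarrow> f \<in> q1 N"
  using q1I[of f 0 N] add_closedD(1)[of N] by simp

lemma q1_scalar: "g \<in> N \<Longrightarrow> scalar (q - 1) * g \<in> q1 N"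
  using q1I[of 0 g N] add_closedD(1)[OF HI_add_closed] by simp

lemma q1_add_closed: "add_closed N \<Longrightarrow> add_closed (q1 N)"
  unfolding add_closed_def[of "q1 N"]
proof (intro conjI ballI)
  assume N: "add_closed N"
  show "0 \<in> q1 N" using q1_HI[OF N] add_closedD(1)[OF HI_add_closed] by blast
  fix x y assume "x \<in> q1 N" "y \<in> q1 N"
  then obtain f g f' g' where *: "x = f + scalar (q - 1) * g" "y = f' + scalar (q - 1) * g'"
    "f \<in> HI" "f' \<in> HI" "g \<in> N" "g' \<in> N" by (auto simp: q1_def)
  have "(f - f') + scalar (q - 1) * (g - g') \<in> q1 N"
    using * N HI_add_closed by (intro q1I add_closedD(2)) auto
  then show "x - y \<in> q1 N" using * by (simp add: algebra_simps)
qed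

lemma F_add_closed: "add_closed F"
  by (simp add: add_closed_def)

abbreviation HQ where "HQ \<equiv> q1 F"
abbreviation MQ where "MQ \<equiv> q1 NF"

lemmas HQ_add_closed = q1_add_closed[OF F_add_closed]
lemmas MQ_add_closed = q1_add_closed[OF NF_add_closed]

lemma HQ_two_sided: "two_sided S HQ"
  unfolding two_sided_def
proof (intro conjI ballI)
  show "HQ \<subseteq> F" by (auto simp: q1_def HI_F)
  fix f x assume f: "f \<in> F" and "x \<in> HQ"
  then obtain i g where x: "x = i + scalar (q - 1) * g" "i \<in> HI" "g \<in> F" by (auto simp: q1_def)
  show "f * x \<in> HQ" "x * f \<in> HQ" using x f HI_left[of f i] HI_right[of f i] q1I[of _ "f * g" F] q1I[of _ "g * f" F]
    by (simp_all add: distrib_left distrib_right scalar_left_commute mult.assoc)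
qed (rule HQ_add_closed)

lemma MQ_NF: "x \<in> MQ \<Longrightarrow> x \<in> NF"
  by (auto simp: q1_def intro: NF.intros NF_scalar)

text \<open>Changing one entry by a multiple of q - 1 changes the bracket by q - 1 times another
  bracket.\<close>

lemma brk_cong:
  assumes "f - f' \<in> HQ" "g - g' \<in> HQ" "f' \<in> F" "g \<in> F"
  shows "brk f g - brk f' g' \<in> MQ"
proof -
  have *: "brk x y \<in> MQ" if x: "x \<in> HQ" and y: "y \<in> F" for x y
  proof -
    obtain i g where x: "x = i + scalar (q - 1) * g" "i \<in> HI" "g \<in> F" using x by (auto simp: q1_def)
    have "brk i y + scalar (q - 1) * brk g y \<in> MQ"
      using x y HI_left[of y i] HI_right[of y i] HI_add_closed
      by (intro q1I NF_brk) (auto simp: brk_def add_closedD)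
    then show ?thesis unfolding x(1) brk_def by (simp add: algebra_simps scalar_left_commute)
  qed
  have "brk (f - f') g - brk (g - g') f' \<in> MQ"
    using assms by (intro add_closedD(2)[OF MQ_add_closed] *) auto
  then show ?thesis by (simp add: brk_def algebra_simps)
qed

lemma gen_cong_HQ:
  assumes s: "s \<in> S" and w: "w \<in> carrier W"
  shows "gen s * Tm w - Tm (s \<otimes> w) \<in> HQ"
proof (cases "len (s \<otimes> w) = len w + 1")
  case True
  then show ?thesis using q1_HI[OF F_add_closed gen_Tm_up[OF s w]] by simp
next
  case False
  then have "len w = len (s \<otimes> w) + 1" using len_gen_mult_cases[OF w s] by auto
  from q1I[OF gen_Tm_down[OF s w this], of "Tm w + Tm (s \<otimes> w)" F] show ?thesis
    using s w by (simp add: scalar_simps algebra_simps)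
qed

lemma mon_cong_HQ: "u \<in> lists S \<Longrightarrow> mon u - Tm (wv u) \<in> HQ"
proof (induction u)
  case (Cons s u)
  then have s: "s \<in> S" and u: "u \<in> lists S" and "mon u - Tm (wv u) \<in> HQ" by auto
  then have "gen s * mon u - gen s * Tm (wv u) \<in> HQ"
    using HQ_two_sided by (auto simp: two_sided_def simp flip: right_diff_distrib)
  then show ?case using cong_trans[OF HQ_add_closed _ gen_cong_HQ[OF s, of "wv u"]] u by (simp add: mon_Cons)
qed (use add_closedD(1)[OF HQ_add_closed] in simp)

lemma Tm_mult_HQ:
  assumes x: "x \<in> carrier W" and y: "y \<in> carrier W"
  shows "Tm x * Tm y - Tm (x \<otimes> y) \<in> HQ"
proof -
  let ?u = "SOME u. u \<in> reduced_words W S x" and ?v = "SOME u. u \<in> reduced_words W S y"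
  have "?u \<in> lists S" "?v \<in> lists S" "wv ?u = x" "wv ?v = y"
    using some_reduced[OF x] some_reduced[OF y] by (auto simp: reduced_words_def)
  then show ?thesis using mon_cong_HQ[of "?u @ ?v"] by (simp add: mon_append Tm_def wv_append)
qed

section \<open>Invertible elements and the conjugation cocycle\<close>

definition gen_inv :: "'a \<Rightarrow> 'a free_alg" where
  "gen_inv s = scalar (Poly_Mapping.single (- 1) 1) * (gen s - scalar (q - 1))"

lemma gen_inv_F [simp]: "s \<in> S \<Longrightarrow> gen_inv s \<in> F"
  by (simp add: gen_inv_def)

text \<open>The quadratic relation reads T_s (T_s - (q - 1)) = q, and the monomial of exponent -1 is
  the inverse of q.\<close>

lemma gen_inv: 
  assumes "s \<in> S"
  shows "gen s * gen_inv s - 1 \<in> HI" "gen_inv s * gen s - 1 \<in> HI"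
proof -
  let ?r = "Poly_Mapping.single (- 1) 1 :: laurent"
  have "?r * q = 1" by (simp add: q_var_def mult_single)
  then have r: "scalar ?r * scalar q = (1 :: 'a free_alg)" by (simp flip: scalar_simps)
  have "scalar ?r * (gen s * gen s - (scalar (q - 1) * gen s + scalar q)) \<in> HI"
    using HI_quadratic[OF assms] by (intro HI_left) auto
  then have *: "scalar ?r * (gen s * gen s - scalar (q - 1) * gen s) - 1 \<in> HI" 
    using r by (simp add: right_diff_distrib distrib_left diff_diff_eq)
  have "gen s * gen_inv s = scalar ?r * (gen s * gen s - scalar (q - 1) * gen s)"
    unfolding gen_inv_def scalar_left_commute[of "gen s"] right_diff_distrib scalar_commute[of "gen s"] ..
  moreover have "gen_inv s * gen s = scalar ?r * (gen s * gen s - scalar (q - 1) * gen s)"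
    unfolding gen_inv_def mult.assoc left_diff_distrib ..
  ultimately show "gen s * gen_inv s - 1 \<in> HI" "gen_inv s * gen s - 1 \<in> HI" using * by simp_all
qed

lemma mon_invertible: 
  "u \<in> lists S \<Longrightarrow> \<exists>B\<in>F. mon u * B - 1 \<in> HI \<and> B * mon u - 1 \<in> HI"
proof (induction u)
  case Nil
  show ?case by (rule bexI[of _ 1]) (use add_closedD(1)[OF HI_add_closed] in simp_all)
next
  case (Cons s u)
  have s: "s \<in> S" and u: "u \<in> lists S" using Cons.prems by simp_all
  obtain B where B: "B \<in> F" "mon u * B - 1 \<in> HI" "B * mon u - 1 \<in> HI" 
    using Cons.IH[OF u] by (elim bexE conjE)
  note H = HI_add_closed and gi = gen_inv[OF s] gen_inv_F[OF s]
  have "gen s * (mon u * B - 1) * gen_inv s \<in> HI" using B s by (intro HI_left HI_right) auto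
  then have "gen s * (mon u * B - 1) * gen_inv s + (gen s * gen_inv s - 1) \<in> HI" using gi(1) by (rule add_closedD(4)[OF H])
  then have 1: "mon (s # u) * (B * gen_inv s) - 1 \<in> HI" by (simp add: algebra_simps mon_Cons)
  have "B * (gen_inv s * gen s - 1) * mon u \<in> HI" using B u gi by (intro HI_left HI_right) auto
  then have "B * (gen_inv s * gen s - 1) * mon u + (B * mon u - 1) \<in> HI" using B(3) by (rule add_closedD(4)[OF H])
  then have 2: "B * gen_inv s * mon (s # u) - 1 \<in> HI" by (simp add: algebra_simps mon_Cons)
  show ?case using 1 2 B(1) gi(3) by (intro bexI[of _ "B * gen_inv s"]) simp_all
qed

text \<open>The bracket of \<open>w z\<^sup>-\<^sup>1\<close> and \<open>z\<close>: modulo \<open>MQ\<close> it is a cocycle in \<open>z\<close> for conjugation.\<close>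

definition phi :: "'a \<Rightarrow> 'a \<Rightarrow> 'a free_alg" where
  "phi w z = brk (Tm (w \<otimes> inv z)) (Tm z)"

lemma phi_NF: "w \<in> carrier W \<Longrightarrow> z \<in> carrier W \<Longrightarrow> phi w z \<in> NF"
  by (simp add: phi_def NF_brk)

text \<open>This is the identity [a, bc] = [ab, c] + [ca, b], with products of basis elements
  replaced by those of the group, which is allowed modulo q - 1.\<close>

lemma phi_mult:
  assumes w: "w \<in> carrier W" and y: "y \<in> carrier W" and z: "z \<in> carrier W"
  shows "phi w (y \<otimes> z) - (phi w z + phi (z \<otimes> w \<otimes> inv z) y) \<in> MQ"
proof -
  let ?a = "w \<otimes> inv (y \<otimes> z)"
  have a: "?a \<in> carrier W" "?a \<otimes> y = w \<otimes> inv z" "z \<otimes> ?a = z \<otimes> w \<otimes> inv z \<otimes> inv y"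
    using w y z by (simp_all add: inv_mult_group m_assoc)
  note 0 = add_closedD(1)[OF HQ_add_closed]
  have 1: "brk (Tm ?a) (Tm (y \<otimes> z)) - brk (Tm ?a) (Tm y * Tm z) \<in> MQ"
    using a y z 0 by (intro brk_cong cong_sym[OF HQ_add_closed Tm_mult_HQ]) auto
  have 2: "brk (Tm ?a * Tm y) (Tm z) - phi w z \<in> MQ"
    unfolding phi_def using a(1) w y z 0 Tm_mult_HQ[OF a(1) y] unfolding a(2) by (intro brk_cong) auto
  have 3: "brk (Tm z * Tm ?a) (Tm y) - phi (z \<otimes> w \<otimes> inv z) y \<in> MQ"
    unfolding phi_def using a(1) w y z 0 Tm_mult_HQ[OF z a(1)] unfolding a(3) by (intro brk_cong) auto
  have "brk (Tm ?a) (Tm y * Tm z) = brk (Tm ?a * Tm y) (Tm z) + brk (Tm z * Tm ?a) (Tm y)"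
    by (simp add: brk_def mult.assoc)
  then show ?thesis using cong_trans[OF MQ_add_closed 1] cong_add[OF MQ_add_closed 2 3] unfolding phi_def[of w "y \<otimes> z"]
    by simp
qed

text \<open>P and B are inverse in H, and P reduces to y at q = 1. As B intertwines T_u and T_u',
  the bracket of T_u B and P is exactly T_u - T_u' in H. Since T_u B reduces to u y^-1, the same
  bracket is \<open>phi u y\<close> modulo \<open>MQ\<close>.\<close>

lemma phi_intertwine:
  assumes u: "u \<in> carrier W" and y: "y \<in> carrier W" and u': "u' \<in> carrier W" and P: "P \<in> F" and B: "B \<in> F"
    and PB: "P * B - 1 \<in> HI" and BP: "B * P - 1 \<in> HI" and Ay: "P - Tm y \<in> HQ"
    and int: "Tm u * B - B * Tm u' \<in> HI"
  shows "phi u y - (Tm u - Tm u') \<in> MQ"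
proof -
  note Q = HQ_add_closed and H = HI_add_closed
  have iy: "inv y \<in> carrier W" using y by simp
  have q: "x \<in> HQ" if "x \<in> HI" for x using q1_HI[OF F_add_closed that] .
  have "Tm y * Tm (inv y) - 1 \<in> HQ" using Tm_mult_HQ[OF y iy] y by simp
  moreover have "P * Tm (inv y) - Tm y * Tm (inv y) \<in> HQ"
    using Ay iy HQ_two_sided by (auto simp: two_sided_def simp flip: left_diff_distrib)
  ultimately have "P * Tm (inv y) - 1 \<in> HQ" using cong_trans[OF Q] by blast
  then have "B * (P * Tm (inv y) - 1) \<in> HQ" using B HQ_two_sided by (auto simp: two_sided_def)
  moreover have "(B * P - 1) * Tm (inv y) \<in> HQ" by (intro q HI_right BP) (use y in simp)
  ultimately have "(B * P - 1) * Tm (inv y) - B * (P * Tm (inv y) - 1) \<in> HQ" by (intro add_closedD(2)[OF Q])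
  then have By: "B - Tm (inv y) \<in> HQ" by (simp add: algebra_simps)
  have "Tm u * B - Tm u * Tm (inv y) \<in> HQ"
    using By u HQ_two_sided by (auto simp: two_sided_def simp flip: right_diff_distrib)
  then have uB: "Tm u * B - Tm (u \<otimes> inv y) \<in> HQ" using cong_trans[OF Q _ Tm_mult_HQ[OF u iy]] by blast
  have 1: "phi u y - brk (Tm u * B) P \<in> MQ"
    unfolding phi_def by (rule brk_cong[OF cong_sym[OF Q uB] cong_sym[OF Q Ay]]) (use u y P B in auto)
  have 2: "Tm u * (B * P) - Tm u \<in> HI" using HI_left[OF Tm_F[OF u] BP] by (simp add: right_diff_distrib)
  have "P * (Tm u * B) - P * (B * Tm u') \<in> HI" using HI_left[OF P int] by (simp add: right_diff_distrib)
  moreover have "P * (B * Tm u') - Tm u' \<in> HI" using HI_right[OF Tm_F[OF u'] PB] by (simp add: left_diff_distrib mult.assoc)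
  ultimately have 3: "P * (Tm u * B) - Tm u' \<in> HI" by (rule cong_trans[OF H])
  have "(Tm u * (B * P) - Tm u) - (P * (Tm u * B) - Tm u') \<in> HI" using 2 3 by (rule add_closedD(2)[OF H])
  then have "brk (Tm u * B) P - (Tm u - Tm u') \<in> MQ" 
    by (intro q1_HI[OF NF_add_closed]) (simp add: brk_def algebra_simps)
  then show ?thesis using cong_trans[OF MQ_add_closed 1] by blast
qed

text \<open>Here B is T_z and P its inverse, which reduces to z^-1 at q = 1 because T_z reduces to
  z.\<close>

lemma phi_intertwine_Tm:
  assumes "u \<in> carrier W" "z \<in> carrier W" "u' \<in> carrier W" "Tm u * Tm z - Tm z * Tm u' \<in> HI"
  shows "phi u (inv z) - (Tm u - Tm u') \<in> MQ"
proof -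
  let ?r = "SOME u. u \<in> reduced_words W S z"
  have "?r \<in> lists S" using some_reduced[OF assms(2)] by (simp add: reduced_words_def)
  then obtain P where P: "P \<in> F" "Tm z * P - 1 \<in> HI" "P * Tm z - 1 \<in> HI"
    using mon_invertible[of ?r] by (auto simp: Tm_def)
  note Q = HQ_add_closed and z = assms(2)
  have iz: "inv z \<in> carrier W" using z by simp
  have "P * (Tm z * Tm (inv z) - 1) \<in> HQ" 
    using Tm_mult_HQ[OF z iz] z P HQ_two_sided by (auto simp: two_sided_def)
  moreover have "(P * Tm z - 1) * Tm (inv z) \<in> HQ" 
    by (intro q1_HI[OF F_add_closed] HI_right P) (use z in simp)
  ultimately have "(P * Tm z - 1) * Tm (inv z) - P * (Tm z * Tm (inv z) - 1) \<in> HQ" by (intro add_closedD(2)[OF Q])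
  then have "P - Tm (inv z) \<in> HQ" by (simp add: algebra_simps)
  then show ?thesis using assms P iz by (intro phi_intertwine[where P = P and B = "Tm z"]) auto
qed

lemma conj_step_cases:
  assumes w: "w \<in> carrier W" and "(a, b) \<in> conj_step w"
  obtains (eq) z where "a \<in> carrier W" "z \<in> carrier W" "b = a \<otimes> z" "len (conjg w b) = len (conjg w a)"
      "len (conjg w a \<otimes> z) = len (conjg w a) + len z"
  | (left) s where "a \<in> carrier W" "s \<in> S" "b = a \<otimes> s" "len (conjg w a) = len (s \<otimes> conjg w a) + 1"
  | (right) s where "a \<in> carrier W" "s \<in> S" "b = a \<otimes> s" "len (conjg w a) = len (conjg w a \<otimes> s) + 1"
proof -
  from assms(2) consider "(a, b) \<in> shift_step w" | "(a, b) \<in> strong_step w" by (auto simp: conj_step_def)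
  then show thesis
  proof cases
    case 1
    then obtain s where "a \<in> carrier W" "s \<in> S" "b = a \<otimes> s" 
      "len (s \<otimes> conjg w a) < len (conjg w a) \<or> len (conjg w a \<otimes> s) < len (conjg w a)"
      by (auto simp: shift_step_def)
    then show thesis using left[of s] right[of s] len_gen_mult_cases[of "conjg w a" s] len_mult_gen_cases[of "conjg w a" s] w
      by fastforce
  next
    case 2
    then show thesis using eq unfolding strong_step_def by blast
  qed
qed

lemma conj_step_closed: "(a, b) \<in> conj_step w \<Longrightarrow> a \<in> carrier W \<and> b \<in> carrier W"
  by (auto simp: conj_step_def shift_step_def strong_step_def)

lemma conj_step_le: 
  assumes w: "w \<in> carrier W" and "(a, b) \<in> conj_step w"
  shows "len (conjg w b) \<le> len (conjg w a)"
  using assms(2) shift_step_le[OF w] by (auto simp: conj_step_def strong_step_def)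

lemma Tm_mult_gen:
  assumes x: "x \<in> carrier W" and s: "s \<in> S" and l: "len (x \<otimes> s) = len x + 1"
  shows "Tm x * gen s - Tm (x \<otimes> s) \<in> HI"
  using Tm_mult[of x s] assms by simp

text \<open>Each kind of step has an exact intertwiner in H: T_z for a strong conjugation, T_s if s
  is a left descent, and the inverse of T_s if it is a right descent.\<close>

lemma conj_step_phi:
  assumes w: "w \<in> carrier W" and st: "(a, b) \<in> conj_step w" and l: "len (conjg w b) = len (conjg w a)"
  shows "phi (conjg w a) (inv b \<otimes> a) - (Tm (conjg w a) - Tm (conjg w b)) \<in> MQ"
proof -
  note H = HI_add_closed
  let ?u = "conjg w a" and ?u' = "conjg w b"
  have ab: "a \<in> carrier W" "b \<in> carrier W" using conj_step_closed[OF st] by auto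
  have u: "?u \<in> carrier W" "?u' \<in> carrier W" using w ab by auto
  from w st show ?thesis
  proof (cases rule: conj_step_cases)
    case (eq z)
    have z: "inv b \<otimes> a = inv z" using eq by (simp add: inv_mult_group m_assoc)
    have uz: "?u \<otimes> z = z \<otimes> ?u'" using eq w u by (simp add: conjg_mult m_assoc)
    have 1: "Tm ?u * Tm z - Tm (?u \<otimes> z) \<in> HI" using Tm_mult u eq by simp
    have 2: "Tm z * Tm ?u' - Tm (?u \<otimes> z) \<in> HI" using Tm_mult[of z ?u'] u eq unfolding uz[symmetric] by simp
    show ?thesis unfolding z
      by (rule phi_intertwine_Tm[OF u(1) eq(2) u(2) cong_trans[OF H 1 cong_sym[OF H 2]]])
  next
    case (left s)
    have z: "inv b \<otimes> a = inv s" using left by (simp add: inv_mult_group m_assoc)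
    let ?v = "s \<otimes> ?u"
    have v: "?v \<in> carrier W" "s \<otimes> ?v = ?u" "?v \<otimes> s = ?u'" using left u w by (simp_all add: conjg_mult m_assoc)
    have 1: "gen s * Tm ?v - Tm ?u \<in> HI" using gen_Tm_up[of s ?v] v left by simp
    have 2: "Tm ?v * gen s - Tm ?u' \<in> HI" using Tm_mult_gen[of ?v s] v left l by simp
    have "(gen s * Tm ?v - Tm ?u) * gen s \<in> HI" "gen s * (Tm ?v * gen s - Tm ?u') \<in> HI"
      using 1 2 HI_left HI_right FA_gen[OF left(2)] by blast+
    then have "gen s * (Tm ?v * gen s - Tm ?u') - (gen s * Tm ?v - Tm ?u) * gen s \<in> HI" by (rule add_closedD(2)[OF H, rotated])
    then have "Tm ?u * Tm s - Tm s * Tm ?u' \<in> HI" using left by (simp add: algebra_simps)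
    then show ?thesis unfolding z by (rule phi_intertwine_Tm[OF u(1) S_closed[OF left(2)] u(2)])
  next
    case (right s)
    have s: "inv b \<otimes> a = s" using right by (simp add: inv_mult_group m_assoc)
    let ?v = "?u \<otimes> s"
    have v: "?v \<in> carrier W" "?v \<otimes> s = ?u" "s \<otimes> ?v = ?u'" using right u w by (simp_all add: conjg_mult m_assoc)
    note gi = gen_inv[OF right(2)] gen_inv_F[OF right(2)]
    have 1: "Tm ?v * gen s - Tm ?u \<in> HI" using Tm_mult_gen[of ?v s] v right by simp
    have 2: "gen s * Tm ?v - Tm ?u' \<in> HI" using gen_Tm_up[of s ?v] v right l by simp
    have "(Tm ?v * gen s - Tm ?u) * gen_inv s \<in> HI" "Tm ?v * (gen s * gen_inv s - 1) \<in> HI"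
      using 1 gi HI_left HI_right Tm_F[OF v(1)] by blast+
    then have "Tm ?v * (gen s * gen_inv s - 1) - (Tm ?v * gen s - Tm ?u) * gen_inv s \<in> HI" 
      by (rule add_closedD(2)[OF H, rotated])
    then have 3: "Tm ?u * gen_inv s - Tm ?v \<in> HI" by (simp add: algebra_simps)
    have "gen_inv s * (gen s * Tm ?v - Tm ?u') \<in> HI" "(gen_inv s * gen s - 1) * Tm ?v \<in> HI"
      using 2 gi HI_left HI_right Tm_F[OF v(1)] by blast+
    then have "(gen_inv s * gen s - 1) * Tm ?v - gen_inv s * (gen s * Tm ?v - Tm ?u') \<in> HI" 
      by (rule add_closedD(2)[OF H, rotated])
    then have 4: "gen_inv s * Tm ?u' - Tm ?v \<in> HI" by (simp add: algebra_simps)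
    have 5: "gen s - Tm s \<in> HQ" using add_closedD(1)[OF HQ_add_closed] right(2) by simp
    show ?thesis unfolding s
      by (rule phi_intertwine[OF u(1) S_closed[OF right(2)] u(2) FA_gen[OF right(2)] gi(3,1,2) 5 
        cong_trans[OF H 3 cong_sym[OF H 4]]])
  qed
qed

text \<open>Minimality of b forces every step of a path to preserve the length. The cocycle adds up
  the values of the steps, and these differences telescope.\<close>

lemma phi_minimal:
  assumes b: "b \<in> carrier W" and x: "x \<in> carrier W" and l: "len (conjg b x) = len b"
    and min: "\<And>v. v \<in> carrier W \<Longrightarrow> len b \<le> len (conjg b v)"
  shows "phi b (inv x) - (Tm b - Tm (conjg b x)) \<in> MQ"
proof -
  note M = MQ_add_closed
  have "(\<one>, x) \<in> (conj_step b)\<^sup>*"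
    by (rule minimal_conj_path[OF b one_closed x]) (use min l in simp)
  then have "x \<in> carrier W \<and> len (conjg b x) = len b \<and> phi b (inv x) - (Tm b - Tm (conjg b x)) \<in> MQ"
  proof (induction rule: rtrancl_induct)
    case base
    show ?case using b add_closedD(1)[OF M] by (simp add: phi_def brk_def conjg_def)
  next
    case (step a c)
    have ac: "a \<in> carrier W" "c \<in> carrier W" using conj_step_closed[OF step(2)] by auto
    have IH: "len (conjg b a) = len b" "phi b (inv a) - (Tm b - Tm (conjg b a)) \<in> MQ" using step.IH by auto
    have lc: "len (conjg b c) = len (conjg b a)"
      using conj_step_le[OF b step(2)] min[of c] ac IH by simp
    have "phi b ((inv c \<otimes> a) \<otimes> inv a) - (phi b (inv a) + phi (inv a \<otimes> b \<otimes> inv (inv a)) (inv c \<otimes> a)) \<in> MQ"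
      using ac b by (intro phi_mult) auto
    then have 1: "phi b (inv c) - (phi b (inv a) + phi (conjg b a) (inv c \<otimes> a)) \<in> MQ"
      using ac b by (simp add: m_assoc conjg_def)
    have "(phi b (inv a) + phi (conjg b a) (inv c \<otimes> a)) - ((Tm b - Tm (conjg b a)) + (Tm (conjg b a) - Tm (conjg b c))) \<in> MQ"
      by (rule cong_add[OF M IH(2) conj_step_phi[OF b step(2) lc]])
    then have "phi b (inv c) - (Tm b - Tm (conjg b c)) \<in> MQ" using cong_trans[OF M 1] by simp
    then show ?case using ac lc IH by simp
  qed
  then show ?thesis by simp
qed

lemma Tm_minimal:
  assumes b: "b \<in> carrier W" and x: "x \<in> carrier W" and l: "len (conjg b x) = len b"
    and min: "\<And>v. v \<in> carrier W \<Longrightarrow> len b \<le> len (conjg b v)"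
  shows "Tm b - Tm (conjg b x) \<in> NF"
proof -
  have "phi b (inv x) \<in> NF" using phi_NF b x by simp
  moreover have "phi b (inv x) - (Tm b - Tm (conjg b x)) \<in> NF" using MQ_NF[OF phi_minimal[OF assms]] .
  ultimately have "phi b (inv x) - (phi b (inv x) - (Tm b - Tm (conjg b x))) \<in> NF" by (rule add_closedD(2)[OF NF_add_closed])
  then show ?thesis by simp
qed

end

subsection \<open>Conjugacy classes\<close>

lemma laurent_q1_nonzero: "q - 1 \<noteq> (0 :: laurent)"
proof
  assume "q - 1 = (0 :: laurent)"
  then have "Poly_Mapping.lookup q 1 = Poly_Mapping.lookup (1 :: laurent) 1" by simp
  then show False by (simp add: q_var_def lookup_one)
qed

lemma lookup_q1_mult:
  "Poly_Mapping.lookup ((q - 1) * b) k = Poly_Mapping.lookup b (k - 1) - Poly_Mapping.lookup b k"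
proof -
  have "Poly_Mapping.lookup (q * b) k = Poly_Mapping.lookup b (k - 1)"
  proof (induction b rule: update_induct)
    case (update b i c)
    have "Poly_Mapping.update i c b = b + Poly_Mapping.single i c"
      using update.hyps by (intro poly_mapping_eqI) (auto simp: lookup_update lookup_add lookup_single in_keys_iff)
    moreover have "q * Poly_Mapping.single i c = Poly_Mapping.single (1 + i) c"
      by (simp add: q_var_def mult_single)
    ultimately show ?case using update.IH by (auto simp: distrib_left lookup_add lookup_single when_def)
  qed simp
  then show ?thesis by (simp add: left_diff_distrib lookup_minus)
qed

text \<open>A lower bound for the width of the support, satisfied by no k if the polynomial is 0.
  Multiplication by q - 1 raises it by one.\<close>

definition spread :: "laurent \<Rightarrow> nat \<Rightarrow> bool" where
  "spread a k \<longleftrightarrow> (\<exists>i\<in>Poly_Mapping.keys a. \<exists>j\<in>Poly_Mapping.keys a. int k \<le> j - i)"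

text \<open>The lowest term of b and the highest one, shifted by one, cannot cancel in the
  product.\<close>

lemma spread_q1_mult:
  assumes "spread b k"
  shows "spread ((q - 1) * b) (Suc k)"
proof -
  let ?K = "Poly_Mapping.keys b"
  have ne: "?K \<noteq> {}" using assms by (auto simp: spread_def)
  have fin: "finite ?K" by simp
  have "Min ?K - 1 \<notin> ?K" "Max ?K + 1 \<notin> ?K"
    using Min_le[OF fin, of "Min ?K - 1"] Max_ge[OF fin, of "Max ?K + 1"] by auto
  then have "Min ?K \<in> Poly_Mapping.keys ((q - 1) * b)" "Max ?K + 1 \<in> Poly_Mapping.keys ((q - 1) * b)"
    using Min_in[OF fin ne] Max_in[OF fin ne] by (auto simp: in_keys_iff lookup_q1_mult)
  moreover have "int k \<le> Max ?K - Min ?K" using assms Min_le[OF fin] Max_ge[OF fin]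
    unfolding spread_def by (meson diff_mono order_trans)
  moreover from this have "int (Suc k) \<le> (Max ?K + 1) - Min ?K" by simp
  ultimately show ?thesis unfolding spread_def by blast
qed

lemma not_spread: "\<exists>k. \<not> spread a k"
proof -
  let ?K = "Poly_Mapping.keys a"
  have "\<not> spread a (nat (Max ?K - Min ?K) + 1)"
  proof
    assume "spread a (nat (Max ?K - Min ?K) + 1)"
    then obtain i j where ij: "i \<in> ?K" "j \<in> ?K" "int (nat (Max ?K - Min ?K) + 1) \<le> j - i" unfolding spread_def by blast
    moreover have "j \<le> Max ?K" "Min ?K \<le> i" using ij by auto
    ultimately show False by linarith
  qed
  then show ?thesis by blast
qed

text \<open>Compare the coefficients of the empty word.\<close>

lemma scalar_cancel_q1:
  fixes f :: "'s free_alg"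
  assumes "scalar a = scalar (q - 1) * f"
  shows "\<exists>b. a = (q - 1) * b"
proof -
  have "lin (\<lambda>u. if u = [] then 1 else 0) (scalar a * (mon [] :: 's free_alg)) = lin (\<lambda>u. if u = [] then 1 else 0) (scalar (q - 1) * f)"
    by (simp only: mon_Nil mult_1_right assms)
  then show ?thesis by (simp only: lin_scalar lin_mon) auto
qed

context km_weyl
begin

definition cls :: "'a \<Rightarrow> 'a set" where
  "cls w = {g \<otimes> w \<otimes> inv g | g. g \<in> carrier W}"

lemma conj_classes_eq: "conj_classes W = cls ` carrier W"
  by (auto simp: conj_classes_def orbits_def orbit_def cls_def image_iff)

lemma clsI: "g \<in> carrier W \<Longrightarrow> g \<otimes> w \<otimes> inv g \<in> cls w"
  by (auto simp: cls_def)

lemma cls_self: "w \<in> carrier W \<Longrightarrow> w \<in> cls w"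
  using clsI[of \<one> w] by simp

lemma cls_conjg: "w \<in> carrier W \<Longrightarrow> x \<in> carrier W \<Longrightarrow> conjg w x \<in> cls w"
  using clsI[of "inv x" w] by (simp add: conjg_def)

lemma cls_closed: "w \<in> carrier W \<Longrightarrow> y \<in> cls w \<Longrightarrow> y \<in> carrier W"
  by (auto simp: cls_def)

lemma cls_eq:
  assumes w: "w \<in> carrier W" and "y \<in> cls w"
  shows "cls y = cls w"
proof -
  obtain g where g: "g \<in> carrier W" "y = g \<otimes> w \<otimes> inv g" using assms by (auto simp: cls_def)
  have y: "y \<in> carrier W" "w = inv g \<otimes> y \<otimes> inv (inv g)" using g w by (simp_all add: m_assoc)
  have sub: "cls b \<subseteq> cls a" if "a \<in> carrier W" "k \<in> carrier W" "b = k \<otimes> a \<otimes> inv k" for a b k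
  proof
    fix x assume "x \<in> cls b"
    then obtain h where h: "h \<in> carrier W" "x = h \<otimes> b \<otimes> inv h" by (auto simp: cls_def)
    then have "x = (h \<otimes> k) \<otimes> a \<otimes> inv (h \<otimes> k)" using that by (simp add: inv_mult_group m_assoc)
    then show "x \<in> cls a" using clsI[of "h \<otimes> k" a] h(1) that(2) by simp
  qed
  show ?thesis using sub[OF w g] sub[OF y(1) inv_closed[OF g(1)] y(2)] by (rule equalityI)
qed

lemma min_elements_cls:
  assumes w: "w \<in> carrier W" and b: "b \<in> min_elements W S (cls w)"
  shows "b \<in> carrier W" "cls b = cls w" "\<And>v. v \<in> carrier W \<Longrightarrow> len b \<le> len (conjg b v)"
proof -
  have "b \<in> cls w" and min: "\<And>x. x \<in> cls w \<Longrightarrow> len b \<le> len x" using b by (auto simp: min_elements_def)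
  then show "b \<in> carrier W" "cls b = cls w" using cls_closed[OF w] cls_eq[OF w] by auto
  then show "len b \<le> len (conjg b v)" if "v \<in> carrier W" for v using min cls_conjg[of b v] that by simp
qed

definition minr :: "'a set \<Rightarrow> 'a" where
  "minr C = (SOME b. b \<in> min_elements W S C)"

lemma minr: "w \<in> carrier W \<Longrightarrow> minr (cls w) \<in> min_elements W S (cls w)"
  unfolding minr_def
  using ex_has_least_nat[of "\<lambda>x. x \<in> cls w" w len] cls_self[of w]
  by (intro someI_ex[of "\<lambda>b. b \<in> min_elements W S (cls w)"]) (auto simp: min_elements_def)

lemma Tm_min_elements:
  assumes w: "w \<in> carrier W" and b: "b \<in> min_elements W S (cls w)" and b': "b' \<in> min_elements W S (cls w)"
  shows "Tm b - Tm b' \<in> NF"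
proof -
  note m = min_elements_cls[OF w b]
  have "b' \<in> cls b" "len b' = len b" using b b' m by (auto simp: min_elements_def intro: order_antisym)
  then obtain g where g: "g \<in> carrier W" "b' = g \<otimes> b \<otimes> inv g" by (auto simp: cls_def)
  then have "b' = conjg b (inv g)" by (simp add: conjg_def)
  then show ?thesis using Tm_minimal[OF m(1) inv_closed[OF g(1)] _ m(3)] \<open>len b' = len b\<close> by simp
qed

text \<open>A potential of the cocycle \<open>phi\<close> on the class of \<open>w\<close>. It exists because \<open>phi\<close> vanishes on the
  centralizer of a minimal element; hence an element of \<open>NF\<close> is determined modulo \<open>MQ\<close> by its
  coefficients, linearly, and its divisibility by \<open>q - 1\<close> can be lifted.\<close>

definition corr :: "'a \<Rightarrow> 'a free_alg" where
  "corr w = - phi (minr (cls w)) (SOME z. z \<in> carrier W \<and> w = z \<otimes> minr (cls w) \<otimes> inv z)"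

text \<open>Two choices of the conjugating element differ by an element c of the centralizer of the
  minimal representative. For it \<open>phi_minimal\<close> gives the difference of a basis element
  with itself, so the potential is well defined modulo \<open>MQ\<close>.\<close>

lemma corr_cong:
  assumes w: "w \<in> carrier W" and z: "z \<in> carrier W" "w = z \<otimes> minr (cls w) \<otimes> inv z"
  shows "corr w + phi (minr (cls w)) z \<in> MQ" "corr w \<in> NF"
proof -
  let ?b = "minr (cls w)"
  define y where "y = (SOME z. z \<in> carrier W \<and> w = z \<otimes> ?b \<otimes> inv z)"
  have "y \<in> carrier W \<and> w = y \<otimes> ?b \<otimes> inv y" unfolding y_def by (rule someI_ex) (use z in blast)
  then have y: "y \<in> carrier W" "w = y \<otimes> ?b \<otimes> inv y" by simp_all
  note m = min_elements_cls[OF w minr[OF w]]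
  have corr: "corr w = - phi ?b y" by (simp add: corr_def y_def)
  show "corr w \<in> NF" unfolding corr using add_closedD(3)[OF NF_add_closed phi_NF] m y by simp
  define c where "c = inv z \<otimes> y"
  have c: "c \<in> carrier W" "y = z \<otimes> c" using z y by (simp_all add: c_def)
  have "y \<otimes> ?b \<otimes> inv y = z \<otimes> ?b \<otimes> inv z" using y z by simp
  then have "inv z \<otimes> (y \<otimes> ?b \<otimes> inv y) \<otimes> z = ?b" using z(1) m by (simp add: m_assoc)
  then have cb: "c \<otimes> ?b \<otimes> inv c = ?b" using z(1) y(1) m by (simp add: c_def inv_mult_group m_assoc)
  then have "conjg ?b (inv c) = ?b" using c by (simp add: conjg_def)
  then have "phi ?b c \<in> MQ" using phi_minimal[OF m(1) inv_closed[OF c(1)] _ m(3)] c by simp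
  moreover have "phi ?b y - (phi ?b c + phi ?b z) \<in> MQ" 
    using phi_mult[OF m(1) z(1) c(1)] cb c by simp
  ultimately have "phi ?b c + (phi ?b y - (phi ?b c + phi ?b z)) \<in> MQ" by (rule add_closedD(4)[OF MQ_add_closed])
  then have "phi ?b y - phi ?b z \<in> MQ" by simp
  then show "corr w + phi ?b z \<in> MQ" unfolding corr using cong_sym[OF MQ_add_closed, of "phi ?b y" "phi ?b z"] by simp
qed

lemma ex_conj_minr: 
  assumes w: "w \<in> carrier W"
  obtains z where "z \<in> carrier W" "w = z \<otimes> minr (cls w) \<otimes> inv z"
proof -
  have "w \<in> cls (minr (cls w))" using min_elements_cls(2)[OF w minr[OF w]] cls_self[OF w] by simp
  then show thesis using that unfolding cls_def[of "minr (cls w)"] by blast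
qed

text \<open>The bracket is the cocycle value for conjugating x y by y, which yields y x. It is
  therefore the difference of the potential at the two ends.\<close>

lemma brk_Tm_corr:
  assumes x: "x \<in> carrier W" and y: "y \<in> carrier W"
  shows "brk (Tm x) (Tm y) - (corr (x \<otimes> y) - corr (y \<otimes> x)) \<in> MQ"
proof -
  note M = MQ_add_closed
  let ?w = "x \<otimes> y"
  have w: "?w \<in> carrier W" and w': "y \<otimes> x \<in> carrier W" using x y by auto
  let ?b = "minr (cls ?w)"
  have b: "?b \<in> carrier W" using min_elements_cls(1)[OF w minr[OF w]] .
  obtain z where z: "z \<in> carrier W" "?w = z \<otimes> ?b \<otimes> inv z" using ex_conj_minr[OF w] .
  have yx: "y \<otimes> x = y \<otimes> ?w \<otimes> inv y" using x y by (simp add: m_assoc)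
  have cl: "cls (y \<otimes> x) = cls ?w" unfolding yx by (rule cls_eq[OF w clsI[OF y]])
  have "y \<otimes> x = (y \<otimes> z) \<otimes> ?b \<otimes> inv (y \<otimes> z)" unfolding yx using y z(1) b 
    by (subst z(2)) (simp add: inv_mult_group m_assoc)
  then have 1: "corr (y \<otimes> x) + phi ?b (y \<otimes> z) \<in> MQ" using corr_cong(1)[OF w', of "y \<otimes> z"] y z(1) unfolding cl by simp
  have 2: "corr ?w + phi ?b z \<in> MQ" by (rule corr_cong(1)[OF w z])
  have "phi ?b (y \<otimes> z) - (phi ?b z + phi (z \<otimes> ?b \<otimes> inv z) y) \<in> MQ" by (rule phi_mult[OF b y z(1)])
  then have 3: "phi ?b (y \<otimes> z) - (phi ?b z + brk (Tm x) (Tm y)) \<in> MQ" 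
    unfolding z(2)[symmetric] using x y by (simp add: phi_def m_assoc)
  have "corr (y \<otimes> x) + phi ?b (y \<otimes> z) - (corr ?w + phi ?b z) - (phi ?b (y \<otimes> z) - (phi ?b z + brk (Tm x) (Tm y))) \<in> MQ"
    by (intro add_closedD(2)[OF M] 1 2 3)
  then show ?thesis by (simp add: algebra_simps)
qed

text \<open>Bilinearity and antisymmetry reduce all brackets to those of basis elements, one
  argument at a time.\<close>

lemma NF_subset:
  assumes K: "add_closed K" and scalar: "\<And>a f. f \<in> K \<Longrightarrow> scalar a * f \<in> K" and HI: "HI \<subseteq> K"
    and Tm: "\<And>x y. x \<in> carrier W \<Longrightarrow> y \<in> carrier W \<Longrightarrow> brk (Tm x) (Tm y) \<in> K"
  shows "NF \<subseteq> K"
proof -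
  have red: "brk f g \<in> K" if f: "f \<in> F" and g: "g \<in> F" and "\<And>w. w \<in> carrier W \<Longrightarrow> brk (Tm w) g \<in> K" for f g
  proof -
    have "brk (tlin Tm f) g = (\<Sum>w | ev f w \<noteq> 0. scalar (ev f w) * brk (Tm w) g)"
      by (simp add: tlin_def brk_def sum_distrib_left sum_distrib_right right_diff_distrib sum_subtractf
          mult.assoc scalar_left_commute[of g])
    also have "\<dots> \<in> K" using ev_support(2)[OF f] that(3) by (intro add_closed_sum[OF K] scalar) auto
    finally have 1: "brk (tlin Tm f) g \<in> K" .
    have "f - tlin Tm f \<in> HI" by (rule cong_tlin_Tm[OF f])
    then have "brk (f - tlin Tm f) g \<in> HI" unfolding brk_def
      using add_closedD(2)[OF HI_add_closed HI_right[OF g] HI_left[OF g]] by simp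
    then have "brk (tlin Tm f) g + brk (f - tlin Tm f) g \<in> K" using 1 HI by (intro add_closedD(4)[OF K]) auto
    then show ?thesis by (simp add: brk_def algebra_simps)
  qed
  have neg: "brk g f = - brk f g" for f g :: "'a free_alg" by (simp add: brk_def)
  have "brk f (Tm y) \<in> K" if "f \<in> F" "y \<in> carrier W" for f y using red[of f "Tm y"] that Tm by simp
  then have "brk (Tm y) f \<in> K" if "f \<in> F" "y \<in> carrier W" for f y 
    using add_closedD(3)[OF K] that neg[of "Tm y" f] by simp
  then have brk: "brk f g \<in> K" if "f \<in> F" "g \<in> F" for f g using red that by simp
  show ?thesis
  proof
    fix f assume "f \<in> NF"
    then show "f \<in> K" by (induction rule: NF.induct) (use HI brk add_closedD(4)[OF K] in auto)
  qed
qed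

text \<open>In H the bracket of T_x and T_y is T_xy - T_yx plus a multiple of q - 1, and the values
  of the map on such multiples are absorbed by N.\<close>

lemma tlin_brk:
  assumes N: "add_closed N" and scalar: "\<And>a f. f \<in> N \<Longrightarrow> scalar a * f \<in> N"
    and g: "\<And>w. w \<in> carrier W \<Longrightarrow> scalar (q - 1) * g w \<in> N"
    and x: "x \<in> carrier W" and y: "y \<in> carrier W"
  shows "tlin g (brk (Tm x) (Tm y)) - (g (x \<otimes> y) - g (y \<otimes> x)) \<in> N"
proof -
  have xy: "x \<otimes> y \<in> carrier W" "y \<otimes> x \<in> carrier W" using x y by auto
  let ?h = "(Tm x * Tm y - Tm y * Tm x) - (Tm (x \<otimes> y) - Tm (y \<otimes> x))"
  have "(Tm x * Tm y - Tm (x \<otimes> y)) - (Tm y * Tm x - Tm (y \<otimes> x)) \<in> HQ"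
    using x y by (intro add_closedD(2)[OF HQ_add_closed] Tm_mult_HQ)
  then have "?h \<in> HQ" by (simp add: algebra_simps)
  then obtain i k where h: "?h = i + scalar (q - 1) * k" "i \<in> HI" "k \<in> F" by (auto simp: q1_def)
  have "tlin g ?h = scalar (q - 1) * tlin g k"
    unfolding h(1) using h(2,3) by (simp add: tlin_add HI_F tlin_HI tlin_scalar)
  also have "\<dots> = (\<Sum>w | ev k w \<noteq> 0. scalar (ev k w) * (scalar (q - 1) * g w))"
    by (simp add: tlin_def sum_distrib_left scalar_left_commute[of "scalar (q - 1)"])
  also have "\<dots> \<in> N" using ev_support(2)[OF h(3)] by (intro add_closed_sum[OF N] scalar g) auto
  finally have "tlin g ?h \<in> N" .
  moreover have "tlin g ?h = tlin g (brk (Tm x) (Tm y)) - (g (x \<otimes> y) - g (y \<otimes> x))"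
    using x y xy by (simp add: tlin_diff tlin_Tm brk_def)
  ultimately show ?thesis by simp
qed

lemma MQ_scalar: "f \<in> MQ \<Longrightarrow> scalar a * f \<in> MQ"
proof -
  assume "f \<in> MQ"
  then obtain i n where f: "f = i + scalar (q - 1) * n" "i \<in> HI" "n \<in> NF" by (auto simp: q1_def)
  then have "scalar a * i + scalar (q - 1) * (scalar a * n) \<in> MQ" 
    by (intro q1I HI_left NF_scalar) auto
  then show ?thesis using f by (simp add: distrib_left scalar_left_commute[of "scalar a" "q - 1"])
qed

text \<open>Elements of \<open>NF\<close> agree with their image under the linear extension of
  \<open>corr\<close> modulo \<open>MQ\<close>. Applied to (q - 1) h, linearity brings out the
  factor q - 1, and what it multiplies lies in \<open>NF\<close>. So (q - 1) h lies in
  \<open>MQ\<close>, where q - 1 can be cancelled because H is free.\<close>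

lemma NF_torsion_free:
  assumes h: "h \<in> F" and "scalar (q - 1) * h \<in> NF"
  shows "h \<in> NF"
proof -
  note M = MQ_add_closed
  have corr_NF: "corr w \<in> NF" if "w \<in> carrier W" for w using corr_cong(2)[OF that] ex_conj_minr[OF that] by blast
  define K where "K = {n \<in> F. n - tlin corr n \<in> MQ}"
  have "NF \<subseteq> K"
  proof (rule NF_subset)
    show "add_closed K" unfolding add_closed_def
    proof (intro conjI ballI)
      show "0 \<in> K" using add_closedD(1)[OF M] by (simp add: K_def tlin_def)
      fix x y assume "x \<in> K" "y \<in> K"
      then have "(x - tlin corr x) - (y - tlin corr y) \<in> MQ" "x \<in> F" "y \<in> F" using add_closedD(2)[OF M] by (auto simp: K_def)
      then show "x - y \<in> K" by (simp add: K_def tlin_diff algebra_simps)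
    qed
    show "scalar a * f \<in> K" if "f \<in> K" for a f
      using that MQ_scalar[of "f - tlin corr f" a] by (simp add: K_def tlin_scalar right_diff_distrib)
    show "HI \<subseteq> K" using q1_HI[OF NF_add_closed] by (auto simp: K_def HI_F tlin_HI)
    fix x y assume xy: "x \<in> carrier W" "y \<in> carrier W"
    have "tlin corr (brk (Tm x) (Tm y)) - (corr (x \<otimes> y) - corr (y \<otimes> x)) \<in> MQ"
      using xy by (intro tlin_brk M MQ_scalar q1_scalar corr_NF) auto
    then show "brk (Tm x) (Tm y) \<in> K" using cong_trans[OF M brk_Tm_corr[OF xy] cong_sym[OF M]] xy
      by (simp add: K_def) (simp add: brk_def)
  qed
  then have "scalar (q - 1) * h - scalar (q - 1) * tlin corr h \<in> MQ" using assms by (auto simp: K_def tlin_scalar)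
  moreover have t: "tlin corr h \<in> NF" using NF_add_closed NF_scalar corr_NF h by (rule tlin_mem)
  ultimately have "scalar (q - 1) * h - scalar (q - 1) * tlin corr h + scalar (q - 1) * tlin corr h \<in> MQ"
    by (intro add_closedD(4)[OF M] q1_scalar)
  then obtain i n where n: "scalar (q - 1) * h = i + scalar (q - 1) * n" "i \<in> HI" "n \<in> NF" by (auto simp: q1_def)
  have "(q - 1) * ev (h - n) w = 0" for w
  proof -
    have "ev (scalar (q - 1) * (h - n)) w = ev i w" using n(1) by (simp add: right_diff_distrib)
    then show ?thesis using n(2) by (simp add: ev_HI)
  qed
  then have "h - n \<in> HI" using HI_iff_ev[of "h - n"] h NF_F[OF n(3)] laurent_q1_nonzero by simp
  then have "(h - n) + n \<in> NF" by (rule NF_add[OF NF_HI n(3)])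
  then show ?thesis by simp
qed

text \<open>The indicator function of the class C is a trace of the group ring. Its linear extension
  to H sends commutators to multiples of q - 1 and the given combination to the coefficient of
  C.\<close>

lemma class_coeff_divisible:
  assumes J: "finite J" "J \<subseteq> conj_classes W" and NF: "(\<Sum>C\<in>J. scalar (a C) * Tm (minr C)) \<in> NF" and C: "C \<in> J"
  shows "\<exists>b. a C = (q - 1) * b"
proof -
  \<comment> \<open>The values 0 and 1 are taken in the free algebra instead of the Laurent ring, so
    that \<open>tlin\<close> can be applied.\<close>
  define g :: "'a \<Rightarrow> 'a free_alg" where "g w = (if w \<in> C then 1 else 0)" for w
  define N :: "'a free_alg set" where "N = {scalar (q - 1) * f | f. f \<in> F}"
  have N: "add_closed N" unfolding add_closed_def N_def
  proof (intro conjI ballI)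
    show "0 \<in> {scalar (q - 1) * f | f. f \<in> F}" by (auto intro: exI[of _ 0])
    fix x y assume "x \<in> {scalar (q - 1) * f | f. f \<in> F}" "y \<in> {scalar (q - 1) * f | f. f \<in> F}"
    then obtain f f' where "x = scalar (q - 1) * f" "y = scalar (q - 1) * f'" "f \<in> F" "f' \<in> F" by auto
    then have "x - y = scalar (q - 1) * (f - f')" "f - f' \<in> F" by (simp_all add: right_diff_distrib)
    then show "x - y \<in> {scalar (q - 1) * f | f. f \<in> F}" by blast
  qed
  have Ns: "scalar c * f \<in> N" if f: "f \<in> N" for c f
  proof -
    obtain f' where "f = scalar (q - 1) * f'" "f' \<in> F" using f by (auto simp: N_def)
    then have "scalar c * f = scalar (q - 1) * (scalar c * f')" "scalar c * f' \<in> F" 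
      by (simp_all add: scalar_left_commute[of "scalar c"])
    then show ?thesis unfolding N_def by blast
  qed
  have Ng: "scalar (q - 1) * g w \<in> N" for w
  proof -
    have "g w \<in> F" by (simp add: g_def)
    then show ?thesis unfolding N_def by blast
  qed
  have cl: "\<exists>w\<in>carrier W. D = cls w" if "D \<in> J" for D using that J(2) by (auto simp: conj_classes_eq)
  define K where "K = {n \<in> F. tlin g n \<in> N}"
  have "NF \<subseteq> K"
  proof (rule NF_subset)
    show "add_closed K" using add_closedD(1,2)[OF N] by (auto simp: add_closed_def K_def tlin_diff tlin_HI add_closedD(1)[OF HI_add_closed])
    show "scalar c * f \<in> K" if "f \<in> K" for c f using that Ns by (auto simp: K_def tlin_scalar)
    show "HI \<subseteq> K" using add_closedD(1)[OF N] by (auto simp: K_def HI_F tlin_HI)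
    fix x y assume xy: "x \<in> carrier W" "y \<in> carrier W"
    have "y \<otimes> x \<in> cls (x \<otimes> y)" using clsI[OF xy(2), of "x \<otimes> y"] xy by (simp add: m_assoc)
    then have "cls (y \<otimes> x) = cls (x \<otimes> y)" using cls_eq xy by blast
    moreover have "v \<in> C \<longleftrightarrow> C = cls v" if "v \<in> carrier W" for v
      using cl[OF C] cls_eq cls_self[OF that] by blast
    ultimately have "g (x \<otimes> y) = g (y \<otimes> x)" using xy by (simp add: g_def)
    then show "brk (Tm x) (Tm y) \<in> K" using tlin_brk[where g = g, OF N Ns Ng xy] xy by (simp add: K_def) (simp add: brk_def)
  qed
  then have t: "tlin g (\<Sum>C\<in>J. scalar (a C) * Tm (minr C)) \<in> N" using NF by (auto simp: K_def)
  have Tc: "minr D \<in> carrier W \<and> (minr D \<in> C \<longleftrightarrow> D = C)" if D: "D \<in> J" for D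
  proof -
    obtain w v where w: "w \<in> carrier W" "D = cls w" "v \<in> carrier W" "C = cls v" using cl[OF D] cl[OF C] by blast
    note m = min_elements_cls[OF w(1) minr[OF w(1)]]
    show ?thesis using m(1,2) w cls_eq[OF w(3)] cls_self[OF m(1)] by auto
  qed
  have "tlin g (\<Sum>D\<in>B. scalar (a D) * Tm (minr D)) = (\<Sum>D\<in>B. scalar (a D) * g (minr D))" if "finite B" "B \<subseteq> J" for B
    using that
  proof induction
    case (insert D B)
    have "(\<Sum>D\<in>B. scalar (a D) * Tm (minr D)) \<in> F" using Tc insert.prems by (intro FA_sum) auto
    moreover have "Tm (minr D) \<in> F" "minr D \<in> carrier W" using Tc insert.prems by auto
    ultimately show ?case using insert by (simp add: tlin_add tlin_scalar tlin_Tm)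
  qed (simp add: tlin_def)
  then have "tlin g (\<Sum>D\<in>J. scalar (a D) * Tm (minr D)) = (\<Sum>D\<in>J. scalar (a D) * g (minr D))" using J by simp
  also have "\<dots> = (\<Sum>D\<in>J. if D = C then scalar (a D) else 0)" using Tc by (intro sum.cong) (auto simp: g_def)
  also have "\<dots> = scalar (a C)" using J C by simp
  finally have "scalar (a C) \<in> N" using t by simp
  then show ?thesis using scalar_cancel_q1 by (auto simp: N_def)
qed

text \<open>Dividing a relation by \<open>q - 1\<close> again and again shrinks its Laurent polynomials for ever.\<close>

lemma class_independent:
  assumes J: "finite J" "J \<subseteq> conj_classes W" and NF: "(\<Sum>C\<in>J. scalar (a C) * Tm (minr C)) \<in> NF" and C: "C \<in> J"
  shows "a C = 0"
proof (rule ccontr)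
  assume "a C \<noteq> 0"
  have "spread (a C) k" for k
    using NF \<open>a C \<noteq> 0\<close>
  proof (induction k arbitrary: a)
    case 0
    then obtain i where "i \<in> Poly_Mapping.keys (a C)" by (metis keys_eq_empty ex_in_conv)
    then show ?case unfolding spread_def by (intro bexI[of _ i]) auto
  next
    case (Suc k)
    have "\<exists>b. \<forall>D\<in>J. a D = (q - 1) * b D"
      using class_coeff_divisible[OF J Suc.prems(1)] by (intro bchoice) blast
    then obtain b where b: "\<And>D. D \<in> J \<Longrightarrow> a D = (q - 1) * b D" by blast
    have "(\<Sum>C\<in>J. scalar (a C) * Tm (minr C)) = scalar (q - 1) * (\<Sum>C\<in>J. scalar (b C) * Tm (minr C))"
      unfolding sum_distrib_left by (intro sum.cong) (simp_all only: b scalar_simps(4) mult.assoc)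
    moreover have "minr D \<in> carrier W" if "D \<in> J" for D
      using that J(2) min_elements_cls(1)[OF _ minr] by (auto simp: conj_classes_eq)
    then have "(\<Sum>C\<in>J. scalar (b C) * Tm (minr C)) \<in> F" by (intro FA_sum) auto
    ultimately have "(\<Sum>C\<in>J. scalar (b C) * Tm (minr C)) \<in> NF" using NF_torsion_free Suc.prems(1) by simp
    moreover have "b C \<noteq> 0" using b[OF C] Suc.prems(2) by auto
    ultimately have "spread (b C) k" by (rule Suc.IH)
    then show ?case using spread_q1_mult b[OF C] by simp
  qed
  then show False using not_spread by blast
qed

section \<open>Spanning by the classes\<close>

definition cspan :: "'a free_alg set" where
  "cspan = {f. \<exists>J a. finite J \<and> J \<subseteq> conj_classes W \<and> f - (\<Sum>C\<in>J. scalar (a C) * Tm (minr C)) \<in> NF}"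

lemma cspanI: "\<lbrakk>finite J; J \<subseteq> conj_classes W; f - (\<Sum>C\<in>J. scalar (a C) * Tm (minr C)) \<in> NF\<rbrakk> \<Longrightarrow> f \<in> cspan"
  unfolding cspan_def by (intro CollectI exI conjI)

lemma cspanE:
  assumes "f \<in> cspan"
  obtains J a where "finite J" "J \<subseteq> conj_classes W" "f - (\<Sum>C\<in>J. scalar (a C) * Tm (minr C)) \<in> NF"
  using assms unfolding cspan_def by (elim CollectE exE conjE)

lemma cspan_cong: "f - f' \<in> NF \<Longrightarrow> f' \<in> cspan \<Longrightarrow> f \<in> cspan"
  by (elim cspanE, rule cspanI) (auto intro: cong_trans[OF NF_add_closed])

lemma cspan_scalar: 
  assumes "f \<in> cspan"
  shows "scalar c * f \<in> cspan"
proof -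
  obtain J a where *: "finite J" "J \<subseteq> conj_classes W" "f - (\<Sum>C\<in>J. scalar (a C) * Tm (minr C)) \<in> NF" 
    using assms by (rule cspanE)
  have "scalar c * f - (\<Sum>C\<in>J. scalar (c * a C) * Tm (minr C)) \<in> NF"
    using NF_scalar[OF *(3), of c] by (simp add: right_diff_distrib sum_distrib_left scalar_simps mult.assoc)
  then show ?thesis by (rule cspanI[OF *(1,2)])
qed

lemma cspan_add: 
  assumes "f \<in> cspan" "f' \<in> cspan"
  shows "f + f' \<in> cspan"
proof -
  obtain J a where *: "finite J" "J \<subseteq> conj_classes W" "f - (\<Sum>C\<in>J. scalar (a C) * Tm (minr C)) \<in> NF" 
    using assms(1) by (rule cspanE)
  obtain J' a' where **: "finite J'" "J' \<subseteq> conj_classes W" "f' - (\<Sum>C\<in>J'. scalar (a' C) * Tm (minr C)) \<in> NF" 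
    using assms(2) by (rule cspanE)
  have ext: "(\<Sum>C\<in>J0. scalar (e C) * Tm (minr C)) = (\<Sum>C\<in>J \<union> J'. scalar (if C \<in> J0 then e C else 0) * Tm (minr C))"
    if "J0 \<in> {J, J'}" for J0 e
    by (rule sum.mono_neutral_cong_left) (use that * ** in auto)
  have s: "(f + f') - (\<Sum>C\<in>J \<union> J'. scalar ((if C \<in> J then a C else 0) + (if C \<in> J' then a' C else 0)) * Tm (minr C)) \<in> NF"
    using cong_add[OF NF_add_closed *(3) **(3)] unfolding ext[of J a, simplified] ext[of J' a', simplified]
    by (simp only: scalar_simps(1) distrib_right sum.distrib)
  show ?thesis by (rule cspanI[OF _ _ s]) (use * ** in auto)
qed

lemma cspan_minr: "w \<in> carrier W \<Longrightarrow> Tm (minr (cls w)) \<in> cspan"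
proof -
  assume w: "w \<in> carrier W"
  have s: "Tm (minr (cls w)) - (\<Sum>C\<in>{cls w}. scalar 1 * Tm (minr C)) \<in> NF" using add_closedD(1)[OF NF_add_closed] by simp
  show ?thesis by (rule cspanI[OF _ _ s]) (use w in \<open>simp_all add: conj_classes_eq\<close>)
qed

text \<open>With v = s u and u' = s u s, T_u = T_s T_v equals T_v T_s modulo commutators. As T_v =
  T_u' T_s, the quadratic relation turns this into (q - 1) T_v + q T_u', with v and u' shorter than
  u.\<close>

lemma cspan_down:
  assumes u: "u \<in> carrier W" and s: "s \<in> S" and l: "len u = len (s \<otimes> u) + 1" "len u = len (s \<otimes> u \<otimes> s) + 2"
    and IH: "\<And>v. v \<in> carrier W \<Longrightarrow> len v < len u \<Longrightarrow> Tm v \<in> cspan"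
  shows "Tm u \<in> cspan"
proof -
  note N = NF_add_closed and H = HI_add_closed
  let ?v = "s \<otimes> u" and ?u' = "s \<otimes> u \<otimes> s" and ?r = "scalar (q - 1)"
  have v: "?v \<in> carrier W" "?u' \<in> carrier W" "s \<otimes> ?v = u" "?u' \<otimes> s = ?v" using s u by auto
  have 1: "gen s * Tm ?v - Tm u \<in> HI" using gen_Tm_up[of s ?v] s v l by simp
  have 2: "Tm ?v * gen s - gen s * Tm ?v \<in> NF" using NF_brk[of "Tm ?v" "gen s"] s v by (simp add: brk_def)
  have 3: "Tm ?u' * gen s - Tm ?v \<in> HI" using Tm_mult_gen[of ?u' s] s v l by simp
  have "(Tm ?u' * gen s - Tm ?v) * gen s \<in> HI" using s 3 by (intro HI_right) auto
  moreover have "Tm ?u' * (gen s * gen s - (?r * gen s + scalar q)) \<in> HI"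
    by (rule HI_left[OF Tm_F[OF v(2)] HI_quadratic[OF s]])
  moreover have "?r * (Tm ?u' * gen s - Tm ?v) \<in> HI" by (rule HI_left[OF FA_scalar 3])
  ultimately have "Tm ?u' * (gen s * gen s - (?r * gen s + scalar q)) + ?r * (Tm ?u' * gen s - Tm ?v)
      - (Tm ?u' * gen s - Tm ?v) * gen s \<in> HI"
    by (intro add_closedD(2)[OF H] add_closedD(4)[OF H])
  moreover have "Tm ?u' * (?r * gen s + scalar q) = ?r * (Tm ?u' * gen s) + scalar q * Tm ?u'"
    by (simp only: distrib_left scalar_left_commute[of "Tm ?u'"] scalar_commute[of "Tm ?u'"])
  ultimately have "Tm ?u' * (gen s * gen s) - (?r * (Tm ?u' * gen s) + scalar q * Tm ?u') + ?r * (Tm ?u' * gen s - Tm ?v)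
      - (Tm ?u' * gen s - Tm ?v) * gen s \<in> HI" by (simp only: right_diff_distrib)
  then have 4: "Tm ?v * gen s - (?r * Tm ?v + scalar q * Tm ?u') \<in> HI" by (simp add: algebra_simps)
  have "Tm u - (?r * Tm ?v + scalar q * Tm ?u') \<in> NF"
    by (rule cong_trans[OF N cong_sym[OF N NF_HI[OF 1]] cong_trans[OF N cong_sym[OF N 2] NF_HI[OF 4]]])
  moreover have "Tm ?u' \<in> cspan" "Tm ?v \<in> cspan" using IH v l by simp_all
  ultimately show ?thesis using cspan_cong cspan_add cspan_scalar by blast
qed

text \<open>Strong conjugations keep the length, so s comes from a shift. Each one-sided
  multiplication changes the length by 1, so a drop must come from two decreases, and then s is also
  a left descent.\<close>

lemma conj_step_drop:
  assumes w: "w \<in> carrier W" and st: "(a, b) \<in> conj_step w" and l: "len (conjg w b) < len (conjg w a)"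
  shows "\<exists>s\<in>S. conjg w b = s \<otimes> conjg w a \<otimes> s \<and> len (conjg w a) = len (s \<otimes> conjg w a) + 1 \<and>
    len (conjg w a) = len (conjg w b) + 2"
proof -
  let ?u = "conjg w a"
  have a: "a \<in> carrier W" using conj_step_closed[OF st] by simp
  have u: "?u \<in> carrier W" using w a by simp
  have "\<exists>s\<in>S. conjg w b = s \<otimes> ?u \<otimes> s \<and> (len ?u = len (s \<otimes> ?u) + 1 \<or> len ?u = len (?u \<otimes> s) + 1)"
    using w st
  proof (cases rule: conj_step_cases)
    case (eq z)
    then show ?thesis using l by simp
  next
    case (left s)
    then show ?thesis using conjg_mult[OF w a, of s] by (intro bexI[of _ s]) simp_all
  next
    case (right s)
    then show ?thesis using conjg_mult[OF w a, of s] by (intro bexI[of _ s]) simp_all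
  qed
  then obtain s where s: "s \<in> S" "conjg w b = s \<otimes> ?u \<otimes> s" "len ?u = len (s \<otimes> ?u) + 1 \<or> len ?u = len (?u \<otimes> s) + 1"
    by blast
  have "len (s \<otimes> ?u \<otimes> s) = len (s \<otimes> ?u) + 1 \<or> len (s \<otimes> ?u) = len (s \<otimes> ?u \<otimes> s) + 1"
    using len_mult_gen_cases[of "s \<otimes> ?u" s] s u by simp
  moreover have "len (s \<otimes> (?u \<otimes> s)) = len (?u \<otimes> s) + 1 \<or> len (?u \<otimes> s) = len (s \<otimes> (?u \<otimes> s)) + 1"
    using len_gen_mult_cases[of "?u \<otimes> s" s] s u by simp
  moreover have "s \<otimes> (?u \<otimes> s) = s \<otimes> ?u \<otimes> s" using s u by (simp add: m_assoc)
  ultimately have "len ?u = len (s \<otimes> ?u) + 1 \<and> len ?u = len (conjg w b) + 2"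
    using s(3) l len_gen_mult_cases[OF u s(1)] len_mult_gen_cases[OF u s(1)] unfolding s(2) by linarith
  then show ?thesis using s(1,2) by (intro bexI[of _ s] conjI) simp_all
qed

lemma Tm_cspan: "w \<in> carrier W \<Longrightarrow> Tm w \<in> cspan"
proof (induction "len w" arbitrary: w rule: less_induct)
  case less
  note w = less.prems and N = NF_add_closed
  obtain x where x: "x \<in> carrier W" and min: "\<And>v. v \<in> carrier W \<Longrightarrow> len (conjg w x) \<le> len (conjg w v)"
    using ex_has_least_nat[of "\<lambda>x. x \<in> carrier W" \<one> "\<lambda>x. len (conjg w x)"] by auto
  have "(\<one>, x) \<in> (conj_step w)\<^sup>*" by (rule minimal_conj_path[OF w one_closed x min])
  \<comment> \<open>The bound is carried back along the path from its minimal end: at a drop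
    \<open>cspan_down\<close> asks for all elements shorter than the current conjugate, and the
    bound puts them within reach of the outer induction.\<close>
  then have "len (conjg w \<one>) \<le> len w \<longrightarrow> Tm (conjg w \<one>) \<in> cspan"
  proof (induction rule: converse_rtrancl_induct)
    case base
    let ?b = "conjg w x"
    have b: "?b \<in> carrier W" "cls ?b = cls w" using w x cls_eq[OF w cls_conjg[OF w x]] by auto
    have "?b \<in> min_elements W S (cls w)" unfolding min_elements_def
    proof (intro CollectI conjI ballI)
      show "?b \<in> cls w" by (rule cls_conjg[OF w x])
      fix y assume "y \<in> cls w"
      then obtain g where "g \<in> carrier W" "y = g \<otimes> w \<otimes> inv g" by (auto simp: cls_def)
      then have "y = conjg w (inv g)" "inv g \<in> carrier W" by (simp_all add: conjg_def)
      then show "len ?b \<le> len y" using min by simp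
    qed
    then show ?case using cspan_cong[OF Tm_min_elements[OF w _ minr[OF w]] cspan_minr[OF w]] by simp
  next
    case (step a c)
    have ac: "a \<in> carrier W" "c \<in> carrier W" using conj_step_closed[OF step(1)] by auto
    show ?case
    proof
      assume la: "len (conjg w a) \<le> len w"
      have le: "len (conjg w c) \<le> len (conjg w a)" by (rule conj_step_le[OF w step(1)])
      then have IH: "Tm (conjg w c) \<in> cspan" using step.IH la by simp
      show "Tm (conjg w a) \<in> cspan"
      proof (cases "len (conjg w c) = len (conjg w a)")
        case True
        let ?u = "conjg w a" and ?u' = "conjg w c" and ?y = "inv c \<otimes> a"
        have "phi ?u ?y \<in> NF" using w ac by (intro phi_NF) auto
        moreover have "phi ?u ?y - (Tm ?u - Tm ?u') \<in> NF" by (rule MQ_NF[OF conj_step_phi[OF w step(1) True]])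
        ultimately have "phi ?u ?y - (phi ?u ?y - (Tm ?u - Tm ?u')) \<in> NF" by (rule add_closedD(2)[OF N])
        then show ?thesis using cspan_cong[OF _ IH] by simp
      next
        case False
        then obtain s where s: "s \<in> S" "conjg w c = s \<otimes> conjg w a \<otimes> s" "len (conjg w a) = len (s \<otimes> conjg w a) + 1"
          "len (conjg w a) = len (conjg w c) + 2" using conj_step_drop[OF w step(1)] le by auto
        show ?thesis
          by (rule cspan_down[OF _ s(1,3)]) (use w ac s(2,4) la less.hyps in auto)
      qed
    qed
  qed
  then show ?case using w by (simp add: conjg_def)
qed

lemma cspan_F: 
  assumes "f \<in> F"
  shows "f \<in> cspan"
proof -
  have z: "0 \<in> cspan" using cspan_scalar[OF Tm_cspan[OF one_closed], of 0] by simp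
  have sum: "sum g B \<in> cspan" if "\<And>w. w \<in> B \<Longrightarrow> g w \<in> cspan" for g and B :: "'a set"
    using that by (induction B rule: infinite_finite_induct) (simp_all add: z cspan_add)
  have "tlin Tm f \<in> cspan" unfolding tlin_def
    by (intro sum cspan_scalar Tm_cspan) (use ev_support(2)[OF assms] in auto)
  then show ?thesis by (rule cspan_cong[OF NF_HI[OF cong_tlin_Tm[OF assms]]])
qed

end

subsection \<open>Quotient modules\<close>

locale quotient = Module.module R M for R (structure) and M +
  fixes N
  assumes N: "submodule N R M"
begin

interpretation N: abelian_subgroup N M
  using N submodule.axioms(1) M.abelian_group_axioms by (intro abelian_subgroupI3 additive_subgroupI) auto

lemma coset_eq_iff:
  assumes "x \<in> carrier M" "y \<in> carrier M"
  shows "N +>\<^bsub>M\<^esub> x = N +>\<^bsub>M\<^esub> y \<longleftrightarrow> x \<ominus>\<^bsub>M\<^esub> y \<in> N"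
  using N.a_repr_independence'[of x y] N.a_rcos_module_minus[OF _ assms(2,1)] N.a_rcos_self[OF assms(1)] assms
    M.abelian_group_axioms N.a_repr_independenceD by (metis N.a_rcos_module N.a_rcos_module_minus M.minus_eq)

lemma quot_carrier: "carrier (quot_module M N) = (\<lambda>x. N +>\<^bsub>M\<^esub> x) ` carrier M"
  by (auto simp: quot_module_def FactRing_def A_RCOSETS_def')

lemma quot_zero: "\<zero>\<^bsub>quot_module M N\<^esub> = N"
  by (simp add: quot_module_def FactRing_def)

lemma quot_zero': "\<zero>\<^bsub>quot_module M N\<^esub> = N +>\<^bsub>M\<^esub> \<zero>\<^bsub>M\<^esub>"
  using N.a_subset by (simp add: quot_zero M.a_coset_add_zero)

lemma quot_add: "x \<in> carrier M \<Longrightarrow> y \<in> carrier M \<Longrightarrow>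
    (N +>\<^bsub>M\<^esub> x) \<oplus>\<^bsub>quot_module M N\<^esub> (N +>\<^bsub>M\<^esub> y) = N +>\<^bsub>M\<^esub> (x \<oplus>\<^bsub>M\<^esub> y)"
  by (simp add: quot_module_def FactRing_def N.a_rcos_sum)

lemma quot_smult:
  assumes a: "a \<in> carrier R" and x: "x \<in> carrier M"
  shows "a \<odot>\<^bsub>quot_module M N\<^esub> (N +>\<^bsub>M\<^esub> x) = N +>\<^bsub>M\<^esub> (a \<odot>\<^bsub>M\<^esub> x)"
proof -
  \<comment> \<open>All members of a coset yield the same coset after scaling, so the union in the
    definition of \<open>quot_module\<close> has a single value.\<close>
  have *: "N +>\<^bsub>M\<^esub> (a \<odot>\<^bsub>M\<^esub> y) = N +>\<^bsub>M\<^esub> (a \<odot>\<^bsub>M\<^esub> x)" if y: "y \<in> N +>\<^bsub>M\<^esub> x" for y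
  proof -
    have yM: "y \<in> carrier M" using y x N.a_elemrcos_carrier by blast
    have "y \<ominus>\<^bsub>M\<^esub> x \<in> N" using y yM x N.a_rcos_module_minus[OF _ x yM] by (simp add: N.a_rcos_module M.minus_eq)
    then have "a \<odot>\<^bsub>M\<^esub> (y \<ominus>\<^bsub>M\<^esub> x) \<in> N" using submodule.smult_closed[OF N a] by blast
    then have "a \<odot>\<^bsub>M\<^esub> y \<ominus>\<^bsub>M\<^esub> a \<odot>\<^bsub>M\<^esub> x \<in> N"
      using a x yM by (simp add: M.minus_eq smult_r_distr smult_r_minus)
    then show ?thesis using coset_eq_iff[of "a \<odot>\<^bsub>M\<^esub> y" "a \<odot>\<^bsub>M\<^esub> x"] a x yM by simp
  qed
  have "(\<Union>y\<in>N +>\<^bsub>M\<^esub> x. N +>\<^bsub>M\<^esub> (a \<odot>\<^bsub>M\<^esub> y)) = N +>\<^bsub>M\<^esub> (a \<odot>\<^bsub>M\<^esub> x)"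
    by (rule UN_constant_eq[OF N.a_rcos_self[OF x]]) (simp add: *)
  then show ?thesis by (simp add: quot_module_def)
qed

lemma quot_module: "Module.module R (quot_module M N)"
proof (rule moduleI)
  show "abelian_group (quot_module M N)"
  proof (rule abelian_groupI)
    fix A assume "A \<in> carrier (quot_module M N)"
    then obtain x where x: "x \<in> carrier M" "A = N +>\<^bsub>M\<^esub> x" by (auto simp: quot_carrier)
    have "(N +>\<^bsub>M\<^esub> (\<ominus>\<^bsub>M\<^esub> x)) \<oplus>\<^bsub>quot_module M N\<^esub> A = \<zero>\<^bsub>quot_module M N\<^esub>"
      using x by (simp add: quot_add quot_zero' M.l_neg)
    then show "\<exists>B\<in>carrier (quot_module M N). B \<oplus>\<^bsub>quot_module M N\<^esub> A = \<zero>\<^bsub>quot_module M N\<^esub>"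
      using x by (intro bexI[of _ "N +>\<^bsub>M\<^esub> (\<ominus>\<^bsub>M\<^esub> x)"]) (auto simp: quot_carrier)
  qed (auto simp: quot_carrier quot_add quot_zero' M.a_ac)
qed (auto simp: quot_carrier quot_add quot_smult smult_l_distr smult_r_distr smult_assoc1 intro: R.cring_axioms)

lemma quot_minus:
  assumes "x \<in> carrier M" "y \<in> carrier M"
  shows "(N +>\<^bsub>M\<^esub> x) \<ominus>\<^bsub>quot_module M N\<^esub> (N +>\<^bsub>M\<^esub> y) = N +>\<^bsub>M\<^esub> (x \<ominus>\<^bsub>M\<^esub> y)"
proof -
  interpret Q: Module.module R "quot_module M N" by (rule quot_module)
  have "\<ominus>\<^bsub>quot_module M N\<^esub> (N +>\<^bsub>M\<^esub> y) = N +>\<^bsub>M\<^esub> (\<ominus>\<^bsub>M\<^esub> y)"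
    using assms by (intro Q.M.minus_equality) (auto simp: quot_carrier quot_add quot_zero' M.l_neg)
  then show ?thesis using assms by (simp add: Q.M.minus_eq M.minus_eq quot_add)
qed

end

subsection \<open>The cocenter\<close>

context km_weyl
begin

abbreviation H where "H \<equiv> hecke_algebra W S"
abbreviation hc where "hc f \<equiv> HI +>\<^bsub>free_algebra S\<^esub> f"

lemma laurent_ring_simps:
  "carrier laurent_ring = UNIV" "\<zero>\<^bsub>laurent_ring\<^esub> = (0 :: laurent)"
  by (simp_all add: ring_of_type_algebra_def)

lemma free_algebra_minus: "x \<in> F \<Longrightarrow> y \<in> F \<Longrightarrow> x \<ominus>\<^bsub>free_algebra S\<^esub> y = x - y"
  by (simp add: a_minus_def free_algebra_uminus free_algebra_simps)

lemma H_quotient: "quotient laurent_ring (free_algebra S) HI"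
proof -
  have "submodule HI laurent_ring (free_algebra S)"
    by (rule Module.module.submoduleI[OF free_algebra_module])
      (auto simp: HI_F free_algebra_simps free_algebra_uminus add_closedD[OF HI_add_closed] HI_left)
  then show ?thesis by (simp add: quotient_def quotient_axioms_def free_algebra_module)
qed

lemma hc_eq_iff: "x \<in> F \<Longrightarrow> y \<in> F \<Longrightarrow> hc x = hc y \<longleftrightarrow> x - y \<in> HI"
  using quotient.coset_eq_iff[OF H_quotient, of x y] by (simp add: free_algebra_minus)

lemma H_module: "Module.module laurent_ring H"
  unfolding hecke_algebra_def by (rule quotient.quot_module[OF H_quotient])

lemma H_carrier: "carrier H = hc ` F"
  unfolding hecke_algebra_def by (rule quotient.quot_carrier[OF H_quotient])

lemma hc_add: "x \<in> F \<Longrightarrow> y \<in> F \<Longrightarrow> hc x \<oplus>\<^bsub>H\<^esub> hc y = hc (x + y)"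
  using quotient.quot_add[OF H_quotient, of x y] by (simp add: hecke_algebra_def free_algebra_simps)

lemma hc_smult: "x \<in> F \<Longrightarrow> a \<odot>\<^bsub>H\<^esub> hc x = hc (scalar a * x)"
  using quotient.quot_smult[OF H_quotient, of a x] by (simp add: hecke_algebra_def free_algebra_simps laurent_ring_simps)

lemma hc_minus: "x \<in> F \<Longrightarrow> y \<in> F \<Longrightarrow> hc x \<ominus>\<^bsub>H\<^esub> hc y = hc (x - y)"
  using quotient.quot_minus[OF H_quotient, of x y] by (simp add: hecke_algebra_def free_algebra_minus)

lemma hc_0: "\<zero>\<^bsub>H\<^esub> = hc 0"
  using quotient.quot_zero'[OF H_quotient] by (simp add: hecke_algebra_def free_algebra_simps)

lemma hc_mult: "x \<in> F \<Longrightarrow> y \<in> F \<Longrightarrow> hc x \<otimes>\<^bsub>H\<^esub> hc y = hc (x * y)"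
  using ideal.rcoset_mult_add[OF HI_ideal, of x y]
  by (simp add: hecke_algebra_def quot_module_def FactRing_def free_algebra_simps)

lemma hc_1: "\<one>\<^bsub>H\<^esub> = hc 1"
  by (simp add: hecke_algebra_def quot_module_def FactRing_def free_algebra_simps)

lemma word_value_H: "u \<in> lists S \<Longrightarrow> word_value H (map (T_gen W S) u) = hc (mon u)"
proof (induction u)
  case (Cons s u)
  then show ?case by (simp add: word_value_def T_gen_def hc_mult mon_Cons)
qed (simp add: word_value_def hc_1)

lemma T_elt_eq: 
  assumes w: "w \<in> carrier W"
  shows "T_elt W S w = hc (Tm w)"
proof -
  have *: "word_value H (map (T_gen W S) u) = hc (Tm w)" if u: "u \<in> reduced_words W S w" for u
  proof -
    have "u \<in> lists S" using u by (simp add: reduced_words_def)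
    then show ?thesis using mon_cong_Tm[OF w u] w by (simp add: word_value_H hc_eq_iff)
  qed
  show ?thesis unfolding T_elt_def
  proof (rule the_equality)
    fix x assume "\<forall>u\<in>reduced_words W S w. x = word_value H (map (T_gen W S) u)"
    then have "x = word_value H (map (T_gen W S) (SOME u. u \<in> reduced_words W S w))" using some_reduced[OF w] by (rule bspec)
    then show "x = hc (Tm w)" using *[OF some_reduced[OF w]] by simp
  qed (simp add: *)
qed

lemma NF_submodule: "submodule (hc ` NF) laurent_ring H"
proof -
  interpret H: Module.module laurent_ring H by (rule H_module)
  show ?thesis
  proof (rule H.submoduleI)
    show "hc ` NF \<subseteq> carrier H" using NF_F by (auto simp: H_carrier)
    show "\<zero>\<^bsub>H\<^esub> \<in> hc ` NF" unfolding hc_0 using add_closedD(1)[OF NF_add_closed] by blast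
    fix a assume "a \<in> hc ` NF"
    then obtain f where f: "f \<in> NF" "a = hc f" by blast
    have "\<ominus>\<^bsub>H\<^esub> a = hc (- f)"
      using NF_F[OF f(1)] f(2) by (intro H.M.minus_equality) (auto simp: hc_add hc_0 H_carrier)
    then show "\<ominus>\<^bsub>H\<^esub> a \<in> hc ` NF" using add_closedD(3)[OF NF_add_closed f(1)] by simp
    fix b assume "b \<in> hc ` NF"
    then obtain g where g: "g \<in> NF" "b = hc g" by blast
    have "a \<oplus>\<^bsub>H\<^esub> b = hc (f + g)" using NF_F f g by (simp add: hc_add)
    then show "a \<oplus>\<^bsub>H\<^esub> b \<in> hc ` NF" using NF_add[OF f(1) g(1)] by simp
  next
    fix c x assume "x \<in> hc ` NF"
    then obtain f where f: "f \<in> NF" "x = hc f" by blast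
    have "c \<odot>\<^bsub>H\<^esub> x = hc (scalar c * f)" using NF_F f by (simp add: hc_smult)
    then show "c \<odot>\<^bsub>H\<^esub> x \<in> hc ` NF" using NF_scalar[OF f(1)] by simp
  qed
qed

text \<open>\<open>NF\<close> was generated without scalars, but a scalar can be moved into one
  entry of a bracket; so its image is already a submodule, and clearly the least one.\<close>

lemma hecke_commutators_eq: "hecke_commutators W S = hc ` NF"
proof -
  let ?E = "{(x \<otimes>\<^bsub>H\<^esub> y) \<ominus>\<^bsub>H\<^esub> (y \<otimes>\<^bsub>H\<^esub> x) | x y. x \<in> carrier H \<and> y \<in> carrier H}"
  have E: "?E = {hc (brk f g) | f g. f \<in> F \<and> g \<in> F}"
  proof -
    have brk: "(hc f \<otimes>\<^bsub>H\<^esub> hc g) \<ominus>\<^bsub>H\<^esub> (hc g \<otimes>\<^bsub>H\<^esub> hc f) = hc (brk f g)" if "f \<in> F" "g \<in> F" for f g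
      using that by (simp add: hc_mult hc_minus brk_def)
    show ?thesis
    proof (intro equalityI subsetI)
      fix z assume "z \<in> ?E"
      then obtain f g where "f \<in> F" "g \<in> F" "z = hc f \<otimes>\<^bsub>H\<^esub> hc g \<ominus>\<^bsub>H\<^esub> hc g \<otimes>\<^bsub>H\<^esub> hc f"
        unfolding H_carrier by auto
      then show "z \<in> {hc (brk f g) | f g. f \<in> F \<and> g \<in> F}" using brk[of f g] by auto
    next
      fix z assume "z \<in> {hc (brk f g) | f g. f \<in> F \<and> g \<in> F}"
      then obtain f g where "f \<in> F" "g \<in> F" "z = hc (brk f g)" by auto
      then have "z = hc f \<otimes>\<^bsub>H\<^esub> hc g \<ominus>\<^bsub>H\<^esub> hc g \<otimes>\<^bsub>H\<^esub> hc f" "hc f \<in> carrier H" "hc g \<in> carrier H"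
        using brk[of f g] by (simp_all add: H_carrier)
      then show "z \<in> ?E" by blast
    qed
  qed
  have "?E \<subseteq> hc ` NF" unfolding E using NF_brk by blast
  moreover have "hc ` NF \<subseteq> N" if N: "submodule N laurent_ring H" "?E \<subseteq> N" for N
  proof
    have sub: "subgroup N (add_monoid H)" using N(1) by (rule submodule.axioms(1))
    fix x assume "x \<in> hc ` NF"
    then obtain f where f: "f \<in> NF" "x = hc f" by blast
    have "hc f \<in> N" using f(1)
    proof (induction rule: NF.induct)
      case (NF_HI f)
      then have "hc f = \<zero>\<^bsub>H\<^esub>" using hc_eq_iff[of f 0] HI_F hc_0 by simp
      then show ?case using subgroup.one_closed[OF sub] by simp
    next
      case (NF_brk f g)
      then show ?case using N(2) unfolding E by blast
    next
      case (NF_add f g)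
      then have "hc (f + g) = hc f \<oplus>\<^bsub>H\<^esub> hc g" using NF_F by (simp add: hc_add)
      then show ?case using subgroup.m_closed[OF sub NF_add.IH] by simp
    qed
    then show "x \<in> N" using f by simp
  qed
  ultimately show ?thesis using NF_submodule unfolding hecke_commutators_def Let_def module_span_def by blast
qed


abbreviation kc where "kc f \<equiv> hecke_commutators W S +>\<^bsub>H\<^esub> hc f"

lemma cocenter_quotient: "quotient laurent_ring H (hecke_commutators W S)"
  using NF_submodule H_module by (simp add: quotient_def quotient_axioms_def hecke_commutators_eq)

lemma cocenter_module: "Module.module laurent_ring (cocenter W S)"
  unfolding cocenter_def by (rule quotient.quot_module[OF cocenter_quotient])

lemma cocenter_carrier: "carrier (cocenter W S) = kc ` F"
  unfolding cocenter_def quotient.quot_carrier[OF cocenter_quotient] H_carrier by (simp add: image_image)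

text \<open>As \<open>NF\<close> contains \<open>HI\<close>, the two successive quotients amount to
  a single one by \<open>NF\<close>.\<close>

lemma kc_eq_iff:
  assumes "x \<in> F" "y \<in> F"
  shows "kc x = kc y \<longleftrightarrow> x - y \<in> NF"
proof -
  have "kc x = kc y \<longleftrightarrow> hc (x - y) \<in> hc ` NF"
    using quotient.coset_eq_iff[OF cocenter_quotient, of "hc x" "hc y"] assms
    by (simp add: hc_minus H_carrier hecke_commutators_eq)
  also have "\<dots> \<longleftrightarrow> x - y \<in> NF"
  proof
    assume "hc (x - y) \<in> hc ` NF"
    then obtain n where n: "n \<in> NF" "hc (x - y) = hc n" by blast
    then have "x - y - n \<in> HI" using assms NF_F[OF n(1)] by (simp add: hc_eq_iff)
    then have "(x - y - n) + n \<in> NF" by (rule NF_add[OF NF_HI n(1)])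
    then show "x - y \<in> NF" by simp
  qed simp
  finally show ?thesis .
qed

lemma kc_add: "x \<in> F \<Longrightarrow> y \<in> F \<Longrightarrow> kc x \<oplus>\<^bsub>cocenter W S\<^esub> kc y = kc (x + y)"
  using quotient.quot_add[OF cocenter_quotient, of "hc x" "hc y"] by (simp add: cocenter_def H_carrier hc_add)

lemma kc_smult: "x \<in> F \<Longrightarrow> a \<odot>\<^bsub>cocenter W S\<^esub> kc x = kc (scalar a * x)"
  using quotient.quot_smult[OF cocenter_quotient, of a "hc x"]
  by (simp add: cocenter_def H_carrier hc_smult laurent_ring_simps)

lemma kc_0: "\<zero>\<^bsub>cocenter W S\<^esub> = kc 0"
  using quotient.quot_zero'[OF cocenter_quotient] by (simp add: cocenter_def hc_0)

lemma kc_finsum: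
  assumes "finite J" "\<And>i. i \<in> J \<Longrightarrow> f i \<in> F"
  shows "(\<Oplus>\<^bsub>cocenter W S\<^esub>i\<in>J. a i \<odot>\<^bsub>cocenter W S\<^esub> kc (f i)) = kc (\<Sum>i\<in>J. scalar (a i) * f i)"
proof -
  interpret K: Module.module laurent_ring "cocenter W S" by (rule cocenter_module)
  show ?thesis using assms
  proof (induction J)
    case (insert i J)
    have c: "a j \<odot>\<^bsub>cocenter W S\<^esub> kc (f j) \<in> carrier (cocenter W S)" if "j \<in> insert i J" for j
      using insert.prems that by (simp add: kc_smult cocenter_carrier)
    have "(\<Sum>i\<in>J. scalar (a i) * f i) \<in> F" using insert.prems by (intro FA_sum) auto
    then show ?case using insert c by (simp add: K.M.finsum_insert Pi_def kc_smult kc_add)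
  qed (simp add: kc_0)
qed

lemma minr_closed: "C \<in> conj_classes W \<Longrightarrow> minr C \<in> carrier W"
  using min_elements_cls(1)[OF _ minr] by (auto simp: conj_classes_eq)

lemma T_class_eq: 
  assumes "C \<in> conj_classes W"
  shows "T_class W S C = kc (Tm (minr C))"
proof -
  obtain w where w: "w \<in> carrier W" "C = cls w" using assms by (auto simp: conj_classes_eq)
  have m: "minr C \<in> min_elements W S C" using minr w by simp
  have *: "hecke_commutators W S +>\<^bsub>H\<^esub> T_elt W S b = kc (Tm (minr C))" if b: "b \<in> min_elements W S C" for b
  proof -
    have bW: "b \<in> carrier W" using min_elements_cls(1)[OF w(1)] b w(2) by simp
    then show ?thesis
      using Tm_min_elements[OF w(1), of b "minr C"] b m w(2) minr_closed[OF assms] by (simp add: T_elt_eq kc_eq_iff)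
  qed
  show ?thesis unfolding T_class_def
  proof (rule the_equality)
    fix x assume "\<forall>b\<in>min_elements W S C. x = hecke_commutators W S +>\<^bsub>H\<^esub> T_elt W S b"
    then have "x = hecke_commutators W S +>\<^bsub>H\<^esub> T_elt W S (minr C)" using m by (rule bspec)
    then show "x = kc (Tm (minr C))" using *[OF m] by simp
  qed (simp add: *)
qed

lemma T_class_finsum:
  assumes J: "finite J" "J \<subseteq> conj_classes W"
  shows "(\<Oplus>\<^bsub>cocenter W S\<^esub>C\<in>J. a C \<odot>\<^bsub>cocenter W S\<^esub> T_class W S C) = kc (\<Sum>C\<in>J. scalar (a C) * Tm (minr C))"
    and "(\<Sum>C\<in>J. scalar (a C) * Tm (minr C)) \<in> F"
proof -
  interpret K: Module.module laurent_ring "cocenter W S" by (rule cocenter_module)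
  have Tm: "Tm (minr C) \<in> F" if "C \<in> J" for C using that minr_closed J by auto
  have "(\<Oplus>\<^bsub>cocenter W S\<^esub>C\<in>J. a C \<odot>\<^bsub>cocenter W S\<^esub> T_class W S C) =
      (\<Oplus>\<^bsub>cocenter W S\<^esub>C\<in>J. a C \<odot>\<^bsub>cocenter W S\<^esub> kc (Tm (minr C)))"
    by (rule K.M.finsum_cong') (use J Tm in \<open>auto simp: T_class_eq kc_smult cocenter_carrier\<close>)
  then show "(\<Oplus>\<^bsub>cocenter W S\<^esub>C\<in>J. a C \<odot>\<^bsub>cocenter W S\<^esub> T_class W S C) = kc (\<Sum>C\<in>J. scalar (a C) * Tm (minr C))"
    using kc_finsum[OF J(1), of "\<lambda>C. Tm (minr C)" a] Tm by simp
  show "(\<Sum>C\<in>J. scalar (a C) * Tm (minr C)) \<in> F" using Tm by (intro FA_sum) auto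
qed

theorem cocenter_basis: "free_module_basis laurent_ring (cocenter W S) (conj_classes W) (T_class W S)"
  unfolding free_module_basis_def
proof (intro conjI ballI allI impI)
  show "Module.module laurent_ring (cocenter W S)" by (rule cocenter_module)
  show "T_class W S \<in> conj_classes W \<rightarrow> carrier (cocenter W S)"
    using minr_closed by (auto simp: T_class_eq cocenter_carrier)
next
  fix x assume "x \<in> carrier (cocenter W S)"
  then obtain f where f: "f \<in> F" "x = kc f" by (auto simp: cocenter_carrier)
  obtain J a where J: "finite J" "J \<subseteq> conj_classes W" and NF: "f - (\<Sum>C\<in>J. scalar (a C) * Tm (minr C)) \<in> NF"
    using cspan_F[OF f(1)] by (rule cspanE)
  have "x = (\<Oplus>\<^bsub>cocenter W S\<^esub>C\<in>J. a C \<odot>\<^bsub>cocenter W S\<^esub> T_class W S C)"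
    using f NF T_class_finsum[OF J, of a] by (simp add: kc_eq_iff)
  moreover have "a \<in> J \<rightarrow> carrier laurent_ring" by (simp add: laurent_ring_simps)
  ultimately show "\<exists>J a. finite J \<and> J \<subseteq> conj_classes W \<and> a \<in> J \<rightarrow> carrier laurent_ring \<and>
      x = (\<Oplus>\<^bsub>cocenter W S\<^esub>C\<in>J. a C \<odot>\<^bsub>cocenter W S\<^esub> T_class W S C)"
    using J by (intro exI conjI)
next
  fix J a C
  assume J: "finite J" "J \<subseteq> conj_classes W" and C: "C \<in> J"
    and 0: "(\<Oplus>\<^bsub>cocenter W S\<^esub>C\<in>J. a C \<odot>\<^bsub>cocenter W S\<^esub> T_class W S C) = \<zero>\<^bsub>cocenter W S\<^esub>"
  have "(\<Sum>C\<in>J. scalar (a C) * Tm (minr C)) - 0 \<in> NF"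
    using 0 T_class_finsum[OF J, of a] kc_eq_iff[of "\<Sum>C\<in>J. scalar (a C) * Tm (minr C)" 0] by (simp add: kc_0)
  then have "a C = 0" using class_independent[OF J _ C] by simp
  then show "a C = \<zero>\<^bsub>laurent_ring\<^esub>" by (simp add: laurent_ring_simps)
qed

end

theorem theorem1:
  fixes W :: "('w, 'm) monoid_scheme" and S :: "'w set"
    and A :: "'w \<Rightarrow> 'w \<Rightarrow> int" and n :: nat and c h :: "'w \<Rightarrow> nat \<Rightarrow> int"
  assumes "kac_moody_root_datum S A n c h"
    and "weyl_group W S A"
  shows "free_module_basis laurent_ring (cocenter W S) (conj_classes W) (T_class W S)"
proof -
  interpret kac_moody_root_datum S A n c h by fact
  interpret weyl_group W S A by fact
  have "km_weyl W S A"
    by unfold_locales (fact finite_index cartan_diag cartan_nonpos cartan_zero)+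
  then show ?thesis by (rule km_weyl.cocenter_basis)
qed

end
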